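(* Let $X$ be a compact Kähler manifold with complex structure $J$, Kähler form $\omega$ and a holomorphic Poisson structure $\beta$, and let $\{(\mathcal{J}_{\beta t},\psi_t)\}_{t\in\Delta'}$ be an analytic family of generalized Kähler structures with one pure spinor on $X$ whose generalized complex structures are the Poisson deformations $\mathcal{J}_{\beta t}$ of $\mathcal{J}_J$. Let $i_M: M\to X$ be a Poisson submanifold of $(X,\beta)$. Then, for $t\in\Delta'$, $M$ is a generalized Kähler manifold with the induced structure $(\mathcal{J}_{\beta t,M},\psi_{t,M})$, where $\psi_{t,M}=i_M^*\psi_t$.
   Context: Generalized complex structures: $\langle\,,\,\rangle$ is the natural symmetric pairing on $TX\oplus T^*X$. A generalized complex structure is a section $\mathcal{J}$ of $SO(TX\oplus T^*X)$ with $\mathcal{J}^2=-\mathrm{id}$ whose $(-\sqrt{-1})$-eigenbundle is involutive for the Courant bracket $[v_1+\theta^1,v_2+\theta^2]_c=[v_1,v_2]+\frac12\{\mathcal{L}_{v_1}\theta^2-\mathcal{L}_{v_2}\theta^1-i_{v_2}d\theta^1+i_{v_1}d\theta^2\}$. A generalized metric is a section $\hat G$ of $SO(TX\oplus T^*X)$ with $\hat G^2=\mathrm{id}$ and $\langle\hat G\,\cdot,\cdot\rangle$ positive-definite. A generalized Kähler structure is a pair $(\mathcal{J}_0,\mathcal{J}_1)$ of commuting generalized complex structures such that $-\mathcal{J}_0\mathcal{J}_1$ is a generalized metric. Pure spinors: $(v+\eta)\cdot\psi=i_v\psi+\eta\wedge\psi$. A pure spinor is a complex form $\psi$ such that $\ker\psi=\{E\in(TX\oplus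 T^*X)^{\mathbb{C}}:E\cdot\psi=0\}$ has complex rank $\dim_{\mathbb{R}}X$; it is non-degenerate if $(TX\oplus T^*X)^{\mathbb{C}}=\ker\psi\oplus\overline{\ker\psi}$, and then $\mathcal{J}_\psi$ is the almost generalized complex structure with $(-\sqrt{-1})$-eigenbundle $\ker\psi$ (integrable if $d\psi=0$). A generalized Kähler structure with one pure spinor is a pair $(\mathcal{J}_0,\psi)$ of a generalized complex structure and a $d$-closed non-degenerate complex pure spinor such that $(\mathcal{J}_0,\mathcal{J}_\psi)$ is generalized Kähler. Poisson deformations: a (holomorphic) Poisson structure is a holomorphic $2$-vector $\beta$ with vanishing Schouten bracket $[\beta,\beta]_{Sch}=0$; $\{f,g\}=\beta(df\wedge dg)$. $\mathcal{J}_J=\begin{pmatrix}J&0\\0&-J^*\end{pmatrix}$ on $TX\oplus T^*X$. With the real $2$-vector $a=\beta+\overline\beta$, regarded as a map $T^*X\to TX$ and as an endomorphism of $TX\oplus T^*X$, $\mathcal{J}_{\beta t}=e^{at}\circ\mathcal{J}_J\circ e^{-at}$, where for a complex parameter $t$ in a disk $\Delta'$ centred at $0$, $at$ is understood as the real $2$-vector $t\beta+\overline{t\beta}$. On a compact Kähler manifold with a Poisson structure, families $(\mathcal{J}_{\beta t},\psi_t)_{t\in\Delta'}$ as in the claim exist for a small disk $\Delta'$. Poisson submanifold: a complex submanifold $M$ with ideal sheaf $I_M$ such that $\{f,g\}\in I_M$ for all $f\in I_M$, $g\in\mathcal{O}_X$. Induced structure: let $N^*$ be the conormal bundle of $M$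 in $X$, the kernel of $\mathrm{id}_{TM}\oplus i_M^*:TM\oplus T^*X|_M\to TM\oplus T^*M$. If $\mathcal{J}(N^* )=N^*$, then $TM\oplus T^*X|_M$ is $\mathcal{J}$-invariant and $\mathcal{J}_M$ denotes the generalized complex structure induced on the quotient $TM\oplus T^*M$. "$M$ is a generalized Kähler manifold with the induced structure" means that $(\mathcal{J}_{\beta t,M},i_M^*\psi_t)$ is defined and is a generalized Kähler structure with one pure spinor on $M$. *)

theory Defs
  imports "HOL-Analysis.Analysis" "HOL-Library.Function_Algebras"
begin

section \<open>Smooth and holomorphic functions on open subsets of Euclidean spaces\<close>

text \<open>All sets named \<open>S\<close> in this section are meant to be open.\<close>

primrec Ck_on :: "nat \<Rightarrow> ('e::euclidean_space \<Rightarrow> 'f::real_normed_vector) \<Rightarrow> 'e set \<Rightarrow> bool" where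
  "Ck_on 0 f S \<longleftrightarrow> continuous_on S f"
| "Ck_on (Suc k) f S \<longleftrightarrow>
     f differentiable_on S \<and> (\<forall>v. Ck_on k (\<lambda>x. frechet_derivative f (at x) v) S)"

definition Cinf_on :: "('e::euclidean_space \<Rightarrow> 'f::real_normed_vector) \<Rightarrow> 'e set \<Rightarrow> bool" where
  "Cinf_on f S \<longleftrightarrow> (\<forall>k. Ck_on k f S)"

definition cn_holomorphic_on :: "(complex^'n \<Rightarrow> complex) \<Rightarrow> (complex^'n) set \<Rightarrow> bool" where
  "cn_holomorphic_on f S \<longleftrightarrow>
     (\<forall>z\<in>S. \<exists>D. (f has_derivative D) (at z) \<and> (\<forall>c v. D (c *s v) = c * D v))"


section \<open>Spaces with smooth functions; tangent and cotangent vectors\<close>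

text \<open>A manifold is handled through its topology and its sheaf of smooth complex functions:
  \<open>sfun S U\<close> is the set of functions that are smooth on the open set \<open>U\<close>
  (their values outside \<open>U\<close> are irrelevant).\<close>

record 'a smooth_space =
  stop :: "'a topology"
  sfun :: "'a set \<Rightarrow> ('a \<Rightarrow> complex) set"

text \<open>Fibres of \<open>TX\<close>, \<open>T\<^sup>*X\<close>, \<open>TX \<oplus> T\<^sup>*X\<close> and of the exterior algebra of \<open>T\<^sup>*X\<close> are all
  complexified; the real objects are those fixed by complex conjugation. A real endomorphism is
  represented by its complex-linear extension, which commutes with conjugation.
  A form may have mixed degree: its value at a point acts on lists of tangent vectors, and its part
  of degree \<open>k\<close> is its restriction to lists of length \<open>k\<close>.\<close>

type_synonym 'a tvec = "('a \<Rightarrow> complex) \<Rightarrow> complex"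
type_synonym 'a covec = "'a tvec \<Rightarrow> complex"
type_synonym 'a gvec = "'a tvec \<times> 'a covec"
type_synonym 'a gendo = "'a \<Rightarrow> 'a gvec \<Rightarrow> 'a gvec"
type_synonym 'a form = "'a \<Rightarrow> 'a tvec list \<Rightarrow> complex"
type_synonym 'a bivec = "'a \<Rightarrow> 'a covec \<Rightarrow> 'a covec \<Rightarrow> complex"

definition fscale :: "complex \<Rightarrow> ('b \<Rightarrow> complex) \<Rightarrow> 'b \<Rightarrow> complex" where
  "fscale c f = (\<lambda>x. c * f x)"

definition gscale :: "complex \<Rightarrow> 'a gvec \<Rightarrow> 'a gvec" where
  "gscale c E = (fscale c (fst E), fscale c (snd E))"

global_interpretation fvs: vector_space "fscale :: complex \<Rightarrow> ('b \<Rightarrow> complex) \<Rightarrow> 'b \<Rightarrow> complex"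
  by unfold_locales (auto simp: fscale_def fun_eq_iff algebra_simps)

global_interpretation gvs: vector_space "gscale :: complex \<Rightarrow> 'a gvec \<Rightarrow> 'a gvec"
  by unfold_locales (auto simp: gscale_def fscale_def fun_eq_iff prod_eq_iff algebra_simps)

text \<open>Tangent vectors at \<open>p\<close> are derivations of the algebra of germs at \<open>p\<close>. Functions whose germ
  at \<open>p\<close> is not smooth are sent to \<open>0\<close>, so that a tangent vector is determined by its values on
  germs; covectors are likewise \<open>0\<close> off the tangent space.\<close>

definition germs :: "'a smooth_space \<Rightarrow> 'a \<Rightarrow> ('a \<Rightarrow> complex) set" where
  "germs S p = {f. \<exists>U. openin (stop S) U \<and> p \<in> U \<and> f \<in> sfun S U}"

definition tangent :: "'a smooth_space \<Rightarrow> 'a \<Rightarrow> 'a tvec set" where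
  "tangent S p = {v.
     (\<forall>f\<in>germs S p. \<forall>g\<in>germs S p.
        v (\<lambda>x. f x + g x) = v f + v g \<and>
        v (\<lambda>x. f x * g x) = f p * v g + g p * v f \<and>
        ((\<exists>U. openin (stop S) U \<and> p \<in> U \<and> (\<forall>x\<in>U. f x = g x)) \<longrightarrow> v f = v g)) \<and>
     (\<forall>f\<in>germs S p. \<forall>c. v (\<lambda>x. c * f x) = c * v f) \<and>
     (\<forall>f. f \<notin> germs S p \<longrightarrow> v f = 0)}"

definition cotangent :: "'a smooth_space \<Rightarrow> 'a \<Rightarrow> 'a covec set" where
  "cotangent S p = {\<eta>.
     (\<forall>v\<in>tangent S p. \<forall>w\<in>tangent S p. \<eta> (v + w) = \<eta> v + \<eta> w) \<and>
     (\<forall>v\<in>tangent S p. \<forall>c. \<eta> (fscale c v) = c * \<eta> v) \<and>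
     (\<forall>v. v \<notin> tangent S p \<longrightarrow> \<eta> v = 0)}"

definition gfibre :: "'a smooth_space \<Rightarrow> 'a \<Rightarrow> 'a gvec set" where
  "gfibre S p = tangent S p \<times> cotangent S p"

definition differential :: "'a smooth_space \<Rightarrow> 'a \<Rightarrow> ('a \<Rightarrow> complex) \<Rightarrow> 'a covec" where
  "differential S p f = (\<lambda>v. if v \<in> tangent S p then v f else 0)"

definition conj_tvec :: "'a tvec \<Rightarrow> 'a tvec" where
  "conj_tvec v = (\<lambda>f. cnj (v (\<lambda>x. cnj (f x))))"

definition conj_covec :: "'a covec \<Rightarrow> 'a covec" where
  "conj_covec \<eta> = (\<lambda>v. cnj (\<eta> (conj_tvec v)))"

definition conj_gvec :: "'a gvec \<Rightarrow> 'a gvec" where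
  "conj_gvec E = (conj_tvec (fst E), conj_covec (snd E))"

definition pairing :: "'a gvec \<Rightarrow> 'a gvec \<Rightarrow> complex" where
  "pairing E F = (snd E (fst F) + snd F (fst E)) / 2"


section \<open>Sections and the Courant bracket\<close>

definition smooth_field :: "'a smooth_space \<Rightarrow> 'a set \<Rightarrow> ('a \<Rightarrow> 'a tvec) \<Rightarrow> bool" where
  "smooth_field S U V \<longleftrightarrow>
     (\<forall>q\<in>U. V q \<in> tangent S q) \<and>
     (\<forall>W f. openin (stop S) W \<and> W \<subseteq> U \<and> f \<in> sfun S W \<longrightarrow> (\<lambda>q. V q f) \<in> sfun S W)"

definition smooth_cofield :: "'a smooth_space \<Rightarrow> 'a set \<Rightarrow> ('a \<Rightarrow> 'a covec) \<Rightarrow> bool" where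
  "smooth_cofield S U \<theta> \<longleftrightarrow>
     (\<forall>q\<in>U. \<theta> q \<in> cotangent S q) \<and>
     (\<forall>W V. openin (stop S) W \<and> W \<subseteq> U \<and> smooth_field S W V \<longrightarrow> (\<lambda>q. \<theta> q (V q)) \<in> sfun S W)"

definition smooth_gsection :: "'a smooth_space \<Rightarrow> 'a set \<Rightarrow> ('a \<Rightarrow> 'a gvec) \<Rightarrow> bool" where
  "smooth_gsection S U E \<longleftrightarrow>
     smooth_field S U (\<lambda>q. fst (E q)) \<and> smooth_cofield S U (\<lambda>q. snd (E q))"

text \<open>Alternating multilinear in every degree, with smooth coefficients.\<close>

definition smooth_form :: "'a smooth_space \<Rightarrow> 'a set \<Rightarrow> 'a form \<Rightarrow> bool" where
  "smooth_form S U \<psi> \<longleftrightarrow>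
     (\<forall>q\<in>U. \<forall>xs ys. set xs \<subseteq> tangent S q \<and> set ys \<subseteq> tangent S q \<longrightarrow>
        (\<forall>v\<in>tangent S q. \<forall>w\<in>tangent S q.
           \<psi> q (xs @ (v + w) # ys) = \<psi> q (xs @ v # ys) + \<psi> q (xs @ w # ys)) \<and>
        (\<forall>v\<in>tangent S q. \<forall>c. \<psi> q (xs @ fscale c v # ys) = c * \<psi> q (xs @ v # ys)) \<and>
        (\<not> distinct xs \<longrightarrow> \<psi> q xs = 0)) \<and>
     (\<forall>W Vs. openin (stop S) W \<and> W \<subseteq> U \<and> (\<forall>V\<in>set Vs. smooth_field S W V) \<longrightarrow>
        (\<lambda>q. \<psi> q (map (\<lambda>V. V q) Vs)) \<in> sfun S W)"

definition lie_bracket ::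
  "'a smooth_space \<Rightarrow> ('a \<Rightarrow> 'a tvec) \<Rightarrow> ('a \<Rightarrow> 'a tvec) \<Rightarrow> 'a \<Rightarrow> 'a tvec" where
  "lie_bracket S V W p =
     (\<lambda>f. if f \<in> germs S p then V p (\<lambda>q. W q f) - W p (\<lambda>q. V q f) else 0)"

definition del_nth :: "nat \<Rightarrow> 'b list \<Rightarrow> 'b list" where
  "del_nth i xs = take i xs @ drop (Suc i) xs"

text \<open>The exterior derivative, evaluated at \<open>p\<close> on vector fields \<open>V\<^sub>0, \<dots>, V\<^sub>k\<close> defined near \<open>p\<close>:
  \<open>\<Sum>\<^sub>i (-1)\<^sup>i V\<^sub>i(\<psi>(\<dots>V\<^sub>i omitted\<dots>)) + \<Sum>\<^sub>i\<^sub><\<^sub>j (-1)\<^sup>i\<^sup>+\<^sup>j \<psi>([V\<^sub>i,V\<^sub>j], \<dots>V\<^sub>i, V\<^sub>j omitted\<dots>)\<close>.\<close>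

definition ext_d :: "'a smooth_space \<Rightarrow> 'a form \<Rightarrow> ('a \<Rightarrow> 'a tvec) list \<Rightarrow> 'a \<Rightarrow> complex" where
  "ext_d S \<psi> Vs p =
     (\<Sum>i<length Vs. (- 1) ^ i * (Vs ! i) p (\<lambda>q. \<psi> q (map (\<lambda>V. V q) (del_nth i Vs)))) +
     (\<Sum>j<length Vs. \<Sum>i<j. (- 1) ^ (i + j) *
        \<psi> p (lie_bracket S (Vs ! i) (Vs ! j) p # map (\<lambda>V. V p) (del_nth i (del_nth j Vs))))"

definition d_closed :: "'a smooth_space \<Rightarrow> 'a form \<Rightarrow> bool" where
  "d_closed S \<psi> \<longleftrightarrow>
     (\<forall>U Vs. openin (stop S) U \<and> (\<forall>V\<in>set Vs. smooth_field S U V) \<longrightarrow>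
        (\<forall>p\<in>U. ext_d S \<psi> Vs p = 0))"

definition one_form :: "('a \<Rightarrow> 'a covec) \<Rightarrow> 'a form" where
  "one_form \<theta> = (\<lambda>q vs. case vs of [v] \<Rightarrow> \<theta> q v | _ \<Rightarrow> 0)"

definition lie_derivative_one_form ::
  "'a smooth_space \<Rightarrow> ('a \<Rightarrow> 'a tvec) \<Rightarrow> ('a \<Rightarrow> 'a covec) \<Rightarrow> ('a \<Rightarrow> 'a tvec) \<Rightarrow> 'a \<Rightarrow> complex" where
  "lie_derivative_one_form S V \<theta> W p = V p (\<lambda>q. \<theta> q (W q)) - \<theta> p (lie_bracket S V W p)"

text \<open>The 1-form part of the Courant bracket is tensorial, so its value on a tangent vector \<open>w\<close>
  is computed with any local vector field through \<open>w\<close>.\<close>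

definition field_through :: "'a smooth_space \<Rightarrow> 'a \<Rightarrow> 'a tvec \<Rightarrow> 'a \<Rightarrow> 'a tvec" where
  "field_through S p w =
     (SOME W. W p = w \<and> (\<exists>U. openin (stop S) U \<and> p \<in> U \<and> smooth_field S U W))"

definition courant ::
  "'a smooth_space \<Rightarrow> ('a \<Rightarrow> 'a gvec) \<Rightarrow> ('a \<Rightarrow> 'a gvec) \<Rightarrow> 'a \<Rightarrow> 'a gvec" where
  "courant S E F p =
     (let v1 = (\<lambda>q. fst (E q)); \<theta>1 = (\<lambda>q. snd (E q));
          v2 = (\<lambda>q. fst (F q)); \<theta>2 = (\<lambda>q. snd (F q))
      in (lie_bracket S v1 v2 p,
          \<lambda>w. if w \<in> tangent S p then
                let W = field_through S p w in
                (lie_derivative_one_form S v1 \<theta>2 W p - lie_derivative_one_form S v2 \<theta>1 W p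
                 - ext_d S (one_form \<theta>1) [v2, W] p + ext_d S (one_form \<theta>2) [v1, W] p) / 2
              else 0))"


section \<open>Generalized Kaehler structures\<close>

text \<open>Determinant of an endomorphism \<open>A\<close> of a finite-dimensional subspace \<open>V\<close>, by the Leibniz
  formula for its matrix in some (equivalently, any) basis \<open>B\<close>.\<close>

definition has_det :: "'a gvec set \<Rightarrow> ('a gvec \<Rightarrow> 'a gvec) \<Rightarrow> complex \<Rightarrow> bool" where
  "has_det V A d \<longleftrightarrow>
     (\<exists>B. finite B \<and> gvs.independent B \<and> gvs.span B = V \<and>
        d = (\<Sum>\<sigma> | \<sigma> permutes B.
              of_int (sign \<sigma>) * (\<Prod>b\<in>B. gvs.representation B (A b) (\<sigma> b))))"

definition so_section :: "'a smooth_space \<Rightarrow> 'a gendo \<Rightarrow> bool" where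
  "so_section S A \<longleftrightarrow>
     (\<forall>p\<in>topspace (stop S).
        (\<forall>E\<in>gfibre S p. A p E \<in> gfibre S p \<and> A p (conj_gvec E) = conj_gvec (A p E) \<and>
           (\<forall>c. A p (gscale c E) = gscale c (A p E)) \<and>
           (\<forall>F\<in>gfibre S p. A p (E + F) = A p E + A p F \<and>
              pairing (A p E) (A p F) = pairing E F)) \<and>
        has_det (gfibre S p) (A p) 1) \<and>
     (\<forall>U E. openin (stop S) U \<and> smooth_gsection S U E \<longrightarrow> smooth_gsection S U (\<lambda>q. A q (E q)))"

definition eigenbundle :: "'a smooth_space \<Rightarrow> 'a gendo \<Rightarrow> 'a \<Rightarrow> 'a gvec set" where
  "eigenbundle S A p = {E \<in> gfibre S p. A p E = gscale (- \<i>) E}"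

definition courant_involutive :: "'a smooth_space \<Rightarrow> ('a \<Rightarrow> 'a gvec set) \<Rightarrow> bool" where
  "courant_involutive S L \<longleftrightarrow>
     (\<forall>U E F. openin (stop S) U \<and> smooth_gsection S U E \<and> smooth_gsection S U F \<and>
        (\<forall>q\<in>U. E q \<in> L q \<and> F q \<in> L q) \<longrightarrow> (\<forall>p\<in>U. courant S E F p \<in> L p))"

definition gen_complex :: "'a smooth_space \<Rightarrow> 'a gendo \<Rightarrow> bool" where
  "gen_complex S A \<longleftrightarrow>
     so_section S A \<and>
     (\<forall>p\<in>topspace (stop S). \<forall>E\<in>gfibre S p. A p (A p E) = - E) \<and>
     courant_involutive S (eigenbundle S A)"

definition gen_metric :: "'a smooth_space \<Rightarrow> 'a gendo \<Rightarrow> bool" where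
  "gen_metric S G \<longleftrightarrow>
     so_section S G \<and>
     (\<forall>p\<in>topspace (stop S). \<forall>E\<in>gfibre S p. G p (G p E) = E \<and>
        (conj_gvec E = E \<and> E \<noteq> 0 \<longrightarrow> Re (pairing (G p E) E) > 0))"

definition gen_kahler :: "'a smooth_space \<Rightarrow> 'a gendo \<Rightarrow> 'a gendo \<Rightarrow> bool" where
  "gen_kahler S A0 A1 \<longleftrightarrow>
     gen_complex S A0 \<and> gen_complex S A1 \<and>
     (\<forall>p\<in>topspace (stop S). \<forall>E\<in>gfibre S p. A0 p (A1 p E) = A1 p (A0 p E)) \<and>
     gen_metric S (\<lambda>p E. - A0 p (A1 p E))"


section \<open>Pure spinors\<close>

text \<open>\<open>(v + \<eta>) \<cdot> \<phi> = i\<^sub>v \<phi> + \<eta> \<and> \<phi>\<close>.\<close>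

definition clifford :: "'a gvec \<Rightarrow> ('a tvec list \<Rightarrow> complex) \<Rightarrow> 'a tvec list \<Rightarrow> complex" where
  "clifford E \<phi> vs =
     \<phi> (fst E # vs) + (\<Sum>i<length vs. (- 1) ^ i * snd E (vs ! i) * \<phi> (del_nth i vs))"

definition spinor_ker :: "'a smooth_space \<Rightarrow> 'a form \<Rightarrow> 'a \<Rightarrow> 'a gvec set" where
  "spinor_ker S \<psi> p =
     {E \<in> gfibre S p. \<forall>vs. set vs \<subseteq> tangent S p \<longrightarrow> clifford E (\<psi> p) vs = 0}"

text \<open>The complex dimension of the complexified tangent space is the real dimension of the
  manifold.\<close>

definition pure_spinor :: "'a smooth_space \<Rightarrow> 'a form \<Rightarrow> bool" where
  "pure_spinor S \<psi> \<longleftrightarrow>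
     smooth_form S (topspace (stop S)) \<psi> \<and>
     (\<forall>p\<in>topspace (stop S). gvs.dim (spinor_ker S \<psi> p) = fvs.dim (tangent S p))"

definition nondegenerate_spinor :: "'a smooth_space \<Rightarrow> 'a form \<Rightarrow> bool" where
  "nondegenerate_spinor S \<psi> \<longleftrightarrow>
     (\<forall>p\<in>topspace (stop S).
        spinor_ker S \<psi> p \<inter> conj_gvec ` spinor_ker S \<psi> p = {0} \<and>
        gfibre S p = {E + F |E F. E \<in> spinor_ker S \<psi> p \<and> F \<in> conj_gvec ` spinor_ker S \<psi> p})"

definition spinor_endo :: "'a smooth_space \<Rightarrow> 'a form \<Rightarrow> 'a gendo" where
  "spinor_endo S \<psi> p E =
     (THE F. \<exists>E1\<in>spinor_ker S \<psi> p. \<exists>E2\<in>conj_gvec ` spinor_ker S \<psi> p.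
        E = E1 + E2 \<and> F = gscale (- \<i>) E1 + gscale \<i> E2)"

definition gen_kahler_one_spinor :: "'a smooth_space \<Rightarrow> 'a gendo \<Rightarrow> 'a form \<Rightarrow> bool" where
  "gen_kahler_one_spinor S A \<psi> \<longleftrightarrow>
     gen_complex S A \<and> pure_spinor S \<psi> \<and> nondegenerate_spinor S \<psi> \<and> d_closed S \<psi> \<and>
     gen_kahler S A (spinor_endo S \<psi>)"

text \<open>Real-analytic dependence on the complex parameter \<open>t\<close>: near each parameter value the family
  is a convergent power series in \<open>t\<close> and its conjugate, with smooth forms as coefficients.\<close>

definition analytic_family :: "'a smooth_space \<Rightarrow> complex set \<Rightarrow> (complex \<Rightarrow> 'a form) \<Rightarrow> bool" where
  "analytic_family S D \<psi> \<longleftrightarrow>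
     (\<forall>t0\<in>D. \<exists>r>0. \<exists>c. (\<forall>j k. smooth_form S (topspace (stop S)) (c (j, k))) \<and>
        (\<forall>t\<in>D \<inter> ball t0 r. \<forall>p\<in>topspace (stop S). \<forall>vs. set vs \<subseteq> tangent S p \<longrightarrow>
           ((\<lambda>(j, k). (t - t0) ^ j * cnj (t - t0) ^ k * c (j, k) p vs) has_sum \<psi> t p vs)
             (UNIV :: (nat \<times> nat) set)))"


section \<open>Complex manifolds\<close>

type_synonym ('a, 'n) chart = "'a set \<times> ('a \<Rightarrow> complex^'n)"

definition chart_inv :: "('a, 'n::finite) chart \<Rightarrow> complex^'n \<Rightarrow> 'a" where
  "chart_inv c = inv_into (fst c) (snd c)"

definition is_chart :: "('a::topological_space, 'n::finite) chart \<Rightarrow> bool" where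
  "is_chart c \<longleftrightarrow> open (fst c) \<and> open (snd c ` fst c) \<and>
     homeomorphism (fst c) (snd c ` fst c) (snd c) (chart_inv c)"

definition holo_transition :: "('a, 'n::finite) chart \<Rightarrow> ('a, 'n) chart \<Rightarrow> bool" where
  "holo_transition c d \<longleftrightarrow>
     (\<forall>i. cn_holomorphic_on (\<lambda>z. snd d (chart_inv c z) $ i) (snd c ` (fst c \<inter> fst d)))"

definition complex_atlas :: "('a::topological_space, 'n::finite) chart set \<Rightarrow> bool" where
  "complex_atlas \<A> \<longleftrightarrow>
     (\<Union>c\<in>\<A>. fst c) = UNIV \<and> (\<forall>c\<in>\<A>. is_chart c) \<and> (\<forall>c\<in>\<A>. \<forall>d\<in>\<A>. holo_transition c d)"

definition holo_chart ::
  "('a::topological_space, 'n::finite) chart set \<Rightarrow> ('a, 'n) chart \<Rightarrow> bool" where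
  "holo_chart \<A> c \<longleftrightarrow>
     is_chart c \<and> (\<forall>d\<in>\<A>. holo_transition c d \<and> holo_transition d c)"

definition holo_fun ::
  "('a::topological_space, 'n::finite) chart set \<Rightarrow> 'a set \<Rightarrow> ('a \<Rightarrow> complex) set" where
  "holo_fun \<A> U =
     {f. \<forall>c\<in>\<A>. cn_holomorphic_on (\<lambda>z. f (chart_inv c z)) (snd c ` (U \<inter> fst c))}"

definition mfd :: "('a::topological_space, 'n::finite) chart set \<Rightarrow> 'a smooth_space" where
  "mfd \<A> = \<lparr> stop = euclidean,
     sfun = (\<lambda>U. {f. \<forall>c\<in>\<A>. Cinf_on (\<lambda>z. f (chart_inv c z)) (snd c ` (U \<inter> fst c))}) \<rparr>"

text \<open>The complex structure \<open>J\<close> on (complexified) tangent vectors, characterized by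
  \<open>(J v) f = \<i> (v f)\<close> for holomorphic \<open>f\<close>, and \<open>(J v) f = - \<i> (v f)\<close> for antiholomorphic \<open>f\<close>.\<close>

definition cstruct ::
  "('a::topological_space, 'n::finite) chart set \<Rightarrow> 'a \<Rightarrow> 'a tvec \<Rightarrow> 'a tvec" where
  "cstruct \<A> p v = (THE w. w \<in> tangent (mfd \<A>) p \<and>
     (\<forall>U f. open U \<and> p \<in> U \<and> f \<in> holo_fun \<A> U \<longrightarrow>
        w f = \<i> * v f \<and> w (\<lambda>x. cnj (f x)) = - \<i> * v (\<lambda>x. cnj (f x))))"

definition kahler_form ::
  "('a::topological_space, 'n::finite) chart set \<Rightarrow> 'a form \<Rightarrow> bool" where
  "kahler_form \<A> \<omega> \<longleftrightarrow>
     smooth_form (mfd \<A>) UNIV \<omega> \<and> d_closed (mfd \<A>) \<omega> \<and>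
     (\<forall>p. (\<forall>vs. set vs \<subseteq> tangent (mfd \<A>) p \<and> length vs \<noteq> 2 \<longrightarrow> \<omega> p vs = 0) \<and>
        (\<forall>v\<in>tangent (mfd \<A>) p. \<forall>w\<in>tangent (mfd \<A>) p.
           \<omega> p [conj_tvec v, conj_tvec w] = cnj (\<omega> p [v, w]) \<and>
           \<omega> p [cstruct \<A> p v, cstruct \<A> p w] = \<omega> p [v, w]) \<and>
        (\<forall>v\<in>tangent (mfd \<A>) p. conj_tvec v = v \<and> v \<noteq> 0 \<longrightarrow> Re (\<omega> p [v, cstruct \<A> p v]) > 0))"


section \<open>Poisson structures and Poisson deformations\<close>

definition biv_bracket ::
  "'a smooth_space \<Rightarrow> 'a bivec \<Rightarrow> ('a \<Rightarrow> complex) \<Rightarrow> ('a \<Rightarrow> complex) \<Rightarrow> 'a \<Rightarrow> complex" where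
  "biv_bracket S P f g = (\<lambda>q. P q (differential S q f) (differential S q g))"

text \<open>The Schouten bracket of two 2-vectors, as a bracket of skew-symmetric multiderivations,
  evaluated at \<open>p\<close> on the differentials of \<open>f\<close>, \<open>g\<close> and \<open>h\<close>.\<close>

definition schouten ::
  "'a smooth_space \<Rightarrow> 'a bivec \<Rightarrow> 'a bivec \<Rightarrow>
     ('a \<Rightarrow> complex) \<Rightarrow> ('a \<Rightarrow> complex) \<Rightarrow> ('a \<Rightarrow> complex) \<Rightarrow> 'a \<Rightarrow> complex" where
  "schouten S P Q f g h p =
     (let \<pi> = biv_bracket S P; \<kappa> = biv_bracket S Q in
        \<pi> (\<kappa> f g) h p + \<pi> (\<kappa> g h) f p + \<pi> (\<kappa> h f) g p +
        \<kappa> (\<pi> f g) h p + \<kappa> (\<pi> g h) f p + \<kappa> (\<pi> h f) g p)"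

text \<open>A section of the second exterior power of the holomorphic tangent bundle: it kills covectors
  of type (0,1), i.e. those vanishing on the \<open>\<i>\<close>-eigenspace of \<open>J\<close>.\<close>

definition holo_bivector ::
  "('a::topological_space, 'n::finite) chart set \<Rightarrow> 'a bivec \<Rightarrow> bool" where
  "holo_bivector \<A> \<beta> \<longleftrightarrow>
     (\<forall>p. \<forall>\<eta>\<in>cotangent (mfd \<A>) p. \<beta> p \<eta> \<eta> = 0 \<and>
        (\<forall>\<zeta>\<in>cotangent (mfd \<A>) p.
           \<beta> p \<eta> \<zeta> = - \<beta> p \<zeta> \<eta> \<and>
           (\<forall>c. \<beta> p (fscale c \<eta>) \<zeta> = c * \<beta> p \<eta> \<zeta>) \<and>
           (\<forall>\<xi>\<in>cotangent (mfd \<A>) p. \<beta> p (\<eta> + \<xi>) \<zeta> = \<beta> p \<eta> \<zeta> + \<beta> p \<xi> \<zeta>) \<and>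
           ((\<forall>v\<in>tangent (mfd \<A>) p. cstruct \<A> p v = fscale \<i> v \<longrightarrow> \<eta> v = 0) \<longrightarrow> \<beta> p \<eta> \<zeta> = 0))) \<and>
     (\<forall>U f g. open U \<and> f \<in> holo_fun \<A> U \<and> g \<in> holo_fun \<A> U \<longrightarrow>
        biv_bracket (mfd \<A>) \<beta> f g \<in> holo_fun \<A> U)"

definition poisson_structure ::
  "('a::topological_space, 'n::finite) chart set \<Rightarrow> 'a bivec \<Rightarrow> bool" where
  "poisson_structure \<A> \<beta> \<longleftrightarrow>
     holo_bivector \<A> \<beta> \<and>
     (\<forall>p. \<forall>f\<in>germs (mfd \<A>) p. \<forall>g\<in>germs (mfd \<A>) p. \<forall>h\<in>germs (mfd \<A>) p.
        schouten (mfd \<A>) \<beta> \<beta> f g h p = 0)"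

definition real_bivector :: "'a bivec \<Rightarrow> complex \<Rightarrow> 'a bivec" where
  "real_bivector \<beta> t =
     (\<lambda>p \<eta> \<zeta>. t * \<beta> p \<eta> \<zeta> + cnj (t * \<beta> p (conj_covec \<eta>) (conj_covec \<zeta>)))"

text \<open>A 2-vector \<open>a\<close> as the map \<open>\<eta> \<mapsto> a(\<eta>, -)\<close> from covectors to tangent vectors.\<close>

definition biv_map :: "'a smooth_space \<Rightarrow> 'a bivec \<Rightarrow> 'a \<Rightarrow> 'a covec \<Rightarrow> 'a tvec" where
  "biv_map S a p \<eta> = (\<lambda>f. if f \<in> germs S p then a p \<eta> (differential S p f) else 0)"

text \<open>\<open>e\<^sup>a = 1 + a\<close>, since \<open>a\<close> has square zero as an endomorphism of \<open>TX \<oplus> T\<^sup>*X\<close>.\<close>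

definition exp_biv :: "'a smooth_space \<Rightarrow> 'a bivec \<Rightarrow> 'a gendo" where
  "exp_biv S a p E = E + (biv_map S a p (snd E), 0)"

definition gcs_of_complex :: "('a::topological_space, 'n::finite) chart set \<Rightarrow> 'a gendo" where
  "gcs_of_complex \<A> p E =
     (cstruct \<A> p (fst E),
      \<lambda>v. if v \<in> tangent (mfd \<A>) p then - snd E (cstruct \<A> p v) else 0)"

definition poisson_deformation ::
  "('a::topological_space, 'n::finite) chart set \<Rightarrow> 'a bivec \<Rightarrow> complex \<Rightarrow> 'a gendo" where
  "poisson_deformation \<A> \<beta> t p =
     exp_biv (mfd \<A>) (real_bivector \<beta> t) p \<circ> gcs_of_complex \<A> p \<circ>
     exp_biv (mfd \<A>) (- real_bivector \<beta> t) p"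


section \<open>Submanifolds and induced structures\<close>

definition complex_submanifold ::
  "('a::topological_space, 'n::finite) chart set \<Rightarrow> nat \<Rightarrow> 'a set \<Rightarrow> bool" where
  "complex_submanifold \<A> m M \<longleftrightarrow>
     (\<forall>p\<in>M. \<exists>c I. holo_chart \<A> c \<and> p \<in> fst c \<and> card I = m \<and>
        snd c ` (fst c \<inter> M) = {z \<in> snd c ` fst c. \<forall>i. i \<notin> I \<longrightarrow> z $ i = 0})"

definition ideal_sheaf ::
  "('a::topological_space, 'n::finite) chart set \<Rightarrow> 'a set \<Rightarrow> 'a set \<Rightarrow> ('a \<Rightarrow> complex) set" where
  "ideal_sheaf \<A> M U = {f \<in> holo_fun \<A> U. \<forall>x\<in>U \<inter> M. f x = 0}"

definition poisson_submanifold ::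
  "('a::topological_space, 'n::finite) chart set \<Rightarrow> 'a bivec \<Rightarrow> nat \<Rightarrow> 'a set \<Rightarrow> bool" where
  "poisson_submanifold \<A> \<beta> m M \<longleftrightarrow>
     complex_submanifold \<A> m M \<and>
     (\<forall>U f g. open U \<and> f \<in> ideal_sheaf \<A> M U \<and> g \<in> holo_fun \<A> U \<longrightarrow>
        biv_bracket (mfd \<A>) \<beta> f g \<in> ideal_sheaf \<A> M U)"

text \<open>Smooth functions on a submanifold are locally restrictions of smooth functions.\<close>

definition sub_space :: "'a smooth_space \<Rightarrow> 'a set \<Rightarrow> 'a smooth_space" where
  "sub_space S M = \<lparr> stop = subtopology (stop S) M,
     sfun = (\<lambda>U. {f. \<forall>p\<in>U. \<exists>V g. openin (stop S) V \<and> p \<in> V \<and> g \<in> sfun S V \<and>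
                                   (\<forall>q\<in>V \<inter> U. f q = g q)}) \<rparr>"

definition push_tvec :: "'a smooth_space \<Rightarrow> 'a \<Rightarrow> 'a tvec \<Rightarrow> 'a tvec" where
  "push_tvec S p v = (\<lambda>f. if f \<in> germs S p then v f else 0)"

definition pull_covec :: "'a smooth_space \<Rightarrow> 'a set \<Rightarrow> 'a \<Rightarrow> 'a covec \<Rightarrow> 'a covec" where
  "pull_covec S M p \<eta> =
     (\<lambda>v. if v \<in> tangent (sub_space S M) p then \<eta> (push_tvec S p v) else 0)"

definition pull_form :: "'a smooth_space \<Rightarrow> 'a form \<Rightarrow> 'a form" where
  "pull_form S \<psi> = (\<lambda>p vs. \<psi> p (map (push_tvec S p) vs))"

text \<open>The fibre of \<open>TM \<oplus> T\<^sup>*X|\<^sub>M\<close>, its inclusion into \<open>TX \<oplus> T\<^sup>*X\<close>, and its projection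
  \<open>id \<oplus> i\<^sub>M\<^sup>*\<close> onto \<open>TM \<oplus> T\<^sup>*M\<close>.\<close>

definition mixed_fibre :: "'a smooth_space \<Rightarrow> 'a set \<Rightarrow> 'a \<Rightarrow> 'a gvec set" where
  "mixed_fibre S M p = tangent (sub_space S M) p \<times> cotangent S p"

definition mixed_incl :: "'a smooth_space \<Rightarrow> 'a \<Rightarrow> 'a gvec \<Rightarrow> 'a gvec" where
  "mixed_incl S p E = (push_tvec S p (fst E), snd E)"

definition mixed_proj :: "'a smooth_space \<Rightarrow> 'a set \<Rightarrow> 'a \<Rightarrow> 'a gvec \<Rightarrow> 'a gvec" where
  "mixed_proj S M p E = (fst E, pull_covec S M p (snd E))"

definition conormal :: "'a smooth_space \<Rightarrow> 'a set \<Rightarrow> 'a \<Rightarrow> 'a gvec set" where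
  "conormal S M p = {E \<in> mixed_fibre S M p. mixed_proj S M p E = 0}"

definition conormal_invariant :: "'a smooth_space \<Rightarrow> 'a gendo \<Rightarrow> 'a set \<Rightarrow> bool" where
  "conormal_invariant S A M \<longleftrightarrow>
     (\<forall>p\<in>M. A p ` mixed_incl S p ` conormal S M p = mixed_incl S p ` conormal S M p)"

definition induced_endo :: "'a smooth_space \<Rightarrow> 'a gendo \<Rightarrow> 'a set \<Rightarrow> 'a gendo" where
  "induced_endo S A M p E' =
     (THE F'. \<exists>E\<in>mixed_fibre S M p. \<exists>F\<in>mixed_fibre S M p.
        mixed_proj S M p E = E' \<and> A p (mixed_incl S p E) = mixed_incl S p F \<and>
        mixed_proj S M p F = F')"

end

theory Submission
  imports Defs "HOL-Complex_Analysis.Cauchy_Integral_Formula"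
begin

text \<open>The theorem combines a fact about the Poisson structure with a reduction principle for generalized
  Kaehler structures.

  The first part shows \<open>\<J>(N\<^sup>*) = N\<^sup>*\<close> for the deformed structure \<open>\<J> = e\<^bsup>at\<^esup> \<J>\<^sub>J e\<^bsup>-at\<^esup>\<close>. The (1,0)-part of the
  conormal bundle is spanned by differentials of functions in the ideal sheaf of \<open>M\<close>. Brackets with such
  functions vanish on \<open>M\<close>, so \<open>\<beta>\<close>, and therefore \<open>a\<close>, annihilates \<open>N\<^sup>*\<close> (\<open>bivector_conormal\<close>). Thus \<open>\<J>\<close> acts on
  \<open>N\<^sup>*\<close> by \<open>- J\<^sup>*\<close>, which preserves it because \<open>M\<close> is complex (\<open>poisson_deformation_conormal\<close>).

  The second part is about any generalized Kaehler structure \<open>(A, \<psi>)\<close> with one pure spinor on a space with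
  smooth functions and any submanifold with \<open>A K = K\<close>, where \<open>K = N\<^sup>*\<close> (\<open>gen_kahler_one_spinor_reduction\<close>). Let
  \<open>B\<close> be the structure given by \<open>\<psi>\<close>, and \<open>G = - A B\<close>. Then \<open>A\<close> acts on \<open>K\<^sup>\<bottom> / K = TM \<oplus> T\<^sup>*M\<close>, but \<open>B\<close> exchanges \<open>K\<close>
  and \<open>G K\<close>. Positivity of \<open>G\<close> gives \<open>K\<^sup>\<bottom> = K \<oplus> W\<close> with \<open>W\<close> the orthogonal complement of \<open>K \<oplus> G K\<close>, and \<open>W\<close> is
  invariant under \<open>A\<close>, \<open>B\<close> and \<open>G\<close>. So \<open>TM \<oplus> T\<^sup>*M\<close>, identified with \<open>W\<close>, inherits a commuting pair of orthogonal
  complex structures with positive product. A vector of \<open>W\<close> that annihilates \<open>\<psi>\<close> reduces to one that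
  annihilates \<open>i\<^sub>M\<^sup>*\<psi>\<close>. For the converse, a larger kernel would force \<open>i\<^sub>M\<^sup>*\<psi> = 0\<close> at a point by the Clifford
  relation; but \<open>K \<inter> ker \<psi> = 0\<close>, again by positivity, so that \<open>TX = TM + pr(ker \<psi>)\<close>, and then \<open>\<psi>\<close> itself would
  vanish there (\<open>spinor_ker_reduction\<close>). Hence the structure induced by \<open>B\<close> is the one of \<open>i\<^sub>M\<^sup>*\<psi>\<close>.

  Smoothness holds because sections over \<open>M\<close> have smooth representatives in \<open>W\<close>, obtained by
  Gram-Schmidt orthogonalization against a frame of \<open>K\<close> (\<open>rep_section\<close>). For integrability, a section of a
  reduced eigenbundle is extended to a section of the eigenbundle on \<open>X\<close> by representatives and the projection
  \<open>(1 + \<i> A) / 2\<close>; the Courant bracket is natural for such extensions (\<open>courant_related\<close>).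

  Tangent vectors are derivations of germs. All that is used about them is that coordinates determine
  them and that \<open>M\<close> has adapted coordinate frames. The first follows from Hadamard's lemma, and the second
  requires that transition functions are smooth, which Cauchy's integral formula gives.\<close>

section \<open>Calculus of smooth functions\<close>

lemma Ck_on_cong:
  assumes "open S" "\<And>x. x \<in> S \<Longrightarrow> f x = g x" "Ck_on k f S"
  shows "Ck_on k g S"
  using assms(2,3)
proof (induction k arbitrary: f g)
  case 0
  then show ?case by (metis Ck_on.simps(1) continuous_on_cong)
next
  case (Suc k)
  have d: "(f has_derivative D) (at x) \<longleftrightarrow> (g has_derivative D) (at x)" if "x \<in> S" for x D
    using has_derivative_transform_within_open[OF _ assms(1) that] Suc.prems(1) by metis
  then have e: "frechet_derivative f (at x) = frechet_derivative g (at x)" if "x \<in> S" for x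
    using that by (simp add: frechet_derivative_def)
  have "g differentiable_on S"
    using Suc.prems(2) d
    by (simp add: differentiable_on_eq_differentiable_at[OF assms(1)] differentiable_def)
  moreover have "Ck_on k (\<lambda>x. frechet_derivative g (at x) v) S" for v
    using Suc.IH[of "\<lambda>x. frechet_derivative f (at x) v" "\<lambda>x. frechet_derivative g (at x) v"] e Suc.prems(2)
    by simp
  ultimately show ?case by simp
qed

text \<open>Reduces smoothness to an explicit formula for the derivative; \<open>frechet_derivative\<close> itself never has
  to be computed.\<close>

lemma Ck_on_SucI:
  assumes "open S" "\<And>x. x \<in> S \<Longrightarrow> (f has_derivative D x) (at x)"
    and "\<And>v. Ck_on k (\<lambda>x. D x v) S"
  shows "Ck_on (Suc k) f S"
proof -
  have "f differentiable_on S"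
    using assms(2) by (auto simp: differentiable_on_eq_differentiable_at[OF assms(1)] differentiable_def)
  moreover have "Ck_on k (\<lambda>x. frechet_derivative f (at x) v) S" for v
    by (rule Ck_on_cong[OF assms(1) _ assms(3)[of v]]) (use assms(2) frechet_derivative_at in metis)
  ultimately show ?thesis by simp
qed

lemma Ck_on_SucD:
  assumes "open S" "Ck_on (Suc k) f S" "x \<in> S"
  shows "(f has_derivative frechet_derivative f (at x)) (at x)"
  using assms by (auto simp: differentiable_on_eq_differentiable_at frechet_derivative_works)

lemma Ck_on_pred: "Ck_on (Suc k) f S \<Longrightarrow> Ck_on k f S"
proof (induction k arbitrary: f)
  case 0
  then show ?case by (simp add: differentiable_imp_continuous_on)
qed auto

lemma Ck_on_subset: "Ck_on k f S \<Longrightarrow> T \<subseteq> S \<Longrightarrow> Ck_on k f T"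
  by (induction k arbitrary: f) (auto intro: continuous_on_subset differentiable_on_subset)

lemma Ck_on_local:
  assumes "\<And>x. x \<in> S \<Longrightarrow> \<exists>V. open V \<and> x \<in> V \<and> Ck_on k f V" "open S"
  shows "Ck_on k f S"
  using assms(1)
proof (induction k arbitrary: f)
  case 0
  show ?case
    unfolding Ck_on.simps continuous_on_eq_continuous_at[OF assms(2)]
  proof
    fix x assume "x \<in> S"
    with 0 obtain V where "open V" "x \<in> V" "continuous_on V f" by auto
    then show "isCont f x" by (simp add: continuous_on_eq_continuous_at)
  qed
next
  case (Suc k)
  have "f differentiable_on S"
    unfolding differentiable_on_eq_differentiable_at[OF assms(2)]
  proof
    fix x assume "x \<in> S"
    with Suc.prems obtain V where "open V" "x \<in> V" "f differentiable_on V" by (metis Ck_on.simps(2))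
    then show "f differentiable at x" by (simp add: differentiable_on_eq_differentiable_at)
  qed
  moreover have "Ck_on k (\<lambda>x. frechet_derivative f (at x) v) S" for v
  proof (rule Suc.IH)
    fix x assume "x \<in> S"
    with Suc.prems show "\<exists>V. open V \<and> x \<in> V \<and> Ck_on k (\<lambda>x. frechet_derivative f (at x) v) V"
      by (metis Ck_on.simps(2))
  qed
  ultimately show ?case by simp
qed

lemma Ck_on_const: "Ck_on k (\<lambda>x. c) S"
  by (induction k arbitrary: c) (auto simp: frechet_derivative_const)

lemma Ck_on_linear:
  assumes "open S" "bounded_linear L" "Ck_on k f S"
  shows "Ck_on k (\<lambda>x. L (f x)) S"
  using assms(3)
proof (induction k arbitrary: f)
  case 0
  then show ?case using bounded_linear.continuous_on[OF assms(2)] by simp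
next
  case (Suc k)
  show ?case
  proof (rule Ck_on_SucI[OF assms(1)])
    show "((\<lambda>x. L (f x)) has_derivative (\<lambda>v. L (frechet_derivative f (at x) v))) (at x)" if "x \<in> S" for x
      by (rule bounded_linear.has_derivative[OF assms(2) Ck_on_SucD[OF assms(1) Suc.prems that]])
    show "Ck_on k (\<lambda>x. L (frechet_derivative f (at x) v)) S" for v
      using Suc.IH Suc.prems by simp
  qed
qed

lemma Ck_on_add:
  assumes "open S" "Ck_on k f S" "Ck_on k g S"
  shows "Ck_on k (\<lambda>x. f x + g x) S"
  using assms(2,3)
proof (induction k arbitrary: f g)
  case 0
  then show ?case by (simp add: continuous_on_add)
next
  case (Suc k)
  show ?case
  proof (rule Ck_on_SucI[OF assms(1)])
    show "((\<lambda>x. f x + g x) has_derivative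
      (\<lambda>v. frechet_derivative f (at x) v + frechet_derivative g (at x) v)) (at x)" if "x \<in> S" for x
      using Ck_on_SucD[OF assms(1) Suc.prems(1) that] Ck_on_SucD[OF assms(1) Suc.prems(2) that]
      by (rule has_derivative_add)
  qed (use Suc in simp)
qed

lemma Ck_on_sum:
  assumes "open S" "finite I" "\<And>i. i \<in> I \<Longrightarrow> Ck_on k (f i) S"
  shows "Ck_on k (\<lambda>x. \<Sum>i\<in>I. f i x) S"
  using assms(2,3) by induction (auto simp: Ck_on_const intro: Ck_on_add[OF assms(1)])

lemma Ck_on_bilinear:
  assumes "open S" "bounded_bilinear B" "Ck_on k f S" "Ck_on k g S"
  shows "Ck_on k (\<lambda>x. B (f x) (g x)) S"
  using assms(3,4)
proof (induction k arbitrary: f g)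
  case 0
  then show ?case by (simp add: bounded_bilinear.continuous_on[OF assms(2)])
next
  case (Suc k)
  show ?case
  proof (rule Ck_on_SucI[OF assms(1)])
    show "((\<lambda>x. B (f x) (g x)) has_derivative
      (\<lambda>v. B (f x) (frechet_derivative g (at x) v) + B (frechet_derivative f (at x) v) (g x))) (at x)"
      if "x \<in> S" for x
      using Ck_on_SucD[OF assms(1) Suc.prems(1) that] Ck_on_SucD[OF assms(1) Suc.prems(2) that]
      by (rule bounded_bilinear.FDERIV[OF assms(2)])
    show "Ck_on k (\<lambda>x. B (f x) (frechet_derivative g (at x) v)
            + B (frechet_derivative f (at x) v) (g x)) S" for v
      using Suc.IH Ck_on_pred[OF Suc.prems(1)] Ck_on_pred[OF Suc.prems(2)] Suc.prems
      by (intro Ck_on_add[OF assms(1)]) auto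
  qed
qed

lemmas Ck_on_mult = Ck_on_bilinear[OF _ bounded_bilinear_mult]

lemma Ck_on_inverse:
  fixes f :: "'e::euclidean_space \<Rightarrow> complex"
  assumes "open S" "Ck_on k f S" "\<And>x. x \<in> S \<Longrightarrow> f x \<noteq> 0"
  shows "Ck_on k (\<lambda>x. inverse (f x)) S"
  using assms(2)
proof (induction k)
  case 0
  then show ?case using assms(3) by (simp add: continuous_on_inverse)
next
  case (Suc k)
  show ?case
  proof (rule Ck_on_SucI[OF assms(1)])
    show "((\<lambda>x. inverse (f x)) has_derivative
      (\<lambda>v. - (inverse (f x) * frechet_derivative f (at x) v * inverse (f x)))) (at x)" if "x \<in> S" for x
      using Deriv.has_derivative_inverse[OF assms(3)[OF that] Ck_on_SucD[OF assms(1) Suc.prems that]] .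
    have i: "Ck_on k (\<lambda>x. inverse (f x)) S"
      using Suc.IH Ck_on_pred[OF Suc.prems] by blast
    show "Ck_on k (\<lambda>x. - (inverse (f x) * frechet_derivative f (at x) v * inverse (f x))) S" for v
      using Suc.prems
      by (intro Ck_on_linear[OF assms(1) bounded_linear_minus[OF bounded_linear_ident]]
            Ck_on_mult[OF assms(1)] i) auto
  qed
qed

lemma has_derivative_basis_expansion:
  fixes f :: "'f::euclidean_space \<Rightarrow> 'g::real_normed_vector"
  assumes "(f has_derivative D) F"
  shows "D v = (\<Sum>b\<in>Basis. (v \<bullet> b) *\<^sub>R D b)"
proof -
  interpret linear D using assms by (rule has_derivative_linear)
  have "D v = D (\<Sum>b\<in>Basis. (v \<bullet> b) *\<^sub>R b)" by (simp add: euclidean_representation)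
  then show ?thesis by (simp add: sum scaleR)
qed

text \<open>The derivative of a composition is expanded in the standard basis, so that it becomes a sum of
  products of compositions of lower order.\<close>

lemma Ck_on_compose:
  fixes f :: "'f::euclidean_space \<Rightarrow> 'g::real_normed_vector" and g :: "'e::euclidean_space \<Rightarrow> 'f"
  assumes "open S" "open T" "g ` S \<subseteq> T" "Ck_on k f T" "\<And>b. b \<in> Basis \<Longrightarrow> Ck_on k (\<lambda>x. g x \<bullet> b) S"
  shows "Ck_on k (\<lambda>x. f (g x)) S"
  using assms(4,5)
proof (induction k arbitrary: f)
  case 0
  then have "continuous_on S g" by (simp add: continuous_on_componentwise[of S g])
  then show ?case
    using 0 assms(3) by (metis Ck_on.simps(1) continuous_on_compose2)
next
  case (Suc k)
  have gd: "(g has_derivative frechet_derivative g (at x)) (at x)" if "x \<in> S" for x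
  proof -
    have "g differentiable at x"
      using Suc.prems(2) that
      by (auto simp: differentiable_componentwise_within[of g] differentiable_on_eq_differentiable_at[OF assms(1)])
    then show ?thesis by (simp add: frechet_derivative_works)
  qed
  have fd: "(f has_derivative frechet_derivative f (at y)) (at y)" if "y \<in> T" for y
    using Ck_on_SucD[OF assms(2) Suc.prems(1) that] .
  show ?case
  proof (rule Ck_on_SucI[OF assms(1)])
    fix x assume x: "x \<in> S"
    have "((\<lambda>x. f (g x)) has_derivative (\<lambda>v. frechet_derivative f (at (g x)) (frechet_derivative g (at x) v))) (at x)"
      by (rule has_derivative_compose[OF gd[OF x] fd]) (use x assms(3) in auto)
    also have "(\<lambda>v. frechet_derivative f (at (g x)) (frechet_derivative g (at x) v)) =
      (\<lambda>v. \<Sum>b\<in>Basis. (frechet_derivative g (at x) v \<bullet> b) *\<^sub>R frechet_derivative f (at (g x)) b)"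
      by (intro ext, rule has_derivative_basis_expansion[OF fd]) (use x assms(3) in auto)
    finally show "((\<lambda>x. f (g x)) has_derivative
      (\<lambda>v. \<Sum>b\<in>Basis. (frechet_derivative g (at x) v \<bullet> b) *\<^sub>R frechet_derivative f (at (g x)) b)) (at x)" .
  next
    fix v
    show "Ck_on k (\<lambda>x. \<Sum>b\<in>Basis. (frechet_derivative g (at x) v \<bullet> b) *\<^sub>R frechet_derivative f (at (g x)) b) S"
    proof (intro Ck_on_sum[OF assms(1)] Ck_on_bilinear[OF assms(1) bounded_bilinear_scaleR] finite_Basis)
      fix b :: 'f assume b: "b \<in> Basis"
      have "frechet_derivative (\<lambda>x. g x \<bullet> b) (at x) v = frechet_derivative g (at x) v \<bullet> b" if "x \<in> S" for x
        using frechet_derivative_at[OF bounded_linear.has_derivative[OF bounded_linear_inner_left gd[OF that]]]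
        by metis
      then show "Ck_on k (\<lambda>x. frechet_derivative g (at x) v \<bullet> b) S"
        by (rule Ck_on_cong[OF assms(1)]) (use Suc.prems(2)[OF b] in simp_all)
      show "Ck_on k (\<lambda>x. frechet_derivative f (at (g x)) b) S"
      proof (rule Suc.IH)
        show "Ck_on k (\<lambda>y. frechet_derivative f (at y) b) T" using Suc.prems(1) by simp
        show "Ck_on k (\<lambda>x. g x \<bullet> c) S" if "c \<in> Basis" for c
          using Ck_on_pred[OF Suc.prems(2)[OF that]] .
      qed
    qed
  qed
qed

lemma Cinf_on_continuous: "Cinf_on f S \<Longrightarrow> continuous_on S f"
  unfolding Cinf_on_def by (metis Ck_on.simps(1))

lemma Cinf_on_deriv: "Cinf_on f S \<Longrightarrow> Cinf_on (\<lambda>x. frechet_derivative f (at x) v) S"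
  unfolding Cinf_on_def by (metis Ck_on.simps(2))

lemma Cinf_onD:
  assumes "open S" "Cinf_on f S" "x \<in> S"
  shows "(f has_derivative frechet_derivative f (at x)) (at x)"
  using assms Ck_on_SucD unfolding Cinf_on_def by blast

section \<open>Integrals depending on a parameter\<close>

text \<open>Differentiation under the integral sign, for integrands that reach \<open>f\<close> through a curve of
  affine maps. Radial curves give the Hadamard lemma, circles give Cauchy's formula.\<close>

lemma has_derivative_affine_integral:
  fixes f :: "'e::euclidean_space \<Rightarrow> complex" and \<gamma> :: "real \<Rightarrow> 'e"
  assumes "open T" "Ck_on 1 f T" "open U" "convex U" "x0 \<in> U"
    and "continuous_on {0..1} w" "continuous_on {0..1} \<alpha>" "continuous_on {0..1} \<gamma>"
    and "\<And>x s. x \<in> U \<Longrightarrow> s \<in> {0..1} \<Longrightarrow> \<alpha> s *\<^sub>R x + \<gamma> s \<in> T"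
  shows "((\<lambda>x. integral {0..1} (\<lambda>s. w s * f (\<alpha> s *\<^sub>R x + \<gamma> s))) has_derivative
     (\<lambda>v. integral {0..1} (\<lambda>s. w s * of_real (\<alpha> s) * frechet_derivative f (at (\<alpha> s *\<^sub>R x0 + \<gamma> s)) v))) (at x0)"
proof -
  let ?\<phi> = "\<lambda>s x. \<alpha> s *\<^sub>R x + \<gamma> s"
  define D where "D x s v = w s * of_real (\<alpha> s) * frechet_derivative f (at (?\<phi> s x)) v" for x s v
  have fd: "(f has_derivative frechet_derivative f (at y)) (at y)" if "y \<in> T" for y
    using Ck_on_SucD[OF assms(1) assms(2)[unfolded One_nat_def] that] .
  have der: "((\<lambda>x. w s * f (?\<phi> s x)) has_derivative D x s) (at x)" if "x \<in> U" "s \<in> {0..1}" for x s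
  proof -
    have "((\<lambda>x. f (?\<phi> s x)) has_derivative (\<lambda>v. frechet_derivative f (at (?\<phi> s x)) (\<alpha> s *\<^sub>R v))) (at x)"
      by (rule has_derivative_compose[OF _ fd]) (auto intro!: derivative_eq_intros assms(9) that)
    then have "((\<lambda>x. w s * f (?\<phi> s x)) has_derivative
       (\<lambda>v. w s * frechet_derivative f (at (?\<phi> s x)) (\<alpha> s *\<^sub>R v))) (at x)"
      by (rule has_derivative_mult_right)
    moreover have "frechet_derivative f (at (?\<phi> s x)) (\<alpha> s *\<^sub>R v)
        = of_real (\<alpha> s) * frechet_derivative f (at (?\<phi> s x)) v" for v
      using linear_scale[OF has_derivative_linear[OF fd[OF assms(9)[OF that]]]]
      by (simp add: scaleR_conv_of_real)
    ultimately show ?thesis by (simp add: D_def[abs_def] mult.assoc)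
  qed
  have bl: "bounded_linear (D x s)" if "x \<in> U" "s \<in> {0..1}" for x s
    using der[OF that] has_derivative_bounded_linear by blast
  have c\<phi>: "continuous_on (U \<times> {0..1}) (\<lambda>p. ?\<phi> (snd p) (fst p))"
    by (intro continuous_intros continuous_on_compose2[OF assms(7)] continuous_on_compose2[OF assms(8)]) auto
  have cD: "continuous_on (U \<times> {0..1}) (\<lambda>p. D (fst p) (snd p) v)" for v
  proof -
    have "continuous_on T (\<lambda>y. frechet_derivative f (at y) v)" using assms(2) by simp
    then have "continuous_on (U \<times> {0..1}) (\<lambda>p. frechet_derivative f (at (?\<phi> (snd p) (fst p))) v)"
      by (rule continuous_on_compose2[OF _ c\<phi>]) (use assms(9) in auto)
    then show ?thesis unfolding D_def
      by (intro continuous_intros continuous_on_compose2[OF assms(6)] continuous_on_compose2[OF assms(7)]) auto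
  qed
  have B: "blinfun_apply (Blinfun (D x s)) = D x s" if "x \<in> U" "s \<in> {0..1}" for x s
    using bl[OF that] by (simp add: bounded_linear_Blinfun_apply)
  have cB: "continuous_on (U \<times> {0..1}) (\<lambda>p. Blinfun (D (fst p) (snd p)))"
  proof (rule continuous_on_blinfun_componentwise)
    fix i :: 'e assume "i \<in> Basis"
    show "continuous_on (U \<times> {0..1}) (\<lambda>p. blinfun_apply (Blinfun (D (fst p) (snd p))) i)"
      by (rule continuous_on_eq[OF cD[of i]]) (auto simp: B)
  qed
  have "((\<lambda>x. integral (cbox 0 1) (\<lambda>s. w s * f (?\<phi> s x))) has_derivative
      integral (cbox 0 1) (\<lambda>s. Blinfun (D x0 s))) (at x0 within U)"
  proof (rule leibniz_rule)
    show "((\<lambda>x. w s * f (?\<phi> s x)) has_derivative blinfun_apply (Blinfun (D x s))) (at x within U)"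
      if "x \<in> U" "s \<in> cbox 0 1" for x s
      using der[of x s] B[of x s] that by (simp add: has_derivative_at_withinI)
    show "(\<lambda>s. w s * f (?\<phi> s x)) integrable_on cbox 0 1" if "x \<in> U" for x
    proof (rule integrable_continuous)
      have "continuous_on T f" using assms(2) Ck_on_pred[of 0 f T] by simp
      then have "continuous_on {0..1} (\<lambda>s. f (?\<phi> s x))"
        by (rule continuous_on_compose2) (use assms(7-9) that in \<open>auto intro!: continuous_intros\<close>)
      then show "continuous_on (cbox 0 1) (\<lambda>s. w s * f (?\<phi> s x))"
        using assms(6) by (auto intro!: continuous_intros)
    qed
    show "continuous_on (U \<times> cbox 0 1) (\<lambda>(x, t). Blinfun (D x t))"
      using cB by (simp add: case_prod_unfold)
  qed (use assms in auto)
  moreover have "integral (cbox 0 1) (\<lambda>s. Blinfun (D x0 s)) v = integral {0..1} (\<lambda>s. D x0 s v)" for v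
  proof -
    have c0: "continuous_on {0..1::real} (\<lambda>s. (x0, s))" by (intro continuous_intros)
    have "continuous_on {0..1} (\<lambda>s. Blinfun (D x0 s))"
      using continuous_on_compose2[OF cB c0] assms(5) by auto
    then have "(\<lambda>s. Blinfun (D x0 s)) integrable_on {0..1}"
      by (rule integrable_continuous_interval)
    then have "integral {0..1} (\<lambda>s. Blinfun (D x0 s)) v = integral {0..1} (\<lambda>s. Blinfun (D x0 s) v)"
      by (rule blinfun_apply_integral)
    also have "\<dots> = integral {0..1} (\<lambda>s. D x0 s v)"
      by (rule integral_cong) (use B assms(5) in auto)
    finally show ?thesis by simp
  qed
  ultimately show ?thesis
    using at_within_open[OF assms(5,3)]
    by (auto simp: D_def elim!: has_derivative_eq_rhs intro!: ext)
qed

text \<open>Differentiation only replaces the weight \<open>w\<close> by \<open>w \<alpha>\<close> and \<open>f\<close> by a derivative, so the integrals of this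
  form are closed under it.\<close>

lemma Cinf_on_affine_integral:
  fixes f :: "'e::euclidean_space \<Rightarrow> complex" and \<gamma> :: "real \<Rightarrow> 'e"
  assumes "open T" "Cinf_on f T" "open U" "convex U"
    and "continuous_on {0..1} w" "continuous_on {0..1} \<alpha>" "continuous_on {0..1} \<gamma>"
    and "\<And>x s. x \<in> U \<Longrightarrow> s \<in> {0..1} \<Longrightarrow> \<alpha> s *\<^sub>R x + \<gamma> s \<in> T"
  shows "Cinf_on (\<lambda>x. integral {0..1} (\<lambda>s. w s * f (\<alpha> s *\<^sub>R x + \<gamma> s))) U"
proof -
  have "Ck_on k (\<lambda>x. integral {0..1} (\<lambda>s. w s * f (\<alpha> s *\<^sub>R x + \<gamma> s))) U" for k
    using assms(2,5)
  proof (induction k arbitrary: f w)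
    case 0
    have "Ck_on 1 f T" using 0(1) unfolding Cinf_on_def by blast
    then have "isCont (\<lambda>x. integral {0..1} (\<lambda>s. w s * f (\<alpha> s *\<^sub>R x + \<gamma> s))) x" if "x \<in> U" for x
      using has_derivative_continuous[OF has_derivative_affine_integral[OF assms(1) _ assms(3,4) that 0(2) assms(6-8)]]
      by blast
    then show ?case by (simp add: continuous_at_imp_continuous_on)
  next
    case (Suc k)
    have c: "Ck_on 1 f T" using Suc.prems(1) unfolding Cinf_on_def by blast
    show ?case
    proof (rule Ck_on_SucI[OF assms(3)])
      show "((\<lambda>x. integral {0..1} (\<lambda>s. w s * f (\<alpha> s *\<^sub>R x + \<gamma> s))) has_derivative
       (\<lambda>v. integral {0..1} (\<lambda>s. (w s * of_real (\<alpha> s)) * frechet_derivative f (at (\<alpha> s *\<^sub>R x + \<gamma> s)) v))) (at x)"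
        if "x \<in> U" for x
        using has_derivative_affine_integral[OF assms(1) c assms(3,4) that Suc.prems(2) assms(6-8)] .
      show "Ck_on k (\<lambda>x. integral {0..1} (\<lambda>s. (w s * of_real (\<alpha> s)) * frechet_derivative f (at (\<alpha> s *\<^sub>R x + \<gamma> s)) v)) U" for v
        by (intro Suc.IH Cinf_on_deriv Suc.prems(1)) (intro continuous_intros Suc.prems(2) assms(6))
    qed
  qed
  then show ?thesis by (simp add: Cinf_on_def)
qed

text \<open>Hadamard's lemma: integrate the derivative along the segments that start at \<open>z\<^sub>0\<close>.\<close>

lemma hadamard:
  fixes f :: "'e::euclidean_space \<Rightarrow> complex"
  assumes "Cinf_on f (ball z0 r)" "r > 0"
  obtains g where "\<And>b. b \<in> Basis \<Longrightarrow> Cinf_on (g b) (ball z0 r)"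
    "\<And>b. b \<in> Basis \<Longrightarrow> g b z0 = frechet_derivative f (at z0) b"
    "\<And>z. z \<in> ball z0 r \<Longrightarrow> f z = f z0 + (\<Sum>b\<in>Basis. of_real ((z - z0) \<bullet> b) * g b z)"
proof -
  define g where "g b z = integral {0..1} (\<lambda>s. 1 * frechet_derivative f (at (s *\<^sub>R z + (1 - s) *\<^sub>R z0)) b)" for b z
  have seg: "s *\<^sub>R z + (1 - s) *\<^sub>R z0 \<in> ball z0 r" if "z \<in> ball z0 r" "s \<in> {0..1}" for s z
    by (rule convexD[OF convex_ball]) (use that assms(2) in auto)
  have "Cinf_on (g b) (ball z0 r)" for b
    unfolding g_def
    by (rule Cinf_on_affine_integral[OF open_ball Cinf_on_deriv[OF assms(1)]])
       (use seg in \<open>auto intro!: continuous_intros\<close>)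
  moreover have "g b z0 = frechet_derivative f (at z0) b" for b
    by (simp add: g_def algebra_simps)
  moreover have "f z = f z0 + (\<Sum>b\<in>Basis. of_real ((z - z0) \<bullet> b) * g b z)" if z: "z \<in> ball z0 r" for z
  proof -
    let ?\<phi> = "\<lambda>s. s *\<^sub>R z + (1 - s) *\<^sub>R z0"
    let ?D = "\<lambda>s. frechet_derivative f (at (?\<phi> s))"
    have fd: "(f has_derivative ?D s) (at (?\<phi> s))" if "s \<in> {0..1}" for s
      using Cinf_onD[OF open_ball assms(1) seg[OF z that]] .
    have "((\<lambda>s. f (?\<phi> s)) has_vector_derivative ?D s (z - z0)) (at s within {0..1})" if "s \<in> {0..1}" for s
    proof -
      have "(?\<phi> has_vector_derivative z - z0) (at s within {0..1})"
        by (auto intro!: derivative_eq_intros simp: algebra_simps)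
      from vector_derivative_diff_chain_within[OF this has_derivative_at_withinI[OF fd[OF that]]]
      show ?thesis by (simp add: o_def)
    qed
    then have "((\<lambda>s. ?D s (z - z0)) has_integral f (?\<phi> 1) - f (?\<phi> 0)) {0..1}"
      by (intro fundamental_theorem_of_calculus) auto
    then have 1: "f z - f z0 = integral {0..1} (\<lambda>s. ?D s (z - z0))"
      by (simp add: integral_unique)
    also have "\<dots> = integral {0..1} (\<lambda>s. \<Sum>b\<in>Basis. of_real ((z - z0) \<bullet> b) * ?D s b)"
      by (rule integral_cong) (simp add: has_derivative_basis_expansion[OF fd, of _ "z - z0"] scaleR_conv_of_real)
    also have "\<dots> = (\<Sum>b\<in>Basis. integral {0..1} (\<lambda>s. of_real ((z - z0) \<bullet> b) * ?D s b))"
    proof (rule integral_sum[OF finite_Basis])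
      fix b :: 'e
      have "continuous_on {0..1} (\<lambda>s. ?D s b)"
        by (rule continuous_on_compose2[OF Cinf_on_continuous[OF Cinf_on_deriv[OF assms(1)]]])
           (use seg[OF z] in \<open>auto intro!: continuous_intros\<close>)
      then show "(\<lambda>s. of_real ((z - z0) \<bullet> b) * ?D s b) integrable_on {0..1}"
        by (intro integrable_continuous_interval continuous_intros)
    qed
    also have "\<dots> = (\<Sum>b\<in>Basis. of_real ((z - z0) \<bullet> b) * g b z)"
      by (simp add: g_def)
    finally show ?thesis by (simp add: algebra_simps)
  qed
  ultimately show ?thesis using that by blast
qed

section \<open>Holomorphic functions of several variables are smooth\<close>

lemma cn_holomorphic_onD:
  assumes "cn_holomorphic_on f S" "z \<in> S"
  shows "(f has_derivative frechet_derivative f (at z)) (at z)"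
    and "frechet_derivative f (at z) (c *s v) = c * frechet_derivative f (at z) v"
  using assms frechet_derivative_at unfolding cn_holomorphic_on_def by metis+

lemma bounded_linear_smult_vec: "bounded_linear (\<lambda>\<zeta>::complex. \<zeta> *s (v::complex^'n))"
proof -
  have "linear (\<lambda>\<zeta>::complex. \<zeta> *s v)"
    by (rule linearI) (auto simp: vec_eq_iff algebra_simps)
  then show ?thesis by (simp add: linear_conv_bounded_linear)
qed

text \<open>Cauchy's formula on the complex line through \<open>x\<close> in direction \<open>v\<close>. The contour integral is written
  over the unit interval, to be differentiated in \<open>x\<close>.\<close>

lemma directional_cauchy_formula:
  fixes f :: "complex^'n::finite \<Rightarrow> complex"
  assumes "cn_holomorphic_on f S" "r > 0" "\<And>\<zeta>. norm \<zeta> \<le> r \<Longrightarrow> x + \<zeta> *s v \<in> S"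
  shows "frechet_derivative f (at x) v =
    integral {0..1} (\<lambda>s. 1 / (of_real r * exp (2 * of_real pi * \<i> * of_real s)) *
      f (1 *\<^sub>R x + (of_real r * exp (2 * of_real pi * \<i> * of_real s)) *s v))"
proof -
  define g where "g \<zeta> = f (x + \<zeta> *s v)" for \<zeta>
  have gd: "(g has_field_derivative frechet_derivative f (at (x + \<zeta> *s v)) v) (at \<zeta>)"
    if "norm \<zeta> \<le> r" for \<zeta>
  proof -
    have "((\<lambda>\<zeta>. x + \<zeta> *s v) has_derivative (\<lambda>h. h *s v)) (at \<zeta>)"
      using has_derivative_add[OF has_derivative_const
          bounded_linear.has_derivative[OF bounded_linear_smult_vec[of v] has_derivative_ident]]
      by simp
    from has_derivative_compose[OF this cn_holomorphic_onD(1)[OF assms(1) assms(3)[OF that]]]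
    show ?thesis
      using cn_holomorphic_onD(2)[OF assms(1) assms(3)[OF that]]
      by (simp add: has_field_derivative_def g_def[abs_def] mult.commute[of _ "frechet_derivative _ _ _"])
  qed
  have "g holomorphic_on ball 0 r"
  proof (rule holomorphic_onI)
    fix \<zeta> :: complex assume "\<zeta> \<in> ball 0 r"
    then have "norm \<zeta> \<le> r" by simp
    from has_field_derivative_at_within[OF gd[OF this]]
    show "g field_differentiable at \<zeta> within ball 0 r" unfolding field_differentiable_def by blast
  qed
  moreover have "continuous_on (cball 0 r) g"
  proof (rule continuous_at_imp_continuous_on, rule ballI)
    fix \<zeta> :: complex assume "\<zeta> \<in> cball 0 r"
    then have "norm \<zeta> \<le> r" by simp
    from DERIV_isCont[OF gd[OF this]] show "isCont g \<zeta>" .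
  qed
  ultimately have "(g has_field_derivative
      1 / (2 * of_real pi * \<i>) * contour_integral (circlepath 0 r) (\<lambda>u. g u / (u - 0)\<^sup>2)) (at 0)"
    by (intro Cauchy_derivative_integral_circlepath) (use assms(2) in auto)
  from DERIV_unique[OF gd[of 0] this] have "frechet_derivative f (at x) v =
      1 / (2 * of_real pi * \<i>) * contour_integral (circlepath 0 r) (\<lambda>u. g u / u\<^sup>2)"
    using assms(2) by simp
  also have "\<dots> = integral {0..1} (\<lambda>s. 1 / (2 * of_real pi * \<i>) *
      (g (circlepath 0 r s) / (circlepath 0 r s)\<^sup>2 * vector_derivative (circlepath 0 r) (at s)))"
    by (simp only: contour_integral_integral integral_mult_right)
  also have "\<dots> = integral {0..1} (\<lambda>s. 1 / (of_real r * exp (2 * of_real pi * \<i> * of_real s)) *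
      f (1 *\<^sub>R x + (of_real r * exp (2 * of_real pi * \<i> * of_real s)) *s v))"
  proof (rule integral_cong)
    fix s :: real
    define E where "E = complex_of_real r * exp (2 * of_real pi * \<i> * of_real s)"
    have "E \<noteq> 0" using assms(2) by (simp add: E_def)
    moreover have "circlepath 0 r s = E" by (simp add: circlepath E_def)
    moreover have "vector_derivative (circlepath 0 r) (at s) = 2 * of_real pi * \<i> * E"
      unfolding vector_derivative_circlepath E_def by (simp add: mult_ac)
    ultimately show "1 / (2 * of_real pi * \<i>) * (g (circlepath 0 r s) / (circlepath 0 r s)\<^sup>2 *
        vector_derivative (circlepath 0 r) (at s)) =
      1 / (of_real r * exp (2 * of_real pi * \<i> * of_real s)) *
        f (1 *\<^sub>R x + (of_real r * exp (2 * of_real pi * \<i> * of_real s)) *s v)"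
      unfolding E_def[symmetric] by (simp add: g_def power2_eq_square)
  qed
  finally show ?thesis .
qed

text \<open>Cauchy's formula expresses a directional derivative by an integral of \<open>f\<close> itself, with one radius for
  all points of a small ball. Hence it is continuous; after that the integral may be differentiated
  under the integral sign, which keeps complex linearity.\<close>

lemma cn_holomorphic_imp_C1:
  fixes f :: "complex^'n::finite \<Rightarrow> complex"
  assumes "open S" "cn_holomorphic_on f S"
  shows "Ck_on 1 f S" and "cn_holomorphic_on (\<lambda>x. frechet_derivative f (at x) v) S"
proof -
  have fc: "continuous_on S f"
    using cn_holomorphic_onD(1)[OF assms(2)] has_derivative_continuous
    by (blast intro: continuous_at_imp_continuous_on)
  define w where "w r = (\<lambda>s. 1 / (complex_of_real r * exp (2 * of_real pi * \<i> * of_real s)))" for r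
  define \<gamma> where "\<gamma> r v = (\<lambda>s. (of_real r * exp (2 * of_real pi * \<i> * of_real s)) *s (v::complex^'n))" for r v
  \<comment> \<open>On a small ball around \<open>x0\<close> one radius serves all circles.\<close>
  have loc: "\<exists>\<delta>>0. \<exists>r>0. (\<forall>x\<in>ball x0 \<delta>. \<forall>\<zeta>. norm \<zeta> \<le> r \<longrightarrow> x + \<zeta> *s v \<in> S)"
    if "x0 \<in> S" for x0 v
  proof -
    obtain d where d: "d > 0" "ball x0 d \<subseteq> S" using assms(1) \<open>x0 \<in> S\<close> openE by blast
    obtain K where K: "K > 0" "\<And>\<zeta>. norm (\<zeta> *s v) \<le> norm \<zeta> * K"
      using bounded_linear.pos_bounded[OF bounded_linear_smult_vec] by blast
    have "x + \<zeta> *s v \<in> S" if "x \<in> ball x0 (d/2)" "norm \<zeta> \<le> d / (2 * K)" for x \<zeta>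
    proof -
      have "norm (\<zeta> *s v) \<le> d / 2"
        using K(2)[of \<zeta>] mult_right_mono[OF that(2), of K] K(1) by (simp add: field_simps)
      moreover have "dist x0 x < d / 2" using that(1) by simp
      moreover have "dist x0 (x + \<zeta> *s v) \<le> dist x0 x + norm (\<zeta> *s v)"
        by (metis add_diff_cancel_left' dist_commute dist_norm dist_triangle)
      ultimately have "dist x0 (x + \<zeta> *s v) < d" by linarith
      then show ?thesis using d(2) by auto
    qed
    then show ?thesis using d(1) K(1)
      by (intro exI[of _ "d/2"] conjI exI[of _ "d / (2*K)"]) auto
  qed
  have wc: "continuous_on {0..1} (w r)" if "r > 0" for r
    unfolding w_def using that by (intro continuous_intros) auto
  have \<gamma>c: "continuous_on {0..1} (\<gamma> r v)" for r v
    unfolding \<gamma>_def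
    by (intro bounded_linear.continuous_on[OF bounded_linear_smult_vec] continuous_intros)
  have n\<gamma>: "norm (complex_of_real r * exp (2 * of_real pi * \<i> * of_real s)) \<le> r" if "r > 0" for r s
    using that by (simp add: norm_mult)
  have cont: "continuous_on S (\<lambda>x. frechet_derivative f (at x) v)" for v
    unfolding continuous_on_eq_continuous_at[OF assms(1)]
  proof
    fix x0 assume "x0 \<in> S"
    then obtain \<delta> r where \<delta>: "\<delta> > 0" "r > 0"
      "\<And>x \<zeta>. x \<in> ball x0 \<delta> \<Longrightarrow> norm \<zeta> \<le> r \<Longrightarrow> x + \<zeta> *s v \<in> S"
      using loc by meson
    have "continuous_on (ball x0 \<delta>) (\<lambda>x. integral (cbox 0 1) (\<lambda>s. w r s * f (1 *\<^sub>R x + \<gamma> r v s)))"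
    proof (rule integral_continuous_on_param)
      have "continuous_on (ball x0 \<delta> \<times> cbox 0 1) (\<lambda>p. w r (snd p) * f (1 *\<^sub>R fst p + \<gamma> r v (snd p)))"
        by (intro continuous_intros continuous_on_compose2[OF fc] continuous_on_compose2[OF wc[OF \<delta>(2)]]
             continuous_on_compose2[OF \<gamma>c])
           (use \<delta>(3) n\<gamma>[OF \<delta>(2)] in \<open>auto simp: \<gamma>_def\<close>)
      then show "continuous_on (ball x0 \<delta> \<times> cbox 0 1) (\<lambda>(x, s). w r s * f (1 *\<^sub>R x + \<gamma> r v s))"
        by (simp add: case_prod_unfold)
    qed
    then have "continuous_on (ball x0 \<delta>) (\<lambda>x. frechet_derivative f (at x) v)"
      by (rule continuous_on_eq)
         (use directional_cauchy_formula[OF assms(2) \<delta>(2) \<delta>(3)] in \<open>simp add: w_def \<gamma>_def\<close>)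
    then show "isCont (\<lambda>x. frechet_derivative f (at x) v) x0"
      using \<delta>(1) by (simp add: continuous_on_eq_continuous_at)
  qed
  have "f differentiable_on S"
    using cn_holomorphic_onD(1)[OF assms(2)]
    unfolding differentiable_on_eq_differentiable_at[OF assms(1)] differentiable_def by blast
  with cont show C1: "Ck_on 1 f S" by simp
  show "cn_holomorphic_on (\<lambda>x. frechet_derivative f (at x) v) S"
    unfolding cn_holomorphic_on_def
  proof
    fix x0 assume "x0 \<in> S"
    then obtain \<delta> r where \<delta>: "\<delta> > 0" "r > 0"
      "\<And>x \<zeta>. x \<in> ball x0 \<delta> \<Longrightarrow> norm \<zeta> \<le> r \<Longrightarrow> x + \<zeta> *s v \<in> S"
      using loc by meson
    let ?D = "\<lambda>u. integral {0..1} (\<lambda>s. w r s * of_real 1 * frechet_derivative f (at (1 *\<^sub>R x0 + \<gamma> r v s)) u)"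
    have inS: "1 *\<^sub>R x + \<gamma> r v s \<in> S" if "x \<in> ball x0 \<delta>" for x s
      using \<delta>(3)[OF that n\<gamma>[OF \<delta>(2)]] by (simp add: \<gamma>_def)
    have "((\<lambda>x. integral {0..1} (\<lambda>s. w r s * f (1 *\<^sub>R x + \<gamma> r v s))) has_derivative ?D) (at x0)"
      by (rule has_derivative_affine_integral[OF assms(1) C1 open_ball convex_ball])
         (use \<delta>(1) inS wc[OF \<delta>(2)] \<gamma>c in auto)
    then have "((\<lambda>x. frechet_derivative f (at x) v) has_derivative ?D) (at x0)"
      by (rule has_derivative_transform_within_open[of _ _ _ _ "ball x0 \<delta>"])
         (use \<delta>(1) directional_cauchy_formula[OF assms(2) \<delta>(2) \<delta>(3)] in \<open>simp_all add: w_def \<gamma>_def\<close>)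
    moreover have "?D (c *s u) = c * ?D u" for c u
    proof -
      have "?D (c *s u) = integral {0..1} (\<lambda>s. c * (w r s * of_real 1 * frechet_derivative f (at (1 *\<^sub>R x0 + \<gamma> r v s)) u))"
        by (rule integral_cong)
           (use inS[of x0] \<delta>(1) cn_holomorphic_onD(2)[OF assms(2)] in auto)
      then show ?thesis by simp
    qed
    ultimately show "\<exists>D. ((\<lambda>x. frechet_derivative f (at x) v) has_derivative D) (at x0) \<and>
        (\<forall>c v. D (c *s v) = c * D v)"
      by blast
  qed
qed

lemma cn_holomorphic_imp_Cinf:
  assumes "open S" "cn_holomorphic_on f S"
  shows "Cinf_on f S"
proof -
  have "Ck_on k f S" for k
    using assms(2)
  proof (induction k arbitrary: f)
    case 0
    then show ?case
      using Ck_on_pred[of 0 f S] cn_holomorphic_imp_C1(1)[OF assms(1)] unfolding One_nat_def by blast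
  next
    case (Suc k)
    then show ?case
      using cn_holomorphic_imp_C1[OF assms(1) Suc.prems] by simp
  qed
  then show ?thesis by (simp add: Cinf_on_def)
qed

section \<open>Complex conjugation and the pairing\<close>

lemma conj_tvec_simps [simp]:
  "conj_tvec (conj_tvec v) = v" "conj_tvec 0 = 0"
  "conj_tvec (v + w) = conj_tvec v + conj_tvec w"
  "conj_tvec (fscale c v) = fscale (cnj c) (conj_tvec v)"
  by (auto simp: conj_tvec_def fscale_def fun_eq_iff)

lemma conj_covec_simps [simp]:
  "conj_covec (conj_covec \<eta>) = \<eta>" "conj_covec 0 = 0"
  "conj_covec (\<eta> + \<zeta>) = conj_covec \<eta> + conj_covec \<zeta>"
  "conj_covec (fscale c \<eta>) = fscale (cnj c) (conj_covec \<eta>)"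
  by (auto simp: conj_covec_def fscale_def fun_eq_iff)

lemma conj_gvec_simps [simp]:
  "conj_gvec (conj_gvec E) = E" "conj_gvec 0 = 0"
  "conj_gvec (E + F) = conj_gvec E + conj_gvec F"
  "conj_gvec (gscale c E) = gscale (cnj c) (conj_gvec E)"
  by (auto simp: conj_gvec_def gscale_def prod_eq_iff)

lemma gscale_simps [simp]: "gscale 1 E = E" "gscale 0 E = 0" "gscale c 0 = 0" "gscale (-1) E = - E"
  "gscale c (gscale d E) = gscale (c * d) E"
  by (auto simp: gscale_def fscale_def fun_eq_iff prod_eq_iff)

lemma fscale_simps [simp]: "fscale 1 v = v" "fscale 0 v = 0" "fscale c 0 = 0" "fscale (-1) v = - v"
  "fscale c (fscale d v) = fscale (c * d) v" "fscale c v f = c * v f"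
  by (auto simp: fscale_def fun_eq_iff)

lemma gscale_sel [simp]: "fst (gscale c E) = fscale c (fst E)" "snd (gscale c E) = fscale c (snd E)"
  by (auto simp: gscale_def)

lemma conj_gvec_sel [simp]: "fst (conj_gvec E) = conj_tvec (fst E)" "snd (conj_gvec E) = conj_covec (snd E)"
  by (auto simp: conj_gvec_def)

lemma conj_gvec_uminus [simp]: "conj_gvec (- E) = - conj_gvec E"
  by (metis conj_gvec_simps(3) conj_gvec_simps(2) add.right_inverse minus_unique)

lemma conj_gvec_diff [simp]: "conj_gvec (E - F) = conj_gvec E - conj_gvec F"
  by (metis conj_gvec_simps(3) conj_gvec_uminus diff_conv_add_uminus)

lemma conj_gvec_sum: "conj_gvec (sum f I) = (\<Sum>i\<in>I. conj_gvec (f i))"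
  by (induction I rule: infinite_finite_induct) auto

lemma conj_gvec_eq_iff [simp]: "conj_gvec E = conj_gvec F \<longleftrightarrow> E = F"
  by (metis conj_gvec_simps(1))

lemma conj_gvec_eq_0_iff [simp]: "conj_gvec E = 0 \<longleftrightarrow> E = 0"
  by (metis conj_gvec_simps(1,2))

lemma mem_conj_image_iff: "E \<in> conj_gvec ` L \<longleftrightarrow> conj_gvec E \<in> L"
  by (metis (no_types, lifting) conj_gvec_simps(1) image_iff)

lemma sum_fun_apply: "(\<Sum>i\<in>I. f i) x = (\<Sum>i\<in>I. f i x :: complex)"
  by (induction I rule: infinite_finite_induct) auto

section \<open>Spaces with a sheaf of smooth functions\<close>

text \<open>These closure properties hold for manifolds and are inherited by the functions induced on a
  submanifold. The calculus of tangent vectors and sections is therefore developed once for both.\<close>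

locale smooth_sheaf =
  fixes S :: "'a smooth_space"
  assumes smooth_const: "openin (stop S) U \<Longrightarrow> (\<lambda>_. c) \<in> sfun S U"
    and smooth_add: "openin (stop S) U \<Longrightarrow> f \<in> sfun S U \<Longrightarrow> g \<in> sfun S U \<Longrightarrow> (\<lambda>x. f x + g x) \<in> sfun S U"
    and smooth_mult: "openin (stop S) U \<Longrightarrow> f \<in> sfun S U \<Longrightarrow> g \<in> sfun S U \<Longrightarrow> (\<lambda>x. f x * g x) \<in> sfun S U"
    and smooth_cnj: "openin (stop S) U \<Longrightarrow> f \<in> sfun S U \<Longrightarrow> (\<lambda>x. cnj (f x)) \<in> sfun S U"
    and smooth_restrict: "openin (stop S) U \<Longrightarrow> f \<in> sfun S U \<Longrightarrow> openin (stop S) W \<Longrightarrow> W \<subseteq> U \<Longrightarrow> f \<in> sfun S W"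
    and smooth_cong: "openin (stop S) U \<Longrightarrow> f \<in> sfun S U \<Longrightarrow> (\<And>x. x \<in> U \<Longrightarrow> f x = g x) \<Longrightarrow> g \<in> sfun S U"
    and smooth_local: "openin (stop S) U \<Longrightarrow>
      (\<And>p. p \<in> U \<Longrightarrow> \<exists>W. openin (stop S) W \<and> p \<in> W \<and> f \<in> sfun S W) \<Longrightarrow> f \<in> sfun S U"
begin

lemma smooth_scale: "openin (stop S) U \<Longrightarrow> f \<in> sfun S U \<Longrightarrow> (\<lambda>x. c * f x) \<in> sfun S U"
  using smooth_mult[OF _ smooth_const] by blast

lemma smooth_diff: "openin (stop S) U \<Longrightarrow> f \<in> sfun S U \<Longrightarrow> g \<in> sfun S U \<Longrightarrow> (\<lambda>x. f x - g x) \<in> sfun S U"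
  using smooth_add[OF _ _ smooth_scale[of U g "-1"]] by simp

lemma germsI: "openin (stop S) U \<Longrightarrow> p \<in> U \<Longrightarrow> f \<in> sfun S U \<Longrightarrow> f \<in> germs S p"
  by (auto simp: germs_def)

lemma germsE:
  assumes "f \<in> germs S p"
  obtains U where "openin (stop S) U" "p \<in> U" "f \<in> sfun S U"
  using assms by (auto simp: germs_def)

lemma germs_common:
  assumes "f \<in> germs S p" "g \<in> germs S p"
  obtains U where "openin (stop S) U" "p \<in> U" "f \<in> sfun S U" "g \<in> sfun S U"
proof -
  obtain U where U: "openin (stop S) U" "p \<in> U" "f \<in> sfun S U" using assms(1) by (rule germsE)
  obtain V where V: "openin (stop S) V" "p \<in> V" "g \<in> sfun S V" using assms(2) by (rule germsE)
  have "openin (stop S) (U \<inter> V)" "p \<in> U \<inter> V" "f \<in> sfun S (U \<inter> V)" "g \<in> sfun S (U \<inter> V)"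
    using U V smooth_restrict[of U f "U \<inter> V"] smooth_restrict[of V g "U \<inter> V"] by auto
  then show ?thesis by (rule that)
qed

lemma germs_add: "f \<in> germs S p \<Longrightarrow> g \<in> germs S p \<Longrightarrow> (\<lambda>x. f x + g x) \<in> germs S p"
  by (erule (1) germs_common) (rule germsI, assumption, assumption, rule smooth_add)

lemma germs_mult: "f \<in> germs S p \<Longrightarrow> g \<in> germs S p \<Longrightarrow> (\<lambda>x. f x * g x) \<in> germs S p"
  by (erule (1) germs_common) (rule germsI, assumption, assumption, rule smooth_mult)

lemma germs_scale: "f \<in> germs S p \<Longrightarrow> (\<lambda>x. c * f x) \<in> germs S p"
  by (erule germsE) (rule germsI, assumption, assumption, rule smooth_scale)

lemma germs_diff: "f \<in> germs S p \<Longrightarrow> g \<in> germs S p \<Longrightarrow> (\<lambda>x. f x - g x) \<in> germs S p"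
  by (erule (1) germs_common) (rule germsI, assumption, assumption, rule smooth_diff)

lemma germs_cnj: "f \<in> germs S p \<Longrightarrow> (\<lambda>x. cnj (f x)) \<in> germs S p"
  by (erule germsE) (rule germsI, assumption, assumption, rule smooth_cnj)

lemma germs_cnj_iff: "(\<lambda>x. cnj (f x)) \<in> germs S p \<longleftrightarrow> f \<in> germs S p"
  using germs_cnj germs_cnj[of "\<lambda>x. cnj (f x)"] by auto

lemma germs_const: "p \<in> topspace (stop S) \<Longrightarrow> (\<lambda>x. c) \<in> germs S p"
  using germsI[OF openin_topspace _ smooth_const[OF openin_topspace]] by blast

lemma germs_sum:
  "p \<in> topspace (stop S) \<Longrightarrow> (\<And>i. i \<in> I \<Longrightarrow> f i \<in> germs S p) \<Longrightarrow> (\<lambda>x. \<Sum>i\<in>I. f i x) \<in> germs S p"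
  by (induction I rule: infinite_finite_induct) (auto intro: germs_const germs_add)

lemma germs_cong:
  assumes "f \<in> germs S p" "openin (stop S) W" "p \<in> W" "\<And>x. x \<in> W \<Longrightarrow> f x = g x"
  shows "g \<in> germs S p"
proof -
  obtain U where U: "openin (stop S) U" "p \<in> U" "f \<in> sfun S U" using assms(1) by (rule germsE)
  then have "f \<in> sfun S (U \<inter> W)" using assms(2) smooth_restrict[of U f "U \<inter> W"] by auto
  then have "g \<in> sfun S (U \<inter> W)" using smooth_cong[of "U \<inter> W" f g] U(1) assms(2,4) by auto
  then show ?thesis using germsI[of "U \<inter> W"] U assms(2,3) by auto
qed

subsection \<open>Tangent and cotangent vectors\<close>

lemma tangentD:
  assumes "v \<in> tangent S p" "f \<in> germs S p"
  shows tangent_add: "g \<in> germs S p \<Longrightarrow> v (\<lambda>x. f x + g x) = v f + v g"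
    and tangent_mult: "g \<in> germs S p \<Longrightarrow> v (\<lambda>x. f x * g x) = f p * v g + g p * v f"
    and tangent_cong: "openin (stop S) U \<Longrightarrow> p \<in> U \<Longrightarrow> (\<And>x. x \<in> U \<Longrightarrow> f x = g x) \<Longrightarrow> v f = v g"
    and tangent_scale: "v (\<lambda>x. c * f x) = c * v f"
proof -
  show "v (\<lambda>x. f x + g x) = v f + v g" "v (\<lambda>x. f x * g x) = f p * v g + g p * v f" if "g \<in> germs S p"
    using assms that unfolding tangent_def by blast+
  show "v f = v g" if "openin (stop S) U" "p \<in> U" "\<And>x. x \<in> U \<Longrightarrow> f x = g x"
    using assms germs_cong[OF assms(2) that] that unfolding tangent_def by blast
  show "v (\<lambda>x. c * f x) = c * v f"
    using assms unfolding tangent_def by blast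
qed

lemma tangent_outside: "v \<in> tangent S p \<Longrightarrow> f \<notin> germs S p \<Longrightarrow> v f = 0"
  unfolding tangent_def by blast

lemma tangentI:
  assumes "\<And>f g. f \<in> germs S p \<Longrightarrow> g \<in> germs S p \<Longrightarrow> v (\<lambda>x. f x + g x) = v f + v g"
    and "\<And>f g. f \<in> germs S p \<Longrightarrow> g \<in> germs S p \<Longrightarrow> v (\<lambda>x. f x * g x) = f p * v g + g p * v f"
    and "\<And>f g U. f \<in> germs S p \<Longrightarrow> g \<in> germs S p \<Longrightarrow> openin (stop S) U \<Longrightarrow> p \<in> U \<Longrightarrow>
           (\<And>x. x \<in> U \<Longrightarrow> f x = g x) \<Longrightarrow> v f = v g"
    and "\<And>f c. f \<in> germs S p \<Longrightarrow> v (\<lambda>x. c * f x) = c * v f"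
    and "\<And>f. f \<notin> germs S p \<Longrightarrow> v f = 0"
  shows "v \<in> tangent S p"
  unfolding tangent_def mem_Collect_eq
  by (intro conjI ballI allI impI; (elim exE conjE)?) (use assms in blast)+

lemma tangent_diff: "v \<in> tangent S p \<Longrightarrow> f \<in> germs S p \<Longrightarrow> g \<in> germs S p \<Longrightarrow> v (\<lambda>x. f x - g x) = v f - v g"
  using tangent_add[of v p f "\<lambda>x. (-1) * g x"] tangent_scale[of v p g "-1"] germs_scale[of g p "-1"]
  by simp

lemma tangent_const:
  assumes "v \<in> tangent S p" shows "v (\<lambda>x. c) = 0"
proof (cases "p \<in> topspace (stop S)")
  case True
  have "v (\<lambda>x. 1 * 1) = 1 * v (\<lambda>x. 1) + 1 * v (\<lambda>x. 1)"
    by (rule tangent_mult[OF assms]) (auto intro: germs_const True)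
  then have "v (\<lambda>x. 1) = 0" by simp
  then show ?thesis using tangent_scale[OF assms germs_const[OF True], of c 1] by simp
next
  case False
  then have "(\<lambda>x. c) \<notin> germs S p" by (auto simp: germs_def dest: openin_subset)
  then show ?thesis using tangent_outside[OF assms] by blast
qed

lemma tangent_sum:
  "v \<in> tangent S p \<Longrightarrow> p \<in> topspace (stop S) \<Longrightarrow> (\<And>i. i \<in> I \<Longrightarrow> f i \<in> germs S p) \<Longrightarrow>
     v (\<lambda>x. \<Sum>i\<in>I. f i x) = (\<Sum>i\<in>I. v (f i))"
proof (induction I rule: infinite_finite_induct)
  case (insert i I)
  then show ?case using tangent_add[of v p "f i" "\<lambda>x. \<Sum>i\<in>I. f i x"] germs_sum[of p I f] by simp
qed (auto simp: tangent_const)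

lemma tangent_eqI:
  "v \<in> tangent S p \<Longrightarrow> w \<in> tangent S p \<Longrightarrow> (\<And>f. f \<in> germs S p \<Longrightarrow> v f = w f) \<Longrightarrow> v = w"
  using tangent_outside by (metis ext)

lemma tangent_subspace: "fvs.subspace (tangent S p)"
proof (rule fvs.subspaceI)
  show "0 \<in> tangent S p" by (rule tangentI) auto
  show "v + w \<in> tangent S p" if "v \<in> tangent S p" "w \<in> tangent S p" for v w
  proof (rule tangentI)
    show "(v + w) f = (v + w) g" if "f \<in> germs S p" "g \<in> germs S p" "openin (stop S) U" "p \<in> U"
        "\<And>x. x \<in> U \<Longrightarrow> f x = g x" for f g U
      using tangent_cong[OF \<open>v \<in> _\<close> that(1,3-5)] tangent_cong[OF \<open>w \<in> _\<close> that(1,3-5)] by simp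
  qed (use that in \<open>auto simp: tangentD tangent_outside algebra_simps\<close>)
  show "fscale c v \<in> tangent S p" if "v \<in> tangent S p" for c v
  proof (rule tangentI)
    show "fscale c v f = fscale c v g" if "f \<in> germs S p" "g \<in> germs S p" "openin (stop S) U" "p \<in> U"
        "\<And>x. x \<in> U \<Longrightarrow> f x = g x" for f g U
      using tangent_cong[OF \<open>v \<in> _\<close> that(1,3-5)] by simp
  qed (use that in \<open>auto simp: tangentD tangent_outside algebra_simps\<close>)
qed

lemmas tangent_closed = fvs.subspace_0[OF tangent_subspace] fvs.subspace_add[OF tangent_subspace]
  fvs.subspace_scale[OF tangent_subspace] fvs.subspace_neg[OF tangent_subspace]
  fvs.subspace_diff[OF tangent_subspace] fvs.subspace_sum[OF tangent_subspace]

lemma conj_tangent: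
  assumes "v \<in> tangent S p" shows "conj_tvec v \<in> tangent S p"
proof (rule tangentI)
  show "conj_tvec v f = conj_tvec v g" if "f \<in> germs S p" "g \<in> germs S p" "openin (stop S) U" "p \<in> U"
      "\<And>x. x \<in> U \<Longrightarrow> f x = g x" for f g U
    using tangent_cong[OF assms germs_cnj[OF that(1)] that(3,4), of "\<lambda>x. cnj (g x)"] that(5)
    by (simp add: conj_tvec_def)
  show "conj_tvec v f = 0" if "f \<notin> germs S p" for f
    using tangent_outside[OF assms] that by (simp add: conj_tvec_def germs_cnj_iff)
qed (use assms tangentD[OF assms] germs_cnj in \<open>auto simp: conj_tvec_def\<close>)

lemma conj_tangent_iff: "conj_tvec v \<in> tangent S p \<longleftrightarrow> v \<in> tangent S p"
  using conj_tangent conj_tvec_simps(1) by metis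

lemma cotangentD:
  assumes "\<eta> \<in> cotangent S p" "v \<in> tangent S p"
  shows "w \<in> tangent S p \<Longrightarrow> \<eta> (v + w) = \<eta> v + \<eta> w" "\<eta> (fscale c v) = c * \<eta> v"
  using assms unfolding cotangent_def by blast+

lemma cotangent_outside: "\<eta> \<in> cotangent S p \<Longrightarrow> v \<notin> tangent S p \<Longrightarrow> \<eta> v = 0"
  unfolding cotangent_def by blast

lemma cotangent_eqI:
  "\<eta> \<in> cotangent S p \<Longrightarrow> \<zeta> \<in> cotangent S p \<Longrightarrow> (\<And>v. v \<in> tangent S p \<Longrightarrow> \<eta> v = \<zeta> v) \<Longrightarrow> \<eta> = \<zeta>"
  using cotangent_outside by (metis ext)

lemma cotangent_0: "\<eta> \<in> cotangent S p \<Longrightarrow> \<eta> 0 = 0"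
  using cotangentD(2)[of \<eta> p 0 0] tangent_closed(1)[of p] by simp

lemma cotangent_diff: "\<eta> \<in> cotangent S p \<Longrightarrow> v \<in> tangent S p \<Longrightarrow> w \<in> tangent S p \<Longrightarrow> \<eta> (v - w) = \<eta> v - \<eta> w"
  using cotangentD(1)[of \<eta> p v "fscale (-1) w"] cotangentD(2)[of \<eta> p w "-1"] tangent_closed(3)[of w p "-1"]
  by simp

lemma cotangent_sum:
  "\<eta> \<in> cotangent S p \<Longrightarrow> (\<And>i. i \<in> I \<Longrightarrow> v i \<in> tangent S p) \<Longrightarrow> \<eta> (\<Sum>i\<in>I. v i) = (\<Sum>i\<in>I. \<eta> (v i))"
  by (induction I rule: infinite_finite_induct)
     (auto simp: cotangent_0 cotangentD(1) tangent_closed(6))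

lemma cotangent_subspace: "fvs.subspace (cotangent S p)"
  by (rule fvs.subspaceI) (auto simp: cotangent_def algebra_simps)

lemmas cotangent_closed = fvs.subspace_0[OF cotangent_subspace] fvs.subspace_add[OF cotangent_subspace]
  fvs.subspace_scale[OF cotangent_subspace] fvs.subspace_neg[OF cotangent_subspace]
  fvs.subspace_diff[OF cotangent_subspace] fvs.subspace_sum[OF cotangent_subspace]

lemma conj_cotangent: "\<eta> \<in> cotangent S p \<Longrightarrow> conj_covec \<eta> \<in> cotangent S p"
  by (auto simp: cotangent_def conj_covec_def conj_tangent_iff conj_tangent)

lemma differential_cotangent: "differential S p f \<in> cotangent S p"
  by (auto simp: cotangent_def differential_def tangent_closed)

lemma gfibreD: "E \<in> gfibre S p \<Longrightarrow> fst E \<in> tangent S p" "E \<in> gfibre S p \<Longrightarrow> snd E \<in> cotangent S p"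
  by (auto simp: gfibre_def)

lemma gfibreI: "fst E \<in> tangent S p \<Longrightarrow> snd E \<in> cotangent S p \<Longrightarrow> E \<in> gfibre S p"
  by (auto simp: gfibre_def mem_Times_iff)

lemma gfibre_subspace: "gvs.subspace (gfibre S p)"
  by (rule gvs.subspaceI) (simp_all add: gfibre_def mem_Times_iff tangent_closed cotangent_closed)

lemmas gfibre_closed = gvs.subspace_0[OF gfibre_subspace] gvs.subspace_add[OF gfibre_subspace]
  gvs.subspace_scale[OF gfibre_subspace] gvs.subspace_neg[OF gfibre_subspace]
  gvs.subspace_diff[OF gfibre_subspace] gvs.subspace_sum[OF gfibre_subspace]

lemma conj_gfibre: "E \<in> gfibre S p \<Longrightarrow> conj_gvec E \<in> gfibre S p"
  by (simp add: gfibre_def mem_Times_iff conj_tangent conj_cotangent)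

lemma pairing_sym: "pairing E F = pairing F E"
  by (simp add: pairing_def)

lemma pairing_add:
  "E \<in> gfibre S p \<Longrightarrow> F \<in> gfibre S p \<Longrightarrow> H \<in> gfibre S p \<Longrightarrow> pairing (E + F) H = pairing E H + pairing F H"
  by (auto simp: pairing_def gfibre_def cotangentD add_divide_distrib)

lemma pairing_scale:
  "E \<in> gfibre S p \<Longrightarrow> H \<in> gfibre S p \<Longrightarrow> pairing (gscale c E) H = c * pairing E H"
  by (auto simp: pairing_def gfibre_def cotangentD algebra_simps)

lemma pairing_scale2:
  "E \<in> gfibre S p \<Longrightarrow> H \<in> gfibre S p \<Longrightarrow> pairing E (gscale c H) = c * pairing E H"
  using pairing_scale pairing_sym by metis

lemma pairing_add2:
  "E \<in> gfibre S p \<Longrightarrow> F \<in> gfibre S p \<Longrightarrow> H \<in> gfibre S p \<Longrightarrow> pairing H (E + F) = pairing H E + pairing H F"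
  using pairing_add pairing_sym by metis

lemma pairing_uminus: "E \<in> gfibre S p \<Longrightarrow> H \<in> gfibre S p \<Longrightarrow> pairing (- E) H = - pairing E H"
  using pairing_scale[of E p H "-1"] by simp

lemma pairing_uminus2: "E \<in> gfibre S p \<Longrightarrow> H \<in> gfibre S p \<Longrightarrow> pairing E (- H) = - pairing E H"
  using pairing_scale2[of E p H "-1"] by simp

lemma pairing_diff:
  "E \<in> gfibre S p \<Longrightarrow> F \<in> gfibre S p \<Longrightarrow> H \<in> gfibre S p \<Longrightarrow> pairing (E - F) H = pairing E H - pairing F H"
  using pairing_add[of E p "- F" H] pairing_uminus[of F p H] gfibre_closed(4)[of F p] by simp

lemma pairing_sum:
  "H \<in> gfibre S p \<Longrightarrow> (\<And>i. i \<in> I \<Longrightarrow> E i \<in> gfibre S p) \<Longrightarrow> pairing (\<Sum>i\<in>I. E i) H = (\<Sum>i\<in>I. pairing (E i) H)"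
proof (induction I rule: infinite_finite_induct)
  case (insert i I)
  then show ?case using pairing_add[of "E i" p "\<Sum>i\<in>I. E i" H] gfibre_closed(6)[of I E p] by simp
qed (auto simp: pairing_def cotangent_0 dest: gfibreD)

lemma pairing_conj: "pairing (conj_gvec E) (conj_gvec F) = cnj (pairing E F)"
  by (simp add: pairing_def conj_covec_def)

lemma pairing_nondegenerate:
  assumes "E \<in> gfibre S p" "\<And>F. F \<in> gfibre S p \<Longrightarrow> pairing E F = 0"
  shows "E = 0"
proof -
  have "snd E v = 0" if "v \<in> tangent S p" for v
    using assms(2)[of "(v, 0)"] that by (auto simp: pairing_def gfibre_def cotangent_closed)
  then have "snd E = 0"
    using cotangent_eqI[of "snd E" p 0] assms(1) by (auto simp: gfibre_def cotangent_closed)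
  moreover have "fst E f = 0" for f
  proof -
    have "(0, differential S p f) \<in> gfibre S p"
      by (simp add: gfibre_def tangent_closed differential_cotangent)
    from assms(2)[OF this] have "differential S p f (fst E) = 0"
      using \<open>snd E = 0\<close> by (simp add: pairing_def)
    then show ?thesis using gfibreD(1)[OF assms(1)] by (simp add: differential_def)
  qed
  ultimately show ?thesis by (auto simp: prod_eq_iff)
qed

text \<open>Covectors are arbitrary linear functionals, so a functional may be prescribed on a basis of the
  subspace together with the vector outside it.\<close>

lemma cotangent_separates:
  assumes "fvs.subspace Q" "Q \<subseteq> tangent S p" "v \<in> tangent S p" "v \<notin> Q"
  obtains \<eta> where "\<eta> \<in> cotangent S p" "\<And>w. w \<in> Q \<Longrightarrow> \<eta> w = 0" "\<eta> v \<noteq> 0"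
proof -
  interpret vp: vector_space_pair "fscale :: complex \<Rightarrow> 'a tvec \<Rightarrow> 'a tvec" "(*) :: complex \<Rightarrow> complex \<Rightarrow> complex"
    by unfold_locales (auto simp: algebra_simps fscale_def fun_eq_iff)
  obtain B where B: "B \<subseteq> Q" "fvs.independent B" "Q \<subseteq> fvs.span B"
    using fvs.basis_exists by metis
  have "fvs.span B \<subseteq> Q" using B(1) assms(1) by (rule fvs.span_minimal)
  then have nv: "v \<notin> fvs.span B" using assms(4) by blast
  then have "fvs.independent (insert v B)"
    using B(2) by (simp add: fvs.independent_insert)
  then obtain g where g: "Vector_Spaces.linear fscale (*) g" "\<And>b. b \<in> insert v B \<Longrightarrow> g b = (if b = v then 1 else (0::complex))"
    using vp.linear_independent_extend[of "insert v B" "\<lambda>b. if b = v then 1 else (0::complex)"] by blast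
  interpret g: Vector_Spaces.linear fscale "(*)" g by (rule g(1))
  have gB: "g b = 0" if "b \<in> B" for b
    using g(2)[of b] that nv fvs.span_base[of b B] by auto
  have gQ: "g w = 0" if "w \<in> Q" for w
    using g.eq_0_on_span[of B w] gB B(3) that by blast
  define \<eta> where "\<eta> = (\<lambda>w. if w \<in> tangent S p then g w else 0)"
  have "\<eta> \<in> cotangent S p"
    unfolding cotangent_def \<eta>_def by (auto simp: tangent_closed g.add g.scale)
  moreover have "\<eta> w = 0" if "w \<in> Q" for w using gQ[OF that] by (simp add: \<eta>_def)
  moreover have "\<eta> v \<noteq> 0" using g(2)[of v] assms(3) by (simp add: \<eta>_def)
  ultimately show ?thesis using that by blast
qed

subsection \<open>Smooth fields and sections\<close>

lemma smooth_fieldD: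
  "smooth_field S U V \<Longrightarrow> q \<in> U \<Longrightarrow> V q \<in> tangent S q"
  "smooth_field S U V \<Longrightarrow> openin (stop S) W \<Longrightarrow> W \<subseteq> U \<Longrightarrow> f \<in> sfun S W \<Longrightarrow> (\<lambda>q. V q f) \<in> sfun S W"
  unfolding smooth_field_def by blast+

lemma smooth_cofieldD:
  "smooth_cofield S U \<theta> \<Longrightarrow> q \<in> U \<Longrightarrow> \<theta> q \<in> cotangent S q"
  "smooth_cofield S U \<theta> \<Longrightarrow> openin (stop S) W \<Longrightarrow> W \<subseteq> U \<Longrightarrow> smooth_field S W V \<Longrightarrow> (\<lambda>q. \<theta> q (V q)) \<in> sfun S W"
  unfolding smooth_cofield_def by blast+

lemma smooth_field_restrict: "smooth_field S U V \<Longrightarrow> W \<subseteq> U \<Longrightarrow> smooth_field S W V"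
  unfolding smooth_field_def by (meson order_trans subsetD)

lemma smooth_cofield_restrict: "smooth_cofield S U \<theta> \<Longrightarrow> W \<subseteq> U \<Longrightarrow> smooth_cofield S W \<theta>"
  unfolding smooth_cofield_def by (meson order_trans subsetD)

lemma smooth_field_cong:
  assumes "smooth_field S U V" "\<And>q. q \<in> U \<Longrightarrow> V q = V' q" shows "smooth_field S U V'"
  unfolding smooth_field_def
proof (intro conjI ballI allI impI)
  show "V' q \<in> tangent S q" if "q \<in> U" for q using smooth_fieldD(1)[OF assms(1)] assms(2) that by metis
  show "(\<lambda>q. V' q f) \<in> sfun S W" if "openin (stop S) W \<and> W \<subseteq> U \<and> f \<in> sfun S W" for W f
  proof (rule smooth_cong)
    show "(\<lambda>q. V q f) \<in> sfun S W" using smooth_fieldD(2)[OF assms(1), of W f] that by blast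
    show "V x f = V' x f" if "x \<in> W" for x using that assms(2)[of x] \<open>_ \<and> _\<close> by auto
  qed (use that in blast)
qed

lemma smooth_cofield_cong:
  assumes "smooth_cofield S U V" "\<And>q. q \<in> U \<Longrightarrow> V q = V' q" shows "smooth_cofield S U V'"
  unfolding smooth_cofield_def
proof (intro conjI ballI allI impI)
  show "V' q \<in> cotangent S q" if "q \<in> U" for q using smooth_cofieldD(1)[OF assms(1)] assms(2) that by metis
  show "(\<lambda>q. V' q (X q)) \<in> sfun S W" if "openin (stop S) W \<and> W \<subseteq> U \<and> smooth_field S W X" for W X
  proof (rule smooth_cong)
    show "(\<lambda>q. V q (X q)) \<in> sfun S W" using smooth_cofieldD(2)[OF assms(1), of W X] that by blast
    show "V x (X x) = V' x (X x)" if "x \<in> W" for x using that assms(2)[of x] \<open>_ \<and> _\<close> by auto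
  qed (use that in blast)
qed

lemma smooth_field_local:
  assumes "\<And>p. p \<in> U \<Longrightarrow> \<exists>W. openin (stop S) W \<and> p \<in> W \<and> smooth_field S W V"
  shows "smooth_field S U V"
  unfolding smooth_field_def
proof (intro conjI ballI allI impI)
  show "V q \<in> tangent S q" if "q \<in> U" for q using assms[OF that] smooth_fieldD(1) by blast
  show "(\<lambda>q. V q f) \<in> sfun S W" if W: "openin (stop S) W \<and> W \<subseteq> U \<and> f \<in> sfun S W" for W f
  proof (rule smooth_local)
    fix p assume "p \<in> W"
    then obtain W' where "openin (stop S) W'" "p \<in> W'" "smooth_field S W' V" using assms W by blast
    then show "\<exists>W. openin (stop S) W \<and> p \<in> W \<and> (\<lambda>q. V q f) \<in> sfun S W"
      using smooth_fieldD(2)[of W' V "W' \<inter> W" f] smooth_restrict[of W f "W' \<inter> W"] W \<open>p \<in> W\<close>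
      by (intro exI[of _ "W' \<inter> W"]) auto
  qed (use W in blast)
qed

lemma smooth_cofield_local:
  assumes "\<And>p. p \<in> U \<Longrightarrow> \<exists>W. openin (stop S) W \<and> p \<in> W \<and> smooth_cofield S W \<theta>"
  shows "smooth_cofield S U \<theta>"
  unfolding smooth_cofield_def
proof (intro conjI ballI allI impI)
  show "\<theta> q \<in> cotangent S q" if "q \<in> U" for q using assms[OF that] smooth_cofieldD(1) by blast
  show "(\<lambda>q. \<theta> q (V q)) \<in> sfun S W" if W: "openin (stop S) W \<and> W \<subseteq> U \<and> smooth_field S W V" for W V
  proof (rule smooth_local)
    fix p assume "p \<in> W"
    then obtain W' where "openin (stop S) W'" "p \<in> W'" "smooth_cofield S W' \<theta>" using assms W by blast
    then show "\<exists>W. openin (stop S) W \<and> p \<in> W \<and> (\<lambda>q. \<theta> q (V q)) \<in> sfun S W"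
      using smooth_cofieldD(2)[of W' \<theta> "W' \<inter> W" V] smooth_field_restrict[of W V "W' \<inter> W"] W \<open>p \<in> W\<close>
      by (intro exI[of _ "W' \<inter> W"]) auto
  qed (use W in blast)
qed

lemma smooth_field_add: "smooth_field S U V \<Longrightarrow> smooth_field S U W \<Longrightarrow> smooth_field S U (\<lambda>q. V q + W q)"
  unfolding smooth_field_def by (auto intro!: tangent_closed smooth_add)

lemma smooth_field_scale:
  "openin (stop S) U \<Longrightarrow> f \<in> sfun S U \<Longrightarrow> smooth_field S U V \<Longrightarrow> smooth_field S U (\<lambda>q. fscale (f q) (V q))"
  unfolding smooth_field_def by (auto intro!: tangent_closed smooth_mult intro: smooth_restrict)

lemma smooth_field_zero: "smooth_field S U (\<lambda>q. 0)"
  unfolding smooth_field_def by (auto intro!: tangent_closed smooth_const)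

lemma smooth_field_sum:
  "(\<And>i. i \<in> I \<Longrightarrow> smooth_field S U (V i)) \<Longrightarrow> smooth_field S U (\<lambda>q. \<Sum>i\<in>I. V i q)"
  by (induction I rule: infinite_finite_induct) (auto intro: smooth_field_add smooth_field_zero)

lemma smooth_field_conj:
  assumes "smooth_field S U V" shows "smooth_field S U (\<lambda>q. conj_tvec (V q))"
  unfolding smooth_field_def
proof (intro conjI ballI allI impI)
  show "conj_tvec (V q) \<in> tangent S q" if "q \<in> U" for q
    using smooth_fieldD(1)[OF assms that] by (rule conj_tangent)
  show "(\<lambda>q. conj_tvec (V q) f) \<in> sfun S W" if "openin (stop S) W \<and> W \<subseteq> U \<and> f \<in> sfun S W" for W f
    using that smooth_fieldD(2)[OF assms, of W "\<lambda>x. cnj (f x)"] by (auto simp: conj_tvec_def intro!: smooth_cnj)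
qed

lemma smooth_cofield_add: "smooth_cofield S U V \<Longrightarrow> smooth_cofield S U W \<Longrightarrow> smooth_cofield S U (\<lambda>q. V q + W q)"
  unfolding smooth_cofield_def by (auto intro!: cotangent_closed smooth_add)

lemma smooth_cofield_scale:
  "openin (stop S) U \<Longrightarrow> f \<in> sfun S U \<Longrightarrow> smooth_cofield S U V \<Longrightarrow> smooth_cofield S U (\<lambda>q. fscale (f q) (V q))"
  unfolding smooth_cofield_def by (auto intro!: cotangent_closed smooth_mult intro: smooth_restrict)

lemma smooth_cofield_zero: "smooth_cofield S U (\<lambda>q. 0)"
  unfolding smooth_cofield_def by (auto intro!: cotangent_closed smooth_const)

lemma smooth_cofield_sum:
  "(\<And>i. i \<in> I \<Longrightarrow> smooth_cofield S U (V i)) \<Longrightarrow> smooth_cofield S U (\<lambda>q. \<Sum>i\<in>I. V i q)"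
  by (induction I rule: infinite_finite_induct) (auto intro: smooth_cofield_add smooth_cofield_zero)

lemma smooth_cofield_conj:
  assumes "smooth_cofield S U V" shows "smooth_cofield S U (\<lambda>q. conj_covec (V q))"
  unfolding smooth_cofield_def
proof (intro conjI ballI allI impI)
  show "conj_covec (V q) \<in> cotangent S q" if "q \<in> U" for q
    using smooth_cofieldD(1)[OF assms that] by (rule conj_cotangent)
  show "(\<lambda>q. conj_covec (V q) (X q)) \<in> sfun S W" if "openin (stop S) W \<and> W \<subseteq> U \<and> smooth_field S W X" for W X
    using that smooth_cofieldD(2)[OF assms, of W "\<lambda>x. conj_tvec (X x)"]
    by (auto simp: conj_covec_def intro!: smooth_cnj smooth_field_conj)
qed

lemma smooth_cofield_differential:
  "openin (stop S) U \<Longrightarrow> f \<in> sfun S U \<Longrightarrow> smooth_cofield S U (\<lambda>q. differential S q f)"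
  unfolding smooth_cofield_def
proof (intro conjI ballI allI impI)
  fix W V assume "openin (stop S) U" "f \<in> sfun S U" "openin (stop S) W \<and> W \<subseteq> U \<and> smooth_field S W V"
  then show "(\<lambda>q. differential S q f (V q)) \<in> sfun S W"
    using smooth_cong[of W "\<lambda>q. V q f" "\<lambda>q. differential S q f (V q)"]
      smooth_fieldD[of W V] smooth_restrict[of U f W]
    by (auto simp: differential_def)
qed (rule differential_cotangent)

lemma smooth_gsectionD: "smooth_gsection S U E \<Longrightarrow> q \<in> U \<Longrightarrow> E q \<in> gfibre S q"
  unfolding smooth_gsection_def by (auto intro!: gfibreI dest: smooth_fieldD smooth_cofieldD)

lemma smooth_gsection_restrict: "smooth_gsection S U E \<Longrightarrow> W \<subseteq> U \<Longrightarrow> smooth_gsection S W E"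
  unfolding smooth_gsection_def using smooth_field_restrict smooth_cofield_restrict by blast

lemma smooth_gsection_local:
  assumes "\<And>p. p \<in> U \<Longrightarrow> \<exists>W. openin (stop S) W \<and> p \<in> W \<and> smooth_gsection S W E"
  shows "smooth_gsection S U E"
  unfolding smooth_gsection_def
proof
  show "smooth_field S U (\<lambda>q. fst (E q))"
    by (rule smooth_field_local) (use assms smooth_gsection_def in blast)
  show "smooth_cofield S U (\<lambda>q. snd (E q))"
    by (rule smooth_cofield_local) (use assms smooth_gsection_def in blast)
qed

lemma smooth_gsection_add: "smooth_gsection S U E \<Longrightarrow> smooth_gsection S U F \<Longrightarrow> smooth_gsection S U (\<lambda>q. E q + F q)"
  unfolding smooth_gsection_def by (auto intro: smooth_field_add smooth_cofield_add)

lemma smooth_gsection_scale: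
  "openin (stop S) U \<Longrightarrow> f \<in> sfun S U \<Longrightarrow> smooth_gsection S U E \<Longrightarrow> smooth_gsection S U (\<lambda>q. gscale (f q) (E q))"
  unfolding smooth_gsection_def by (auto intro: smooth_field_scale smooth_cofield_scale)

lemma smooth_gsection_const_scale:
  "openin (stop S) U \<Longrightarrow> smooth_gsection S U E \<Longrightarrow> smooth_gsection S U (\<lambda>q. gscale c (E q))"
  using smooth_gsection_scale[OF _ smooth_const] by blast

lemma smooth_gsection_uminus: "openin (stop S) U \<Longrightarrow> smooth_gsection S U E \<Longrightarrow> smooth_gsection S U (\<lambda>q. - E q)"
  using smooth_gsection_const_scale[of U E "-1"] by simp

lemma smooth_gsection_diff:
  "openin (stop S) U \<Longrightarrow> smooth_gsection S U E \<Longrightarrow> smooth_gsection S U F \<Longrightarrow> smooth_gsection S U (\<lambda>q. E q - F q)"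
  using smooth_gsection_add[OF _ smooth_gsection_uminus, of U E F] by simp

lemma smooth_gsection_zero: "smooth_gsection S U (\<lambda>q. 0)"
  by (simp add: smooth_gsection_def smooth_field_zero smooth_cofield_zero)

lemma smooth_gsection_sum:
  assumes "\<And>i. i \<in> I \<Longrightarrow> smooth_gsection S U (E i)"
  shows "smooth_gsection S U (\<lambda>q. \<Sum>i\<in>I. E i q)"
  using assms
  by (induction I rule: infinite_finite_induct)
     (auto intro: smooth_gsection_add smooth_gsection_zero)

lemma smooth_gsection_conj: "smooth_gsection S U E \<Longrightarrow> smooth_gsection S U (\<lambda>q. conj_gvec (E q))"
  unfolding smooth_gsection_def by (auto intro: smooth_field_conj smooth_cofield_conj)

lemma smooth_pairing:
  assumes "openin (stop S) U" "smooth_gsection S U E" "smooth_gsection S U F"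
  shows "(\<lambda>q. pairing (E q) (F q)) \<in> sfun S U"
proof -
  have "(\<lambda>q. (1/2) * (snd (E q) (fst (F q)) + snd (F q) (fst (E q)))) \<in> sfun S U"
    by (intro smooth_scale smooth_add assms(1))
       (use assms smooth_cofieldD(2)[OF _ assms(1) order_refl] in \<open>auto simp: smooth_gsection_def\<close>)
  then show ?thesis by (simp add: pairing_def)
qed

text \<open>The second-order terms of \<open>V (W (f g)) - W (V (f g))\<close> cancel. The germs have to be controlled on a
  whole neighbourhood of \<open>p\<close>, because the inner field is evaluated there.\<close>

lemma lie_bracket_tangent:
  assumes "openin (stop S) U" "p \<in> U" "smooth_field S U V" "smooth_field S U W"
  shows "lie_bracket S V W p \<in> tangent S p"
proof -
  have Vp: "V p \<in> tangent S p" and Wp: "W p \<in> tangent S p"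
    using assms smooth_fieldD by blast+
  have germ: "(\<lambda>q. X q f) \<in> germs S p" if "f \<in> germs S p" "smooth_field S U X" for f X
  proof -
    obtain U' where U': "openin (stop S) U'" "p \<in> U'" "f \<in> sfun S U'" using \<open>f \<in> germs S p\<close> by (rule germsE)
    then have "(\<lambda>q. X q f) \<in> sfun S (U' \<inter> U)"
      using smooth_fieldD(2)[OF that(2), of "U' \<inter> U" f] smooth_restrict[of U' f "U' \<inter> U"] assms(1) by auto
    then show ?thesis using germsI[of "U' \<inter> U"] U' assms by auto
  qed
  have ev: "\<exists>O'. openin (stop S) O' \<and> p \<in> O' \<and> (\<forall>q\<in>O'. q \<in> U \<and> f \<in> germs S q \<and> g \<in> germs S q)"
    if "f \<in> germs S p" "g \<in> germs S p" for f g
  proof -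
    note fg = that
    obtain U' where U': "openin (stop S) U'" "p \<in> U'" "f \<in> sfun S U'" "g \<in> sfun S U'" using fg by (rule germs_common)
    then show ?thesis using assms germsI[of U'] by (intro exI[of _ "U' \<inter> U"]) auto
  qed
  have addd: "Y p (\<lambda>q. X q (\<lambda>x. f x + g x)) = Y p (\<lambda>q. X q f) + Y p (\<lambda>q. X q g)"
    and mul: "Y p (\<lambda>q. X q (\<lambda>x. f x * g x)) =
      f p * Y p (\<lambda>q. X q g) + X p g * Y p f + (g p * Y p (\<lambda>q. X q f) + X p f * Y p g)"
    and sca: "Y p (\<lambda>q. X q (\<lambda>x. c * f x)) = c * Y p (\<lambda>q. X q f)"
    if X: "smooth_field S U X" and Y: "Y p \<in> tangent S p" and f: "f \<in> germs S p" and g: "g \<in> germs S p" for X Y f g c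
  proof -
    obtain O' where O': "openin (stop S) O'" "p \<in> O'" "\<And>q. q \<in> O' \<Longrightarrow> q \<in> U \<and> f \<in> germs S q \<and> g \<in> germs S q"
      using ev[OF f g] by blast
    have *: "Y p h = Y p k" if "h \<in> germs S p" "\<And>q. q \<in> O' \<Longrightarrow> h q = k q" for h k
      using tangent_cong[OF Y that(1) O'(1,2) that(2)] .
    have XO: "X q \<in> tangent S q" if "q \<in> O'" for q using smooth_fieldD(1)[OF X] O'(3)[OF that] by blast
    note gg = germ[OF f X] germ[OF g X]
    have "Y p (\<lambda>q. X q f + X q g) = Y p (\<lambda>q. X q (\<lambda>x. f x + g x))"
      by (rule *[OF germs_add[OF gg]]) (use tangent_add[OF XO] O'(3) in simp)
    then show "Y p (\<lambda>q. X q (\<lambda>x. f x + g x)) = Y p (\<lambda>q. X q f) + Y p (\<lambda>q. X q g)"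
      using tangent_add[OF Y gg] by simp
    have "Y p (\<lambda>q. f q * X q g + g q * X q f) = Y p (\<lambda>q. X q (\<lambda>x. f x * g x))"
      by (rule *) (use tangent_mult[OF XO] O'(3) gg f g in \<open>auto intro!: germs_add germs_mult\<close>)
    then show "Y p (\<lambda>q. X q (\<lambda>x. f x * g x)) =
      f p * Y p (\<lambda>q. X q g) + X p g * Y p f + (g p * Y p (\<lambda>q. X q f) + X p f * Y p g)"
      using tangent_add[OF Y germs_mult[OF f gg(2)] germs_mult[OF g gg(1)]]
        tangent_mult[OF Y f gg(2)] tangent_mult[OF Y g gg(1)] by simp
    have "Y p (\<lambda>q. c * X q f) = Y p (\<lambda>q. X q (\<lambda>x. c * f x))"
      by (rule *[OF germs_scale[OF gg(1)]]) (use tangent_scale[OF XO] O'(3) in simp)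
    then show "Y p (\<lambda>q. X q (\<lambda>x. c * f x)) = c * Y p (\<lambda>q. X q f)"
      using tangent_scale[OF Y gg(1)] by simp
  qed
  show ?thesis
  proof (rule tangentI)
    fix f g U' assume fg: "f \<in> germs S p" "g \<in> germs S p" "openin (stop S) U'" "p \<in> U'" "\<And>x. x \<in> U' \<Longrightarrow> f x = g x"
    obtain O' where O': "openin (stop S) O'" "p \<in> O'" "\<And>q. q \<in> O' \<Longrightarrow> q \<in> U \<and> f \<in> germs S q \<and> g \<in> germs S q"
      using ev[OF fg(1,2)] by blast
    have eq: "Y p (\<lambda>q. X q f) = Y p (\<lambda>q. X q g)" if X: "smooth_field S U X" and Y: "Y p \<in> tangent S p" for X Y
    proof (rule tangent_cong[OF Y germ[OF fg(1) X], of "O' \<inter> U'"])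
      show "X q f = X q g" if "q \<in> O' \<inter> U'" for q
        by (rule tangent_cong[of _ q _ U']) (use that fg O'(3)[of q] smooth_fieldD(1)[OF X] in auto)
    qed (use O' fg in auto)
    show "lie_bracket S V W p f = lie_bracket S V W p g"
      using fg(1,2) eq[of W V] eq[of V W] assms(3,4) Vp Wp by (simp add: lie_bracket_def)
  qed (use assms(3,4) Vp Wp in \<open>auto simp: lie_bracket_def germs_add germs_mult germs_scale addd mul sca algebra_simps\<close>)
qed

end

section \<open>Linear algebra of a space with a conjugation\<close>

context vector_space
begin

lemma independent_family:
  fixes b :: "'c \<Rightarrow> 'b"
  assumes "finite N" "\<And>c i. (\<Sum>i\<in>N. scale (c i) (b i)) = 0 \<Longrightarrow> i \<in> N \<Longrightarrow> c i = 0"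
  shows "inj_on b N" and "independent (b ` N)"
proof -
  show inj: "inj_on b N"
  proof (rule inj_onI, rule ccontr)
    fix i j assume ij: "i \<in> N" "j \<in> N" "b i = b j" "i \<noteq> j"
    define c :: "'c \<Rightarrow> 'a" where "c k = (if k = i then 1 else if k = j then - 1 else 0)" for k
    have "(\<Sum>k\<in>N. scale (c k) (b k)) = (\<Sum>k\<in>{i, j}. scale (c k) (b k))"
      by (rule sum.mono_neutral_right) (use ij assms(1) in \<open>auto simp: c_def\<close>)
    also have "\<dots> = 0" using ij by (simp add: c_def)
    finally have "c i = 0" using assms(2) ij(1) by blast
    then show False by (simp add: c_def)
  qed
  show "independent (b ` N)"
  proof (rule independent_if_scalars_zero)
    fix f x assume "(\<Sum>x\<in>b ` N. scale (f x) x) = 0" "x \<in> b ` N"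
    then show "f x = 0"
      using assms(2)[of "\<lambda>i. f (b i)"] by (auto simp: sum.reindex[OF inj])
  qed (use assms(1) in simp)
qed

lemma independent_union:
  assumes "finite B" "finite C" "independent B" "independent C" "span B \<inter> span C = {0}"
  shows "independent (B \<union> C)" and "B \<inter> C = {}"
proof -
  show disj: "B \<inter> C = {}"
  proof (rule ccontr)
    assume "B \<inter> C \<noteq> {}"
    then obtain x where "x \<in> B" "x \<in> C" by blast
    then have "x = 0" using assms(5) span_base[of x B] span_base[of x C] by blast
    then show False using \<open>x \<in> B\<close> assms(3) dependent_zero by blast
  qed
  show "independent (B \<union> C)"
  proof (rule independent_if_scalars_zero)
    fix f x assume s: "(\<Sum>x\<in>B \<union> C. scale (f x) x) = 0" and x: "x \<in> B \<union> C"
    let ?b = "\<Sum>x\<in>B. scale (f x) x" and ?c = "\<Sum>x\<in>C. scale (f x) x"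
    have bc: "?b + ?c = 0" using s sum.union_disjoint[OF assms(1,2) disj, of "\<lambda>x. scale (f x) x"] by simp
    have b: "?b \<in> span B" and c: "?c \<in> span C"
      by (intro span_sum span_scale span_base, assumption)+
    have "?b = - ?c" using bc by (simp only: eq_neg_iff_add_eq_0)
    then have "?b \<in> span C" using span_neg[OF c] by simp
    then have b0: "?b = 0" using b assms(5) by blast
    then have c0: "?c = 0" using bc by simp
    from x show "f x = 0"
    proof
      assume "x \<in> B" then show ?thesis by (rule independentD[OF assms(3,1) order_refl b0])
    next
      assume "x \<in> C" then show ?thesis by (rule independentD[OF assms(4,2) order_refl c0])
    qed
  qed (use assms in simp)
qed

end

lemma conj_span: "conj_gvec ` gvs.span B = gvs.span (conj_gvec ` B)"
proof -
  have 1: "conj_gvec E \<in> gvs.span (conj_gvec ` B)" if "E \<in> gvs.span B" for E B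
    using that by (induction rule: gvs.span_induct_alt) (auto intro: gvs.span_zero gvs.span_add gvs.span_scale gvs.span_base)
  show ?thesis
  proof (intro equalityI subsetI)
    fix E assume "E \<in> gvs.span (conj_gvec ` B)"
    from 1[OF this] have "conj_gvec E \<in> gvs.span B" by (simp add: image_image)
    then show "E \<in> conj_gvec ` gvs.span B" by (simp add: mem_conj_image_iff)
  qed (use 1 in auto)
qed

lemma conj_independent:
  assumes "gvs.independent B" "finite B" shows "gvs.independent (conj_gvec ` B)"
proof (rule gvs.independent_family(2)[OF assms(2)])
  fix c i assume s: "(\<Sum>i\<in>B. gscale (c i) (conj_gvec i)) = 0" and i: "i \<in> B"
  have "conj_gvec (\<Sum>i\<in>B. gscale (c i) (conj_gvec i)) = (\<Sum>i\<in>B. gscale (cnj (c i)) i)"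
    by (simp add: conj_gvec_sum)
  then have "(\<Sum>i\<in>B. gscale (cnj (c i)) i) = 0" using s by simp
  from gvs.independentD[OF assms(1,2) order_refl this i] show "c i = 0" by simp
qed

text \<open>Conjugation is antilinear and maps a basis of \<open>L\<close> to a basis of \<open>conj L\<close>; together they are independent
  because the two spaces meet in \<open>0\<close>.\<close>

lemma conj_split_basis:
  assumes "gvs.independent B" "finite B" "gvs.span B \<inter> conj_gvec ` gvs.span B = {0}"
  shows "gvs.independent (B \<union> conj_gvec ` B)" "B \<inter> conj_gvec ` B = {}"
    "gvs.span (B \<union> conj_gvec ` B) = {E + F |E F. E \<in> gvs.span B \<and> F \<in> conj_gvec ` gvs.span B}"
    "card (B \<union> conj_gvec ` B) = 2 * card B"
proof -
  note c = conj_independent[OF assms(1,2)]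
  show "gvs.independent (B \<union> conj_gvec ` B)"
    using gvs.independent_union(1)[OF assms(2) finite_imageI[OF assms(2)] assms(1) c] assms(3)
    by (simp add: conj_span)
  show d: "B \<inter> conj_gvec ` B = {}"
    using gvs.independent_union(2)[OF assms(2) finite_imageI[OF assms(2)] assms(1) c] assms(3)
    by (simp add: conj_span)
  show "gvs.span (B \<union> conj_gvec ` B) = {E + F |E F. E \<in> gvs.span B \<and> F \<in> conj_gvec ` gvs.span B}"
    by (simp add: gvs.span_Un conj_span)
  have "card (conj_gvec ` B) = card B" by (rule card_image) (simp add: inj_on_def)
  then show "card (B \<union> conj_gvec ` B) = 2 * card B"
    using card_Un_disjoint[OF assms(2) finite_imageI[OF assms(2)] d] by simp
qed

text \<open>In an eigenbasis the Leibniz formula has only the term of the identity permutation, which is a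
  product of factors \<open>\<lambda> * cnj \<lambda> = 1\<close>.\<close>

lemma has_det_1_of_eigenbasis:
  assumes B: "gvs.independent B" "finite B" "gvs.span B \<inter> conj_gvec ` gvs.span B = {0}"
    and V: "V = {E + F |E F. E \<in> gvs.span B \<and> F \<in> conj_gvec ` gvs.span B}"
    and eig: "\<And>b. b \<in> B \<Longrightarrow> T b = gscale (l b) b \<and> T (conj_gvec b) = gscale (cnj (l b)) (conj_gvec b) \<and> norm (l b) = 1"
  shows "has_det V T 1"
proof -
  let ?B = "B \<union> conj_gvec ` B"
  note bs = conj_split_basis[OF B]
  have fin: "finite ?B" using B(2) by simp
  define m where "m b = (if b \<in> B then l b else cnj (l (conj_gvec b)))" for b
  have T: "T b = gscale (m b) b" if "b \<in> ?B" for b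
    using that eig bs(2) by (auto simp: m_def)
  have rep: "gvs.representation ?B (T b) = (\<lambda>c. m b * (if c = b then 1 else 0))" if "b \<in> ?B" for b
    using T[OF that] gvs.representation_scale[OF bs(1) gvs.span_base[OF that]]
      gvs.representation_basis[OF bs(1) that] by simp
  have "(\<Sum>\<sigma> | \<sigma> permutes ?B. of_int (sign \<sigma>) * (\<Prod>b\<in>?B. gvs.representation ?B (T b) (\<sigma> b)))
      = (\<Sum>\<sigma>\<in>{id}. of_int (sign \<sigma>) * (\<Prod>b\<in>?B. gvs.representation ?B (T b) (\<sigma> b)))"
  proof (rule sum.mono_neutral_right)
    show "finite {\<sigma>. \<sigma> permutes ?B}" using fin by (rule finite_permutations)
    show "\<forall>\<sigma>\<in>{\<sigma>. \<sigma> permutes ?B} - {id}. of_int (sign \<sigma>) * (\<Prod>b\<in>?B. gvs.representation ?B (T b) (\<sigma> b)) = (0::complex)"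
    proof
      fix \<sigma> assume \<sigma>: "\<sigma> \<in> {\<sigma>. \<sigma> permutes ?B} - {id}"
      then have p\<sigma>: "\<sigma> permutes ?B" and "\<sigma> \<noteq> id" by auto
      then obtain b where "\<sigma> b \<noteq> b" by (metis eq_id_iff)
      moreover have "b \<in> ?B" using permutes_not_in[OF p\<sigma>] calculation by blast
      ultimately have "gvs.representation ?B (T b) (\<sigma> b) = 0" using rep by simp
      then have "(\<Prod>b\<in>?B. gvs.representation ?B (T b) (\<sigma> b)) = 0"
        by (intro prod_zero[OF fin] bexI[OF _ \<open>b \<in> ?B\<close>])
      then show "of_int (sign \<sigma>) * (\<Prod>b\<in>?B. gvs.representation ?B (T b) (\<sigma> b)) = (0::complex)" by simp
    qed
  qed (auto simp: permutes_id)
  also have "\<dots> = (\<Prod>b\<in>?B. m b)" using rep by (simp add: sign_id)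
  also have "\<dots> = (\<Prod>b\<in>B. m b) * (\<Prod>b\<in>conj_gvec ` B. m b)"
    by (rule prod.union_disjoint) (use B(2) bs(2) in auto)
  also have "(\<Prod>b\<in>conj_gvec ` B. m b) = (\<Prod>b\<in>B. m (conj_gvec b))"
    by (rule prod.reindex_cong[of conj_gvec]) (auto simp: inj_on_def)
  also have "(\<Prod>b\<in>B. m b) * (\<Prod>b\<in>B. m (conj_gvec b)) = (\<Prod>b\<in>B. m b * m (conj_gvec b))"
    by (simp add: prod.distrib)
  also have "\<dots> = 1"
  proof (rule prod.neutral, rule ballI)
    fix b assume b: "b \<in> B"
    then have "conj_gvec b \<notin> B" using bs(2) by auto
    then have "m b * m (conj_gvec b) = l b * cnj (l b)" using b by (simp add: m_def)
    also have "\<dots> = 1" using eig[OF b] complex_norm_square[of "l b"] by simp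
    finally show "m b * m (conj_gvec b) = 1" .
  qed
  finally show ?thesis
    unfolding has_det_def using bs(1,3) fin V by (intro exI[of _ ?B]) auto
qed

section \<open>Coordinate frames\<close>

text \<open>The last clause says that a derivation is determined by its values on the coordinates; it makes the
  fields \<open>e i\<close> a basis of every tangent space over \<open>U\<close>.\<close>

definition coord_frame ::
  "'a smooth_space \<Rightarrow> 'a set \<Rightarrow> 'i set \<Rightarrow> ('i \<Rightarrow> 'a \<Rightarrow> complex) \<Rightarrow> ('i \<Rightarrow> 'a \<Rightarrow> 'a tvec) \<Rightarrow> bool" where
  "coord_frame S U N x e \<longleftrightarrow>
     openin (stop S) U \<and> finite N \<and> (\<forall>i\<in>N. x i \<in> sfun S U \<and> smooth_field S U (e i)) \<and>
     (\<forall>q\<in>U. (\<forall>i\<in>N. \<forall>j\<in>N. e i q (x j) = (if i = j then 1 else 0)) \<and>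
            (\<forall>v\<in>tangent S q. (\<forall>i\<in>N. v (x i) = 0) \<longrightarrow> v = 0))"

context smooth_sheaf
begin

lemma coord_frameD:
  assumes "coord_frame S U N x e"
  shows "openin (stop S) U" "finite N" "i \<in> N \<Longrightarrow> x i \<in> sfun S U" "i \<in> N \<Longrightarrow> smooth_field S U (e i)"
    "q \<in> U \<Longrightarrow> i \<in> N \<Longrightarrow> j \<in> N \<Longrightarrow> e i q (x j) = (if i = j then 1 else 0)"
    "q \<in> U \<Longrightarrow> v \<in> tangent S q \<Longrightarrow> (\<And>i. i \<in> N \<Longrightarrow> v (x i) = 0) \<Longrightarrow> v = 0"
    "q \<in> U \<Longrightarrow> i \<in> N \<Longrightarrow> x i \<in> germs S q" "q \<in> U \<Longrightarrow> i \<in> N \<Longrightarrow> e i q \<in> tangent S q"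
  using assms unfolding coord_frame_def by (auto intro: germsI smooth_fieldD(1))

lemma coord_frame_combination:
  assumes "coord_frame S U N x e" "q \<in> U" "j \<in> N"
  shows "(\<Sum>i\<in>N. fscale (c i) (e i q)) (x j) = c j"
proof -
  have "(\<Sum>i\<in>N. c i * e i q (x j)) = (\<Sum>i\<in>N. if i = j then c i else 0)"
    by (rule sum.cong) (use coord_frameD(5)[OF assms(1,2)] assms(3) in auto)
  then show ?thesis using assms(3) coord_frameD(2)[OF assms(1)] by (simp add: sum_fun_apply)
qed

lemma coord_frame_expand:
  assumes "coord_frame S U N x e" "q \<in> U" "v \<in> tangent S q"
  shows "v = (\<Sum>i\<in>N. fscale (v (x i)) (e i q))"
proof -
  let ?w = "\<Sum>i\<in>N. fscale (v (x i)) (e i q)"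
  have "v - ?w = 0"
  proof (rule coord_frameD(6)[OF assms(1,2)])
    show "v - ?w \<in> tangent S q"
      by (intro tangent_closed assms(3) coord_frameD(8)[OF assms(1,2)])
    show "(v - ?w) (x j) = 0" if "j \<in> N" for j
      using coord_frame_combination[OF assms(1,2) that] by simp
  qed
  then show ?thesis by simp
qed

lemma coord_frame_eqI:
  assumes "coord_frame S U N x e" "q \<in> U" "v \<in> tangent S q" "w \<in> tangent S q"
    "\<And>i. i \<in> N \<Longrightarrow> v (x i) = w (x i)"
  shows "v = w"
  using coord_frame_expand[OF assms(1,2,3)] coord_frame_expand[OF assms(1,2,4)] assms(5) by simp

lemma coord_frame_expand_cotangent:
  assumes "coord_frame S U N x e" "q \<in> U" "\<eta> \<in> cotangent S q"
  shows "\<eta> = (\<Sum>i\<in>N. fscale (\<eta> (e i q)) (differential S q (x i)))"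
proof (rule cotangent_eqI[OF assms(3)])
  show "(\<Sum>i\<in>N. fscale (\<eta> (e i q)) (differential S q (x i))) \<in> cotangent S q"
    by (intro cotangent_closed differential_cotangent)
  fix v assume v: "v \<in> tangent S q"
  have "\<eta> v = \<eta> (\<Sum>i\<in>N. fscale (v (x i)) (e i q))" using coord_frame_expand[OF assms(1,2) v] by simp
  also have "\<dots> = (\<Sum>i\<in>N. v (x i) * \<eta> (e i q))"
    using coord_frameD(8)[OF assms(1,2)] assms(3)
    by (subst cotangent_sum) (auto intro: tangent_closed simp: cotangentD)
  finally show "\<eta> v = (\<Sum>i\<in>N. fscale (\<eta> (e i q)) (differential S q (x i))) v"
    using v by (simp add: sum_fun_apply differential_def mult.commute)
qed

lemma field_through_vector:
  assumes "coord_frame S U N x e" "p \<in> U" "w \<in> tangent S p"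
  shows "\<exists>W. smooth_field S U W \<and> W p = w"
  using coord_frame_expand[OF assms] coord_frameD(1,4)[OF assms(1)]
  by (intro exI[of _ "\<lambda>q. \<Sum>i\<in>N. fscale (w (x i)) (e i q)"])
     (auto intro!: smooth_field_sum smooth_field_scale[where f = "\<lambda>_. _"] smooth_const)

lemma cofield_through_covector:
  assumes "coord_frame S U N x e" "p \<in> U" "\<eta> \<in> cotangent S p"
  shows "\<exists>\<theta>. smooth_cofield S U \<theta> \<and> \<theta> p = \<eta>"
  using coord_frame_expand_cotangent[OF assms] coord_frameD(1,3)[OF assms(1)]
  by (intro exI[of _ "\<lambda>q. \<Sum>i\<in>N. fscale (\<eta> (e i p)) (differential S q (x i))"])
     (auto intro!: smooth_cofield_sum smooth_cofield_scale[where f = "\<lambda>_. _"] smooth_const smooth_cofield_differential)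

lemma gsection_through_gvec:
  assumes "coord_frame S U N x e" "p \<in> U" "E \<in> gfibre S p"
  shows "\<exists>F. smooth_gsection S U F \<and> F p = E"
proof -
  obtain V \<theta> where "smooth_field S U V" "V p = fst E" "smooth_cofield S U \<theta>" "\<theta> p = snd E"
    using field_through_vector[OF assms(1,2)] cofield_through_covector[OF assms(1,2)] gfibreD[OF assms(3)] by metis
  then show ?thesis by (intro exI[of _ "\<lambda>q. (V q, \<theta> q)"]) (simp add: smooth_gsection_def)
qed

lemma field_through:
  assumes "coord_frame S U N x e" "p \<in> U" "w \<in> tangent S p"
  obtains O' where "field_through S p w p = w" "openin (stop S) O'" "p \<in> O'" "smooth_field S O' (field_through S p w)"
proof -
  have "\<exists>W. W p = w \<and> (\<exists>U. openin (stop S) U \<and> p \<in> U \<and> smooth_field S U W)"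
    using field_through_vector[OF assms] coord_frameD(1)[OF assms(1)] assms(2) by metis
  from someI_ex[OF this] show ?thesis using that unfolding field_through_def by blast
qed

lemma tangent_dim:
  assumes "coord_frame S U N x e" "p \<in> U"
  shows "fvs.dim (tangent S p) = card N"
proof -
  have z: "c i = 0" if "(\<Sum>i\<in>N. fscale (c i) (e i p)) = 0" "i \<in> N" for c i
    using coord_frame_combination[OF assms that(2), of c] that(1) by simp
  have fam: "inj_on (\<lambda>i. e i p) N" "fvs.independent ((\<lambda>i. e i p) ` N)"
    by (rule fvs.independent_family[OF coord_frameD(2)[OF assms(1)]], erule (1) z)+
  have "fvs.span ((\<lambda>i. e i p) ` N) = tangent S p"
  proof
    show "fvs.span ((\<lambda>i. e i p) ` N) \<subseteq> tangent S p"
      by (rule fvs.span_minimal[OF _ tangent_subspace]) (use coord_frameD(8)[OF assms] in auto)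
    show "tangent S p \<subseteq> fvs.span ((\<lambda>i. e i p) ` N)"
    proof
      fix v assume "v \<in> tangent S p"
      then have "v = (\<Sum>i\<in>N. fscale (v (x i)) (e i p))" using coord_frame_expand[OF assms] by blast
      also have "\<dots> \<in> fvs.span ((\<lambda>i. e i p) ` N)"
        by (intro fvs.span_sum fvs.span_scale fvs.span_base imageI)
      finally show "v \<in> fvs.span ((\<lambda>i. e i p) ` N)" .
    qed
  qed
  then have "fvs.dim (tangent S p) = card ((\<lambda>i. e i p) ` N)"
    using fvs.dim_eq_card[OF _ fam(2)] fvs.span_span by metis
  then show ?thesis using card_image[OF fam(1)] by simp
qed

lemma gfibre_basis:
  assumes "coord_frame S U N x e" "p \<in> U"
  shows "\<exists>B. finite B \<and> gvs.independent B \<and> gvs.span B = gfibre S p \<and> card B = 2 * card N"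
proof -
  define b where "b = case_sum (\<lambda>i. (e i p, 0)) (\<lambda>i. (0, differential S p (x i)))"
  note fN = coord_frameD(2)[OF assms(1)]
  have fs: "(\<Sum>k\<in>N <+> N. gscale (c k) (b k)) =
      (\<Sum>i\<in>N. fscale (c (Inl i)) (e i p), \<Sum>i\<in>N. fscale (c (Inr i)) (differential S p (x i)))" for c
    by (simp add: sum.Plus[OF fN fN] b_def prod_eq_iff fst_sum snd_sum)
  have z: "c k = 0" if s: "(\<Sum>k\<in>N <+> N. gscale (c k) (b k)) = 0" and k: "k \<in> N <+> N" for c k
  proof (cases k)
    case (Inl i)
    then show ?thesis
      using coord_frame_combination[OF assms, of i "\<lambda>i. c (Inl i)"] s k by (auto simp: fs prod_eq_iff)
  next
    case (Inr j)
    then have j: "j \<in> N" using k by auto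
    have "(\<Sum>i\<in>N. c (Inr i) * differential S p (x i) (e j p)) = (\<Sum>i\<in>N. if i = j then c (Inr i) else 0)"
      by (rule sum.cong)
         (use coord_frameD(5)[OF assms j] coord_frameD(8)[OF assms j] in \<open>auto simp: differential_def\<close>)
    moreover have "(\<Sum>i\<in>N. fscale (c (Inr i)) (differential S p (x i))) (e j p) = 0"
      using s by (simp add: fs prod_eq_iff)
    ultimately show ?thesis using Inr j fN by (simp add: sum_fun_apply)
  qed
  have fin: "finite (N <+> N)" using fN by simp
  have fam: "inj_on b (N <+> N)" "gvs.independent (b ` (N <+> N))"
    by (rule gvs.independent_family[OF fin], erule (1) z)+
  have "gvs.span (b ` (N <+> N)) = gfibre S p"
  proof
    show "gvs.span (b ` (N <+> N)) \<subseteq> gfibre S p"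
      by (rule gvs.span_minimal[OF _ gfibre_subspace])
         (use coord_frameD(8)[OF assms] in \<open>auto simp: b_def gfibre_def tangent_closed cotangent_closed differential_cotangent\<close>)
    show "gfibre S p \<subseteq> gvs.span (b ` (N <+> N))"
    proof
      fix E assume E: "E \<in> gfibre S p"
      define c where "c = case_sum (\<lambda>i. fst E (x i)) (\<lambda>i. snd E (e i p))"
      have "E = (\<Sum>k\<in>N <+> N. gscale (c k) (b k))"
        using coord_frame_expand[OF assms gfibreD(1)[OF E]] coord_frame_expand_cotangent[OF assms gfibreD(2)[OF E]]
        by (simp add: fs c_def prod_eq_iff)
      also have "\<dots> \<in> gvs.span (b ` (N <+> N))"
        by (intro gvs.span_sum gvs.span_scale gvs.span_base imageI)
      finally show "E \<in> gvs.span (b ` (N <+> N))" .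
    qed
  qed
  moreover have "card (b ` (N <+> N)) = 2 * card N"
    using card_image[OF fam(1)] fN by (simp add: card_Plus)
  ultimately show ?thesis using fam(2) fin by blast
qed

text \<open>A basis of \<open>L\<close> and its conjugate form a basis of the fibre, which has twice as many elements as the
  frame. This computes the rank of a spinor kernel.\<close>

lemma conj_split_dim:
  assumes "coord_frame S U N x e" "p \<in> U" "gvs.subspace L"
    and "L \<inter> conj_gvec ` L = {0}" "gfibre S p = {E + F |E F. E \<in> L \<and> F \<in> conj_gvec ` L}"
  shows "\<exists>B. finite B \<and> gvs.independent B \<and> gvs.span B = L \<and> card B = card N"
proof -
  obtain C where C: "finite C" "gvs.independent C" "gvs.span C = gfibre S p" "card C = 2 * card N"
    using gfibre_basis[OF assms(1,2)] by blast
  obtain B where B: "B \<subseteq> L" "gvs.independent B" "L \<subseteq> gvs.span B" using gvs.basis_exists by metis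
  have sB: "gvs.span B = L" using B gvs.span_minimal[OF B(1) assms(3)] by blast
  have "L \<subseteq> gfibre S p"
  proof
    fix E assume "E \<in> L"
    moreover have "0 \<in> conj_gvec ` L" using assms(4) by blast
    ultimately have "E + 0 \<in> gfibre S p" unfolding assms(5) by blast
    then show "E \<in> gfibre S p" by simp
  qed
  then have fB: "finite B" using gvs.independent_span_bound[OF C(1) B(2)] B(1) C(3) by blast
  note sp = conj_split_basis[OF B(2) fB, unfolded sB, OF assms(4)]
  have "gvs.span (B \<union> conj_gvec ` B) = gvs.span C" using sp(3) assms(5) C(3) by simp
  then have "card (B \<union> conj_gvec ` B) = card C"
    using gvs.dim_eq_card[OF _ sp(1)] gvs.dim_eq_card[OF refl C(2)] by metis
  then show ?thesis using sp(4) C(4) fB B(2) sB by auto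
qed

subsection \<open>The Courant bracket as a tensor in the test vector\<close>

lemma ext_d_one_form:
  "ext_d S (one_form \<theta>) [V, W] p =
     V p (\<lambda>q. \<theta> q (W q)) - W p (\<lambda>q. \<theta> q (V q)) - \<theta> p (lie_bracket S V W p)"
  by (simp add: ext_d_def one_form_def del_nth_def lessThan_Suc numeral_2_eq_2)

text \<open>Both sides differ by the value on a field \<open>D\<close> with \<open>D p = 0\<close>, which in a frame is
  \<open>\<Sum> d\<^sub>i e\<^sub>i\<close> with \<open>d\<^sub>i p = 0\<close>; the derivatives of the \<open>d\<^sub>i\<close> along \<open>V\<close> cancel.\<close>

lemma lie_derivative_one_form_tensorial:
  assumes fr: "coord_frame S U N x e" and p: "p \<in> U"
    and V: "smooth_field S U V" and W: "smooth_field S U W" and W': "smooth_field S U W'"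
    and \<theta>: "smooth_cofield S U \<theta>" and eq: "W p = W' p"
  shows "lie_derivative_one_form S V \<theta> W p = lie_derivative_one_form S V \<theta> W' p"
proof -
  note U = coord_frameD(1)[OF fr]
  have pt: "p \<in> topspace (stop S)" using U p openin_subset by blast
  note Vp = smooth_fieldD(1)[OF V p] and \<theta>p = smooth_cofieldD(1)[OF \<theta> p]
  define d where "d i q = W q (x i) - W' q (x i)" for i q
  have ds: "d i \<in> sfun S U" if "i \<in> N" for i
    unfolding d_def
    using smooth_diff[OF U smooth_fieldD(2)[OF W U order_refl] smooth_fieldD(2)[OF W' U order_refl]]
      coord_frameD(3)[OF fr that] by blast
  then have dg: "d i \<in> germs S p" if "i \<in> N" for i using germsI[OF U p] that by blast
  have dp: "d i p = 0" for i using eq by (simp add: d_def)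
  have diff: "W q - W' q = (\<Sum>i\<in>N. fscale (d i q) (e i q))" if "q \<in> U" for q
    using coord_frame_expand[OF fr that, of "W q - W' q"] smooth_fieldD(1)[OF W that] smooth_fieldD(1)[OF W' that]
    by (simp add: tangent_closed d_def)
  have gf: "(\<lambda>q. X q f) \<in> germs S p" if "smooth_field S U X" "f \<in> germs S p" for X f
  proof -
    obtain U' where U': "openin (stop S) U'" "p \<in> U'" "f \<in> sfun S U'" using \<open>f \<in> germs S p\<close> by (rule germsE)
    then have "(\<lambda>q. X q f) \<in> sfun S (U' \<inter> U)"
      using smooth_fieldD(2)[OF that(1), of "U' \<inter> U" f] smooth_restrict[of U' f "U' \<inter> U"] U by auto
    then show ?thesis using germsI[of "U' \<inter> U"] U' U p by auto
  qed
  have prod: "V p (\<lambda>q. \<Sum>i\<in>N. d i q * g i q) = (\<Sum>i\<in>N. V p (d i) * g i p)" if "\<And>i. i \<in> N \<Longrightarrow> g i \<in> germs S p" for g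
    using tangent_sum[OF Vp pt, of N "\<lambda>i q. d i q * g i q"] tangent_mult[OF Vp dg] that germs_mult[OF dg] dp
    by (simp add: mult.commute)
  have g\<theta>: "(\<lambda>q. \<theta> q (X q)) \<in> germs S p" if "smooth_field S U X" for X
    using germsI[OF U p smooth_cofieldD(2)[OF \<theta> U order_refl that]] .
  have "V p (\<lambda>q. \<theta> q (W q)) - V p (\<lambda>q. \<theta> q (W' q)) = V p (\<lambda>q. \<theta> q (W q) - \<theta> q (W' q))"
    using tangent_diff[OF Vp g\<theta>[OF W] g\<theta>[OF W']] by simp
  also have "\<dots> = V p (\<lambda>q. \<Sum>i\<in>N. d i q * \<theta> q (e i q))"
  proof (rule tangent_cong[OF Vp germs_diff[OF g\<theta>[OF W] g\<theta>[OF W']] U p])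
    fix q assume q: "q \<in> U"
    have "\<theta> q (W q) - \<theta> q (W' q) = \<theta> q (\<Sum>i\<in>N. fscale (d i q) (e i q))"
      using cotangent_diff[OF smooth_cofieldD(1)[OF \<theta> q] smooth_fieldD(1)[OF W q] smooth_fieldD(1)[OF W' q]]
      by (simp add: diff[OF q, symmetric])
    also have "\<dots> = (\<Sum>i\<in>N. d i q * \<theta> q (e i q))"
      by (subst cotangent_sum[OF smooth_cofieldD(1)[OF \<theta> q]])
         (auto intro: tangent_closed coord_frameD(8)[OF fr q] simp: cotangentD(2)[OF smooth_cofieldD(1)[OF \<theta> q]] coord_frameD(8)[OF fr q])
    finally show "\<theta> q (W q) - \<theta> q (W' q) = (\<Sum>i\<in>N. d i q * \<theta> q (e i q))" .
  qed
  also have "\<dots> = (\<Sum>i\<in>N. V p (d i) * \<theta> p (e i p))"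
    by (rule prod) (rule g\<theta>[OF coord_frameD(4)[OF fr]])
  finally have 1: "V p (\<lambda>q. \<theta> q (W q)) - V p (\<lambda>q. \<theta> q (W' q)) = (\<Sum>i\<in>N. V p (d i) * \<theta> p (e i p))" .
  note LW = lie_bracket_tangent[OF U p V W] and LW' = lie_bracket_tangent[OF U p V W']
  have "lie_bracket S V W p - lie_bracket S V W' p = (\<Sum>i\<in>N. fscale (V p (d i)) (e i p))"
  proof (rule tangent_eqI)
    show "lie_bracket S V W p - lie_bracket S V W' p \<in> tangent S p" by (intro tangent_closed LW LW')
    show "(\<Sum>i\<in>N. fscale (V p (d i)) (e i p)) \<in> tangent S p" by (intro tangent_closed coord_frameD(8)[OF fr p])
    fix f assume f: "f \<in> germs S p"
    have "(lie_bracket S V W p - lie_bracket S V W' p) f = V p (\<lambda>q. W q f) - V p (\<lambda>q. W' q f)"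
      using f eq by (simp add: lie_bracket_def)
    also have "\<dots> = V p (\<lambda>q. W q f - W' q f)"
      using tangent_diff[OF Vp gf[OF W f] gf[OF W' f]] by simp
    also have "\<dots> = V p (\<lambda>q. \<Sum>i\<in>N. d i q * e i q f)"
    proof (rule tangent_cong[OF Vp germs_diff[OF gf[OF W f] gf[OF W' f]] U p])
      fix q assume "q \<in> U"
      from fun_cong[OF diff[OF this], of f] show "W q f - W' q f = (\<Sum>i\<in>N. d i q * e i q f)"
        by (simp add: sum_fun_apply)
    qed
    also have "\<dots> = (\<Sum>i\<in>N. V p (d i) * e i p f)"
      by (rule prod) (rule gf[OF coord_frameD(4)[OF fr] f])
    finally show "(lie_bracket S V W p - lie_bracket S V W' p) f = (\<Sum>i\<in>N. fscale (V p (d i)) (e i p)) f"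
      by (simp add: sum_fun_apply)
  qed
  then have "\<theta> p (lie_bracket S V W p) - \<theta> p (lie_bracket S V W' p) = \<theta> p (\<Sum>i\<in>N. fscale (V p (d i)) (e i p))"
    using cotangent_diff[OF \<theta>p LW LW'] by simp
  also have "\<dots> = (\<Sum>i\<in>N. V p (d i) * \<theta> p (e i p))"
    by (subst cotangent_sum[OF \<theta>p])
       (auto intro: tangent_closed coord_frameD(8)[OF fr p] simp: cotangentD(2)[OF \<theta>p] coord_frameD(8)[OF fr p])
  finally show ?thesis using 1 by (simp add: lie_derivative_one_form_def algebra_simps)
qed

text \<open>Twice the 1-form part of the bracket, with \<open>d \<theta>\<close> expanded by Cartan's formula: the test field \<open>W\<close> enters
  only through its value and through terms that are tensorial by the preceding lemma.\<close>

definition courant_test ::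
  "('a \<Rightarrow> 'a gvec) \<Rightarrow> ('a \<Rightarrow> 'a gvec) \<Rightarrow> ('a \<Rightarrow> 'a tvec) \<Rightarrow> 'a \<Rightarrow> complex" where
  "courant_test E F W p =
    2 * lie_derivative_one_form S (\<lambda>q. fst (E q)) (\<lambda>q. snd (F q)) W p
    - 2 * lie_derivative_one_form S (\<lambda>q. fst (F q)) (\<lambda>q. snd (E q)) W p
    + W p (\<lambda>q. snd (E q) (fst (F q))) - W p (\<lambda>q. snd (F q) (fst (E q)))"

lemma courant_snd:
  assumes fr: "coord_frame S U N x e" and p: "p \<in> U" and O': "openin (stop S) O'" "p \<in> O'"
    and E: "smooth_gsection S O' E" and F: "smooth_gsection S O' F" and W: "smooth_field S O' W"
  shows "snd (courant S E F p) (W p) = courant_test E F W p / 2"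
proof -
  have Wp: "W p \<in> tangent S p" using W O' smooth_fieldD(1) by blast
  let ?W = "field_through S p (W p)"
  obtain O2 where O2: "?W p = W p" "openin (stop S) O2" "p \<in> O2" "smooth_field S O2 ?W"
    using field_through[OF fr p Wp] .
  define D where "D = U \<inter> O' \<inter> O2"
  have D: "openin (stop S) D" "D \<subseteq> U" "D \<subseteq> O'" "D \<subseteq> O2" "p \<in> D"
    using coord_frameD(1)[OF fr] O' O2 p by (auto simp: D_def)
  have frD: "coord_frame S D N x e"
    using fr D smooth_restrict[of U _ D] smooth_field_restrict[of U _ D]
    unfolding coord_frame_def by blast
  have "courant_test E F ?W p = courant_test E F W p"
    unfolding courant_test_def
    using lie_derivative_one_form_tensorial[OF frD D(5) _ smooth_field_restrict[OF O2(4) D(4)] smooth_field_restrict[OF W D(3)] _ O2(1)]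
      smooth_gsection_restrict[OF E D(3)] smooth_gsection_restrict[OF F D(3)]
    by (simp add: smooth_gsection_def O2(1))
  moreover have "snd (courant S E F p) (W p) = courant_test E F ?W p / 2"
    using Wp by (simp add: courant_def Let_def courant_test_def lie_derivative_one_form_def ext_d_one_form)
  ultimately show ?thesis by simp
qed

end

section \<open>Submanifolds with adapted frames\<close>

definition vanishes_near :: "'a smooth_space \<Rightarrow> 'a set \<Rightarrow> 'a \<Rightarrow> ('a \<Rightarrow> complex) \<Rightarrow> bool" where
  "vanishes_near S M p f \<longleftrightarrow> (\<exists>V. openin (stop S) V \<and> p \<in> V \<and> (\<forall>q\<in>V \<inter> M. f q = 0))"

text \<open>\<open>T\<close> indexes the tangential part of the frame, so that the tangential fields span \<open>TM\<close> along \<open>M\<close>; the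
  coordinates with index in \<open>N - T\<close> are normal to \<open>M\<close>.\<close>

definition adapted_frame ::
  "'a smooth_space \<Rightarrow> 'a set \<Rightarrow> 'a set \<Rightarrow> 'i set \<Rightarrow> 'i set \<Rightarrow> ('i \<Rightarrow> 'a \<Rightarrow> complex) \<Rightarrow> ('i \<Rightarrow> 'a \<Rightarrow> 'a tvec) \<Rightarrow> bool" where
  "adapted_frame S M U N T x e \<longleftrightarrow>
     coord_frame S U N x e \<and> T \<subseteq> N \<and> (\<forall>i\<in>N - T. \<forall>q\<in>U \<inter> M. x i q = 0) \<and>
     (\<forall>i\<in>T. \<forall>q\<in>U \<inter> M. \<forall>f\<in>germs S q. vanishes_near S M q f \<longrightarrow> e i q f = 0)"

text \<open>The argument \<open>index_type\<close> only names the type of the frame indices, which occurs in no other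
  parameter.\<close>

locale adapted_submanifold = smooth_sheaf S for S :: "'a smooth_space" +
  fixes M :: "'a set" and index_type :: "'i itself"
  assumes smooth_inverse:
      "openin (stop S) U \<Longrightarrow> f \<in> sfun S U \<Longrightarrow> (\<And>q. q \<in> U \<Longrightarrow> f q \<noteq> 0) \<Longrightarrow> (\<lambda>q. inverse (f q)) \<in> sfun S U"
    and adapted: "p \<in> M \<Longrightarrow> \<exists>U N T x (e::'i \<Rightarrow> 'a \<Rightarrow> 'a tvec). p \<in> U \<and> adapted_frame S M U N T x e"
begin

abbreviation R where "R \<equiv> sub_space S M"

lemma adapted_frameE:
  assumes "p \<in> M"
  obtains U N T x e where "p \<in> U" "coord_frame S U (N::'i set) x e" "T \<subseteq> N"
    "\<And>i q. i \<in> N - T \<Longrightarrow> q \<in> U \<inter> M \<Longrightarrow> x i q = 0"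
    "\<And>i q f. i \<in> T \<Longrightarrow> q \<in> U \<inter> M \<Longrightarrow> f \<in> germs S q \<Longrightarrow> vanishes_near S M q f \<Longrightarrow> e i q f = 0"
  using adapted[OF assms] unfolding adapted_frame_def by blast

lemma M_subset: "M \<subseteq> topspace (stop S)"
proof
  fix p assume "p \<in> M"
  then obtain U N T x e where "p \<in> U" "coord_frame S U (N::'i set) x e" by (rule adapted_frameE)
  then show "p \<in> topspace (stop S)" using coord_frameD(1) openin_subset by blast
qed

lemma sub_topspace [simp]: "topspace (stop R) = M"
  using M_subset by (auto simp: sub_space_def)

lemma openin_sub: "openin (stop R) W \<longleftrightarrow> (\<exists>V. openin (stop S) V \<and> W = V \<inter> M)"
  by (simp add: sub_space_def openin_subtopology)

lemma openin_subI: "openin (stop S) V \<Longrightarrow> openin (stop R) (V \<inter> M)"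
  using openin_sub by blast

lemma sfun_sub: "sfun R W = {f. \<forall>p\<in>W. \<exists>V g. openin (stop S) V \<and> p \<in> V \<and> g \<in> sfun S V \<and> (\<forall>q\<in>V \<inter> W. f q = g q)}"
  by (simp add: sub_space_def)

lemma sfun_subE:
  assumes "f \<in> sfun R W" "p \<in> W"
  obtains V g where "openin (stop S) V" "p \<in> V" "g \<in> sfun S V" "\<And>q. q \<in> V \<Longrightarrow> q \<in> W \<Longrightarrow> f q = g q"
  using assms unfolding sfun_sub by blast

lemma sfun_subI:
  assumes "\<And>p. p \<in> W \<Longrightarrow> \<exists>V g. openin (stop S) V \<and> p \<in> V \<and> g \<in> sfun S V \<and> (\<forall>q\<in>V \<inter> W. f q = g q)"
  shows "f \<in> sfun R W"
  using assms unfolding sfun_sub by blast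

lemma sfun_sub_common:
  assumes "f \<in> sfun R W" "g \<in> sfun R W" "p \<in> W"
  obtains V f' g' where "openin (stop S) V" "p \<in> V" "f' \<in> sfun S V" "g' \<in> sfun S V"
    "\<And>q. q \<in> V \<inter> W \<Longrightarrow> f q = f' q \<and> g q = g' q"
proof -
  obtain V f' where V: "openin (stop S) V" "p \<in> V" "f' \<in> sfun S V" "\<And>q. q \<in> V \<Longrightarrow> q \<in> W \<Longrightarrow> f q = f' q"
    by (rule sfun_subE[OF assms(1,3)]) blast?
  obtain V2 g' where V2: "openin (stop S) V2" "p \<in> V2" "g' \<in> sfun S V2" "\<And>q. q \<in> V2 \<Longrightarrow> q \<in> W \<Longrightarrow> g q = g' q"
    by (rule sfun_subE[OF assms(2,3)]) blast?
  have o: "openin (stop S) (V \<inter> V2)" using V V2 by auto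
  show ?thesis
    by (rule that[OF o _ smooth_restrict[OF V(1,3) o] smooth_restrict[OF V2(1,3) o]]) (use V V2 in auto)
qed

sublocale R: smooth_sheaf R
proof
  fix U W f g c assume U: "openin (stop R) U"
  show "(\<lambda>_. c) \<in> sfun R U"
    using smooth_const[OF openin_topspace] openin_subset[OF U] M_subset
    by (intro sfun_subI exI[of _ "topspace (stop S)"]) auto
  show "(\<lambda>x. f x + g x) \<in> sfun R U" if "f \<in> sfun R U" "g \<in> sfun R U"
  proof (rule sfun_subI)
    note fg = that
    fix p assume p: "p \<in> U"
    obtain V f' g' where "openin (stop S) V" "p \<in> V" "f' \<in> sfun S V" "g' \<in> sfun S V"
      "\<And>q. q \<in> V \<inter> U \<Longrightarrow> f q = f' q \<and> g q = g' q" by (rule sfun_sub_common[OF fg p]) blast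
    then show "\<exists>V h. openin (stop S) V \<and> p \<in> V \<and> h \<in> sfun S V \<and> (\<forall>q\<in>V \<inter> U. f q + g q = h q)"
      by (intro exI[of _ V] exI[of _ "\<lambda>q. f' q + g' q"]) (auto intro: smooth_add)
  qed
  show "(\<lambda>x. f x * g x) \<in> sfun R U" if "f \<in> sfun R U" "g \<in> sfun R U"
  proof (rule sfun_subI)
    note fg = that
    fix p assume p: "p \<in> U"
    obtain V f' g' where "openin (stop S) V" "p \<in> V" "f' \<in> sfun S V" "g' \<in> sfun S V"
      "\<And>q. q \<in> V \<inter> U \<Longrightarrow> f q = f' q \<and> g q = g' q" by (rule sfun_sub_common[OF fg p]) blast
    then show "\<exists>V h. openin (stop S) V \<and> p \<in> V \<and> h \<in> sfun S V \<and> (\<forall>q\<in>V \<inter> U. f q * g q = h q)"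
      by (intro exI[of _ V] exI[of _ "\<lambda>q. f' q * g' q"]) (auto intro: smooth_mult)
  qed
  show "(\<lambda>x. cnj (f x)) \<in> sfun R U" if "f \<in> sfun R U"
  proof (rule sfun_subI)
    note f = that
    fix p assume p: "p \<in> U"
    obtain V f' where "openin (stop S) V" "p \<in> V" "f' \<in> sfun S V" "\<And>q. q \<in> V \<Longrightarrow> q \<in> U \<Longrightarrow> f q = f' q"
      by (rule sfun_subE[OF f p]) blast?
    then show "\<exists>V h. openin (stop S) V \<and> p \<in> V \<and> h \<in> sfun S V \<and> (\<forall>q\<in>V \<inter> U. cnj (f q) = h q)"
      by (intro exI[of _ V] exI[of _ "\<lambda>q. cnj (f' q)"]) (auto intro: smooth_cnj)
  qed
  show "f \<in> sfun R W" if "f \<in> sfun R U" "openin (stop R) W" "W \<subseteq> U"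
    using that unfolding sfun_sub by blast
  show "g \<in> sfun R U" if "f \<in> sfun R U" "\<And>x. x \<in> U \<Longrightarrow> f x = g x"
    using that unfolding sfun_sub by simp
  show "f \<in> sfun R U" if loc: "\<And>p. p \<in> U \<Longrightarrow> \<exists>W. openin (stop R) W \<and> p \<in> W \<and> f \<in> sfun R W"
  proof (rule sfun_subI)
    fix p assume p: "p \<in> U"
    then obtain W0 where W: "openin (stop S) W0" "p \<in> W0 \<inter> M" "f \<in> sfun R (W0 \<inter> M)"
      using loc openin_sub by metis
    obtain V g where V: "openin (stop S) V" "p \<in> V" "g \<in> sfun S V" "\<And>q. q \<in> V \<Longrightarrow> q \<in> W0 \<inter> M \<Longrightarrow> f q = g q"
      by (rule sfun_subE[OF W(3,2)]) blast?
    have "openin (stop S) (V \<inter> W0)" using V W by auto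
    moreover have "U \<subseteq> M" using openin_subset[OF U] by simp
    ultimately show "\<exists>V g. openin (stop S) V \<and> p \<in> V \<and> g \<in> sfun S V \<and> (\<forall>q\<in>V \<inter> U. f q = g q)"
      using V W smooth_restrict[of V g "V \<inter> W0"] by (intro exI[of _ "V \<inter> W0"] exI[of _ g]) auto
  qed
qed

lemma sfun_sub_restrict: "openin (stop S) V \<Longrightarrow> f \<in> sfun S V \<Longrightarrow> f \<in> sfun R (V \<inter> M)"
  by (rule sfun_subI) auto

lemma germs_sub: "p \<in> M \<Longrightarrow> f \<in> germs S p \<Longrightarrow> f \<in> germs R p"
  by (erule germsE) (rule R.germsI[OF openin_subI _ sfun_sub_restrict], auto)

lemma germs_sub_point: "f \<in> germs R p \<Longrightarrow> p \<in> M"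
  using openin_subset by (force simp: germs_def)

lemma germs_extend:
  assumes "f \<in> germs R p"
  obtains V g where "openin (stop S) V" "p \<in> V" "g \<in> sfun S V" "\<And>q. q \<in> V \<inter> M \<Longrightarrow> f q = g q"
proof -
  obtain W where W: "openin (stop R) W" "p \<in> W" "f \<in> sfun R W" using assms by (rule R.germsE)
  obtain W0 where W0: "openin (stop S) W0" "W = W0 \<inter> M" using W(1) openin_sub by blast
  obtain V g where V: "openin (stop S) V" "p \<in> V" "g \<in> sfun S V" "\<And>q. q \<in> V \<Longrightarrow> q \<in> W \<Longrightarrow> f q = g q"
    by (rule sfun_subE[OF W(3,2)]) blast?
  have o: "openin (stop S) (V \<inter> W0)" using V W0 by auto
  show ?thesis
    by (rule that[OF o _ smooth_restrict[OF V(1,3) o]]) (use V W W0 in auto)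
qed

subsection \<open>Tangent vectors and covectors of the submanifold\<close>

lemma push_apply: "f \<in> germs S p \<Longrightarrow> push_tvec S p v f = v f"
  by (simp add: push_tvec_def)

text \<open>A tangent vector of \<open>M\<close> sees a function only through its restriction. All comparisons of derivatives
  on \<open>M\<close> and on the ambient space go through this lemma.\<close>

lemma push_deriv:
  assumes "v \<in> tangent R p" "p \<in> M" "g \<in> germs S p" "openin (stop S) V" "p \<in> V"
    "\<And>q. q \<in> V \<inter> M \<Longrightarrow> h q = g q"
  shows "v h = push_tvec S p v g"
  using R.tangent_cong[OF assms(1) germs_sub[OF assms(2,3)] openin_subI[OF assms(4)], of h] assms
  by (simp add: push_apply)

lemma push_tangent:
  assumes v: "v \<in> tangent R p" and p: "p \<in> M"
  shows "push_tvec S p v \<in> tangent S p"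
proof (rule tangentI)
  show "push_tvec S p v f = push_tvec S p v g" if "f \<in> germs S p" "g \<in> germs S p" "openin (stop S) U" "p \<in> U"
      "\<And>x. x \<in> U \<Longrightarrow> f x = g x" for f g U
    using push_deriv[OF v p that(2,3,4), of f] that(1,5) by (simp add: push_apply)
qed (use R.tangentD[OF v] germs_sub[OF p] in \<open>auto simp: push_tvec_def germs_add germs_mult germs_scale\<close>)

lemma push_vanishing:
  assumes "v \<in> tangent R p" "p \<in> M" "f \<in> germs S p" "vanishes_near S M p f"
  shows "push_tvec S p v f = 0"
proof -
  obtain V where "openin (stop S) V" "p \<in> V" "\<And>q. q \<in> V \<inter> M \<Longrightarrow> f q = 0"
    using assms(4) unfolding vanishes_near_def by blast
  from push_deriv[OF assms(1,2,3) this(1,2), of "\<lambda>_. 0"] this(3) R.tangent_const[OF assms(1)]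
  show ?thesis by simp
qed

lemma push_inj:
  assumes "v \<in> tangent R p" "w \<in> tangent R p" "push_tvec S p v = push_tvec S p w"
  shows "v = w"
proof (rule R.tangent_eqI[OF assms(1,2)])
  fix f assume f: "f \<in> germs R p"
  then obtain V g where V: "openin (stop S) V" "p \<in> V" "g \<in> sfun S V" "\<And>q. q \<in> V \<inter> M \<Longrightarrow> f q = g q"
    by (rule germs_extend) blast
  show "v f = w f"
    using push_deriv[OF assms(1) germs_sub_point[OF f] germsI[OF V(1-3)] V(1,2,4)]
      push_deriv[OF assms(2) germs_sub_point[OF f] germsI[OF V(1-3)] V(1,2,4)] assms(3) by simp
qed

text \<open>Functions on \<open>M\<close> extend locally, so a tangent vector that annihilates the functions vanishing
  on \<open>M\<close> acts on them.\<close>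

lemma tangent_descends:
  assumes u: "u \<in> tangent S p" and p: "p \<in> M"
    and van: "\<And>f. f \<in> germs S p \<Longrightarrow> vanishes_near S M p f \<Longrightarrow> u f = 0"
  shows "\<exists>v\<in>tangent R p. push_tvec S p v = u"
proof -
  define ex where "ex f g \<longleftrightarrow> g \<in> germs S p \<and> vanishes_near S M p (\<lambda>x. f x - g x)" for f g
  have exists: "\<exists>g. ex f g" if f: "f \<in> germs R p" for f
  proof -
    obtain V g where "openin (stop S) V" "p \<in> V" "g \<in> sfun S V" "\<And>q. q \<in> V \<inter> M \<Longrightarrow> f q = g q"
      using f by (rule germs_extend) blast
    then show ?thesis unfolding ex_def vanishes_near_def using germsI by (intro exI[of _ g]) auto
  qed
  have van2: "vanishes_near S M p (\<lambda>x. h x)"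
    if "vanishes_near S M p f" "vanishes_near S M p g" "\<And>x. f x = 0 \<Longrightarrow> g x = 0 \<Longrightarrow> h x = 0" for f g h
  proof -
    note h = that
    obtain V1 V2 where "openin (stop S) V1" "p \<in> V1" "\<forall>q\<in>V1 \<inter> M. f q = 0"
      "openin (stop S) V2" "p \<in> V2" "\<forall>q\<in>V2 \<inter> M. g q = 0"
      using h(1,2) unfolding vanishes_near_def by blast
    then show ?thesis unfolding vanishes_near_def using h(3)
      by (intro exI[of _ "V1 \<inter> V2"]) auto
  qed
  define v where "v f = (if f \<in> germs R p then u (SOME g. ex f g) else 0)" for f
  have v: "v f = u g" if f: "f \<in> germs R p" and g: "ex f g" for f g
  proof -
    define G where "G = (SOME g. ex f g)"
    have g': "ex f G" unfolding G_def using exists[OF f] by (rule someI_ex)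
    have "vanishes_near S M p (\<lambda>x. G x - g x)"
      by (rule van2[of "\<lambda>x. f x - G x" "\<lambda>x. f x - g x"]) (use g g' in \<open>auto simp: ex_def\<close>)
    then have "u (\<lambda>x. G x - g x) = 0" using van germs_diff g g' by (simp add: ex_def)
    then have "u G = u g" using tangent_diff[OF u, of G g] g g' by (simp add: ex_def)
    then show ?thesis using f by (simp add: v_def G_def)
  qed
  have "v \<in> tangent R p"
  proof (rule R.tangentI)
    fix f g assume f: "f \<in> germs R p" and g: "g \<in> germs R p"
    obtain f' g' where f': "ex f f'" and g': "ex g g'" using exists f g by blast
    have "ex (\<lambda>x. f x + g x) (\<lambda>x. f' x + g' x)"
      unfolding ex_def using f' g' van2[of "\<lambda>x. f x - f' x" "\<lambda>x. g x - g' x"] by (auto simp: ex_def germs_add)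
    from v[OF R.germs_add[OF f g] this] show "v (\<lambda>x. f x + g x) = v f + v g"
      using v[OF f f'] v[OF g g'] tangent_add[OF u, of f' g'] f' g' by (simp add: ex_def)
    have "ex (\<lambda>x. f x * g x) (\<lambda>x. f' x * g' x)"
      unfolding ex_def using f' g' van2[of "\<lambda>x. f x - f' x" "\<lambda>x. g x - g' x"] by (auto simp: ex_def germs_mult)
    moreover have "f p = f' p" "g p = g' p" using f' g' p by (auto simp: ex_def vanishes_near_def)
    ultimately show "v (\<lambda>x. f x * g x) = f p * v g + g p * v f"
      using v[OF R.germs_mult[OF f g]] v[OF f f'] v[OF g g'] tangent_mult[OF u, of f' g'] f' g' by (simp add: ex_def)
    show "v f = v g" if U: "openin (stop R) U" "p \<in> U" "\<And>x. x \<in> U \<Longrightarrow> f x = g x" for U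
    proof -
      obtain U0 where U0: "openin (stop S) U0" "U = U0 \<inter> M" using U(1) openin_sub by blast
      have "vanishes_near S M p (\<lambda>x. f x - g x)"
        unfolding vanishes_near_def using U U0 by (intro exI[of _ U0]) auto
      then have "ex f g'" using van2[of "\<lambda>x. f x - g x" "\<lambda>x. g x - g' x" "\<lambda>x. f x - g' x"] g' by (auto simp: ex_def)
      then show ?thesis using v[OF f] v[OF g g'] by simp
    qed
    show "v (\<lambda>x. c * f x) = c * v f" for c
    proof -
      have "ex (\<lambda>x. c * f x) (\<lambda>x. c * f' x)"
        unfolding ex_def using f' van2[of "\<lambda>x. f x - f' x" "\<lambda>x. f x - f' x"] by (auto simp: ex_def germs_scale)
      from v[OF R.germs_scale[OF f] this] show ?thesis
        using v[OF f f'] tangent_scale[OF u, of f'] f' by (simp add: ex_def)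
    qed
  qed (simp add: v_def)
  moreover have "push_tvec S p v = u"
  proof
    fix f show "push_tvec S p v f = u f"
    proof (cases "f \<in> germs S p")
      case True
      have "vanishes_near S M p (\<lambda>x. f x - f x)"
        unfolding vanishes_near_def using p M_subset by (intro exI[of _ "topspace (stop S)"]) auto
      then have "ex f f" using True by (simp add: ex_def)
      then show ?thesis using v[OF germs_sub[OF p True]] True by (simp add: push_apply)
    qed (use tangent_outside[OF u] in \<open>simp add: push_tvec_def\<close>)
  qed
  ultimately show ?thesis by blast
qed

lemma push_linear [simp]: "push_tvec S p (v + w) = push_tvec S p v + push_tvec S p w"
  "push_tvec S p (fscale c v) = fscale c (push_tvec S p v)" "push_tvec S p 0 = 0"
  by (auto simp: push_tvec_def fun_eq_iff)

lemma push_sum: "push_tvec S p (\<Sum>i\<in>I. v i) = (\<Sum>i\<in>I. push_tvec S p (v i))"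
  by (induction I rule: infinite_finite_induct) (simp_all only: sum.infinite sum.empty sum.insert push_linear not_False_eq_True)

lemma push_conj: "push_tvec S p (conj_tvec v) = conj_tvec (push_tvec S p v)"
  by (auto simp: push_tvec_def conj_tvec_def fun_eq_iff germs_cnj_iff)

lemma pull_apply: "v \<in> tangent R p \<Longrightarrow> pull_covec S M p \<eta> v = \<eta> (push_tvec S p v)"
  by (simp add: pull_covec_def)

lemma pull_cotangent:
  assumes "p \<in> M" "\<eta> \<in> cotangent S p" shows "pull_covec S M p \<eta> \<in> cotangent R p"
  unfolding cotangent_def
  using cotangentD[OF assms(2) push_tangent[OF _ assms(1)]] push_tangent[OF _ assms(1)]
  by (auto simp: pull_covec_def R.tangent_closed)

lemma pull_linear [simp]: "pull_covec S M p (v + w) = pull_covec S M p v + pull_covec S M p w"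
  "pull_covec S M p (fscale c v) = fscale c (pull_covec S M p v)" "pull_covec S M p 0 = 0"
  by (auto simp: pull_covec_def fun_eq_iff)

lemma pull_conj: "pull_covec S M p (conj_covec \<eta>) = conj_covec (pull_covec S M p \<eta>)"
  by (auto simp: pull_covec_def conj_covec_def fun_eq_iff push_conj R.conj_tangent_iff)

subsection \<open>The reduction correspondence\<close>

text \<open>\<open>related p E' E\<close>: the vector \<open>E\<close> of \<open>TX \<oplus> T\<^sup>*X\<close> lies in \<open>TM \<oplus> T\<^sup>*X\<close> and its class modulo the
  conormal space is \<open>E'\<close>. Everything below is transported from \<open>X\<close> to \<open>M\<close> along this relation.\<close>

definition related :: "'a \<Rightarrow> 'a gvec \<Rightarrow> 'a gvec \<Rightarrow> bool" where
  "related p E' E \<longleftrightarrow> E' \<in> gfibre R p \<and> E \<in> gfibre S p \<and>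
     fst E = push_tvec S p (fst E') \<and> snd E' = pull_covec S M p (snd E)"

definition conormal_vecs :: "'a \<Rightarrow> 'a gvec set" where
  "conormal_vecs p = {E. related p 0 E}"

lemma relatedD: "related p E' E \<Longrightarrow> E' \<in> gfibre R p" "related p E' E \<Longrightarrow> E \<in> gfibre S p"
  by (auto simp: related_def)

lemma related_add: "related p E' E \<Longrightarrow> related p F' F \<Longrightarrow> related p (E' + F') (E + F)"
  by (auto simp: related_def gfibre_closed R.gfibre_closed)

lemma related_scale: "related p E' E \<Longrightarrow> related p (gscale c E') (gscale c E)"
  by (auto simp: related_def gfibre_closed R.gfibre_closed)

lemma related_uminus: "related p E' E \<Longrightarrow> related p (- E') (- E)"
  using related_scale[of p E' E "-1"] by simp

lemma related_diff: "related p E' E \<Longrightarrow> related p F' F \<Longrightarrow> related p (E' - F') (E - F)"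
  using related_add[OF _ related_uminus] by simp

lemma related_conj: "related p E' E \<Longrightarrow> related p (conj_gvec E') (conj_gvec E)"
  by (auto simp: related_def conj_gfibre R.conj_gfibre push_conj pull_conj)

lemma related_zero: "related p 0 0"
  by (simp add: related_def gfibre_closed R.gfibre_closed)

lemma related_pairing: "related p E' E \<Longrightarrow> related p F' F \<Longrightarrow> pairing E F = pairing E' F'"
  by (simp add: related_def pairing_def pull_apply R.gfibreD)

lemma related_unique: "related p E' E \<Longrightarrow> related p F' E \<Longrightarrow> E' = F'"
  unfolding related_def using push_inj R.gfibreD(1) by (metis prod_eqI)

lemma conormal_vecs_pairing:
  assumes "k \<in> conormal_vecs p" "related p E' E" shows "pairing E k = 0"
proof -
  have "fst k = 0" "pull_covec S M p (snd k) = 0"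
    using assms(1) by (auto simp: conormal_vecs_def related_def)
  moreover have "snd E 0 = 0" using cotangent_0[OF gfibreD(2)[OF relatedD(2)[OF assms(2)]]] .
  moreover have "fst E = push_tvec S p (fst E')" "fst E' \<in> tangent R p"
    using assms(2) R.gfibreD by (auto simp: related_def)
  ultimately show ?thesis using pull_apply[of "fst E'" p "snd k"] by (simp add: pairing_def)
qed

lemma conormal_vecs_conj: "k \<in> conormal_vecs p \<Longrightarrow> conj_gvec k \<in> conormal_vecs p"
  using related_conj[of p 0 k] by (simp add: conormal_vecs_def)

lemma conormal_vecs_subspace: "gvs.subspace (conormal_vecs p)"
  by (rule gvs.subspaceI)
     (use related_zero related_add[of p 0 _ 0] related_scale[of p 0] in \<open>auto simp: conormal_vecs_def\<close>)

lemma conormal_vecsI: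
  assumes "\<eta> \<in> cotangent S p" "p \<in> M" "\<And>v. v \<in> tangent R p \<Longrightarrow> \<eta> (push_tvec S p v) = 0"
  shows "(0, \<eta>) \<in> conormal_vecs p"
proof -
  have "pull_covec S M p \<eta> = 0" using assms(3) by (auto simp: pull_covec_def fun_eq_iff)
  moreover have "(0, \<eta>) \<in> gfibre S p" using assms(1) by (simp add: gfibre_def tangent_closed)
  ultimately show ?thesis by (simp add: conormal_vecs_def related_def R.gfibre_closed)
qed

lemma conormal_vecsD:
  assumes "k \<in> conormal_vecs p"
  shows "fst k = 0" "snd k \<in> cotangent S p" "v \<in> tangent R p \<Longrightarrow> snd k (push_tvec S p v) = 0"
proof -
  show "fst k = 0" "snd k \<in> cotangent S p"
    using assms by (auto simp: conormal_vecs_def related_def gfibre_def)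
  show "snd k (push_tvec S p v) = 0" if "v \<in> tangent R p"
    using assms pull_apply[OF that, of "snd k"] by (auto simp: conormal_vecs_def related_def)
qed

text \<open>\<open>TM \<oplus> T\<^sup>*X\<close> is the orthogonal complement of the conormal space, because differentials of
  functions vanishing on \<open>M\<close> are conormal.\<close>

lemma related_exists:
  assumes "E \<in> gfibre S p" "p \<in> M" "\<And>k. k \<in> conormal_vecs p \<Longrightarrow> pairing E k = 0"
  shows "\<exists>E'. related p E' E"
proof -
  have "\<exists>v\<in>tangent R p. push_tvec S p v = fst E"
  proof (rule tangent_descends[OF gfibreD(1)[OF assms(1)] assms(2)])
    fix f assume f: "f \<in> germs S p" "vanishes_near S M p f"
    have "(0, differential S p f) \<in> conormal_vecs p"
      by (rule conormal_vecsI[OF differential_cotangent assms(2)])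
         (use push_vanishing[OF _ assms(2) f] push_tangent[OF _ assms(2)] in \<open>simp add: differential_def\<close>)
    from assms(3)[OF this] show "fst E f = 0"
      using gfibreD[OF assms(1)] by (simp add: pairing_def differential_def cotangent_0)
  qed
  then obtain v where "v \<in> tangent R p" "push_tvec S p v = fst E" by blast
  then have "related p (v, pull_covec S M p (snd E)) E"
    using assms(1) gfibreD(2)[OF assms(1)] pull_cotangent[OF assms(2)] by (auto simp: related_def gfibre_def)
  then show ?thesis by blast
qed

subsection \<open>Restriction and extension of sections\<close>

lemma smooth_field_descends:
  assumes U: "openin (stop S) U" and V: "smooth_field S U V"
    and rel: "\<And>q. q \<in> U \<inter> M \<Longrightarrow> V' q \<in> tangent R q \<and> push_tvec S q (V' q) = V q"
  shows "smooth_field R (U \<inter> M) V'"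
  unfolding smooth_field_def
proof (intro conjI ballI allI impI)
  show "V' q \<in> tangent R q" if "q \<in> U \<inter> M" for q using rel[OF that] by blast
  fix W f assume W: "openin (stop R) W \<and> W \<subseteq> U \<inter> M \<and> f \<in> sfun R W"
  show "(\<lambda>q. V' q f) \<in> sfun R W"
  proof (rule sfun_subI)
    fix p assume p: "p \<in> W"
    obtain O' g where O': "openin (stop S) O'" "p \<in> O'" "g \<in> sfun S O'" "\<And>q. q \<in> O' \<Longrightarrow> q \<in> W \<Longrightarrow> f q = g q"
      using sfun_subE[OF _ p] W by metis
    have o: "openin (stop S) (O' \<inter> U)" using O'(1) U by auto
    have "(\<lambda>q. V q g) \<in> sfun S (O' \<inter> U)"
      using smooth_fieldD(2)[OF V o _ smooth_restrict[OF O'(1,3) o]] by auto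
    moreover have "V' q f = V q g" if q: "q \<in> O' \<inter> U \<inter> W" for q
    proof -
      have qM: "q \<in> M" using q W by auto
      obtain W0 where W0: "openin (stop S) W0" "W = W0 \<inter> M" using W openin_sub by blast
      have "V' q f = push_tvec S q (V' q) g"
        by (rule push_deriv[of _ _ _ "O' \<inter> W0"])
           (use rel[of q] q qM W0 O' germsI[OF O'(1) _ O'(3)] in auto)
      then show ?thesis using rel[of q] q qM by simp
    qed
    ultimately show "\<exists>V'' g. openin (stop S) V'' \<and> p \<in> V'' \<and> g \<in> sfun S V'' \<and> (\<forall>q\<in>V'' \<inter> W. V' q f = g q)"
      using o p O'(2) W by (intro exI[of _ "O' \<inter> U"] exI[of _ "\<lambda>q. V q g"]) auto
  qed
qed

text \<open>The tangential fields of an adapted frame descend to \<open>M\<close>, and they form a frame there since the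
  normal coordinates are annihilated by every tangent vector of \<open>M\<close>.\<close>

lemma submanifold_frame:
  assumes "p \<in> M"
  obtains U N T x e e' where "p \<in> U" "coord_frame S U (N::'i set) x e" "T \<subseteq> N"
    "\<And>i q. i \<in> N - T \<Longrightarrow> q \<in> U \<inter> M \<Longrightarrow> x i q = 0"
    "coord_frame R (U \<inter> M) T x e'"
    "\<And>i q. i \<in> T \<Longrightarrow> q \<in> U \<inter> M \<Longrightarrow> push_tvec S q (e' i q) = e i q"
proof -
  obtain U N T x e where fr: "p \<in> U" "coord_frame S U (N::'i set) x e" "T \<subseteq> N"
    "\<And>i q. i \<in> N - T \<Longrightarrow> q \<in> U \<inter> M \<Longrightarrow> x i q = 0"
    "\<And>i q f. i \<in> T \<Longrightarrow> q \<in> U \<inter> M \<Longrightarrow> f \<in> germs S q \<Longrightarrow> vanishes_near S M q f \<Longrightarrow> e i q f = 0"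
    using assms by (rule adapted_frameE) blast
  note F = coord_frameD[OF fr(2)]
  define e' where "e' i q = (SOME v. v \<in> tangent R q \<and> push_tvec S q v = e i q)" for i q
  have e': "e' i q \<in> tangent R q \<and> push_tvec S q (e' i q) = e i q" if "i \<in> T" "q \<in> U \<inter> M" for i q
  proof -
    have "\<exists>v. v \<in> tangent R q \<and> push_tvec S q v = e i q"
      using tangent_descends[of "e i q" q] F(8)[of q i] fr(3,5) that by blast
    then show ?thesis unfolding e'_def by (rule someI_ex)
  qed
  have "coord_frame R (U \<inter> M) T x e'"
    unfolding coord_frame_def
  proof (intro conjI ballI impI)
    show "openin (stop R) (U \<inter> M)" using openin_subI[OF F(1)] .
    show "finite T" using F(2) fr(3) finite_subset by blast
    show "x i \<in> sfun R (U \<inter> M)" if "i \<in> T" for i using sfun_sub_restrict[OF F(1,3)] that fr(3) by blast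
    show "smooth_field R (U \<inter> M) (e' i)" if "i \<in> T" for i
      using smooth_field_descends[OF F(1) F(4) e'[OF that]] that fr(3) by blast
    show "e' i q (x j) = (if i = j then 1 else 0)" if "q \<in> U \<inter> M" "i \<in> T" "j \<in> T" for i j q
    proof -
      have "e' i q (x j) = push_tvec S q (e' i q) (x j)"
        by (rule push_apply[symmetric]) (use F(7) that fr(3) in blast)
      also have "\<dots> = e i q (x j)" using e' that by simp
      also have "\<dots> = (if i = j then 1 else 0)" using F(5) that fr(3) by blast
      finally show ?thesis .
    qed
    show "v = 0" if q: "q \<in> U \<inter> M" and v: "v \<in> tangent R q" and z: "\<forall>i\<in>T. v (x i) = 0" for q v
    proof -
      have qM: "q \<in> M" and qU: "q \<in> U" using q by auto
      have "push_tvec S q v = 0"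
      proof (rule F(6)[OF qU push_tangent[OF v qM]])
        fix i assume i: "i \<in> N"
        show "push_tvec S q v (x i) = 0"
        proof (cases "i \<in> T")
          case True then show ?thesis using z push_apply[OF F(7)[OF qU i]] by simp
        next
          case False
          have "vanishes_near S M q (x i)"
            unfolding vanishes_near_def using F(1) qU fr(4)[of i] i False by (intro exI[of _ U]) auto
          then show ?thesis using push_vanishing[OF v qM F(7)[OF qU i]] by simp
        qed
      qed
      then show ?thesis using push_inj[OF v R.tangent_closed(1)] by simp
    qed
  qed
  then show ?thesis using that[OF fr(1-4)] e' by blast
qed

lemma extend_functions:
  assumes "finite T" "\<And>i. i \<in> T \<Longrightarrow> f i \<in> sfun R W" "p \<in> W" "openin (stop S) U" "p \<in> U"
  shows "\<exists>V g. openin (stop S) V \<and> p \<in> V \<and> V \<subseteq> U \<and> (\<forall>i\<in>T. g i \<in> sfun S V \<and> (\<forall>q\<in>V \<inter> W. f i q = g i q))"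
  using assms(1,2)
proof induction
  case empty
  then show ?case using assms(4,5) by blast
next
  case (insert i T)
  then obtain V g where V: "openin (stop S) V" "p \<in> V" "V \<subseteq> U"
    "\<And>i. i \<in> T \<Longrightarrow> g i \<in> sfun S V \<and> (\<forall>q\<in>V \<inter> W. f i q = g i q)"
    by (metis insertCI)
  obtain V2 h where V2: "openin (stop S) V2" "p \<in> V2" "h \<in> sfun S V2" "\<And>q. q \<in> V2 \<Longrightarrow> q \<in> W \<Longrightarrow> f i q = h q"
    using sfun_subE[OF _ assms(3), of "f i"] insert.prems by blast
  have o: "openin (stop S) (V \<inter> V2)" using V V2 by auto
  show ?case
  proof (intro exI conjI ballI)
    fix j assume "j \<in> insert i T"
    then show "(g(i := h)) j \<in> sfun S (V \<inter> V2)"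
      using smooth_restrict[OF V(1) _ o, of "g j"] smooth_restrict[OF V2(1,3) o] V(4)[of j] insert.hyps by auto
    show "f j q = (g(i := h)) j q" if "q \<in> V \<inter> V2 \<inter> W" for q
      using that V(4)[of j] V2(4)[of q] \<open>j \<in> insert i T\<close> by auto
  qed (use o V V2 in auto)
qed

text \<open>In an adapted frame a field on \<open>M\<close> is \<open>\<Sum> V(x\<^sub>i) e\<^sub>i\<close> over the tangential indices; its coefficients extend
  locally by the definition of smooth functions on \<open>M\<close>. Dually, a covector field is \<open>\<Sum> \<theta>(e\<^sub>i) dx\<^sub>i\<close>.\<close>

lemma extend_field:
  assumes W: "openin (stop R) W" "p \<in> W" and V: "smooth_field R W V"
  shows "\<exists>O' V'. openin (stop S) O' \<and> p \<in> O' \<and> O' \<inter> M \<subseteq> W \<and> smooth_field S O' V' \<and>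
     (\<forall>q\<in>O' \<inter> M. push_tvec S q (V q) = V' q)"
proof -
  obtain W0 where W0: "openin (stop S) W0" "W = W0 \<inter> M" using W openin_sub by blast
  have pM: "p \<in> M" using W W0 by auto
  obtain U N T x e e' where fr: "p \<in> U" "coord_frame S U (N::'i set) x e" "T \<subseteq> N"
    "\<And>i q. i \<in> N - T \<Longrightarrow> q \<in> U \<inter> M \<Longrightarrow> x i q = 0" "coord_frame R (U \<inter> M) T x e'"
    "\<And>i q. i \<in> T \<Longrightarrow> q \<in> U \<inter> M \<Longrightarrow> push_tvec S q (e' i q) = e i q"
    using pM by (rule submanifold_frame) blast
  note F = coord_frameD[OF fr(2)] and F' = R.coord_frameD[OF fr(5)]
  have o: "openin (stop R) (W \<inter> (U \<inter> M))" using W(1) F'(1) by auto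
  have f: "(\<lambda>q. V q (x i)) \<in> sfun R (W \<inter> (U \<inter> M))" if "i \<in> T" for i
    by (rule R.smooth_fieldD(2)[OF V o _ R.smooth_restrict[OF F'(1) F'(3)[OF that] o]]) auto
  obtain O' g where O': "openin (stop S) O'" "p \<in> O'" "O' \<subseteq> U \<inter> W0"
    "\<And>i. i \<in> T \<Longrightarrow> g i \<in> sfun S O'" "\<And>i q. i \<in> T \<Longrightarrow> q \<in> O' \<inter> (W \<inter> (U \<inter> M)) \<Longrightarrow> V q (x i) = g i q"
    using extend_functions[where f = "\<lambda>i q. V q (x i)" and U = "U \<inter> W0" and T = T and p = p and W = "W \<inter> (U \<inter> M)"]
      F'(2) f W pM fr(1) F(1) W0 by (auto; blast)
  let ?V = "\<lambda>q. \<Sum>i\<in>T. fscale (g i q) (e i q)"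
  have "smooth_field S O' ?V"
    by (intro smooth_field_sum smooth_field_scale O'(1,4) smooth_field_restrict[OF F(4)]) (use fr(3) O'(3) in auto)
  moreover have "push_tvec S q (V q) = ?V q" if q: "q \<in> O' \<inter> M" for q
  proof -
    have qW: "q \<in> W" and qU: "q \<in> U" and qM: "q \<in> M" using q O'(3) W0(2) by auto
    have "V q = (\<Sum>i\<in>T. fscale (V q (x i)) (e' i q))"
      by (rule R.coord_frame_expand[OF fr(5)]) (use qU qM R.smooth_fieldD(1)[OF V qW] in auto)
    also have "\<dots> = (\<Sum>i\<in>T. fscale (g i q) (e' i q))"
      by (rule sum.cong) (use O'(5) q qW qU in auto)
    finally have "push_tvec S q (V q) = push_tvec S q (\<Sum>i\<in>T. fscale (g i q) (e' i q))" by simp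
    also have "\<dots> = (\<Sum>i\<in>T. push_tvec S q (fscale (g i q) (e' i q)))" by (rule push_sum)
    also have "\<dots> = ?V q" using fr(6) qU qM by simp
    finally show ?thesis .
  qed
  moreover have "O' \<inter> M \<subseteq> W" using O'(3) W0 by auto
  ultimately show ?thesis using O' by (intro exI[of _ O'] exI[of _ ?V]) auto
qed

lemma smooth_cofield_descends:
  assumes U: "openin (stop S) U" and \<theta>: "smooth_cofield S U \<theta>"
    and rel: "\<And>q. q \<in> U \<inter> M \<Longrightarrow> \<theta>' q = pull_covec S M q (\<theta> q)"
  shows "smooth_cofield R (U \<inter> M) \<theta>'"
  unfolding smooth_cofield_def
proof (intro conjI ballI allI impI)
  show "\<theta>' q \<in> cotangent R q" if "q \<in> U \<inter> M" for q
    using rel[OF that] pull_cotangent smooth_cofieldD(1)[OF \<theta>] that by auto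
  fix W X assume W: "openin (stop R) W \<and> W \<subseteq> U \<inter> M \<and> smooth_field R W X"
  show "(\<lambda>q. \<theta>' q (X q)) \<in> sfun R W"
  proof (rule sfun_subI)
    fix p assume p: "p \<in> W"
    obtain O' X' where O': "openin (stop S) O'" "p \<in> O'" "O' \<inter> M \<subseteq> W" "smooth_field S O' X'"
       "\<And>q. q \<in> O' \<inter> M \<Longrightarrow> push_tvec S q (X q) = X' q"
      using extend_field[of W p X] W p by blast
    have o: "openin (stop S) (O' \<inter> U)" using O'(1) U by auto
    have "(\<lambda>q. \<theta> q (X' q)) \<in> sfun S (O' \<inter> U)"
      by (rule smooth_cofieldD(2)[OF \<theta> o _ smooth_field_restrict[OF O'(4)]]) auto
    moreover have "\<theta>' q (X q) = \<theta> q (X' q)" if "q \<in> O' \<inter> U \<inter> W" for q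
    proof -
      have "q \<in> M" and "X q \<in> tangent R q" using that W R.smooth_fieldD(1) by auto
      then show ?thesis using rel[of q] O'(5)[of q] that by (simp add: pull_apply)
    qed
    ultimately show "\<exists>V g. openin (stop S) V \<and> p \<in> V \<and> g \<in> sfun S V \<and> (\<forall>q\<in>V \<inter> W. \<theta>' q (X q) = g q)"
      using o p O'(2) W by (intro exI[of _ "O' \<inter> U"] exI[of _ "\<lambda>q. \<theta> q (X' q)"]) auto
  qed
qed

lemma extend_cofield:
  assumes W: "openin (stop R) W" "p \<in> W" and \<theta>: "smooth_cofield R W \<theta>"
  shows "\<exists>O' \<theta>'. openin (stop S) O' \<and> p \<in> O' \<and> O' \<inter> M \<subseteq> W \<and> smooth_cofield S O' \<theta>' \<and>
     (\<forall>q\<in>O' \<inter> M. \<theta> q = pull_covec S M q (\<theta>' q))"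
proof -
  obtain W0 where W0: "openin (stop S) W0" "W = W0 \<inter> M" using W openin_sub by blast
  have pM: "p \<in> M" using W W0 by auto
  obtain U N T x e e' where fr: "p \<in> U" "coord_frame S U (N::'i set) x e" "T \<subseteq> N"
    "\<And>i q. i \<in> N - T \<Longrightarrow> q \<in> U \<inter> M \<Longrightarrow> x i q = 0" "coord_frame R (U \<inter> M) T x e'"
    "\<And>i q. i \<in> T \<Longrightarrow> q \<in> U \<inter> M \<Longrightarrow> push_tvec S q (e' i q) = e i q"
    using pM by (rule submanifold_frame) blast
  note F = coord_frameD[OF fr(2)] and F' = R.coord_frameD[OF fr(5)]
  have o: "openin (stop R) (W \<inter> (U \<inter> M))" using W(1) F'(1) by auto
  have f: "(\<lambda>q. \<theta> q (e' i q)) \<in> sfun R (W \<inter> (U \<inter> M))" if "i \<in> T" for i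
    by (rule R.smooth_cofieldD(2)[OF \<theta> o _ R.smooth_field_restrict[OF F'(4)[OF that]]]) auto
  obtain O' g where O': "openin (stop S) O'" "p \<in> O'" "O' \<subseteq> U \<inter> W0"
    "\<And>i. i \<in> T \<Longrightarrow> g i \<in> sfun S O'" "\<And>i q. i \<in> T \<Longrightarrow> q \<in> O' \<inter> (W \<inter> (U \<inter> M)) \<Longrightarrow> \<theta> q (e' i q) = g i q"
    using extend_functions[where f = "\<lambda>i q. \<theta> q (e' i q)" and U = "U \<inter> W0" and T = T and p = p and W = "W \<inter> (U \<inter> M)"]
      F'(2) f W pM fr(1) F(1) W0 by (auto; blast)
  let ?V = "\<lambda>q. \<Sum>i\<in>T. fscale (g i q) (differential S q (x i))"
  have "smooth_cofield S O' ?V"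
    by (intro smooth_cofield_sum smooth_cofield_scale O'(1,4)
          smooth_cofield_restrict[OF smooth_cofield_differential[OF F(1,3)]]) (use fr(3) O'(3) in auto)
  moreover have "\<theta> q = pull_covec S M q (?V q)" if q: "q \<in> O' \<inter> M" for q
  proof (rule R.cotangent_eqI)
    have qW: "q \<in> W" and qU: "q \<in> U" and qM: "q \<in> M" using q O'(3) W0(2) by auto
    show "\<theta> q \<in> cotangent R q" using R.smooth_cofieldD(1)[OF \<theta> qW] .
    show "pull_covec S M q (?V q) \<in> cotangent R q"
      by (intro pull_cotangent qM cotangent_closed differential_cotangent)
    fix v assume v: "v \<in> tangent R q"
    have "\<theta> q = (\<Sum>i\<in>T. fscale (\<theta> q (e' i q)) (differential R q (x i)))"
      by (rule R.coord_frame_expand_cotangent[OF fr(5)]) (use qU qM R.smooth_cofieldD(1)[OF \<theta> qW] in auto)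
    from fun_cong[OF this, of v] have "\<theta> q v = (\<Sum>i\<in>T. \<theta> q (e' i q) * v (x i))"
      using v by (simp add: sum_fun_apply differential_def)
    also have "\<dots> = (\<Sum>i\<in>T. g i q * push_tvec S q v (x i))"
      by (rule sum.cong) (use O'(5) q qW qU push_apply[OF F(7)[OF qU]] fr(3) in auto)
    also have "\<dots> = pull_covec S M q (?V q) v"
      using push_tangent[OF v qM] by (simp add: pull_apply[OF v] sum_fun_apply differential_def)
    finally show "\<theta> q v = pull_covec S M q (?V q) v" .
  qed
  moreover have "O' \<inter> M \<subseteq> W" using O'(3) W0 by auto
  ultimately show ?thesis using O' by (intro exI[of _ O'] exI[of _ ?V]) auto
qed

lemma smooth_gsection_descends:
  assumes "openin (stop S) U" "smooth_gsection S U E" "\<And>q. q \<in> U \<inter> M \<Longrightarrow> related q (E' q) (E q)"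
  shows "smooth_gsection R (U \<inter> M) E'"
  unfolding smooth_gsection_def
proof
  show "smooth_field R (U \<inter> M) (\<lambda>q. fst (E' q))"
    by (rule smooth_field_descends[OF assms(1), of "\<lambda>q. fst (E q)"])
       (use assms in \<open>auto simp: smooth_gsection_def related_def R.gfibreD\<close>)
  show "smooth_cofield R (U \<inter> M) (\<lambda>q. snd (E' q))"
    by (rule smooth_cofield_descends[OF assms(1), of "\<lambda>q. snd (E q)"])
       (use assms in \<open>auto simp: smooth_gsection_def related_def\<close>)
qed

lemma extend_gsection:
  assumes W: "openin (stop R) W" "p \<in> W" and E: "smooth_gsection R W E'"
  shows "\<exists>O' E. openin (stop S) O' \<and> p \<in> O' \<and> O' \<inter> M \<subseteq> W \<and> smooth_gsection S O' E \<and>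
     (\<forall>q\<in>O' \<inter> M. related q (E' q) (E q))"
proof -
  obtain O1 V where O1: "openin (stop S) O1" "p \<in> O1" "O1 \<inter> M \<subseteq> W" "smooth_field S O1 V"
     "\<forall>q\<in>O1 \<inter> M. push_tvec S q (fst (E' q)) = V q"
    using extend_field[OF W] E unfolding smooth_gsection_def by blast
  obtain O2 \<theta> where O2: "openin (stop S) O2" "p \<in> O2" "O2 \<inter> M \<subseteq> W" "smooth_cofield S O2 \<theta>"
     "\<forall>q\<in>O2 \<inter> M. snd (E' q) = pull_covec S M q (\<theta> q)"
    using extend_cofield[OF W] E unfolding smooth_gsection_def by blast
  have 1: "smooth_gsection S (O1 \<inter> O2) (\<lambda>q. (V q, \<theta> q))"
    using smooth_field_restrict[OF O1(4), of "O1 \<inter> O2"] smooth_cofield_restrict[OF O2(4), of "O1 \<inter> O2"]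
    by (simp add: smooth_gsection_def)
  have "related q (E' q) (V q, \<theta> q)" if "q \<in> O1 \<inter> O2 \<inter> M" for q
    using smooth_gsectionD[OF 1, of q] that R.smooth_gsectionD[OF E, of q] O1(3,5) O2(5)
    by (auto simp: related_def)
  then show ?thesis using O1(1-3) O2(1,2) 1
    by (intro exI[of _ "O1 \<inter> O2"] exI[of _ "\<lambda>q. (V q, \<theta> q)"]) auto
qed

subsection \<open>Naturality of the brackets\<close>

lemma lie_bracket_push:
  assumes U: "openin (stop S) U" "p \<in> U" and p: "p \<in> M"
    and V: "smooth_field S U V" "\<And>q. q \<in> U \<inter> M \<Longrightarrow> V' q \<in> tangent R q \<and> push_tvec S q (V' q) = V q"
    and W: "smooth_field S U W" "\<And>q. q \<in> U \<inter> M \<Longrightarrow> W' q \<in> tangent R q \<and> push_tvec S q (W' q) = W q"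
  shows "push_tvec S p (lie_bracket R V' W' p) = lie_bracket S V W p"
proof
  fix f
  show "push_tvec S p (lie_bracket R V' W' p) f = lie_bracket S V W p f"
  proof (cases "f \<in> germs S p")
    case True
    then obtain O' where O': "openin (stop S) O'" "p \<in> O'" "f \<in> sfun S O'" by (rule germsE)
    have o: "openin (stop S) (O' \<inter> U)" using O'(1) U(1) by auto
    have *: "X' p (\<lambda>q. Y' q f) = X p (\<lambda>q. Y q f)"
      if X: "\<And>q. q \<in> U \<inter> M \<Longrightarrow> X' q \<in> tangent R q \<and> push_tvec S q (X' q) = X q"
        and Y: "smooth_field S U Y" "\<And>q. q \<in> U \<inter> M \<Longrightarrow> Y' q \<in> tangent R q \<and> push_tvec S q (Y' q) = Y q" for X X' Y Y'
    proof -
      have "(\<lambda>q. Y q f) \<in> sfun S (O' \<inter> U)"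
        using smooth_fieldD(2)[OF Y(1) o _ smooth_restrict[OF O'(1,3) o]] by auto
      then have g: "(\<lambda>q. Y q f) \<in> germs S p" using germsI[OF o] O'(2) U(2) by auto
      have "X' p (\<lambda>q. Y' q f) = push_tvec S p (X' p) (\<lambda>q. Y q f)"
      proof (rule push_deriv[OF _ p g o])
        show "X' p \<in> tangent R p" using X U(2) p by blast
        show "Y' q f = Y q f" if "q \<in> O' \<inter> U \<inter> M" for q
          using Y(2)[of q] that push_apply[OF germsI[OF O'(1) _ O'(3)], of q "Y' q"] by auto
      qed (use O'(2) U(2) in auto)
      then show ?thesis using X[of p] U(2) p by simp
    qed
    show ?thesis
      using *[OF V(2) W] *[OF W(2) V] True germs_sub[OF p True] by (simp add: push_apply lie_bracket_def)
  qed (simp add: push_tvec_def lie_bracket_def)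
qed

lemma field_pairing_push:
  assumes U: "openin (stop S) U" "p \<in> U" and p: "p \<in> M"
    and X: "X' p \<in> tangent R p" "push_tvec S p (X' p) = X p"
    and g: "g \<in> sfun S U" "\<And>q. q \<in> U \<inter> M \<Longrightarrow> h q = g q"
  shows "X' p h = X p g"
  using push_deriv[OF X(1) p germsI[OF U g(1)] U g(2)] X(2) by simp

text \<open>The vector part is naturality of the Lie bracket. For the 1-form part, both brackets are evaluated on
  a test field of \<open>M\<close> and an extension of it; \<open>courant_snd\<close> allows this although the definition of
  \<open>courant\<close> picks unrelated test fields on the two spaces.\<close>

lemma courant_related:
  assumes U: "openin (stop S) U" "p \<in> U" and p: "p \<in> M"
    and E: "smooth_gsection S U E" "\<And>q. q \<in> U \<inter> M \<Longrightarrow> related q (E' q) (E q)"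
    and F: "smooth_gsection S U F" "\<And>q. q \<in> U \<inter> M \<Longrightarrow> related q (F' q) (F q)"
    and C: "courant S E F p \<in> gfibre S p"
  shows "related p (courant R E' F' p) (courant S E F p)"
proof -
  have relV: "fst (H' q) \<in> tangent R q \<and> push_tvec S q (fst (H' q)) = fst (H q)"
    if "\<And>q. q \<in> U \<inter> M \<Longrightarrow> related q (H' q) (H q)" "q \<in> U \<inter> M" for H H' q
    using that(1)[OF that(2)] by (auto simp: related_def R.gfibreD)
  have sE': "smooth_gsection R (U \<inter> M) E'" and sF': "smooth_gsection R (U \<inter> M) F'"
    using smooth_gsection_descends[OF U(1)] E F by blast+
  note fE = E(1)[unfolded smooth_gsection_def, THEN conjunct1] and fF = F(1)[unfolded smooth_gsection_def, THEN conjunct1]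
  have lb: "push_tvec S p (lie_bracket R (\<lambda>q. fst (E' q)) (\<lambda>q. fst (F' q)) p) = fst (courant S E F p)"
    unfolding courant_def Let_def fst_conv
    by (rule lie_bracket_push[OF U p fE relV[OF E(2)] fF relV[OF F(2)]])
  have lbT: "lie_bracket R (\<lambda>q. fst (E' q)) (\<lambda>q. fst (F' q)) p \<in> tangent R p"
    by (rule R.lie_bracket_tangent[OF openin_subI[OF U(1)]]) (use U(2) p sE' sF' in \<open>auto simp: smooth_gsection_def\<close>)
  obtain U1 N T x e e' where fr: "p \<in> U1" "coord_frame S U1 (N::'i set) x e"
     "coord_frame R (U1 \<inter> M) T x e'"
    using p by (rule submanifold_frame) blast
  have "snd (courant R E' F' p) = pull_covec S M p (snd (courant S E F p))"
  proof
    fix w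
    show "snd (courant R E' F' p) w = pull_covec S M p (snd (courant S E F p)) w"
    proof (cases "w \<in> tangent R p")
      case True
      obtain W' where W': "smooth_field R (U1 \<inter> M) W'" "W' p = w"
        using R.field_through_vector[OF fr(3) _ True] fr(1) p by blast
      obtain O' W where O': "openin (stop S) O'" "p \<in> O'" "O' \<inter> M \<subseteq> U1 \<inter> M" "smooth_field S O' W"
        "\<And>q. q \<in> O' \<inter> M \<Longrightarrow> push_tvec S q (W' q) = W q"
        using extend_field[OF R.coord_frameD(1)[OF fr(3)] _ W'(1), of p] fr(1) p by blast
      define D where "D = O' \<inter> U"
      have D: "openin (stop S) D" "p \<in> D" "D \<subseteq> O'" "D \<subseteq> U" using O' U by (auto simp: D_def)
      have DM: "D \<inter> M \<subseteq> U \<inter> M" and pU1: "p \<in> U1 \<inter> M" using D(4) fr(1) p by auto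
      have oD: "openin (stop R) (D \<inter> M)" "p \<in> D \<inter> M" using openin_subI[OF D(1)] D(2) p by auto
      have relW: "W' q \<in> tangent R q \<and> push_tvec S q (W' q) = W q" if "q \<in> D \<inter> M" for q
        using that D(3) O'(3,5) R.smooth_fieldD(1)[OF W'(1), of q] by auto
      note sW = smooth_field_restrict[OF O'(4) D(3)]
      have sW': "smooth_field R (D \<inter> M) W'" using smooth_field_descends[OF D(1) sW relW] .
      have Wp: "W p = push_tvec S p w" using O'(5)[of p] O'(2) p W'(2) by simp
      have L: "lie_derivative_one_form R (\<lambda>q. fst (H' q)) (\<lambda>q. snd (K' q)) W' p =
          lie_derivative_one_form S (\<lambda>q. fst (H q)) (\<lambda>q. snd (K q)) W p"
        if H: "smooth_gsection S U H" "\<And>q. q \<in> U \<inter> M \<Longrightarrow> related q (H' q) (H q)"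
          and K: "smooth_gsection S U K" "\<And>q. q \<in> U \<inter> M \<Longrightarrow> related q (K' q) (K q)" for H H' K K'
      proof -
        have sK: "smooth_cofield S D (\<lambda>q. snd (K q))"
          using smooth_gsection_restrict[OF K(1) D(4)] by (simp add: smooth_gsection_def)
        have sH: "smooth_field S D (\<lambda>q. fst (H q))"
          using smooth_gsection_restrict[OF H(1) D(4)] by (simp add: smooth_gsection_def)
        have rH: "fst (H' q) \<in> tangent R q \<and> push_tvec S q (fst (H' q)) = fst (H q)" if "q \<in> D \<inter> M" for q
          using relV[OF H(2)] that D(4) by blast
        have 1: "fst (H' p) (\<lambda>q. snd (K' q) (W' q)) = fst (H p) (\<lambda>q. snd (K q) (W q))"
        proof (rule field_pairing_push[OF D(1,2) p, where X = "\<lambda>q. fst (H q)" and X' = "\<lambda>q. fst (H' q)"])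
          show "(\<lambda>q. snd (K q) (W q)) \<in> sfun S D" using smooth_cofieldD(2)[OF sK D(1) order_refl sW] .
          show "snd (K' q) (W' q) = snd (K q) (W q)" if "q \<in> D \<inter> M" for q
            using K(2)[of q] relW[OF that] that D(4) by (auto simp: related_def pull_apply)
        qed (use rH[of p] D(2) p in auto)
        have lbp: "push_tvec S p (lie_bracket R (\<lambda>q. fst (H' q)) W' p) = lie_bracket S (\<lambda>q. fst (H q)) W p"
          by (rule lie_bracket_push[OF D(1,2) p sH rH sW relW])
        have lbt: "lie_bracket R (\<lambda>q. fst (H' q)) W' p \<in> tangent R p"
          by (rule R.lie_bracket_tangent[OF oD smooth_field_descends[OF D(1) sH rH] sW'])
        have "snd (K' p) (lie_bracket R (\<lambda>q. fst (H' q)) W' p) = snd (K p) (lie_bracket S (\<lambda>q. fst (H q)) W p)"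
          using K(2)[of p] U(2) p lbp lbt by (auto simp: related_def pull_apply)
        then show ?thesis using 1 by (simp add: lie_derivative_one_form_def)
      qed
      have P: "W' p (\<lambda>q. snd (H' q) (fst (K' q))) = W p (\<lambda>q. snd (H q) (fst (K q)))"
        if H: "smooth_gsection S U H" "\<And>q. q \<in> U \<inter> M \<Longrightarrow> related q (H' q) (H q)"
          and K: "smooth_gsection S U K" "\<And>q. q \<in> U \<inter> M \<Longrightarrow> related q (K' q) (K q)" for H H' K K'
      proof (rule field_pairing_push[OF D(1,2) p, where X = W and X' = W'])
        have "smooth_cofield S D (\<lambda>q. snd (H q))" "smooth_field S D (\<lambda>q. fst (K q))"
          using smooth_gsection_restrict[OF H(1) D(4)] smooth_gsection_restrict[OF K(1) D(4)]
          by (simp_all add: smooth_gsection_def)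
        then show "(\<lambda>q. snd (H q) (fst (K q))) \<in> sfun S D" using smooth_cofieldD(2) D(1) by blast
        show "snd (H' q) (fst (K' q)) = snd (H q) (fst (K q))" if "q \<in> D \<inter> M" for q
          using H(2)[of q] K(2)[of q] that D(4) by (auto simp: related_def pull_apply R.gfibreD)
      qed (use relW[of p] D(2) p in auto)
      have "R.courant_test E' F' W' p = courant_test E F W p"
        unfolding R.courant_test_def courant_test_def
        using L[OF E F] L[OF F E] P[OF E F] P[OF F E] by simp
      moreover have "snd (courant R E' F' p) (W' p) = R.courant_test E' F' W' p / 2"
        by (rule R.courant_snd[OF fr(3) pU1 oD R.smooth_gsection_restrict[OF sE' DM] R.smooth_gsection_restrict[OF sF' DM] sW'])
      moreover have "snd (courant S E F p) (W p) = courant_test E F W p / 2"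
        by (rule courant_snd[OF fr(2,1) D(1,2) smooth_gsection_restrict[OF E(1) D(4)] smooth_gsection_restrict[OF F(1) D(4)] sW])
      ultimately have "snd (courant R E' F' p) (W' p) = snd (courant S E F p) (W p)" by metis
      then show ?thesis using W'(2) Wp True by (simp add: pull_apply)
    qed (simp add: courant_def Let_def pull_covec_def)
  qed
  moreover have "fst (courant R E' F' p) = lie_bracket R (\<lambda>q. fst (E' q)) (\<lambda>q. fst (F' q)) p"
    by (simp add: courant_def Let_def)
  ultimately show ?thesis
    using lb lbT C pull_cotangent[OF p gfibreD(2)[OF C]] by (auto simp: related_def gfibre_def mem_Times_iff)
qed

subsection \<open>Pull-back of forms\<close>

lemma extend_fields:
  assumes U: "openin (stop R) U" "p \<in> U" and Vs: "\<And>V. V \<in> set Vs \<Longrightarrow> smooth_field R U V"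
  shows "\<exists>O' ex. openin (stop S) O' \<and> p \<in> O' \<and> O' \<inter> M \<subseteq> U \<and>
    (\<forall>V\<in>set Vs. smooth_field S O' (ex V) \<and> (\<forall>q\<in>O' \<inter> M. push_tvec S q (V q) = ex V q))"
  using Vs
proof (induction Vs)
  case Nil
  obtain U0 where "openin (stop S) U0" "U = U0 \<inter> M" using U(1) openin_sub by blast
  then show ?case using U(2) by (intro exI[of _ U0]) auto
next
  case (Cons V Vs)
  then obtain O1 ex where O1: "openin (stop S) O1" "p \<in> O1" "O1 \<inter> M \<subseteq> U"
    "\<And>V. V \<in> set Vs \<Longrightarrow> smooth_field S O1 (ex V) \<and> (\<forall>q\<in>O1 \<inter> M. push_tvec S q (V q) = ex V q)"
    by (metis list.set_intros(2))
  obtain O2 V' where O2: "openin (stop S) O2" "p \<in> O2" "O2 \<inter> M \<subseteq> U" "smooth_field S O2 V'"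
     "\<And>q. q \<in> O2 \<inter> M \<Longrightarrow> push_tvec S q (V q) = V' q"
    using extend_field[OF U, of V] Cons.prems by (meson list.set_intros(1))
  have "smooth_field S (O1 \<inter> O2) ((ex(V := V')) X) \<and>
      (\<forall>q\<in>O1 \<inter> O2 \<inter> M. push_tvec S q (X q) = (ex(V := V')) X q)" if "X \<in> set (V # Vs)" for X
    using O1(4)[of X] O2(4,5) that smooth_field_restrict[of O1 "ex X" "O1 \<inter> O2"]
      smooth_field_restrict[of O2 V' "O1 \<inter> O2"] by (cases "X = V") simp_all
  then show ?case using O1(1-3) O2(1,2)
    by (intro exI[of _ "O1 \<inter> O2"] exI[of _ "ex(V := V')"]) auto
qed

lemma map_push:
  assumes "\<forall>V\<in>set Vs. smooth_field S O' (ex V) \<and> (\<forall>q\<in>O' \<inter> M. push_tvec S q (V q) = ex V q)" "q \<in> O' \<inter> M"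
  shows "map (push_tvec S q) (map (\<lambda>V. V q) Vs) = map (\<lambda>V. V q) (map ex Vs)"
  using assms by (auto simp: o_def)

lemma smooth_form_pull:
  assumes \<psi>: "smooth_form S (topspace (stop S)) \<psi>"
  shows "smooth_form R (topspace (stop R)) (pull_form S \<psi>)"
  unfolding smooth_form_def
proof (intro conjI ballI allI impI)
  fix q xs ys assume q: "q \<in> topspace (stop R)" and l: "set xs \<subseteq> tangent R q \<and> set ys \<subseteq> tangent R q"
  have qS: "q \<in> topspace (stop S)" and qM: "q \<in> M" using q M_subset by auto
  let ?p = "push_tvec S q"
  have l': "set (map ?p xs) \<subseteq> tangent S q \<and> set (map ?p ys) \<subseteq> tangent S q"
    using l push_tangent[OF _ qM] by auto
  note m = \<psi>[unfolded smooth_form_def, THEN conjunct1, rule_format, OF qS l']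
  show "pull_form S \<psi> q (xs @ (v + w) # ys) = pull_form S \<psi> q (xs @ v # ys) + pull_form S \<psi> q (xs @ w # ys)"
    if "v \<in> tangent R q" "w \<in> tangent R q" for v w
    using m push_tangent[OF that(1) qM] push_tangent[OF that(2) qM] by (simp add: pull_form_def)
  show "pull_form S \<psi> q (xs @ fscale c v # ys) = c * pull_form S \<psi> q (xs @ v # ys)" if "v \<in> tangent R q" for v c
    using m push_tangent[OF that(1) qM] by (simp add: pull_form_def)
  show "pull_form S \<psi> q xs = 0" if "\<not> distinct xs"
    using m that by (auto simp: pull_form_def distinct_map)
next
  fix W Vs assume W: "openin (stop R) W \<and> W \<subseteq> topspace (stop R) \<and> (\<forall>V\<in>set Vs. smooth_field R W V)"
  show "(\<lambda>q. pull_form S \<psi> q (map (\<lambda>V. V q) Vs)) \<in> sfun R W"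
  proof (rule sfun_subI)
    fix p assume p: "p \<in> W"
    obtain O' ex where O': "openin (stop S) O'" "p \<in> O'" "O' \<inter> M \<subseteq> W"
      "\<forall>V\<in>set Vs. smooth_field S O' (ex V) \<and> (\<forall>q\<in>O' \<inter> M. push_tvec S q (V q) = ex V q)"
      using extend_fields[of W p Vs] W p by blast
    have "(\<lambda>q. \<psi> q (map (\<lambda>V. V q) (map ex Vs))) \<in> sfun S O'"
      using \<psi>[unfolded smooth_form_def, THEN conjunct2, rule_format, of O' "map ex Vs"] O'(1,4) openin_subset[OF O'(1)] by auto
    then show "\<exists>V g. openin (stop S) V \<and> p \<in> V \<and> g \<in> sfun S V \<and> (\<forall>q\<in>V \<inter> W. pull_form S \<psi> q (map (\<lambda>V. V q) Vs) = g q)"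
      using O'(1,2) map_push[OF O'(4)] W
      by (intro exI[of _ O'] exI[of _ "\<lambda>q. \<psi> q (map (\<lambda>V. V q) (map ex Vs))"])
         (auto simp: pull_form_def simp del: map_map)
  qed
qed

lemma del_nth_map: "del_nth i (map f xs) = map f (del_nth i xs)"
  by (simp add: del_nth_def take_map drop_map)

lemma set_del_nth: "set (del_nth i xs) \<subseteq> set xs"
  using set_take_subset[of i xs] set_drop_subset[of "Suc i" xs] by (auto simp: del_nth_def)

text \<open>Every term of the Koszul formula is natural for vector fields that extend those given on \<open>M\<close>.\<close>

lemma d_closed_pull:
  assumes \<psi>: "smooth_form S (topspace (stop S)) \<psi>" and d: "d_closed S \<psi>"
  shows "d_closed R (pull_form S \<psi>)"
  unfolding d_closed_def
proof (intro allI impI ballI)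
  fix U Vs p assume U: "openin (stop R) U \<and> (\<forall>V\<in>set Vs. smooth_field R U V)" and p: "p \<in> U"
  have pM: "p \<in> M" using U p openin_subset by force
  obtain O' ex where O': "openin (stop S) O'" "p \<in> O'" "O' \<inter> M \<subseteq> U"
    "\<forall>V\<in>set Vs. smooth_field S O' (ex V) \<and> (\<forall>q\<in>O' \<inter> M. push_tvec S q (V q) = ex V q)"
    using extend_fields[of U p Vs] U p by blast
  have rel: "V q \<in> tangent R q \<and> push_tvec S q (V q) = ex V q" if "V \<in> set Vs" "q \<in> O' \<inter> M" for V q
    using O'(3,4) that U R.smooth_fieldD(1) by blast
  have sub: "\<forall>V\<in>set Xs. smooth_field S O' (ex V) \<and> (\<forall>q\<in>O' \<inter> M. push_tvec S q (V q) = ex V q)" if "set Xs \<subseteq> set Vs" for Xs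
    using O'(4) that by blast
  have 1: "(Vs ! i) p (\<lambda>q. pull_form S \<psi> q (map (\<lambda>V. V q) (del_nth i Vs))) =
      (map ex Vs ! i) p (\<lambda>q. \<psi> q (map (\<lambda>V. V q) (del_nth i (map ex Vs))))" if i: "i < length Vs" for i
  proof -
    note s = sub[OF set_del_nth[of i Vs]]
    have "(\<lambda>q. \<psi> q (map (\<lambda>V. V q) (map ex (del_nth i Vs)))) \<in> sfun S O'"
      using \<psi>[unfolded smooth_form_def, THEN conjunct2, rule_format, of O' "map ex (del_nth i Vs)"] O'(1) s openin_subset[OF O'(1)] by auto
    then have "(Vs ! i) p (\<lambda>q. pull_form S \<psi> q (map (\<lambda>V. V q) (del_nth i Vs))) =
      (ex (Vs ! i)) p (\<lambda>q. \<psi> q (map (\<lambda>V. V q) (map ex (del_nth i Vs))))"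
    proof (rule field_pairing_push[OF O'(1,2) pM, where X = "ex (Vs ! i)" and X' = "Vs ! i", rotated 2])
      show "(Vs ! i) p \<in> tangent R p" "push_tvec S p ((Vs ! i) p) = ex (Vs ! i) p"
        using rel[of "Vs ! i" p] i O'(2) pM by auto
      show "pull_form S \<psi> q (map (\<lambda>V. V q) (del_nth i Vs)) = \<psi> q (map (\<lambda>V. V q) (map ex (del_nth i Vs)))"
        if "q \<in> O' \<inter> M" for q
        unfolding pull_form_def map_push[OF s that] ..
    qed
    then show ?thesis using i by (simp add: del_nth_map)
  qed
  have 2: "pull_form S \<psi> p (lie_bracket R (Vs ! i) (Vs ! j) p # map (\<lambda>V. V p) (del_nth i (del_nth j Vs))) =
      \<psi> p (lie_bracket S (map ex Vs ! i) (map ex Vs ! j) p # map (\<lambda>V. V p) (del_nth i (del_nth j (map ex Vs))))"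
    if ij: "j < length Vs" "i < j" for i j
  proof -
    note s = sub[OF order_trans[OF set_del_nth set_del_nth], of i j]
    have "push_tvec S p (lie_bracket R (Vs ! i) (Vs ! j) p) = lie_bracket S (ex (Vs ! i)) (ex (Vs ! j)) p"
      by (rule lie_bracket_push[OF O'(1,2) pM]) (use rel O'(4) ij in auto)
    then show ?thesis
      using map_push[OF s, of p] O'(2) pM ij by (simp add: pull_form_def del_nth_map del: map_map)
  qed
  have "ext_d R (pull_form S \<psi>) Vs p = ext_d S \<psi> (map ex Vs) p"
    unfolding ext_d_def using 1 2 by simp
  also have "\<dots> = 0" using d[unfolded d_closed_def, rule_format, of O' "map ex Vs" p] O'(1,2,4) by auto
  finally show "ext_d R (pull_form S \<psi>) Vs p = 0" .
qed

end

section \<open>Clifford algebra on lists of tangent vectors\<close>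

definition wedge :: "'a covec \<Rightarrow> ('a tvec list \<Rightarrow> complex) \<Rightarrow> 'a tvec list \<Rightarrow> complex" where
  "wedge \<eta> \<phi> vs = (\<Sum>i<length vs. (- 1) ^ i * \<eta> (vs ! i) * \<phi> (del_nth i vs))"

lemma clifford_wedge: "clifford E \<phi> vs = \<phi> (fst E # vs) + wedge (snd E) \<phi> vs"
  by (simp add: clifford_def wedge_def)

lemma wedge_Nil [simp]: "wedge \<eta> \<phi> [] = 0"
  by (simp add: wedge_def)

text \<open>The identity \<open>i\<^sub>v (\<eta> \<and> \<phi>) + \<eta> \<and> i\<^sub>v \<phi> = \<eta>(v) \<phi>\<close>, which serves as a recursion along the argument list.\<close>

lemma wedge_Cons: "wedge \<eta> \<phi> (v # vs) = \<eta> v * \<phi> vs - wedge \<eta> (\<lambda>us. \<phi> (v # us)) vs"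
proof -
  have "wedge \<eta> \<phi> (v # vs) = (\<Sum>i<Suc (length vs). (- 1) ^ i * \<eta> ((v # vs) ! i) * \<phi> (del_nth i (v # vs)))"
    by (simp only: wedge_def list.size add_0_right add_Suc_right)
  also have "\<dots> = \<eta> v * \<phi> vs + (\<Sum>i<length vs. - ((- 1) ^ i * \<eta> (vs ! i) * \<phi> (v # del_nth i vs)))"
    unfolding sum.lessThan_Suc_shift by (simp add: del_nth_def mult_ac)
  finally show ?thesis by (simp add: wedge_def sum_negf)
qed

lemma wedge_linear: "wedge \<eta> (\<lambda>us. c * f us - g us) vs = c * wedge \<eta> f vs - wedge \<eta> g vs"
  by (simp add: wedge_def sum_distrib_left sum_subtractf[symmetric] algebra_simps)

lemma wedge_anticommute: "wedge \<eta> (wedge \<zeta> \<phi>) vs + wedge \<zeta> (wedge \<eta> \<phi>) vs = 0"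
proof (induction vs arbitrary: \<phi>)
  case (Cons v vs)
  have e: "wedge \<eta> (wedge \<zeta> \<phi>) (v # vs) =
      \<eta> v * wedge \<zeta> \<phi> vs - (\<zeta> v * wedge \<eta> \<phi> vs - wedge \<eta> (wedge \<zeta> (\<lambda>us. \<phi> (v # us))) vs)" for \<eta> \<zeta>
    by (simp add: wedge_Cons wedge_linear)
  show ?case unfolding e using Cons.IH[of "\<lambda>us. \<phi> (v # us)"] by (simp add: algebra_simps)
qed simp

text \<open>Only the term with two contractions uses that \<open>\<phi>\<close> is alternating; the other terms cancel for every
  function of lists.\<close>

lemma clifford_relation:
  assumes "\<phi> (fst F # fst E # vs) = - \<phi> (fst E # fst F # vs)"
  shows "clifford E (clifford F \<phi>) vs + clifford F (clifford E \<phi>) vs = 2 * pairing E F * \<phi> vs"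
proof -
  have w: "wedge \<eta> (\<lambda>us. f us + g us) vs = wedge \<eta> f vs + wedge \<eta> g vs" for \<eta> f g
    by (simp add: wedge_def sum.distrib[symmetric] algebra_simps)
  have e: "clifford E (clifford F \<phi>) vs = \<phi> (fst F # fst E # vs) + (snd F (fst E) * \<phi> vs - wedge (snd F) (\<lambda>us. \<phi> (fst E # us)) vs)
      + (wedge (snd E) (\<lambda>us. \<phi> (fst F # us)) vs + wedge (snd E) (wedge (snd F) \<phi>) vs)" for E F
    unfolding clifford_wedge[of E] by (simp add: clifford_wedge[abs_def] wedge_Cons w)
  have "wedge (snd F) (wedge (snd E) \<phi>) vs = - wedge (snd E) (wedge (snd F) \<phi>) vs"
    using wedge_anticommute[of "snd F" "snd E" \<phi> vs] by (simp add: eq_neg_iff_add_eq_0)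
  then show ?thesis
    unfolding e[of E F] e[of F E] assms pairing_def by (simp add: algebra_simps)
qed

lemma del_nth_append:
  "i < length xs \<Longrightarrow> del_nth i (xs @ ys) = del_nth i xs @ ys"
  "length xs \<le> i \<Longrightarrow> del_nth i (xs @ ys) = xs @ del_nth (i - length xs) ys"
  by (auto simp: del_nth_def Suc_diff_le)

lemma length_del_nth: "i < length xs \<Longrightarrow> length (del_nth i xs) = length xs - 1"
  by (simp add: del_nth_def)

context smooth_sheaf
begin

lemma smooth_formD:
  assumes "smooth_form S U \<psi>" "q \<in> U" "set xs \<subseteq> tangent S q" "set ys \<subseteq> tangent S q"
  shows "v \<in> tangent S q \<Longrightarrow> w \<in> tangent S q \<Longrightarrow> \<psi> q (xs @ (v + w) # ys) = \<psi> q (xs @ v # ys) + \<psi> q (xs @ w # ys)"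
    and "v \<in> tangent S q \<Longrightarrow> \<psi> q (xs @ fscale c v # ys) = c * \<psi> q (xs @ v # ys)"
    and "\<not> distinct xs \<Longrightarrow> \<psi> q xs = 0"
  using assms(1)[unfolded smooth_form_def, THEN conjunct1, rule_format, OF assms(2), of xs ys] assms(3,4) by auto

lemma form_swap:
  assumes "smooth_form S U \<psi>" "q \<in> U" "set xs \<subseteq> tangent S q" "set ys \<subseteq> tangent S q" "v \<in> tangent S q" "w \<in> tangent S q"
  shows "\<psi> q (xs @ v # w # ys) = - \<psi> q (xs @ w # v # ys)"
proof -
  note vw = tangent_closed(2)[OF assms(5,6)]
  have l: "\<psi> q (xs @ (v + w) # y # ys) = \<psi> q (xs @ v # y # ys) + \<psi> q (xs @ w # y # ys)"
    and r: "\<psi> q (xs @ y # (v + w) # ys) = \<psi> q (xs @ y # v # ys) + \<psi> q (xs @ y # w # ys)"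
    and z: "\<psi> q (xs @ y # y # ys) = 0" if "y \<in> tangent S q" for y
    using smooth_formD(1)[OF assms(1,2,3), of "y # ys"] smooth_formD(1)[OF assms(1,2), of "xs @ [y]" ys]
      smooth_formD(3)[OF assms(1,2), of "xs @ y # y # ys" "[]"] assms(3-6) that by auto
  have "0 = \<psi> q (xs @ (v + w) # (v + w) # ys)" using z[OF vw] by simp
  also have "\<dots> = \<psi> q (xs @ v # w # ys) + \<psi> q (xs @ w # v # ys)"
    using l[OF vw] r[OF assms(5)] r[OF assms(6)] z[OF assms(5)] z[OF assms(6)] by simp
  finally show ?thesis by (simp add: eq_neg_iff_add_eq_0)
qed

lemma form_move:
  assumes "smooth_form S U \<psi>" "q \<in> U" "v \<in> tangent S q" "set us \<subseteq> tangent S q"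
  shows "set xs \<subseteq> tangent S q \<Longrightarrow> set ws \<subseteq> tangent S q \<Longrightarrow>
    \<psi> q (xs @ v # ws @ us) = (- 1) ^ length ws * \<psi> q (xs @ ws @ v # us)"
proof (induction ws arbitrary: xs)
  case (Cons w ws)
  have "\<psi> q (xs @ v # (w # ws) @ us) = - \<psi> q ((xs @ [w]) @ v # ws @ us)"
    using form_swap[OF assms(1,2) Cons.prems(1), of "ws @ us" v w] Cons.prems(2) assms(3,4) by simp
  also have "\<dots> = - ((- 1) ^ length ws * \<psi> q ((xs @ [w]) @ ws @ v # us))"
    using Cons.IH[of "xs @ [w]"] Cons.prems by simp
  finally show ?case by simp
qed simp

lemma spinor_ker_gfibre: "E \<in> spinor_ker S \<psi> p \<Longrightarrow> E \<in> gfibre S p"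
  by (simp add: spinor_ker_def)

lemma spinor_ker_subspace:
  assumes "smooth_form S U \<psi>" "p \<in> U"
  shows "gvs.subspace (spinor_ker S \<psi> p)"
proof -
  have add: "\<psi> p ((v + w) # vs) = \<psi> p (v # vs) + \<psi> p (w # vs)"
    if "v \<in> tangent S p" "w \<in> tangent S p" "set vs \<subseteq> tangent S p" for v w vs
    using smooth_formD(1)[OF assms, of "[]" vs] that by simp
  have sc: "\<psi> p (fscale c v # vs) = c * \<psi> p (v # vs)"
    if "v \<in> tangent S p" "set vs \<subseteq> tangent S p" for c v vs
    using smooth_formD(2)[OF assms, of "[]" vs] that by simp
  have wadd: "wedge (\<eta> + \<zeta>) \<phi> vs = wedge \<eta> \<phi> vs + wedge \<zeta> \<phi> vs" for \<eta> \<zeta> \<phi> and vs :: "'a tvec list"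
    by (simp add: wedge_def sum.distrib[symmetric] algebra_simps)
  have wsc: "wedge (fscale c \<eta>) \<phi> vs = c * wedge \<eta> \<phi> vs" for \<eta> \<phi> c and vs :: "'a tvec list"
    by (simp add: wedge_def sum_distrib_left mult_ac)
  have cadd: "clifford (E + F) (\<psi> p) vs = clifford E (\<psi> p) vs + clifford F (\<psi> p) vs"
    if "E \<in> gfibre S p" "F \<in> gfibre S p" "set vs \<subseteq> tangent S p" for E F vs
    using add[OF gfibreD(1) gfibreD(1)] that by (simp add: clifford_wedge wadd)
  have csc: "clifford (gscale c E) (\<psi> p) vs = c * clifford E (\<psi> p) vs"
    if "E \<in> gfibre S p" "set vs \<subseteq> tangent S p" for c E vs
    using sc[OF gfibreD(1)] that by (simp add: clifford_wedge wsc algebra_simps)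
  show ?thesis
  proof (rule gvs.subspaceI)
    have "clifford 0 (\<psi> p) vs = 0" if "set vs \<subseteq> tangent S p" for vs
      using csc[OF gfibre_closed(1) that, of 0] by simp
    then show "0 \<in> spinor_ker S \<psi> p" by (simp add: spinor_ker_def gfibre_closed)
    show "E + F \<in> spinor_ker S \<psi> p" if "E \<in> spinor_ker S \<psi> p" "F \<in> spinor_ker S \<psi> p" for E F
      using that cadd by (simp add: spinor_ker_def gfibre_closed)
    show "gscale c E \<in> spinor_ker S \<psi> p" if "E \<in> spinor_ker S \<psi> p" for c E
      using that csc by (simp add: spinor_ker_def gfibre_closed)
  qed
qed

lemma spinor_endo_eq:
  assumes "gvs.subspace (spinor_ker S \<psi> p)" "spinor_ker S \<psi> p \<inter> conj_gvec ` spinor_ker S \<psi> p = {0}"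
    and E: "E1 \<in> spinor_ker S \<psi> p" "conj_gvec E2 \<in> spinor_ker S \<psi> p"
  shows "spinor_endo S \<psi> p (E1 + E2) = gscale (- \<i>) E1 + gscale \<i> E2"
  unfolding spinor_endo_def
proof (rule the_equality)
  let ?L = "spinor_ker S \<psi> p"
  show "\<exists>F1\<in>?L. \<exists>F2\<in>conj_gvec ` ?L. E1 + E2 = F1 + F2 \<and> gscale (- \<i>) E1 + gscale \<i> E2 = gscale (- \<i>) F1 + gscale \<i> F2"
    using E by (intro bexI[of _ E1] bexI[of _ E2]) (auto simp: mem_conj_image_iff)
  fix F assume "\<exists>F1\<in>?L. \<exists>F2\<in>conj_gvec ` ?L. E1 + E2 = F1 + F2 \<and> F = gscale (- \<i>) F1 + gscale \<i> F2"
  then obtain F1 F2 where F: "F1 \<in> ?L" "conj_gvec F2 \<in> ?L" "E1 + E2 = F1 + F2" "F = gscale (- \<i>) F1 + gscale \<i> F2"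
    unfolding mem_conj_image_iff[symmetric] by blast
  have m: "E1 - F1 = F2 - E2" using arg_cong[OF F(3), of "\<lambda>X. X - F1 - E2"] by simp
  have 1: "E1 - F1 \<in> ?L" using gvs.subspace_diff[OF assms(1) E(1) F(1)] .
  have "F2 - E2 \<in> conj_gvec ` ?L"
    unfolding mem_conj_image_iff conj_gvec_diff using gvs.subspace_diff[OF assms(1) F(2) E(2)] .
  then have 2: "E1 - F1 \<in> conj_gvec ` ?L" by (simp only: m)
  have "E1 - F1 = 0" using assms(2) 1 2 by blast
  then have "F1 = E1" "F2 = E2" using m by simp_all
  then show "F = gscale (- \<i>) E1 + gscale \<i> E2" using F(4) by simp
qed

subsection \<open>Orthogonal endomorphisms\<close>

lemma so_sectionD:
  assumes "so_section S A" "p \<in> topspace (stop S)" "E \<in> gfibre S p"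
  shows "A p E \<in> gfibre S p" "A p (conj_gvec E) = conj_gvec (A p E)" "A p (gscale c E) = gscale c (A p E)"
    "F \<in> gfibre S p \<Longrightarrow> A p (E + F) = A p E + A p F"
    "F \<in> gfibre S p \<Longrightarrow> pairing (A p E) (A p F) = pairing E F"
  using assms unfolding so_section_def by blast+

lemma so_section_uminus:
  "so_section S A \<Longrightarrow> p \<in> topspace (stop S) \<Longrightarrow> E \<in> gfibre S p \<Longrightarrow> A p (- E) = - A p E"
  using so_sectionD(3)[of A p E "-1"] by simp

lemma so_section_diff:
  assumes "so_section S A" "p \<in> topspace (stop S)" "E \<in> gfibre S p" "F \<in> gfibre S p"
  shows "A p (E - F) = A p E - A p F"
  using so_sectionD(4)[OF assms(1-3) gfibre_closed(4)[OF assms(4)]] so_section_uminus[OF assms(1,2,4)] by simp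

lemma so_section_smooth:
  "so_section S A \<Longrightarrow> openin (stop S) U \<Longrightarrow> smooth_gsection S U E \<Longrightarrow> smooth_gsection S U (\<lambda>q. A q (E q))"
  unfolding so_section_def by blast

text \<open>If \<open>A\<^sup>2 = - 1\<close>, this is the projection \<open>(1 + \<i> A) / 2\<close> onto the \<open>(- \<i>)\<close>-eigenbundle.\<close>

definition eigenproj :: "'a gendo \<Rightarrow> 'a gendo" where
  "eigenproj A p E = gscale (1/2) (E + gscale \<i> (A p E))"

lemma
  assumes "so_section S A" "p \<in> topspace (stop S)" "A p (A p E) = - E" "E \<in> gfibre S p"
  shows eigenproj_eigenbundle: "eigenproj A p E \<in> eigenbundle S A p"
    and eigenproj_conj_eigenbundle: "conj_gvec (E - eigenproj A p E) \<in> eigenbundle S A p"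
proof -
  note D = so_sectionD[OF assms(1,2)]
  note AE = D(1)[OF assms(4)]
  note h = gfibre_closed(2)[OF assms(4) gfibre_closed(3)[OF AE, of \<i>]]
  have "A p (eigenproj A p E) = gscale (1/2) (A p E + gscale \<i> (- E))"
    unfolding eigenproj_def
    by (simp add: D(3)[OF h] D(4)[OF assms(4) gfibre_closed(3)[OF AE]] D(3)[OF AE] assms(3))
  also have "\<dots> = gscale (- \<i>) (eigenproj A p E)"
    unfolding eigenproj_def by (auto simp: prod_eq_iff fun_eq_iff algebra_simps)
  finally show 1: "eigenproj A p E \<in> eigenbundle S A p"
    using gfibre_closed(3)[OF h] by (simp add: eigenbundle_def eigenproj_def)
  have c: "conj_gvec (E - eigenproj A p E) = eigenproj A p (conj_gvec E)"
    using D(2)[OF assms(4)] unfolding eigenproj_def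
    by (auto simp: prod_eq_iff fun_eq_iff algebra_simps)
  have "A p (A p (conj_gvec E)) = - conj_gvec E"
    using D(2)[OF assms(4)] D(2)[OF AE] assms(3) by simp
  note c2 = this
  note AE' = D(1)[OF conj_gfibre[OF assms(4)]]
  note h' = gfibre_closed(2)[OF conj_gfibre[OF assms(4)] gfibre_closed(3)[OF AE', of \<i>]]
  have "A p (eigenproj A p (conj_gvec E)) = gscale (1/2) (A p (conj_gvec E) + gscale \<i> (- conj_gvec E))"
    unfolding eigenproj_def
    by (simp add: D(3)[OF h'] D(4)[OF conj_gfibre[OF assms(4)] gfibre_closed(3)[OF AE']] D(3)[OF AE'] c2)
  also have "\<dots> = gscale (- \<i>) (eigenproj A p (conj_gvec E))"
    unfolding eigenproj_def by (auto simp: prod_eq_iff fun_eq_iff algebra_simps)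
  finally show "conj_gvec (E - eigenproj A p E) \<in> eigenbundle S A p"
    unfolding c using gfibre_closed(3)[OF h'] by (simp add: eigenbundle_def eigenproj_def)
qed

lemma eigenproj_smooth:
  assumes "so_section S A" "openin (stop S) U" "smooth_gsection S U E"
  shows "smooth_gsection S U (\<lambda>q. eigenproj A q (E q))"
  unfolding eigenproj_def
  by (intro smooth_gsection_const_scale smooth_gsection_add assms so_section_smooth[OF assms(1)])

lemma eigenproj_fixed: "A p E = gscale (- \<i>) E \<Longrightarrow> eigenproj A p E = E"
  by (auto simp: eigenproj_def prod_eq_iff fun_eq_iff algebra_simps)

end

section \<open>Reduction of generalized Kaehler structures\<close>

context adapted_submanifold
begin

lemma mixed_related:
  assumes "p \<in> M"
  shows "related p E' E \<longleftrightarrow> (\<exists>F\<in>mixed_fibre S M p. mixed_incl S p F = E \<and> mixed_proj S M p F = E')"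
proof
  assume r: "related p E' E"
  then show "\<exists>F\<in>mixed_fibre S M p. mixed_incl S p F = E \<and> mixed_proj S M p F = E'"
    by (intro bexI[of _ "(fst E', snd E)"])
       (auto simp: related_def mixed_fibre_def mixed_incl_def mixed_proj_def prod_eq_iff R.gfibreD gfibreD)
next
  assume "\<exists>F\<in>mixed_fibre S M p. mixed_incl S p F = E \<and> mixed_proj S M p F = E'"
  then show "related p E' E"
    using push_tangent[OF _ assms] pull_cotangent[OF assms]
    by (auto simp: related_def mixed_fibre_def mixed_incl_def mixed_proj_def gfibre_def)
qed

lemma conormal_image:
  assumes "p \<in> M" shows "mixed_incl S p ` conormal S M p = conormal_vecs p"
proof -
  have "E \<in> mixed_incl S p ` conormal S M p \<longleftrightarrow> related p 0 E" for E
    unfolding mixed_related[OF assms] conormal_def image_iff by blast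
  then show ?thesis unfolding conormal_vecs_def by blast
qed

lemma clifford_pull:
  assumes "related p E' E" "set us \<subseteq> tangent R p"
  shows "clifford E' (pull_form S \<psi> p) us = clifford E (\<psi> p) (map (push_tvec S p) us)"
proof -
  have "snd E' (us ! i) = snd E (push_tvec S p (us ! i))" if "i < length us" for i
    using assms that by (auto simp: related_def pull_apply subset_iff)
  then show ?thesis
    using assms(1) by (simp add: clifford_def pull_form_def del_nth_map related_def)
qed

text \<open>If every tangent vector of the ambient space is tangent to \<open>M\<close> modulo the tangent parts of the
  spinor kernel, the spinor is determined by its pull-back: an argument \<open>fst l\<close> with \<open>l \<cdot> \<psi> = 0\<close> can
  be traded for lists with fewer ambient vectors.\<close>

lemma spinor_eq_0_of_pull_eq_0:
  assumes \<psi>: "smooth_form S (topspace (stop S)) \<psi>" and p: "p \<in> M"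
    and dec: "\<And>v. v \<in> tangent S p \<Longrightarrow> \<exists>u\<in>tangent R p. \<exists>l\<in>spinor_ker S \<psi> p. v = push_tvec S p u + fst l"
    and zero: "\<And>us. set us \<subseteq> tangent R p \<Longrightarrow> pull_form S \<psi> p us = 0"
  shows "set ws \<subseteq> tangent S p \<Longrightarrow> \<psi> p ws = 0"
proof -
  have pS: "p \<in> topspace (stop S)" using p M_subset by blast
  have "\<psi> p (ws @ map (push_tvec S p) us) = 0" if "set ws \<subseteq> tangent S p" "set us \<subseteq> tangent R p" for ws us
    using that
  proof (induction "length ws" arbitrary: ws us rule: less_induct)
    case less
    let ?us = "map (push_tvec S p) us"
    have us: "set ?us \<subseteq> tangent S p" using less.prems(2) push_tangent[OF _ p] by auto
    show ?case
    proof (cases ws)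
      case Nil
      then show ?thesis using zero[OF less.prems(2)] by (simp add: pull_form_def)
    next
      case (Cons v ws')
      have ws': "set ws' \<subseteq> tangent S p" and v: "v \<in> tangent S p" using less.prems(1) Cons by auto
      obtain u l where u: "u \<in> tangent R p" and l: "l \<in> spinor_ker S \<psi> p" and vd: "v = push_tvec S p u + fst l"
        using dec[OF v] by blast
      have pu: "push_tvec S p u \<in> tangent S p" using push_tangent[OF u p] .
      have l1: "fst l \<in> tangent S p" using gfibreD(1)[OF spinor_ker_gfibre[OF l]] .
      have "\<psi> p (push_tvec S p u # ws' @ ?us) = (- 1) ^ length ws' * \<psi> p (ws' @ push_tvec S p u # ?us)"
        using form_move[OF \<psi> pS pu us, of "[]" ws'] ws' by simp
      also have "\<psi> p (ws' @ push_tvec S p u # ?us) = 0"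
        using less.hyps[of ws' "u # us"] Cons ws' u less.prems(2) by simp
      finally have 1: "\<psi> p (push_tvec S p u # ws' @ ?us) = 0" by simp
      have "snd l ((ws' @ ?us) ! i) * \<psi> p (del_nth i (ws' @ ?us)) = 0" if "i < length (ws' @ ?us)" for i
      proof (cases "i < length ws'")
        case True
        have "\<psi> p (del_nth i ws' @ ?us) = 0"
          by (rule less.hyps) (use True Cons set_del_nth[of i ws'] ws' less.prems(2) in \<open>auto simp: length_del_nth\<close>)
        then show ?thesis using True by (simp add: del_nth_append)
      next
        case False
        have "\<psi> p (ws' @ map (push_tvec S p) (del_nth (i - length ws') us)) = 0"
          by (rule less.hyps) (use Cons ws' less.prems(2) set_del_nth[of "i - length ws'" us] in auto)
        then show ?thesis using False by (simp add: del_nth_append del_nth_map)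
      qed
      then have "(\<Sum>i<length (ws' @ ?us). (- 1) ^ i * snd l ((ws' @ ?us) ! i) * \<psi> p (del_nth i (ws' @ ?us))) = 0"
        by (intro sum.neutral) (simp add: mult.assoc)
      moreover have "clifford l (\<psi> p) (ws' @ ?us) = 0"
        using l ws' us unfolding spinor_ker_def by (metis (mono_tags, lifting) Un_least mem_Collect_eq set_append)
      ultimately have 2: "\<psi> p (fst l # ws' @ ?us) = 0" by (simp add: clifford_def)
      show ?thesis
        using smooth_formD(1)[OF \<psi> pS, of "[]" "ws' @ ?us" "push_tvec S p u" "fst l"] pu l1 ws' us 1 2 Cons vd by simp
    qed
  qed
  from this[of ws "[]"] show "\<psi> p ws = 0" if "set ws \<subseteq> tangent S p" using that by simp
qed

end

locale kahler_reduction = adapted_submanifold S M index_type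
  for S :: "'a smooth_space" and M :: "'a set" and index_type :: "'i itself" +
  fixes A :: "'a gendo" and \<psi> :: "'a form"
  assumes gk: "gen_kahler_one_spinor S A \<psi>"
    and conormal_inv: "conormal_invariant S A M"
begin

abbreviation B where "B \<equiv> spinor_endo S \<psi>"
abbreviation L where "L \<equiv> spinor_ker S \<psi>"
definition G :: "'a gendo" where "G p E = - A p (B p E)"
abbreviation \<psi>\<^sub>M where "\<psi>\<^sub>M \<equiv> pull_form S \<psi>"

lemma form: "smooth_form S (topspace (stop S)) \<psi>"
  using gk by (simp add: gen_kahler_one_spinor_def pure_spinor_def)

lemma so: "so_section S A" "so_section S B" "so_section S G"
  using gk unfolding gen_kahler_one_spinor_def gen_kahler_def gen_complex_def gen_metric_def G_def[abs_def] by blast+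

lemma square:
  assumes "p \<in> topspace (stop S)" "E \<in> gfibre S p"
  shows A_A: "A p (A p E) = - E" and B_B: "B p (B p E) = - E" and A_B: "A p (B p E) = B p (A p E)"
    and G_G: "G p (G p E) = E" and G_pos: "conj_gvec E = E \<Longrightarrow> E \<noteq> 0 \<Longrightarrow> Re (pairing (G p E) E) > 0"
  using gk assms unfolding gen_kahler_one_spinor_def gen_kahler_def gen_complex_def gen_metric_def G_def[abs_def] by auto

lemma spinor_split:
  assumes "p \<in> topspace (stop S)"
  shows "L p \<inter> conj_gvec ` L p = {0}" "gfibre S p = {E + F |E F. E \<in> L p \<and> F \<in> conj_gvec ` L p}"
  using gk assms unfolding gen_kahler_one_spinor_def nondegenerate_spinor_def by auto

lemma L_subspace: "p \<in> topspace (stop S) \<Longrightarrow> gvs.subspace (L p)"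
  using spinor_ker_subspace[OF form] .

lemma eigenbundle_B:
  assumes p: "p \<in> topspace (stop S)" shows "eigenbundle S B p = L p"
proof
  note eq = spinor_endo_eq[OF L_subspace[OF p] spinor_split(1)[OF p]]
  show "L p \<subseteq> eigenbundle S B p"
  proof
    fix E assume E: "E \<in> L p"
    have "B p (E + 0) = gscale (- \<i>) E + gscale \<i> 0"
      by (rule eq[OF E]) (simp add: gvs.subspace_0[OF L_subspace[OF p]])
    then show "E \<in> eigenbundle S B p" using spinor_ker_gfibre[OF E] by (simp add: eigenbundle_def)
  qed
  show "eigenbundle S B p \<subseteq> L p"
  proof
    fix E assume E: "E \<in> eigenbundle S B p"
    then have "E \<in> gfibre S p" by (simp add: eigenbundle_def)
    then obtain E1 E2 where d: "E = E1 + E2" "E1 \<in> L p" "conj_gvec E2 \<in> L p"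
      using spinor_split(2)[OF p] by (auto simp: mem_conj_image_iff)
    have "gscale (- \<i>) E1 + gscale \<i> E2 = gscale (- \<i>) (E1 + E2)"
      using eq[OF d(2,3)] E d(1) by (simp add: eigenbundle_def)
    then have "gscale \<i> E2 = gscale (- \<i>) E2"
      unfolding gvs.scale_right_distrib by (rule add_left_imp_eq)
    moreover have "\<i> \<noteq> - \<i>" by (simp add: complex_eq_iff)
    ultimately have "E2 = 0" by (metis gvs.scale_cancel_right)
    then show "E \<in> L p" using d by simp
  qed
qed

lemma B_on_L: "p \<in> topspace (stop S) \<Longrightarrow> E \<in> L p \<Longrightarrow> B p E = gscale (- \<i>) E"
  using eigenbundle_B by (auto simp: eigenbundle_def)

text \<open>An orthogonal map multiplies the pairing of two of its \<open>(- \<i>)\<close>-eigenvectors by \<open>(- \<i>)\<^sup>2 = - 1\<close>.\<close>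

lemma L_isotropic:
  assumes p: "p \<in> topspace (stop S)" and "E \<in> L p" "F \<in> L p"
  shows "pairing E F = 0"
proof -
  note g = spinor_ker_gfibre[OF assms(2)] spinor_ker_gfibre[OF assms(3)]
  have "pairing E F = pairing (gscale (- \<i>) E) (gscale (- \<i>) F)"
    using so_sectionD(5)[OF so(2) p g] B_on_L[OF p] assms by simp
  also have "\<dots> = - pairing E F"
    unfolding pairing_scale[OF g(1) gfibre_closed(3)[OF g(2)]] pairing_scale2[OF g] by simp
  finally show ?thesis by simp
qed

lemma skew:
  assumes "p \<in> topspace (stop S)" "E \<in> gfibre S p" "F \<in> gfibre S p"
  shows "pairing (A p E) F = - pairing E (A p F)" "pairing (B p E) F = - pairing E (B p F)"
    "pairing (G p E) F = pairing E (G p F)"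
proof -
  have "pairing (A p E) (A p (A p F)) = pairing E (A p F)"
    using so_sectionD(5)[OF so(1) assms(1,2) so_sectionD(1)[OF so(1) assms(1,3)]] .
  then show "pairing (A p E) F = - pairing E (A p F)"
    using A_A[OF assms(1,3)] pairing_uminus2[OF so_sectionD(1)[OF so(1) assms(1,2)] assms(3)] by (simp add: eq_neg_iff_add_eq_0 neg_eq_iff_add_eq_0 add.commute)
  have "pairing (B p E) (B p (B p F)) = pairing E (B p F)"
    using so_sectionD(5)[OF so(2) assms(1,2) so_sectionD(1)[OF so(2) assms(1,3)]] .
  then show "pairing (B p E) F = - pairing E (B p F)"
    using B_B[OF assms(1,3)] pairing_uminus2[OF so_sectionD(1)[OF so(2) assms(1,2)] assms(3)] by (simp add: eq_neg_iff_add_eq_0 neg_eq_iff_add_eq_0 add.commute)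
  have "pairing (G p E) (G p (G p F)) = pairing E (G p F)"
    using so_sectionD(5)[OF so(3) assms(1,2) so_sectionD(1)[OF so(3) assms(1,3)]] .
  then show "pairing (G p E) F = pairing E (G p F)" using G_G[OF assms(1,3)] by simp
qed

lemma G_commute:
  assumes p: "p \<in> topspace (stop S)" and E: "E \<in> gfibre S p"
  shows "G p (A p E) = A p (G p E)" "A p (G p E) = B p E" "G p (B p E) = A p E" "B p E = G p (A p E)"
proof -
  note AE = so_sectionD(1)[OF so(1) p E] and BE = so_sectionD(1)[OF so(2) p E]
  note ABE = so_sectionD(1)[OF so(1) p BE]
  show 2: "A p (G p E) = B p E"
    using so_section_uminus[OF so(1) p ABE] A_A[OF p BE] by (simp add: G_def)
  show 1: "G p (A p E) = A p (G p E)"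
    using A_B[OF p AE] A_B[OF p E] A_B[OF p ABE] 2 A_A[OF p E] A_A[OF p BE] so_section_uminus[OF so(2) p E]
    by (simp add: G_def A_B[OF p AE])
  show "G p (B p E) = A p E"
    using B_B[OF p E] so_section_uminus[OF so(1) p E] by (simp add: G_def)
  show "B p E = G p (A p E)" using 1 2 by simp
qed

text \<open>For \<open>E = X + \<i> Y\<close> with real \<open>X\<close> and \<open>Y\<close> the mixed terms cancel, because \<open>G\<close> is symmetric for the pairing.\<close>

lemma G_hermitian_pos:
  assumes p: "p \<in> topspace (stop S)" and E: "E \<in> gfibre S p" "E \<noteq> 0"
  shows "Re (pairing (G p E) (conj_gvec E)) > 0"
proof -
  define X where "X = gscale (1/2) (E + conj_gvec E)"
  define Y where "Y = gscale (1/(2 * \<i>)) (E - conj_gvec E)"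
  have X: "X \<in> gfibre S p" "conj_gvec X = X" and Y: "Y \<in> gfibre S p" "conj_gvec Y = Y"
    using E(1) conj_gfibre[OF E(1)]
    by (auto simp: X_def Y_def gfibre_closed add.commute) (auto simp: prod_eq_iff fun_eq_iff algebra_simps)
  have Ed: "E = X + gscale \<i> Y"
    by (auto simp: X_def Y_def prod_eq_iff fun_eq_iff field_simps)
  then have nz: "X \<noteq> 0 \<or> Y \<noteq> 0" using E(2) by auto
  note D = so_sectionD[OF so(3) p]
  note iY = gfibre_closed(3)[OF Y(1), of \<i>] and miY = gfibre_closed(3)[OF Y(1), of "- \<i>"]
  note GX = D(1)[OF X(1)] and GY = D(1)[OF Y(1)]
  note iGY = gfibre_closed(3)[OF GY, of \<i>]
  have "pairing (G p E) (conj_gvec E) = pairing (G p X + gscale \<i> (G p Y)) (X + gscale (- \<i>) Y)"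
    unfolding Ed using D(4)[OF X(1) iY] D(3)[OF Y(1), of \<i>] X(2) Y(2) by simp
  also have "\<dots> = pairing (G p X) X + pairing (G p Y) Y + (- \<i> * pairing (G p X) Y + \<i> * pairing (G p Y) X)"
    using pairing_add[OF GX iGY gfibre_closed(2)[OF X(1) miY]] pairing_add2[OF X(1) miY GX]
      pairing_add2[OF X(1) miY iGY] pairing_scale2[OF GX Y(1), of "- \<i>"] pairing_scale2[OF iGY Y(1), of "- \<i>"]
      pairing_scale[OF GY X(1), of \<i>] pairing_scale[OF GY Y(1), of \<i>]
    by (simp add: algebra_simps)
  also have "pairing (G p Y) X = pairing (G p X) Y"
    using skew(3)[OF p Y(1) X(1)] pairing_sym by metis
  finally have e: "pairing (G p E) (conj_gvec E) = pairing (G p X) X + pairing (G p Y) Y" by simp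
  have ge: "Re (pairing (G p Z) Z) \<ge> 0" if "Z \<in> gfibre S p" "conj_gvec Z = Z" for Z
    using G_pos[OF p that(1,2)] D(3)[OF gfibre_closed(1), of 0] by (cases "Z = 0") (auto simp: pairing_def)
  show ?thesis
    unfolding e using nz ge[OF X] ge[OF Y] G_pos[OF p X] G_pos[OF p Y] by (auto simp: add_pos_nonneg add_nonneg_pos)
qed

subsection \<open>The conormal space and its complement\<close>

lemma A_conormal:
  assumes "p \<in> M" "k \<in> conormal_vecs p" shows "A p k \<in> conormal_vecs p"
  using conormal_inv assms conormal_image[OF assms(1)] unfolding conormal_invariant_def by blast

lemma conormal_gfibre: "k \<in> conormal_vecs p \<Longrightarrow> k \<in> gfibre S p"
  by (auto simp: conormal_vecs_def related_def)

lemma A_related: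
  assumes p: "p \<in> M" and r: "related p E' E"
  shows "\<exists>F'. related p F' (A p E)"
proof -
  have pS: "p \<in> topspace (stop S)" using p M_subset by blast
  note E = relatedD(2)[OF r]
  show ?thesis
  proof (rule related_exists[OF so_sectionD(1)[OF so(1) pS E] p])
    fix k assume k: "k \<in> conormal_vecs p"
    show "pairing (A p E) k = 0"
      using skew(1)[OF pS E conormal_gfibre[OF k]] conormal_vecs_pairing[OF A_conormal[OF p k] r] by simp
  qed
qed

text \<open>\<open>rep\<close> restricts \<open>related\<close> to the orthogonal complement of \<open>K + G K\<close>, where \<open>K\<close> is the conormal space. This
  complement meets \<open>K\<close> in \<open>0\<close> by positivity of \<open>G\<close>, so it represents the quotient of \<open>K\<^sup>\<bottom>\<close> by \<open>K\<close>; and it is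
  invariant under \<open>A\<close>, \<open>B\<close> and \<open>G\<close>, whereas \<open>B\<close> does not preserve \<open>K\<^sup>\<bottom>\<close> in general.\<close>

definition rep :: "'a \<Rightarrow> 'a gvec \<Rightarrow> 'a gvec \<Rightarrow> bool" where
  "rep p E' E \<longleftrightarrow> related p E' E \<and> (\<forall>k\<in>conormal_vecs p. pairing (G p E) k = 0)"

lemma rep_related: "rep p E' E \<Longrightarrow> related p E' E"
  by (simp add: rep_def)

lemma rep_gfibre: "rep p E' E \<Longrightarrow> E \<in> gfibre S p" "rep p E' E \<Longrightarrow> E' \<in> gfibre R p"
  using rep_related relatedD by blast+

lemma rep_add:
  assumes "p \<in> M" "rep p E' E" "rep p F' F" shows "rep p (E' + F') (E + F)"
proof -
  have pS: "p \<in> topspace (stop S)" using assms(1) M_subset by blast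
  note D = so_sectionD[OF so(3) pS] and E = rep_gfibre(1)[OF assms(2)] and F = rep_gfibre(1)[OF assms(3)]
  have "pairing (G p (E + F)) k = 0" if k: "k \<in> conormal_vecs p" for k
    using pairing_add[OF D(1)[OF E] D(1)[OF F] conormal_gfibre[OF k]] D(4)[OF E F] assms(2,3) k
    by (simp add: rep_def)
  then show ?thesis using related_add[OF rep_related[OF assms(2)] rep_related[OF assms(3)]] by (simp add: rep_def)
qed

lemma rep_scale:
  assumes "p \<in> M" "rep p E' E" shows "rep p (gscale c E') (gscale c E)"
proof -
  have pS: "p \<in> topspace (stop S)" using assms(1) M_subset by blast
  note D = so_sectionD[OF so(3) pS] and E = rep_gfibre(1)[OF assms(2)]
  have "pairing (G p (gscale c E)) k = 0" if k: "k \<in> conormal_vecs p" for k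
    using pairing_scale[OF D(1)[OF E] conormal_gfibre[OF k]] D(3)[OF E] assms(2) k by (simp add: rep_def)
  then show ?thesis using related_scale[OF rep_related[OF assms(2)]] by (simp add: rep_def)
qed

lemma rep_conj:
  assumes "p \<in> M" "rep p E' E" shows "rep p (conj_gvec E') (conj_gvec E)"
proof -
  have pS: "p \<in> topspace (stop S)" using assms(1) M_subset by blast
  have "pairing (G p (conj_gvec E)) k = 0" if "k \<in> conormal_vecs p" for k
  proof -
    have "pairing (G p (conj_gvec E)) k = cnj (pairing (G p E) (conj_gvec k))"
      using so_sectionD(2)[OF so(3) pS rep_gfibre(1)[OF assms(2)]] pairing_conj[of "G p E" "conj_gvec k"] by simp
    then show ?thesis using assms(2) conormal_vecs_conj[OF that] by (simp add: rep_def)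
  qed
  then show ?thesis using related_conj assms(2) by (simp add: rep_def)
qed

lemma rep_A:
  assumes p: "p \<in> M" and r: "rep p E' E" shows "\<exists>F'. rep p F' (A p E)"
proof -
  have pS: "p \<in> topspace (stop S)" using p M_subset by blast
  note E = rep_gfibre(1)[OF r]
  obtain F' where F': "related p F' (A p E)" using A_related[OF p rep_related[OF r]] by blast
  have "pairing (G p (A p E)) k = 0" if k: "k \<in> conormal_vecs p" for k
    using G_commute(1)[OF pS E] skew(1)[OF pS so_sectionD(1)[OF so(3) pS E] conormal_gfibre[OF k]]
      r A_conormal[OF p k] by (simp add: rep_def)
  then have "rep p F' (A p E)" using F' by (simp add: rep_def)
  then show ?thesis by blast
qed

text \<open>\<open>B = G A\<close> exchanges \<open>K\<close> and \<open>G K\<close>, since \<open>A\<close> preserves \<open>K\<close> and commutes with \<open>G\<close>.\<close>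

lemma rep_B:
  assumes p: "p \<in> M" and r: "rep p E' E" shows "\<exists>F'. rep p F' (B p E)"
proof -
  have pS: "p \<in> topspace (stop S)" using p M_subset by blast
  note E = rep_gfibre(1)[OF r]
  have "\<exists>F'. related p F' (B p E)"
  proof (rule related_exists[OF so_sectionD(1)[OF so(2) pS E] p])
    fix k assume k: "k \<in> conormal_vecs p"
    note kg = conormal_gfibre[OF k]
    have "pairing (B p E) k = - pairing E (G p (A p k))"
      using skew(2)[OF pS E kg] G_commute(4)[OF pS kg] by simp
    also have "\<dots> = - pairing (G p E) (A p k)"
      using skew(3)[OF pS E so_sectionD(1)[OF so(1) pS kg]] by simp
    also have "\<dots> = 0" using r A_conormal[OF p k] by (simp add: rep_def)
    finally show "pairing (B p E) k = 0" .
  qed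
  moreover have "pairing (G p (B p E)) k = 0" if k: "k \<in> conormal_vecs p" for k
    using G_commute(3)[OF pS E] skew(1)[OF pS E conormal_gfibre[OF k]]
      conormal_vecs_pairing[OF A_conormal[OF p k] rep_related[OF r]] by simp
  ultimately show ?thesis unfolding rep_def by blast
qed

text \<open>The difference of two representatives is a conormal vector \<open>k\<close> with \<open>\<langle>G k, conj k\<rangle> = 0\<close>.\<close>

lemma rep_unique:
  assumes p: "p \<in> M" and r: "rep p E' E" "rep p E' F" shows "E = F"
proof (rule ccontr)
  assume ne: "E \<noteq> F"
  have pS: "p \<in> topspace (stop S)" using p M_subset by blast
  have "rep p (gscale (-1) E') (gscale (-1) F)" using rep_scale[OF p r(2)] .
  from rep_add[OF p r(1) this] have d: "rep p 0 (E - F)" by simp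
  then have "E - F \<in> conormal_vecs p" by (simp add: rep_def conormal_vecs_def)
  then have "pairing (G p (E - F)) (conj_gvec (E - F)) = 0"
    using d conormal_vecs_conj by (simp add: rep_def del: conj_gvec_diff)
  then show False using G_hermitian_pos[OF pS rep_gfibre(1)[OF d]] ne by simp
qed

lemma rep_unique2: "rep p E' E \<Longrightarrow> rep p F' E \<Longrightarrow> E' = F'"
  using related_unique rep_related by blast

subsection \<open>Smooth representatives\<close>

text \<open>Gram-Schmidt orthogonalization of a section against a frame, for the hermitian form of \<open>G\<close>. The
  frame is taken one element at a time, so only scalar functions have to be inverted.\<close>

lemma gram_schmidt:
  fixes \<eta> :: "'k \<Rightarrow> 'a \<Rightarrow> 'a gvec"
  assumes U: "openin (stop S) U" and N: "finite N"
  shows "(\<And>i. i \<in> N \<Longrightarrow> smooth_gsection S U (\<eta> i)) \<Longrightarrow>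
    \<forall>q\<in>U. \<forall>c. (\<Sum>i\<in>N. gscale (c i) (\<eta> i q)) = 0 \<longrightarrow> (\<forall>i\<in>N. c i = 0) \<Longrightarrow>
    smooth_gsection S U E \<Longrightarrow>
    \<exists>c. (\<forall>i\<in>N. c i \<in> sfun S U) \<and>
      (\<forall>q\<in>U. \<forall>j\<in>N. pairing (G q (E q - (\<Sum>i\<in>N. gscale (c i q) (\<eta> i q)))) (conj_gvec (\<eta> j q)) = 0)"
  using N
proof (induction N arbitrary: E)
  case empty
  then show ?case by auto
next
  case (insert k N)
  have \<eta>: "smooth_gsection S U (\<eta> i)" if "i \<in> N" for i using insert.prems(1) that by blast
  have indk: "c i = 0" if "q \<in> U" "(\<Sum>i\<in>insert k N. gscale (c i) (\<eta> i q)) = 0" "i \<in> insert k N" for q c i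
    using insert.prems(2) that by blast
  have "c i = 0" if "q \<in> U" "(\<Sum>i\<in>N. gscale (c i) (\<eta> i q)) = 0" "i \<in> N" for q c i
  proof -
    have "(\<Sum>j\<in>insert k N. gscale (if j = k then 0 else c j) (\<eta> j q)) = (\<Sum>j\<in>N. gscale (c j) (\<eta> j q))"
      using insert.hyps by (simp, intro sum.cong) auto
    then have "(if i = k then 0 else c i) = 0"
      using indk[OF that(1), of "\<lambda>j. if j = k then 0 else c j" i] that(2,3) by simp
    then show ?thesis using that(3) insert.hyps(2) by (auto split: if_splits)
  qed
  then have ind: "\<forall>q\<in>U. \<forall>c. (\<Sum>i\<in>N. gscale (c i) (\<eta> i q)) = 0 \<longrightarrow> (\<forall>i\<in>N. c i = 0)" by blast
  obtain d where d: "\<And>i. i \<in> N \<Longrightarrow> d i \<in> sfun S U"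
    "\<And>q j. q \<in> U \<Longrightarrow> j \<in> N \<Longrightarrow> pairing (G q (\<eta> k q - (\<Sum>i\<in>N. gscale (d i q) (\<eta> i q)))) (conj_gvec (\<eta> j q)) = 0"
    using insert.IH[OF \<eta> ind, of "\<eta> k"] insert.prems(1)[of k] by blast
  obtain c where c: "\<And>i. i \<in> N \<Longrightarrow> c i \<in> sfun S U"
    "\<And>q j. q \<in> U \<Longrightarrow> j \<in> N \<Longrightarrow> pairing (G q (E q - (\<Sum>i\<in>N. gscale (c i q) (\<eta> i q)))) (conj_gvec (\<eta> j q)) = 0"
    using insert.IH[OF \<eta> ind insert.prems(3)] by blast
  define \<xi> where "\<xi> q = \<eta> k q - (\<Sum>i\<in>N. gscale (d i q) (\<eta> i q))" for q
  define F where "F q = E q - (\<Sum>i\<in>N. gscale (c i q) (\<eta> i q))" for q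
  have s\<xi>: "smooth_gsection S U \<xi>" unfolding \<xi>_def
    by (intro smooth_gsection_diff smooth_gsection_sum smooth_gsection_scale U d(1) \<eta> insert.prems(1)) auto
  have sF: "smooth_gsection S U F" unfolding F_def
    by (intro smooth_gsection_diff smooth_gsection_sum smooth_gsection_scale U c(1) \<eta> insert.prems(3)) auto
  have \<xi>nz: "\<xi> q \<noteq> 0" if q: "q \<in> U" for q
  proof
    assume z: "\<xi> q = 0"
    have "(\<Sum>i\<in>insert k N. gscale (if i = k then 1 else - d i q) (\<eta> i q)) =
        \<eta> k q + (\<Sum>i\<in>N. gscale (if i = k then 1 else - d i q) (\<eta> i q))"
      using insert.hyps by simp
    also have "(\<Sum>i\<in>N. gscale (if i = k then 1 else - d i q) (\<eta> i q)) = (\<Sum>i\<in>N. - gscale (d i q) (\<eta> i q))"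
      by (rule sum.cong) (use insert.hyps in \<open>auto simp: gvs.scale_minus_left\<close>)
    also have "\<eta> k q + \<dots> = \<xi> q" by (simp add: \<xi>_def sum_negf)
    finally have "(if k = k then 1 else - d k q) = 0"
      using indk[OF q, of "\<lambda>i. if i = k then 1 else - d i q" k] z by simp
    then show False by simp
  qed
  have qS: "q \<in> topspace (stop S)" if "q \<in> U" for q using U openin_subset that by blast
  define n where "n q = pairing (G q (\<xi> q)) (conj_gvec (\<xi> q))" for q
  define \<gamma> where "\<gamma> q = pairing (G q (F q)) (conj_gvec (\<xi> q)) * inverse (n q)" for q
  have nnz: "n q \<noteq> 0" if "q \<in> U" for q
    using G_hermitian_pos[OF qS[OF that] smooth_gsectionD[OF s\<xi> that] \<xi>nz[OF that]] by (auto simp: n_def)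
  have s\<gamma>: "\<gamma> \<in> sfun S U"
    unfolding \<gamma>_def n_def
    by (intro smooth_mult smooth_inverse U smooth_pairing so_section_smooth[OF so(3)] smooth_gsection_conj sF s\<xi>)
       (use nnz n_def in auto)
  define c' where "c' i q = (if i = k then \<gamma> q else c i q - \<gamma> q * d i q)" for i q
  have sc': "c' i \<in> sfun S U" if "i \<in> insert k N" for i
  proof (cases "i = k")
    case True then show ?thesis using s\<gamma> by (simp add: c'_def[abs_def])
  next
    case False
    then have "(\<lambda>q. c i q - \<gamma> q * d i q) \<in> sfun S U"
      using smooth_diff[OF U c(1) smooth_mult[OF U s\<gamma> d(1)]] that by blast
    then show ?thesis using False by (simp add: c'_def[abs_def])
  qed
  have comb: "E q - (\<Sum>i\<in>insert k N. gscale (c' i q) (\<eta> i q)) = F q - gscale (\<gamma> q) (\<xi> q)" for q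
  proof -
    have "(\<Sum>i\<in>insert k N. gscale (c' i q) (\<eta> i q)) = gscale (\<gamma> q) (\<eta> k q) + (\<Sum>i\<in>N. gscale (c' i q) (\<eta> i q))"
      using insert.hyps by (simp add: c'_def)
    also have "(\<Sum>i\<in>N. gscale (c' i q) (\<eta> i q)) =
        (\<Sum>i\<in>N. gscale (c i q) (\<eta> i q) - gscale (\<gamma> q) (gscale (d i q) (\<eta> i q)))"
      by (rule sum.cong) (use insert.hyps in \<open>auto simp: c'_def gvs.scale_left_diff_distrib\<close>)
    also have "\<dots> = (\<Sum>i\<in>N. gscale (c i q) (\<eta> i q)) - gscale (\<gamma> q) (\<Sum>i\<in>N. gscale (d i q) (\<eta> i q))"
      unfolding sum_subtractf gvs.scale_sum_right ..
    finally show ?thesis by (simp add: F_def \<xi>_def gvs.scale_right_diff_distrib algebra_simps)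
  qed
  have "pairing (G q (F q - gscale (\<gamma> q) (\<xi> q))) (conj_gvec (\<eta> j q)) = 0" if q: "q \<in> U" and j: "j \<in> insert k N" for q j
  proof -
    note D = so_sectionD[OF so(3) qS[OF q]]
    have F: "F q \<in> gfibre S q" and x: "\<xi> q \<in> gfibre S q" and \<eta>g: "\<And>i. i \<in> insert k N \<Longrightarrow> \<eta> i q \<in> gfibre S q"
      using smooth_gsectionD q sF s\<xi> insert.prems(1) by blast+
    have lin: "pairing (G q (F q - gscale (\<gamma> q) (\<xi> q))) Z = pairing (G q (F q)) Z - \<gamma> q * pairing (G q (\<xi> q)) Z"
      if "Z \<in> gfibre S q" for Z
      using so_section_diff[OF so(3) qS[OF q] F gfibre_closed(3)[OF x]] D(3)[OF x, of "\<gamma> q"]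
        pairing_diff[OF D(1)[OF F] gfibre_closed(3)[OF D(1)[OF x]] that] pairing_scale[OF D(1)[OF x] that] by simp
    have N0: "pairing (G q (F q - gscale (\<gamma> q) (\<xi> q))) (conj_gvec (\<eta> i q)) = 0" if "i \<in> N" for i
      using lin[OF conj_gfibre[OF \<eta>g]] that c(2)[OF q that] d(2)[OF q that] by (simp add: F_def \<xi>_def)
    show ?thesis
    proof (cases "j = k")
      case False then show ?thesis using N0 j by blast
    next
      case True
      let ?P = "G q (F q - gscale (\<gamma> q) (\<xi> q))"
      have P: "?P \<in> gfibre S q" by (intro D(1) gfibre_closed F x)
      have "\<eta> k q = \<xi> q + (\<Sum>i\<in>N. gscale (d i q) (\<eta> i q))" by (simp add: \<xi>_def)
      then have "conj_gvec (\<eta> k q) = conj_gvec (\<xi> q) + (\<Sum>i\<in>N. gscale (cnj (d i q)) (conj_gvec (\<eta> i q)))"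
        by (simp add: conj_gvec_sum)
      moreover have sm: "(\<Sum>i\<in>N. gscale (cnj (d i q)) (conj_gvec (\<eta> i q))) \<in> gfibre S q"
        by (intro gfibre_closed(6) gfibre_closed(3) conj_gfibre \<eta>g) auto
      ultimately have "pairing ?P (conj_gvec (\<eta> k q)) =
          pairing ?P (conj_gvec (\<xi> q)) + pairing ?P (\<Sum>i\<in>N. gscale (cnj (d i q)) (conj_gvec (\<eta> i q)))"
        using pairing_add2[OF conj_gfibre[OF x] sm P] by simp
      also have "pairing ?P (\<Sum>i\<in>N. gscale (cnj (d i q)) (conj_gvec (\<eta> i q))) =
          (\<Sum>i\<in>N. pairing (gscale (cnj (d i q)) (conj_gvec (\<eta> i q))) ?P)"
        by (subst pairing_sym, rule pairing_sum[OF P]) (intro gfibre_closed(3) conj_gfibre \<eta>g, simp)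
      also have "\<dots> = 0"
      proof (rule sum.neutral, rule ballI)
        fix i assume i: "i \<in> N"
        have "pairing (conj_gvec (\<eta> i q)) ?P = 0" using N0[OF i] by (subst pairing_sym)
        then show "pairing (gscale (cnj (d i q)) (conj_gvec (\<eta> i q))) ?P = 0"
          using pairing_scale[OF conj_gfibre[OF \<eta>g] P, of i] i by simp
      qed
      also have "pairing ?P (conj_gvec (\<xi> q)) = 0"
        using lin[OF conj_gfibre[OF x]] nnz[OF q] by (simp add: \<gamma>_def n_def)
      finally show ?thesis using True by simp
    qed
  qed
  then show ?case using sc' comb by (intro exI[of _ c']) auto
qed

text \<open>The differentials of the normal coordinates are a smooth frame of the conormal space. An arbitrary
  extension of the section is orthogonalized against them.\<close>

lemma rep_section:
  assumes W: "openin (stop R) W0" "p \<in> W0" and E': "smooth_gsection R W0 E'"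
  shows "\<exists>O' E. openin (stop S) O' \<and> p \<in> O' \<and> O' \<inter> M \<subseteq> W0 \<and> smooth_gsection S O' E \<and>
     (\<forall>q\<in>O' \<inter> M. rep q (E' q) (E q))"
proof -
  have pM: "p \<in> M" using W openin_subset by force
  obtain O' E where O': "openin (stop S) O'" "p \<in> O'" "O' \<inter> M \<subseteq> W0" "smooth_gsection S O' E"
    "\<And>q. q \<in> O' \<inter> M \<Longrightarrow> related q (E' q) (E q)"
    using extend_gsection[OF W E'] by blast
  obtain U N T x e e' where fr: "p \<in> U" "coord_frame S U (N::'i set) x e" "T \<subseteq> N"
    "\<And>i q. i \<in> N - T \<Longrightarrow> q \<in> U \<inter> M \<Longrightarrow> x i q = 0" "coord_frame R (U \<inter> M) T x e'"
    "\<And>i q. i \<in> T \<Longrightarrow> q \<in> U \<inter> M \<Longrightarrow> push_tvec S q (e' i q) = e i q"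
    using pM by (rule submanifold_frame) blast
  note F = coord_frameD[OF fr(2)] and F' = R.coord_frameD[OF fr(5)]
  define D where "D = O' \<inter> U"
  have D: "openin (stop S) D" "p \<in> D" "D \<subseteq> O'" "D \<subseteq> U" using O' F(1) fr(1) by (auto simp: D_def)
  define \<eta> where "\<eta> i q = (0 :: 'a tvec, differential S q (x i))" for i q
  have s\<eta>: "smooth_gsection S D (\<eta> i)" if "i \<in> N - T" for i
    using smooth_cofield_restrict[OF smooth_cofield_differential[OF F(1) F(3)[of i]] D(4)] that
    by (simp add: smooth_gsection_def \<eta>_def smooth_field_zero)
  have snd_comb: "snd (\<Sum>i\<in>N - T. gscale (c i) (\<eta> i q)) = (\<Sum>i\<in>N - T. fscale (c i) (differential S q (x i)))"
    and fst_comb: "fst (\<Sum>i\<in>N - T. gscale (c i) (\<eta> i q)) = 0" for c q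
    by (simp_all add: snd_sum fst_sum \<eta>_def)
  have "c i = 0" if q: "q \<in> D" and z: "(\<Sum>i\<in>N - T. gscale (c i) (\<eta> i q)) = 0" and j: "i \<in> N - T" for q c i
  proof -
    have qU: "q \<in> U" using q D(4) by blast
    have "(\<Sum>j\<in>N - T. fscale (c j) (differential S q (x j))) (e i q) = 0"
      using z snd_comb[of c q] by (metis snd_zero zero_fun_apply)
    then have "(\<Sum>j\<in>N - T. c j * differential S q (x j) (e i q)) = 0" by (simp add: sum_fun_apply)
    also have "(\<Sum>j\<in>N - T. c j * differential S q (x j) (e i q)) = (\<Sum>j\<in>N - T. if j = i then c j else 0)"
      by (rule sum.cong) (use F(5)[OF qU, of i] F(8)[OF qU, of i] j in \<open>auto simp: differential_def\<close>)
    finally show ?thesis using j F(2) by simp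
  qed
  then have ind: "\<forall>q\<in>D. \<forall>c. (\<Sum>i\<in>N - T. gscale (c i) (\<eta> i q)) = 0 \<longrightarrow> (\<forall>i\<in>N - T. c i = 0)" by blast
  have K: "k \<in> conormal_vecs q \<Longrightarrow> k = (\<Sum>i\<in>N - T. gscale (snd k (e i q)) (\<eta> i q))"
    and \<eta>K: "i \<in> N - T \<Longrightarrow> \<eta> i q \<in> conormal_vecs q" if q: "q \<in> D \<inter> M" for q k i
  proof -
    have qU: "q \<in> U" and qM: "q \<in> M" using q D(4) by auto
    {
      assume k: "k \<in> conormal_vecs q"
      note kD = conormal_vecsD[OF k]
      have "snd k = (\<Sum>i\<in>N. fscale (snd k (e i q)) (differential S q (x i)))"
        by (rule coord_frame_expand_cotangent[OF fr(2) qU kD(2)])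
      also have "\<dots> = (\<Sum>i\<in>N - T. fscale (snd k (e i q)) (differential S q (x i)))"
      proof (rule sum.mono_neutral_right[OF F(2)])
        show "\<forall>i\<in>N - (N - T). fscale (snd k (e i q)) (differential S q (x i)) = 0"
        proof
          fix i assume "i \<in> N - (N - T)"
          then have i: "i \<in> T" by blast
          have "e' i q \<in> tangent R q" using F'(8) qU qM i by blast
          then have "snd k (e i q) = 0" using kD(3) fr(6)[OF i, of q] qU qM by fastforce
          then show "fscale (snd k (e i q)) (differential S q (x i)) = 0" by simp
        qed
      qed auto
      finally have sk: "snd k = (\<Sum>i\<in>N - T. fscale (snd k (e i q)) (differential S q (x i)))" .
      show "k = (\<Sum>i\<in>N - T. gscale (snd k (e i q)) (\<eta> i q))"
        by (rule prod_eqI, simp only: fst_comb kD(1), unfold snd_comb, rule sk)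
    }
    {
      assume i: "i \<in> N - T"
      have van: "vanishes_near S M q (x i)"
        unfolding vanishes_near_def using F(1) qU fr(4)[OF i] by (intro exI[of _ U]) auto
      show "\<eta> i q \<in> conormal_vecs q"
        unfolding \<eta>_def
        by (rule conormal_vecsI[OF differential_cotangent qM])
           (use push_vanishing[OF _ qM F(7)[OF qU] van] push_tangent[OF _ qM] i in \<open>simp add: differential_def\<close>)
    }
  qed
  have "finite (N - T)" using F(2) by blast
  from gram_schmidt[OF D(1) this s\<eta> ind smooth_gsection_restrict[OF O'(4) D(3)]]
  obtain c where c: "\<And>i. i \<in> N - T \<Longrightarrow> c i \<in> sfun S D"
    "\<And>q j. q \<in> D \<Longrightarrow> j \<in> N - T \<Longrightarrow> pairing (G q (E q - (\<Sum>i\<in>N - T. gscale (c i q) (\<eta> i q)))) (conj_gvec (\<eta> j q)) = 0"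
    by blast
  define H where "H q = E q - (\<Sum>i\<in>N - T. gscale (c i q) (\<eta> i q))" for q
  have sH: "smooth_gsection S D H" unfolding H_def
    by (intro smooth_gsection_diff smooth_gsection_sum smooth_gsection_scale D(1) c(1) s\<eta>
         smooth_gsection_restrict[OF O'(4) D(3)])
  have "rep q (E' q) (H q)" if q: "q \<in> D \<inter> M" for q
  proof -
    have qS: "q \<in> topspace (stop S)" using q M_subset by blast
    have "(\<Sum>i\<in>N - T. gscale (c i q) (\<eta> i q)) \<in> conormal_vecs q"
      by (intro gvs.subspace_sum[OF conormal_vecs_subspace] gvs.subspace_scale[OF conormal_vecs_subspace] \<eta>K[OF q])
    then have "related q 0 (\<Sum>i\<in>N - T. gscale (c i q) (\<eta> i q))" by (simp add: conormal_vecs_def)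
    moreover have "q \<in> O' \<inter> M" using q D(3) by blast
    ultimately have 1: "related q (E' q) (H q)"
      using related_diff[OF O'(5)] unfolding H_def by fastforce
    have GH: "G q (H q) \<in> gfibre S q" using so_sectionD(1)[OF so(3) qS relatedD(2)[OF 1]] .
    have "pairing (G q (H q)) k = 0" if k: "k \<in> conormal_vecs q" for k
    proof -
      have ck: "conj_gvec k \<in> conormal_vecs q" using conormal_vecs_conj[OF k] .
      define b where "b i = snd (conj_gvec k) (e i q)" for i
      have "conj_gvec k = (\<Sum>i\<in>N - T. gscale (b i) (\<eta> i q))" unfolding b_def by (rule K[OF q ck])
      then have "conj_gvec (conj_gvec k) = (\<Sum>i\<in>N - T. gscale (cnj (b i)) (conj_gvec (\<eta> i q)))"
        by (simp add: conj_gvec_sum del: conj_gvec_simps(1))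
      then have kk: "k = (\<Sum>i\<in>N - T. gscale (cnj (b i)) (conj_gvec (\<eta> i q)))" by simp
      have \<eta>g: "conj_gvec (\<eta> i q) \<in> gfibre S q" if "i \<in> N - T" for i
        using conj_gfibre[OF conormal_gfibre[OF \<eta>K[OF q that]]] .
      have "pairing k (G q (H q)) = (\<Sum>i\<in>N - T. pairing (gscale (cnj (b i)) (conj_gvec (\<eta> i q))) (G q (H q)))"
        by (subst kk, rule pairing_sum[OF GH]) (use \<eta>g gfibre_closed(3) in blast)
      also have "\<dots> = 0"
      proof (rule sum.neutral, rule ballI)
        fix i assume i: "i \<in> N - T"
        have "pairing (conj_gvec (\<eta> i q)) (G q (H q)) = 0"
          unfolding H_def using c(2)[of q i] q i by (subst pairing_sym) blast
        then show "pairing (gscale (cnj (b i)) (conj_gvec (\<eta> i q))) (G q (H q)) = 0"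
          using pairing_scale[OF \<eta>g[OF i] GH] by simp
      qed
      finally show ?thesis by (subst pairing_sym)
    qed
    then show ?thesis using 1 by (simp add: rep_def)
  qed
  then show ?thesis using D sH O'(3) by (intro exI[of _ D] exI[of _ H]) auto
qed

lemma rep_exists:
  assumes p: "p \<in> M" and E': "E' \<in> gfibre R p" shows "\<exists>E. rep p E' E"
proof -
  obtain U N T x e e' where fr: "p \<in> U" "coord_frame R (U \<inter> M) (T::'i set) x e'"
    using p by (rule submanifold_frame) blast
  obtain F where F: "smooth_gsection R (U \<inter> M) F" "F p = E'"
    using R.gsection_through_gvec[OF fr(2) _ E'] fr(1) p by blast
  have "openin (stop R) (U \<inter> M)" "p \<in> U \<inter> M" using R.coord_frameD(1)[OF fr(2)] fr(1) p by auto
  from rep_section[OF this F(1)] show ?thesis using F(2) p by blast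
qed

end

context kahler_reduction
begin

lemma M_top: "p \<in> M \<Longrightarrow> p \<in> topspace (stop S)"
  using M_subset by blast

text \<open>Representatives split into their parts in \<open>ker \<psi>\<close> and its conjugate without leaving the
  representatives, because these are stable under \<open>B\<close>.\<close>

lemma rep_split:
  assumes p: "p \<in> M" and r: "rep p E' E"
  obtains E1' E1 E2' E2 where "E' = E1' + E2'" "E = E1 + E2" "rep p E1' E1" "rep p E2' E2"
    "E1 \<in> L p" "conj_gvec E2 \<in> L p"
proof -
  note pS = M_top[OF p] and E = rep_gfibre(1)[OF r]
  obtain F' where F': "rep p F' (B p E)" using rep_B[OF p r] by blast
  define E1' where "E1' = gscale (1/2) (E' + gscale \<i> F')"
  have 1: "rep p E1' (eigenproj B p E)"
    unfolding E1'_def eigenproj_def by (intro rep_scale rep_add p r F')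
  have 2: "rep p (E' - E1') (E - eigenproj B p E)"
    using rep_add[OF p r rep_scale[OF p 1, of "-1"]] by simp
  show ?thesis
  proof (rule that[OF _ _ 1 2])
    show "eigenproj B p E \<in> L p" "conj_gvec (E - eigenproj B p E) \<in> L p"
      using eigenproj_eigenbundle[OF so(2) pS B_B[OF pS E] E] eigenproj_conj_eigenbundle[OF so(2) pS B_B[OF pS E] E]
        eigenbundle_B[OF pS] by simp_all
  qed simp_all
qed

lemma L_reduces:
  assumes r: "related p E' E" and E: "E \<in> L p" and p: "p \<in> M"
  shows "E' \<in> spinor_ker R \<psi>\<^sub>M p"
proof -
  have "clifford E' (\<psi>\<^sub>M p) us = 0" if us: "set us \<subseteq> tangent R p" for us
  proof -
    have "set (map (push_tvec S p) us) \<subseteq> tangent S p" using us push_tangent[OF _ p] by auto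
    then have "clifford E (\<psi> p) (map (push_tvec S p) us) = 0" using E unfolding spinor_ker_def by blast
    then show ?thesis using clifford_pull[OF r us] by simp
  qed
  then show ?thesis using relatedD(1)[OF r] unfolding spinor_ker_def by blast
qed

text \<open>For \<open>k\<close> in both spaces \<open>G k = \<i> A k\<close> is conormal as well, and conormal vectors are orthogonal to each
  other; so \<open>\<langle>G k, conj k\<rangle> = 0\<close>.\<close>

lemma conormal_meets_L:
  assumes p: "p \<in> M" and k: "k \<in> conormal_vecs p" "k \<in> L p" shows "k = 0"
proof (rule ccontr)
  assume "k \<noteq> 0"
  note pS = M_top[OF p] and kg = conormal_gfibre[OF k(1)]
  have "G p k = gscale \<i> (A p k)"
    using B_on_L[OF pS k(2)] so_sectionD(3)[OF so(1) pS kg, of "- \<i>"]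
    unfolding G_def by (simp only: gvs.scale_minus_left minus_minus)
  then have "related p 0 (G p k)"
    using related_scale[of p 0 "A p k" \<i>] A_conormal[OF p k(1)] by (simp add: conormal_vecs_def)
  from conormal_vecs_pairing[OF conormal_vecs_conj[OF k(1)] this] G_hermitian_pos[OF pS kg \<open>k \<noteq> 0\<close>]
  show False by simp
qed

text \<open>\<open>TX = TM + pr(ker \<psi>)\<close>: a covector annihilating the right-hand side would be a conormal vector
  orthogonal to the maximal isotropic space \<open>ker \<psi>\<close>, hence in it.\<close>

lemma tangent_decomposition:
  assumes p: "p \<in> M" and v: "v \<in> tangent S p"
  shows "\<exists>u\<in>tangent R p. \<exists>l\<in>L p. v = push_tvec S p u + fst l"
proof (rule ccontr)
  assume neg: "\<not> ?thesis"
  note pS = M_top[OF p]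
  define Q where "Q = {push_tvec S p u + fst l |u l. u \<in> tangent R p \<and> l \<in> L p}"
  note Ls = L_subspace[OF pS]
  have "fvs.subspace Q"
  proof (rule fvs.subspaceI)
    show "0 \<in> Q" unfolding Q_def mem_Collect_eq
      using R.tangent_closed(1) gvs.subspace_0[OF Ls] by (intro exI[of _ 0]) auto
    show "a + b \<in> Q" if ab: "a \<in> Q" "b \<in> Q" for a b
    proof -
      obtain u l u' l' where *: "u \<in> tangent R p" "l \<in> L p" "a = push_tvec S p u + fst l"
        "u' \<in> tangent R p" "l' \<in> L p" "b = push_tvec S p u' + fst l'" using ab unfolding Q_def by blast
      have "a + b = push_tvec S p (u + u') + fst (l + l')" unfolding * push_linear fst_add by (simp only: ac_simps)
      then show ?thesis unfolding Q_def mem_Collect_eq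
        using R.tangent_closed(2)[OF *(1,4)] gvs.subspace_add[OF Ls *(2,5)] by blast
    qed
    show "fscale c a \<in> Q" if a: "a \<in> Q" for c a
    proof -
      obtain u l where *: "u \<in> tangent R p" "l \<in> L p" "a = push_tvec S p u + fst l" using a unfolding Q_def by blast
      have "fscale c a = push_tvec S p (fscale c u) + fst (gscale c l)"
        unfolding * push_linear gscale_sel fvs.scale_right_distrib ..
      then show ?thesis unfolding Q_def mem_Collect_eq
        using R.tangent_closed(3)[OF *(1)] gvs.subspace_scale[OF Ls *(2)] by blast
    qed
  qed
  moreover have "Q \<subseteq> tangent S p"
    unfolding Q_def using push_tangent[OF _ p] gfibreD(1)[OF spinor_ker_gfibre] tangent_closed(2) by blast
  moreover have "v \<notin> Q" using neg unfolding Q_def by blast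
  ultimately obtain \<eta> where \<eta>: "\<eta> \<in> cotangent S p" "\<And>w. w \<in> Q \<Longrightarrow> \<eta> w = 0" "\<eta> v \<noteq> 0"
    using cotangent_separates[of Q p v] v by blast
  have uQ: "push_tvec S p u \<in> Q" if "u \<in> tangent R p" for u
    unfolding Q_def mem_Collect_eq
    by (rule exI[of _ u], rule exI[of _ 0]) (use that gvs.subspace_0[OF Ls] in simp)
  have lQ: "fst l \<in> Q" if "l \<in> L p" for l
    unfolding Q_def mem_Collect_eq
    by (rule exI[of _ 0], rule exI[of _ l]) (use that R.tangent_closed(1) in simp)
  have k: "(0, \<eta>) \<in> conormal_vecs p" using conormal_vecsI[OF \<eta>(1) p] \<eta>(2) uQ by blast
  note kg = conormal_gfibre[OF k]
  obtain E1 E2 where E: "(0, \<eta>) = E1 + E2" "E1 \<in> L p" "conj_gvec E2 \<in> L p"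
    using kg spinor_split(2)[OF pS] by (auto simp: mem_conj_image_iff)
  note g1 = spinor_ker_gfibre[OF E(2)]
  have g2: "E2 \<in> gfibre S p" using conj_gfibre[OF spinor_ker_gfibre[OF E(3)]] by simp
  have "E2 = 0"
  proof (rule pairing_nondegenerate[OF g2])
    fix F assume "F \<in> gfibre S p"
    then obtain F1 F2 where F: "F = F1 + F2" "F1 \<in> L p" "conj_gvec F2 \<in> L p"
      using spinor_split(2)[OF pS] by (auto simp: mem_conj_image_iff)
    note f1 = spinor_ker_gfibre[OF F(2)]
    have f2: "F2 \<in> gfibre S p" using conj_gfibre[OF spinor_ker_gfibre[OF F(3)]] by simp
    have "pairing (0, \<eta>) F1 = 0"
      using \<eta>(2)[OF lQ[OF F(2)]] cotangent_0[OF gfibreD(2)[OF f1]] by (simp add: pairing_def)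
    then have "pairing E2 F1 = 0"
      using pairing_add[OF g1 g2 f1] E(1) L_isotropic[OF pS E(2) F(2)] by simp
    moreover have "cnj (pairing E2 F2) = 0"
      using pairing_conj[of E2 F2] L_isotropic[OF pS E(3) F(3)] by simp
    ultimately show "pairing E2 F = 0" using pairing_add2[OF f1 f2 g2] F(1) by simp
  qed
  then have "(0, \<eta>) \<in> L p" using E by simp
  from conormal_meets_L[OF p k this] have "\<eta> = 0" by (simp add: prod_eq_iff)
  then show False using \<eta>(3) by simp
qed

lemma formM: "smooth_form R (topspace (stop R)) \<psi>\<^sub>M"
  using smooth_form_pull[OF form] .

text \<open>The kernel of the pulled-back spinor is the reduction of \<open>ker \<psi>\<close>. A larger kernel would contain
  two vectors with non-zero pairing, and then the Clifford relation makes the pulled-back spinor, hence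
  \<open>\<psi>\<close> itself, vanish at the point.\<close>

lemma spinor_ker_reduction:
  assumes p: "p \<in> M" and r: "rep p E' E"
  shows "E' \<in> spinor_ker R \<psi>\<^sub>M p \<longleftrightarrow> E \<in> L p"
proof
  assume "E \<in> L p"
  then show "E' \<in> spinor_ker R \<psi>\<^sub>M p" using L_reduces[OF rep_related[OF r] _ p] by blast
next
  assume E': "E' \<in> spinor_ker R \<psi>\<^sub>M p"
  note pS = M_top[OF p]
  have pR: "p \<in> topspace (stop R)" using p by simp
  obtain E1' E1 E2' E2 where d: "E' = E1' + E2'" "E = E1 + E2" "rep p E1' E1" "rep p E2' E2"
    "E1 \<in> L p" "conj_gvec E2 \<in> L p" using p r by (rule rep_split)
  have "E1' \<in> spinor_ker R \<psi>\<^sub>M p" using L_reduces[OF rep_related[OF d(3)] d(5) p] .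
  then have k2: "E2' \<in> spinor_ker R \<psi>\<^sub>M p"
    using gvs.subspace_diff[OF R.spinor_ker_subspace[OF formM pR] E'] d(1) by fastforce
  have "E2' = 0"
  proof (rule ccontr)
    assume "E2' \<noteq> 0"
    then obtain F' where F': "F' \<in> gfibre R p" "pairing E2' F' \<noteq> 0"
      using R.pairing_nondegenerate[OF rep_gfibre(2)[OF d(4)]] by blast
    obtain F where F: "rep p F' F" using rep_exists[OF p F'(1)] by blast
    obtain F1' F1 F2' F2 where f: "F' = F1' + F2'" "F = F1 + F2" "rep p F1' F1" "rep p F2' F2"
      "F1 \<in> L p" "conj_gvec F2 \<in> L p" using p F by (rule rep_split)
    have "cnj (pairing E2 F2) = 0" using pairing_conj[of E2 F2] L_isotropic[OF pS d(6) f(6)] by simp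
    then have "pairing E2' F2' = 0" using related_pairing[OF rep_related[OF d(4)] rep_related[OF f(4)]] by simp
    then have nz: "pairing E2' F1' \<noteq> 0"
      using F'(2) f(1) R.pairing_add2[OF rep_gfibre(2)[OF f(3)] rep_gfibre(2)[OF f(4)] rep_gfibre(2)[OF d(4)]] by simp
    have k1: "F1' \<in> spinor_ker R \<psi>\<^sub>M p" using L_reduces[OF rep_related[OF f(3)] f(5) p] .
    have zero: "\<psi>\<^sub>M p us = 0" if us: "set us \<subseteq> tangent R p" for us
    proof -
      have c0: "clifford X (clifford Y (\<psi>\<^sub>M p)) us = 0" if X: "X \<in> spinor_ker R \<psi>\<^sub>M p" and Y: "Y \<in> spinor_ker R \<psi>\<^sub>M p" for X Y
      proof -
        have Yz: "clifford Y (\<psi>\<^sub>M p) ws = 0" if "set ws \<subseteq> tangent R p" for ws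
          using Y that unfolding spinor_ker_def by blast
        have "fst X \<in> tangent R p" using R.gfibreD(1)[OF R.spinor_ker_gfibre[OF X]] .
        then have "clifford Y (\<psi>\<^sub>M p) (fst X # us) = 0" using Yz us by simp
        moreover have "clifford Y (\<psi>\<^sub>M p) (del_nth i us) = 0" for i
          using Yz[OF order_trans[OF set_del_nth us]] .
        ultimately show ?thesis unfolding clifford_def[of X] by simp
      qed
      have "\<psi>\<^sub>M p (fst F1' # fst E2' # us) = - \<psi>\<^sub>M p (fst E2' # fst F1' # us)"
        using R.form_swap[OF formM pR, of "[]" us "fst F1'" "fst E2'"] us
          R.gfibreD(1)[OF rep_gfibre(2)[OF f(3)]] R.gfibreD(1)[OF rep_gfibre(2)[OF d(4)]] by simp
      from clifford_relation[of "\<psi>\<^sub>M p", OF this] show ?thesis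
        using c0[OF k2 k1] c0[OF k1 k2] nz by simp
    qed
    have z: "\<psi> p ws = 0" if "set ws \<subseteq> tangent S p" for ws
      using spinor_eq_0_of_pull_eq_0[OF form p tangent_decomposition[OF p] zero that] .
    have allL: "H \<in> L p" if H: "H \<in> gfibre S p" for H
    proof -
      have "clifford H (\<psi> p) vs = 0" if vs: "set vs \<subseteq> tangent S p" for vs
      proof -
        have "\<psi> p (fst H # vs) = 0" using z gfibreD(1)[OF H] vs by simp
        moreover have "\<psi> p (del_nth i vs) = 0" for i using z[OF order_trans[OF set_del_nth vs]] .
        ultimately show ?thesis by (simp add: clifford_def)
      qed
      then show ?thesis using H unfolding spinor_ker_def by blast
    qed
    have "conj_gvec E2 \<in> L p \<inter> conj_gvec ` L p"
      using d(6) allL[OF rep_gfibre(1)[OF d(4)]] by auto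
    then have "E2 = 0" using spinor_split(1)[OF pS] by simp
    then have "E2' = 0" using rep_unique2[OF d(4)] related_zero d(4) unfolding rep_def using related_unique by blast
    then show False using \<open>E2' \<noteq> 0\<close> by simp
  qed
  moreover have "rep p 0 0" using rep_scale[OF p r, of 0] by simp
  ultimately have "E2 = 0" using rep_unique[OF p] d(4) by blast
  then show "E \<in> L p" using d by simp
qed

lemma spinor_split_M:
  assumes p: "p \<in> M"
  shows "spinor_ker R \<psi>\<^sub>M p \<inter> conj_gvec ` spinor_ker R \<psi>\<^sub>M p = {0}"
    and "gfibre R p = {E + F |E F. E \<in> spinor_ker R \<psi>\<^sub>M p \<and> F \<in> conj_gvec ` spinor_ker R \<psi>\<^sub>M p}"
proof -
  note pS = M_top[OF p]
  have pR: "p \<in> topspace (stop R)" using p by simp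
  let ?L' = "spinor_ker R \<psi>\<^sub>M p"
  note sub = R.spinor_ker_subspace[OF formM pR]
  show "?L' \<inter> conj_gvec ` ?L' = {0}"
  proof (intro equalityI subsetI)
    fix E' assume "E' \<in> ?L' \<inter> conj_gvec ` ?L'"
    then have E': "E' \<in> ?L'" "conj_gvec E' \<in> ?L'" by (auto simp: mem_conj_image_iff)
    obtain E where E: "rep p E' E" using rep_exists[OF p R.spinor_ker_gfibre[OF E'(1)]] by blast
    have "E \<in> L p" "conj_gvec E \<in> L p"
      using spinor_ker_reduction[OF p E] spinor_ker_reduction[OF p rep_conj[OF p E]] E' by blast+
    then have "E \<in> L p \<inter> conj_gvec ` L p" by (simp add: mem_conj_image_iff)
    then have "E = 0" using spinor_split(1)[OF pS] by blast
    then have "E' = 0" using related_unique[OF rep_related[OF E]] related_zero by blast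
    then show "E' \<in> {0}" by simp
  next
    fix E' :: "'a gvec" assume "E' \<in> {0}"
    then show "E' \<in> ?L' \<inter> conj_gvec ` ?L'" using gvs.subspace_0[OF sub] by (simp add: mem_conj_image_iff)
  qed
  show "gfibre R p = {E + F |E F. E \<in> ?L' \<and> F \<in> conj_gvec ` ?L'}"
  proof (intro equalityI subsetI)
    fix E' assume "E' \<in> gfibre R p"
    then obtain E where "rep p E' E" using rep_exists[OF p] by blast
    with p obtain E1' E1 E2' E2 where d: "E' = E1' + E2'" "rep p E1' E1" "rep p E2' E2" "E1 \<in> L p" "conj_gvec E2 \<in> L p"
      by (rule rep_split)
    have "E1' \<in> ?L'" "conj_gvec E2' \<in> ?L'"
      using spinor_ker_reduction[OF p d(2)] spinor_ker_reduction[OF p rep_conj[OF p d(3)]] d(4,5) by blast+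
    then show "E' \<in> {E + F |E F. E \<in> ?L' \<and> F \<in> conj_gvec ` ?L'}"
      using d(1) unfolding mem_Collect_eq mem_conj_image_iff by blast
  next
    fix E' assume "E' \<in> {E + F |E F. E \<in> ?L' \<and> F \<in> conj_gvec ` ?L'}"
    then obtain E F where "E' = E + F" "E \<in> ?L'" "conj_gvec F \<in> ?L'" unfolding mem_conj_image_iff by blast
    then show "E' \<in> gfibre R p"
      using R.gfibre_closed(2)[OF R.spinor_ker_gfibre R.conj_gfibre[OF R.spinor_ker_gfibre]] by fastforce
  qed
qed

subsection \<open>The induced endomorphisms\<close>

abbreviation A\<^sub>M where "A\<^sub>M \<equiv> induced_endo S A M"
abbreviation B\<^sub>M where "B\<^sub>M \<equiv> spinor_endo R \<psi>\<^sub>M"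
definition G\<^sub>M :: "'a gendo" where "G\<^sub>M p E = - A\<^sub>M p (B\<^sub>M p E)"

lemma induced_related:
  assumes p: "p \<in> M" and r: "related p E' E"
  shows "related p (A\<^sub>M p E') (A p E)"
proof -
  note pS = M_top[OF p]
  obtain F' where F': "related p F' (A p E)" using A_related[OF p r] by blast
  have "A\<^sub>M p E' = F'"
    unfolding induced_endo_def
  proof (rule the_equality)
    obtain X where X: "X \<in> mixed_fibre S M p" "mixed_incl S p X = E" "mixed_proj S M p X = E'"
      using r mixed_related[OF p] by blast
    obtain Y where Y: "Y \<in> mixed_fibre S M p" "mixed_incl S p Y = A p E" "mixed_proj S M p Y = F'"
      using F' mixed_related[OF p] by blast
    show "\<exists>X\<in>mixed_fibre S M p. \<exists>Y\<in>mixed_fibre S M p. mixed_proj S M p X = E' \<and>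
        A p (mixed_incl S p X) = mixed_incl S p Y \<and> mixed_proj S M p Y = F'"
      using X Y by metis
    fix H' assume "\<exists>X\<in>mixed_fibre S M p. \<exists>Y\<in>mixed_fibre S M p. mixed_proj S M p X = E' \<and>
        A p (mixed_incl S p X) = mixed_incl S p Y \<and> mixed_proj S M p Y = H'"
    then obtain X Y where XY: "X \<in> mixed_fibre S M p" "Y \<in> mixed_fibre S M p" "mixed_proj S M p X = E'"
      "A p (mixed_incl S p X) = mixed_incl S p Y" "mixed_proj S M p Y = H'" by blast
    have rX: "related p E' (mixed_incl S p X)" using XY mixed_related[OF p] by blast
    have rY: "related p H' (A p (mixed_incl S p X))" using XY mixed_related[OF p] by metis
    have "related p 0 (mixed_incl S p X - E)" using related_diff[OF rX r] by simp
    then have "related p 0 (A p (mixed_incl S p X - E))"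
      using A_conormal[OF p] by (simp add: conormal_vecs_def)
    then have "related p 0 (A p (mixed_incl S p X) - A p E)"
      using so_section_diff[OF so(1) pS relatedD(2)[OF rX] relatedD(2)[OF r]] by simp
    from related_unique[OF this related_diff[OF rY F']] show "H' = F'" by simp
  qed
  then show ?thesis using F' by simp
qed

lemma rep_A\<^sub>M: "p \<in> M \<Longrightarrow> rep p E' E \<Longrightarrow> rep p (A\<^sub>M p E') (A p E)"
  using rep_A induced_related related_unique rep_related by metis

lemma rep_B\<^sub>M:
  assumes p: "p \<in> M" and r: "rep p E' E" shows "rep p (B\<^sub>M p E') (B p E)"
proof -
  note pS = M_top[OF p]
  have pR: "p \<in> topspace (stop R)" using p by simp
  obtain E1' E1 E2' E2 where d: "E' = E1' + E2'" "E = E1 + E2" "rep p E1' E1" "rep p E2' E2"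
    "E1 \<in> L p" "conj_gvec E2 \<in> L p" using p r by (rule rep_split)
  have "E1' \<in> spinor_ker R \<psi>\<^sub>M p" "conj_gvec E2' \<in> spinor_ker R \<psi>\<^sub>M p"
    using spinor_ker_reduction[OF p d(3)] spinor_ker_reduction[OF p rep_conj[OF p d(4)]] d(5,6) by blast+
  then have "B\<^sub>M p E' = gscale (- \<i>) E1' + gscale \<i> E2'"
    unfolding d(1) by (rule R.spinor_endo_eq[OF R.spinor_ker_subspace[OF formM pR] spinor_split_M(1)[OF p]])
  moreover have "B p E = gscale (- \<i>) E1 + gscale \<i> E2"
    unfolding d(2) by (rule spinor_endo_eq[OF L_subspace[OF pS] spinor_split(1)[OF pS] d(5,6)])
  ultimately show ?thesis by (simp only: rep_add[OF p rep_scale[OF p d(3)] rep_scale[OF p d(4)]])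
qed

lemma rep_G\<^sub>M:
  assumes p: "p \<in> M" and r: "rep p E' E" shows "rep p (G\<^sub>M p E') (G p E)"
  using rep_scale[OF p rep_A\<^sub>M[OF p rep_B\<^sub>M[OF p r]], of "-1"] by (simp add: G\<^sub>M_def G_def)

text \<open>An identity in the fibre over \<open>M\<close> may be checked on representatives, since a vector is determined by
  any of its representatives.\<close>

lemma linear_descends:
  assumes p: "p \<in> M" and C: "so_section S C" and all: "\<forall>E' E. rep p E' E \<longrightarrow> rep p (C' p E') (C p E)"
    and E': "E' \<in> gfibre R p"
  shows "C' p E' \<in> gfibre R p" "C' p (conj_gvec E') = conj_gvec (C' p E')" "C' p (gscale c E') = gscale c (C' p E')"
    "F' \<in> gfibre R p \<Longrightarrow> C' p (E' + F') = C' p E' + C' p F'"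
proof -
  have C': "rep p (C' p E') (C p E)" if "rep p E' E" for E' E using all that by blast
  obtain E where E: "rep p E' E" using rep_exists[OF p E'] by blast
  note D = so_sectionD[OF C M_top[OF p]] and Eg = rep_gfibre(1)[OF E]
  show "C' p E' \<in> gfibre R p" using rep_gfibre(2)[OF C'[OF E]] .
  have "rep p (C' p (conj_gvec E')) (conj_gvec (C p E))"
    using C'[OF rep_conj[OF p E]] D(2)[OF Eg] by simp
  then show "C' p (conj_gvec E') = conj_gvec (C' p E')"
    using rep_unique2[OF _ rep_conj[OF p C'[OF E]]] by blast
  have "rep p (C' p (gscale c E')) (gscale c (C p E))"
    using C'[OF rep_scale[OF p E]] D(3)[OF Eg] by simp
  then show "C' p (gscale c E') = gscale c (C' p E')"
    using rep_unique2[OF _ rep_scale[OF p C'[OF E]]] by blast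
  assume "F' \<in> gfibre R p"
  then obtain F where F: "rep p F' F" using rep_exists[OF p] by blast
  have "rep p (C' p (E' + F')) (C p E + C p F)"
    using C'[OF rep_add[OF p E F]] D(4)[OF Eg rep_gfibre(1)[OF F]] by simp
  then show "C' p (E' + F') = C' p E' + C' p F'"
    using rep_unique2[OF _ rep_add[OF p C'[OF E] C'[OF F]]] by blast
qed

text \<open>Orthogonality, reality and smoothness descend along \<open>rep\<close>; the determinant is found separately
  from an eigenbasis.\<close>

lemma so_section_descends:
  assumes C: "so_section S C" and C': "\<And>p E' E. p \<in> M \<Longrightarrow> rep p E' E \<Longrightarrow> rep p (C' p E') (C p E)"
    and det: "\<And>p. p \<in> M \<Longrightarrow> has_det (gfibre R p) (C' p) 1"
  shows "so_section R C'"
  unfolding so_section_def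
proof (intro conjI ballI allI impI)
  fix p assume "p \<in> topspace (stop R)"
  then have p: "p \<in> M" by simp
  note pS = M_top[OF p]
  have all: "\<forall>E' E. rep p E' E \<longrightarrow> rep p (C' p E') (C p E)" using C'[OF p] by blast
  note lin = linear_descends[where C' = C', OF p C all]
  show "has_det (gfibre R p) (C' p) 1" using det[OF p] .
  fix E' assume E': "E' \<in> gfibre R p"
  show "C' p E' \<in> gfibre R p" "C' p (conj_gvec E') = conj_gvec (C' p E')"
    "\<And>c. C' p (gscale c E') = gscale c (C' p E')" using lin(1-3)[OF E'] by blast+
  fix F' assume F': "F' \<in> gfibre R p"
  show "C' p (E' + F') = C' p E' + C' p F'" using lin(4)[OF E' F'] .
  obtain E F where E: "rep p E' E" and F: "rep p F' F" using rep_exists[OF p E'] rep_exists[OF p F'] by blast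
  show "pairing (C' p E') (C' p F') = pairing E' F'"
    using related_pairing[OF rep_related[OF C'[OF p E]] rep_related[OF C'[OF p F]]]
      related_pairing[OF rep_related[OF E] rep_related[OF F]]
      so_sectionD(5)[OF C pS rep_gfibre(1)[OF E] rep_gfibre(1)[OF F]] by simp
next
  fix U E' assume U: "openin (stop R) U \<and> smooth_gsection R U E'"
  show "smooth_gsection R U (\<lambda>q. C' q (E' q))"
  proof (rule R.smooth_gsection_local)
    fix p assume p: "p \<in> U"
    obtain O' E where O': "openin (stop S) O'" "p \<in> O'" "O' \<inter> M \<subseteq> U" "smooth_gsection S O' E"
      "\<And>q. q \<in> O' \<inter> M \<Longrightarrow> rep q (E' q) (E q)"
      using rep_section[of U p E'] U p by blast
    have pM: "p \<in> M" using U p openin_subset by force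
    have "smooth_gsection R (O' \<inter> M) (\<lambda>q. C' q (E' q))"
      by (rule smooth_gsection_descends[OF O'(1) so_section_smooth[OF C O'(1,4)]])
         (use rep_related[OF C'] O'(5) in blast)
    then show "\<exists>W. openin (stop R) W \<and> p \<in> W \<and> smooth_gsection R W (\<lambda>q. C' q (E' q))"
      using openin_subI[OF O'(1)] O'(2) pM by blast
  qed
qed

text \<open>A section of the eigenbundle on \<open>M\<close> extends to a section of the eigenbundle on \<open>X\<close>: extend it by
  representatives and project.\<close>

lemma involutive_descends:
  assumes C: "so_section S C" and sq: "\<And>p E. p \<in> topspace (stop S) \<Longrightarrow> E \<in> gfibre S p \<Longrightarrow> C p (C p E) = - E"
    and C': "\<And>p E' E. p \<in> M \<Longrightarrow> rep p E' E \<Longrightarrow> rep p (C' p E') (C p E)"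
    and inv: "courant_involutive S (eigenbundle S C)"
    and red: "\<And>p E' E. p \<in> M \<Longrightarrow> related p E' E \<Longrightarrow> E \<in> eigenbundle S C p \<Longrightarrow> E' \<in> eigenbundle R C' p"
  shows "courant_involutive R (eigenbundle R C')"
  unfolding courant_involutive_def
proof (intro allI impI ballI)
  fix U E' F' p
  assume U: "openin (stop R) U \<and> smooth_gsection R U E' \<and> smooth_gsection R U F' \<and>
      (\<forall>q\<in>U. E' q \<in> eigenbundle R C' q \<and> F' q \<in> eigenbundle R C' q)" and p: "p \<in> U"
  have pM: "p \<in> M" using U p openin_subset by force
  have ext: "\<exists>O' E. openin (stop S) O' \<and> p \<in> O' \<and> smooth_gsection S O' E \<and>
      (\<forall>q\<in>O'. E q \<in> eigenbundle S C q) \<and> (\<forall>q\<in>O' \<inter> M. related q (H' q) (E q))"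
    if H': "smooth_gsection R U H'" "\<And>q. q \<in> U \<Longrightarrow> H' q \<in> eigenbundle R C' q" for H'
  proof -
    obtain O' H where O': "openin (stop S) O'" "p \<in> O'" "O' \<inter> M \<subseteq> U" "smooth_gsection S O' H"
      "\<And>q. q \<in> O' \<inter> M \<Longrightarrow> rep q (H' q) (H q)"
      using rep_section[of U p H'] U p H'(1) by blast
    have fixed: "eigenproj C q (H q) = H q" if q: "q \<in> O' \<inter> M" for q
    proof (rule eigenproj_fixed)
      have qM: "q \<in> M" and qU: "q \<in> U" using q O'(3) by auto
      have e: "C' q (H' q) = gscale (- \<i>) (H' q)" using H'(2)[OF qU] by (simp only: eigenbundle_def mem_Collect_eq)
      have "rep q (gscale (- \<i>) (H' q)) (C q (H q))" using C'[OF qM O'(5)[OF q]] by (simp only: e)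
      from rep_unique[OF qM this rep_scale[OF qM O'(5)[OF q]]] show "C q (H q) = gscale (- \<i>) (H q)" .
    qed
    have "eigenproj C q (H q) \<in> eigenbundle S C q" if q: "q \<in> O'" for q
    proof -
      have qS: "q \<in> topspace (stop S)" using O'(1) openin_subset q by blast
      note Hq = smooth_gsectionD[OF O'(4) q]
      show ?thesis using eigenproj_eigenbundle[OF C qS sq[OF qS Hq] Hq] .
    qed
    moreover have "related q (H' q) (eigenproj C q (H q))" if "q \<in> O' \<inter> M" for q
      using fixed[OF that] rep_related[OF O'(5)[OF that]] by simp
    ultimately show ?thesis
      using O'(1,2) eigenproj_smooth[OF C O'(1,4)] by (intro exI[of _ O'] exI[of _ "\<lambda>q. eigenproj C q (H q)"]) auto
  qed
  obtain O1 E where E: "openin (stop S) O1" "p \<in> O1" "smooth_gsection S O1 E"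
    "\<And>q. q \<in> O1 \<Longrightarrow> E q \<in> eigenbundle S C q" "\<And>q. q \<in> O1 \<inter> M \<Longrightarrow> related q (E' q) (E q)"
    using ext[of E'] U by blast
  obtain O2 F where F: "openin (stop S) O2" "p \<in> O2" "smooth_gsection S O2 F"
    "\<And>q. q \<in> O2 \<Longrightarrow> F q \<in> eigenbundle S C q" "\<And>q. q \<in> O2 \<inter> M \<Longrightarrow> related q (F' q) (F q)"
    using ext[of F'] U by blast
  have o: "openin (stop S) (O1 \<inter> O2)" "p \<in> O1 \<inter> O2" using E F by auto
  have sE: "smooth_gsection S (O1 \<inter> O2) E" and sF: "smooth_gsection S (O1 \<inter> O2) F"
    using smooth_gsection_restrict E(3) F(3) by blast+
  have c: "courant S E F p \<in> eigenbundle S C p"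
    using inv[unfolded courant_involutive_def, rule_format, of "O1 \<inter> O2" E F p] o sE sF E(4) F(4) by blast
  have "related p (courant R E' F' p) (courant S E F p)"
  proof (rule courant_related[OF o pM sE _ sF])
    show "courant S E F p \<in> gfibre S p" using c by (simp add: eigenbundle_def)
  qed (use E(5) F(5) in blast)+
  from red[OF pM this c] show "courant R E' F' p \<in> eigenbundle R C' p" .
qed

lemma A\<^sub>M_A\<^sub>M: "p \<in> M \<Longrightarrow> E' \<in> gfibre R p \<Longrightarrow> A\<^sub>M p (A\<^sub>M p E') = - E'"
proof -
  assume p: "p \<in> M" and E': "E' \<in> gfibre R p"
  obtain E where E1: "rep p E' E" using rep_exists[OF p E'] by blast
  note E = E1 rep_A\<^sub>M[OF p rep_A\<^sub>M[OF p E1]]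
  from E(2) have "rep p (A\<^sub>M p (A\<^sub>M p E')) (- E)" using A_A[OF M_top[OF p] rep_gfibre(1)[OF E(1)]] by simp
  then show ?thesis using rep_unique2 rep_scale[OF p E(1), of "-1"] by simp
qed

lemma B\<^sub>M_B\<^sub>M: "p \<in> M \<Longrightarrow> E' \<in> gfibre R p \<Longrightarrow> B\<^sub>M p (B\<^sub>M p E') = - E'"
proof -
  assume p: "p \<in> M" and E': "E' \<in> gfibre R p"
  obtain E where E1: "rep p E' E" using rep_exists[OF p E'] by blast
  note E = E1 rep_B\<^sub>M[OF p rep_B\<^sub>M[OF p E1]]
  from E(2) have "rep p (B\<^sub>M p (B\<^sub>M p E')) (- E)" using B_B[OF M_top[OF p] rep_gfibre(1)[OF E(1)]] by simp
  then show ?thesis using rep_unique2 rep_scale[OF p E(1), of "-1"] by simp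
qed

lemma A\<^sub>M_B\<^sub>M: "p \<in> M \<Longrightarrow> E' \<in> gfibre R p \<Longrightarrow> A\<^sub>M p (B\<^sub>M p E') = B\<^sub>M p (A\<^sub>M p E')"
proof -
  assume p: "p \<in> M" and E': "E' \<in> gfibre R p"
  obtain E where E1: "rep p E' E" using rep_exists[OF p E'] by blast
  note E = E1 rep_A\<^sub>M[OF p rep_B\<^sub>M[OF p E1]]
  have "rep p (B\<^sub>M p (A\<^sub>M p E')) (A p (B p E))"
    using rep_B\<^sub>M[OF p rep_A\<^sub>M[OF p E(1)]] A_B[OF M_top[OF p] rep_gfibre(1)[OF E(1)]] by simp
  then show ?thesis using rep_unique2 E(2) by blast
qed

lemma G\<^sub>M_G\<^sub>M: "p \<in> M \<Longrightarrow> E' \<in> gfibre R p \<Longrightarrow> G\<^sub>M p (G\<^sub>M p E') = E'"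
proof -
  assume p: "p \<in> M" and E': "E' \<in> gfibre R p"
  obtain E where E1: "rep p E' E" using rep_exists[OF p E'] by blast
  note E = E1 rep_G\<^sub>M[OF p rep_G\<^sub>M[OF p E1]]
  from E(2) have "rep p (G\<^sub>M p (G\<^sub>M p E')) E" using G_G[OF M_top[OF p] rep_gfibre(1)[OF E(1)]] by simp
  then show ?thesis using rep_unique2 E(1) by blast
qed

lemma G\<^sub>M_pos:
  assumes p: "p \<in> M" and E': "E' \<in> gfibre R p" "conj_gvec E' = E'" "E' \<noteq> 0"
  shows "Re (pairing (G\<^sub>M p E') E') > 0"
proof -
  obtain E where E: "rep p E' E" using rep_exists[OF p E'(1)] by blast
  have "rep p E' (conj_gvec E)" using rep_conj[OF p E] by (simp only: E'(2))
  then have "conj_gvec E = E" using rep_unique[OF p _ E] by blast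
  moreover have "E \<noteq> 0"
  proof
    assume "E = 0"
    then have "related p E' 0" using rep_related[OF E] by simp
    then have "E' = 0" using related_unique related_zero by blast
    then show False using E'(3) by simp
  qed
  ultimately have "Re (pairing (G p E) E) > 0"
    using G_pos[OF M_top[OF p] rep_gfibre(1)[OF E]] by blast
  then show ?thesis using related_pairing[OF rep_related[OF rep_G\<^sub>M[OF p E]] rep_related[OF E]] by simp
qed

subsection \<open>Determinants\<close>

lemma rep_all:
  assumes "p \<in> M"
  shows "\<forall>E' E. rep p E' E \<longrightarrow> rep p (A\<^sub>M p E') (A p E)"
    "\<forall>E' E. rep p E' E \<longrightarrow> rep p (B\<^sub>M p E') (B p E)"
    "\<forall>E' E. rep p E' E \<longrightarrow> rep p (G\<^sub>M p E') (G p E)"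
  using rep_A\<^sub>M[OF assms] rep_B\<^sub>M[OF assms] rep_G\<^sub>M[OF assms] by blast+

text \<open>The eigenspace of the spinor endomorphism is a half of the fibre. On it \<open>G\<^sub>M\<close>, which commutes with \<open>B\<^sub>M\<close>
  and has square one, splits into eigenvectors for \<open>\<plusminus> 1\<close>; on these also \<open>A\<^sub>M\<close> is scalar. So one basis
  diagonalizes all three endomorphisms.\<close>

lemma common_eigenbasis:
  assumes p: "p \<in> M"
  obtains Bs \<epsilon> where "finite Bs" "gvs.independent Bs" "gvs.span Bs = spinor_ker R \<psi>\<^sub>M p"
    "\<And>b. b \<in> Bs \<Longrightarrow> B\<^sub>M p b = gscale (- \<i>) b"
    "\<And>b. b \<in> Bs \<Longrightarrow> G\<^sub>M p b = gscale (\<epsilon> b) b" "\<And>b. b \<in> Bs \<Longrightarrow> A\<^sub>M p b = gscale (- \<i> * \<epsilon> b) b"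
    "\<And>b. \<epsilon> b = 1 \<or> \<epsilon> b = (-1::complex)"
proof -
  note pS = M_top[OF p]
  have pR: "p \<in> topspace (stop R)" using p by simp
  let ?L' = "spinor_ker R \<psi>\<^sub>M p"
  note sub = R.spinor_ker_subspace[OF formM pR]
  have Lg: "b \<in> gfibre R p" if "b \<in> ?L'" for b using R.spinor_ker_gfibre[OF that] .
  have BL: "B\<^sub>M p b = gscale (- \<i>) b" if "b \<in> ?L'" for b
    using R.spinor_endo_eq[OF sub spinor_split_M(1)[OF p] that, of 0] gvs.subspace_0[OF sub] by simp
  have LB: "b \<in> ?L'" if b: "b \<in> gfibre R p" "B\<^sub>M p b = gscale (- \<i>) b" for b
  proof -
    obtain E where E: "rep p b E" using rep_exists[OF p b(1)] by blast
    have "rep p (gscale (- \<i>) b) (B p E)" using rep_B\<^sub>M[OF p E] by (simp only: b(2))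
    from rep_unique[OF p this rep_scale[OF p E]] have "E \<in> eigenbundle S B p"
      using rep_gfibre(1)[OF E] by (simp add: eigenbundle_def)
    then show ?thesis using spinor_ker_reduction[OF p E] eigenbundle_B[OF pS] by simp
  qed
  note GD = linear_descends[where C = G and C' = G\<^sub>M, OF p so(3) rep_all(3)[OF p]]
  note AD = linear_descends[where C = A and C' = A\<^sub>M, OF p so(1) rep_all(1)[OF p]]
  note BD = linear_descends[where C = B and C' = B\<^sub>M, OF p so(2) rep_all(2)[OF p]]
  have AG: "A\<^sub>M p (G\<^sub>M p b) = B\<^sub>M p b" if b: "b \<in> gfibre R p" for b
    using AD(3)[OF AD(1)[OF BD(1)[OF b]], of "-1"] A\<^sub>M_A\<^sub>M[OF p BD(1)[OF b]] by (simp add: G\<^sub>M_def)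
  have GL: "G\<^sub>M p b \<in> ?L'" if b: "b \<in> ?L'" for b
  proof (rule LB[OF GD(1)[OF Lg[OF b]]])
    note bg = Lg[OF b]
    have "B\<^sub>M p (G\<^sub>M p b) = - A\<^sub>M p (B\<^sub>M p (B\<^sub>M p b))"
      using BD(3)[OF AD(1)[OF BD(1)[OF bg]], of "-1"] A\<^sub>M_B\<^sub>M[OF p BD(1)[OF bg]] by (simp add: G\<^sub>M_def)
    also have "\<dots> = gscale (- \<i>) (G\<^sub>M p b)"
      unfolding BL[OF b] G\<^sub>M_def
      using BD(3)[OF bg, of "- \<i>"] AD(3)[OF BD(1)[OF bg], of "- \<i>"] BL[OF b] by simp
    finally show "B\<^sub>M p (G\<^sub>M p b) = gscale (- \<i>) (G\<^sub>M p b)" .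
  qed
  define P where "P s = {b \<in> ?L'. G\<^sub>M p b = gscale s b}" for s :: complex
  have Psub: "gvs.subspace (P s)" for s
  proof (rule gvs.subspaceI)
    show "0 \<in> P s" using gvs.subspace_0[OF sub] GD(3)[OF R.gfibre_closed(1), of 0] by (simp add: P_def)
    show "b + c \<in> P s" if "b \<in> P s" "c \<in> P s" for b c
      using that gvs.subspace_add[OF sub] GD(4)[OF Lg Lg] by (simp add: P_def gvs.scale_right_distrib)
    show "gscale c b \<in> P s" if "b \<in> P s" for c b
      using that gvs.subspace_scale[OF sub] GD(3)[OF Lg] by (simp add: P_def mult.commute)
  qed
  obtain U N T x e e' where fr: "p \<in> U" "coord_frame R (U \<inter> M) (T::'i set) x e'"
    using p by (rule submanifold_frame) blast
  obtain C where C: "finite C" "gvs.span C = gfibre R p"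
    using R.gfibre_basis[OF fr(2)] fr(1) p by blast
  have "\<exists>Bs. finite Bs \<and> gvs.independent Bs \<and> gvs.span Bs = P s" for s
  proof -
    obtain Bs where Bs: "Bs \<subseteq> P s" "gvs.independent Bs" "P s \<subseteq> gvs.span Bs" using gvs.basis_exists by metis
    have "Bs \<subseteq> gvs.span C" using Bs(1) Lg C(2) by (auto simp: P_def)
    then have "finite Bs" using gvs.independent_span_bound[OF C(1) Bs(2)] by blast
    moreover have "gvs.span Bs \<subseteq> P s" using gvs.span_minimal[OF Bs(1) Psub] .
    ultimately show ?thesis using Bs by blast
  qed
  then obtain Bp Bm where Bp: "finite Bp" "gvs.independent Bp" "gvs.span Bp = P 1"
    and Bm: "finite Bm" "gvs.independent Bm" "gvs.span Bm = P (-1)" by metis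
  have "gvs.span Bp \<inter> gvs.span Bm = {0}"
  proof (intro equalityI subsetI)
    fix b assume "b \<in> gvs.span Bp \<inter> gvs.span Bm"
    then have "gscale 1 b = gscale (-1) b" unfolding Bp(3) Bm(3) P_def by (metis (mono_tags, lifting) Int_iff mem_Collect_eq)
    moreover have "(1::complex) \<noteq> -1" by simp
    ultimately show "b \<in> {0}" using gvs.scale_cancel_right by blast
  qed (use gvs.span_zero in auto)
  note un = gvs.independent_union[OF Bp(1) Bm(1) Bp(2) Bm(2) this]
  have sp: "gvs.span (Bp \<union> Bm) = ?L'"
  proof (intro equalityI subsetI)
    fix b assume "b \<in> gvs.span (Bp \<union> Bm)"
    then obtain x y where "b = x + y" "x \<in> P 1" "y \<in> P (-1)" unfolding gvs.span_Un Bp(3) Bm(3) by blast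
    then show "b \<in> ?L'" using gvs.subspace_add[OF sub] by (simp add: P_def)
  next
    fix b assume b: "b \<in> ?L'"
    note bg = Lg[OF b] and Gb = GL[OF b]
    have h: "G\<^sub>M p (b + gscale s (G\<^sub>M p b)) = G\<^sub>M p b + gscale s b" for s
      using GD(4)[OF bg R.gfibre_closed(3)[OF Lg[OF Gb], of s]] GD(3)[OF Lg[OF Gb], of s] G\<^sub>M_G\<^sub>M[OF p bg] by simp
    have m: "gscale (1/2) (b + gscale s (G\<^sub>M p b)) \<in> P s" if s: "s * s = 1" for s
    proof -
      have L: "b + gscale s (G\<^sub>M p b) \<in> ?L'" by (intro gvs.subspace_add[OF sub] gvs.subspace_scale[OF sub] b Gb)
      have "G\<^sub>M p b + gscale s b = gscale s (b + gscale s (G\<^sub>M p b))"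
        using s by (simp add: gvs.scale_right_distrib add.commute)
      then show ?thesis
        unfolding P_def mem_Collect_eq
        using gvs.subspace_scale[OF sub L] GD(3)[OF Lg[OF L], of "1/2"] h[of s] by (simp add: mult.commute)
    qed
    have "b = gscale (1/2) (b + gscale 1 (G\<^sub>M p b)) + gscale (1/2) (b + gscale (-1) (G\<^sub>M p b))"
      by (auto simp: prod_eq_iff fun_eq_iff algebra_simps)
    then show "b \<in> gvs.span (Bp \<union> Bm)"
      unfolding gvs.span_Un Bp(3) Bm(3) mem_Collect_eq using m[of 1] m[of "-1"] by fastforce
  qed
  define \<epsilon> :: "'a gvec \<Rightarrow> complex" where "\<epsilon> b = (if b \<in> Bp then 1 else -1)" for b
  have inL: "b \<in> ?L'" and Geig: "G\<^sub>M p b = gscale (\<epsilon> b) b" if "b \<in> Bp \<union> Bm" for b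
  proof -
    have "b \<in> P (\<epsilon> b)" using that gvs.span_base[of b Bp] gvs.span_base[of b Bm] un(2) Bp(3) Bm(3) by (auto simp: \<epsilon>_def)
    then show "b \<in> ?L'" "G\<^sub>M p b = gscale (\<epsilon> b) b" by (simp_all add: P_def)
  qed
  have Aeig: "A\<^sub>M p b = gscale (- \<i> * \<epsilon> b) b" if b: "b \<in> Bp \<union> Bm" for b
  proof -
    have "A\<^sub>M p (gscale (\<epsilon> b) b) = gscale (- \<i>) b" using AG[OF Lg[OF inL[OF b]]] Geig[OF b] BL[OF inL[OF b]] by simp
    then have "gscale (\<epsilon> b) (A\<^sub>M p b) = gscale (- \<i>) b" using AD(3)[OF Lg[OF inL[OF b]]] by simp
    then have "gscale (\<epsilon> b) (gscale (\<epsilon> b) (A\<^sub>M p b)) = gscale (\<epsilon> b) (gscale (- \<i>) b)" by simp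
    moreover have "\<epsilon> b * \<epsilon> b = 1" by (simp add: \<epsilon>_def)
    ultimately show ?thesis by (simp add: mult.commute)
  qed
  show ?thesis
    by (rule that[OF _ un(1) sp BL[OF inL] Geig Aeig]) (use Bp(1) Bm(1) \<epsilon>_def in auto)
qed

lemma determinants:
  assumes p: "p \<in> M"
  shows "has_det (gfibre R p) (A\<^sub>M p) 1" "has_det (gfibre R p) (B\<^sub>M p) 1" "has_det (gfibre R p) (G\<^sub>M p) 1"
proof -
  obtain Bs \<epsilon> where b: "finite Bs" "gvs.independent Bs" "gvs.span Bs = spinor_ker R \<psi>\<^sub>M p"
    "\<And>b. b \<in> Bs \<Longrightarrow> B\<^sub>M p b = gscale (- \<i>) b"
    "\<And>b. b \<in> Bs \<Longrightarrow> G\<^sub>M p b = gscale (\<epsilon> b) b" "\<And>b. b \<in> Bs \<Longrightarrow> A\<^sub>M p b = gscale (- \<i> * \<epsilon> b) b"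
    "\<And>b. \<epsilon> b = 1 \<or> \<epsilon> b = -1" using common_eigenbasis[OF p] by blast
  have g: "b \<in> gfibre R p" if "b \<in> Bs" for b
    using that gvs.span_base[of b Bs] b(3) R.spinor_ker_gfibre by blast
  note det = has_det_1_of_eigenbasis[OF b(2,1), unfolded b(3), OF spinor_split_M[OF p]]
  show "has_det (gfibre R p) (A\<^sub>M p) 1"
  proof (rule det[of "A\<^sub>M p" "\<lambda>b. - \<i> * \<epsilon> b"])
    fix b assume "b \<in> Bs"
    then show "A\<^sub>M p b = gscale (- \<i> * \<epsilon> b) b \<and> A\<^sub>M p (conj_gvec b) = gscale (cnj (- \<i> * \<epsilon> b)) (conj_gvec b) \<and> cmod (- \<i> * \<epsilon> b) = 1"
      using b(6) b(7)[of b] linear_descends(2)[where C = A and C' = A\<^sub>M, OF p so(1) rep_all(1)[OF p] g] by (auto simp: norm_mult)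
  qed
  show "has_det (gfibre R p) (B\<^sub>M p) 1"
  proof (rule det[of "B\<^sub>M p" "\<lambda>b. - \<i>"])
    fix b assume "b \<in> Bs"
    then show "B\<^sub>M p b = gscale (- \<i>) b \<and> B\<^sub>M p (conj_gvec b) = gscale (cnj (- \<i>)) (conj_gvec b) \<and> cmod (- \<i>) = 1"
      using b(4) linear_descends(2)[where C = B and C' = B\<^sub>M, OF p so(2) rep_all(2)[OF p] g] by auto
  qed
  show "has_det (gfibre R p) (G\<^sub>M p) 1"
  proof (rule det[of "G\<^sub>M p" \<epsilon>])
    fix b assume "b \<in> Bs"
    then show "G\<^sub>M p b = gscale (\<epsilon> b) b \<and> G\<^sub>M p (conj_gvec b) = gscale (cnj (\<epsilon> b)) (conj_gvec b) \<and> cmod (\<epsilon> b) = 1"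
      using b(5) b(7)[of b] linear_descends(2)[where C = G and C' = G\<^sub>M, OF p so(3) rep_all(3)[OF p] g] by auto
  qed
qed

subsection \<open>The induced structure\<close>

lemma gen_complex_A\<^sub>M: "gen_complex R A\<^sub>M"
  unfolding gen_complex_def
proof (intro conjI ballI)
  show "so_section R A\<^sub>M" by (rule so_section_descends[OF so(1) rep_A\<^sub>M determinants(1)])
  show "A\<^sub>M p (A\<^sub>M p E) = - E" if "p \<in> topspace (stop R)" "E \<in> gfibre R p" for p E
    using A\<^sub>M_A\<^sub>M that by simp
  show "courant_involutive R (eigenbundle R A\<^sub>M)"
  proof (rule involutive_descends[OF so(1) A_A rep_A\<^sub>M])
    show "courant_involutive S (eigenbundle S A)"
      using gk by (simp add: gen_kahler_one_spinor_def gen_complex_def)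
    fix p E' E assume p: "p \<in> M" and r: "related p E' E" and E: "E \<in> eigenbundle S A p"
    have "related p (A\<^sub>M p E') (gscale (- \<i>) E)"
      using induced_related[OF p r] E by (simp only: eigenbundle_def mem_Collect_eq)
    from related_unique[OF this related_scale[OF r]] show "E' \<in> eigenbundle R A\<^sub>M p"
      using relatedD(1)[OF r] by (simp only: eigenbundle_def mem_Collect_eq)
  qed
qed

lemma gen_complex_B\<^sub>M: "gen_complex R B\<^sub>M"
  unfolding gen_complex_def
proof (intro conjI ballI)
  show "so_section R B\<^sub>M" by (rule so_section_descends[OF so(2) rep_B\<^sub>M determinants(2)])
  show "B\<^sub>M p (B\<^sub>M p E) = - E" if "p \<in> topspace (stop R)" "E \<in> gfibre R p" for p E
    using B\<^sub>M_B\<^sub>M that by simp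
  show "courant_involutive R (eigenbundle R B\<^sub>M)"
  proof (rule involutive_descends[OF so(2) B_B rep_B\<^sub>M])
    show "courant_involutive S (eigenbundle S B)"
      using gk by (simp add: gen_kahler_one_spinor_def gen_kahler_def gen_complex_def)
    fix p E' E assume p: "p \<in> M" and r: "related p E' E" and E: "E \<in> eigenbundle S B p"
    have pR: "p \<in> topspace (stop R)" using p by simp
    have "E' \<in> spinor_ker R \<psi>\<^sub>M p" using L_reduces[OF r _ p] E eigenbundle_B[OF M_top[OF p]] by simp
    then have "B\<^sub>M p (E' + 0) = gscale (- \<i>) E' + gscale \<i> 0"
      by (rule R.spinor_endo_eq[OF R.spinor_ker_subspace[OF formM pR] spinor_split_M(1)[OF p]])
         (simp add: gvs.subspace_0[OF R.spinor_ker_subspace[OF formM pR]])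
    then show "E' \<in> eigenbundle R B\<^sub>M p" using relatedD(1)[OF r] by (simp add: eigenbundle_def)
  qed
qed

lemma gen_metric_M: "gen_metric R G\<^sub>M"
  unfolding gen_metric_def
proof (intro conjI ballI impI)
  show "so_section R G\<^sub>M" by (rule so_section_descends[OF so(3) rep_G\<^sub>M determinants(3)])
qed (use G\<^sub>M_G\<^sub>M G\<^sub>M_pos in auto)

lemma pure_spinor_M: "pure_spinor R \<psi>\<^sub>M"
  unfolding pure_spinor_def
proof (intro conjI ballI)
  show "smooth_form R (topspace (stop R)) \<psi>\<^sub>M" by (rule formM)
  fix p assume pR: "p \<in> topspace (stop R)"
  then have p: "p \<in> M" by simp
  obtain U N T x e e' where fr: "p \<in> U" "coord_frame R (U \<inter> M) (T::'i set) x e'"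
    using p by (rule submanifold_frame) blast
  have pU: "p \<in> U \<inter> M" using fr(1) p by simp
  obtain Bs where "gvs.independent Bs" "gvs.span Bs = spinor_ker R \<psi>\<^sub>M p" "card Bs = card T"
    using R.conj_split_dim[OF fr(2) pU R.spinor_ker_subspace[OF formM pR] spinor_split_M[OF p]] by blast
  then show "gvs.dim (spinor_ker R \<psi>\<^sub>M p) = fvs.dim (tangent R p)"
    using gvs.dim_span_eq_card_independent[of Bs] R.tangent_dim[OF fr(2) pU] by simp
qed

theorem gen_kahler_one_spinor_reduction: "gen_kahler_one_spinor R A\<^sub>M \<psi>\<^sub>M"
proof -
  have "nondegenerate_spinor R \<psi>\<^sub>M"
    unfolding nondegenerate_spinor_def using spinor_split_M by simp
  moreover have "d_closed R \<psi>\<^sub>M"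
    using d_closed_pull[OF form] gk by (simp add: gen_kahler_one_spinor_def)
  moreover have "gen_kahler R A\<^sub>M B\<^sub>M"
    unfolding gen_kahler_def
    using gen_complex_A\<^sub>M gen_complex_B\<^sub>M A\<^sub>M_B\<^sub>M gen_metric_M by (simp add: G\<^sub>M_def[abs_def])
  ultimately show ?thesis
    unfolding gen_kahler_one_spinor_def using gen_complex_A\<^sub>M pure_spinor_M by blast
qed

end

section \<open>Complex manifolds\<close>

lemma Cinf_on_bounded_linear:
  assumes "open S" "bounded_linear f" shows "Cinf_on f S"
proof -
  have "Ck_on k f S" for k
  proof (cases k)
    case 0
    then show ?thesis using assms(2) by (simp add: linear_continuous_on)
  next
    case (Suc j)
    show ?thesis unfolding Suc
      by (rule Ck_on_SucI[OF assms(1) bounded_linear_imp_has_derivative[OF assms(2)] Ck_on_const])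
  qed
  then show ?thesis by (simp add: Cinf_on_def)
qed

lemma chart_inv_left: "is_chart c \<Longrightarrow> q \<in> fst c \<Longrightarrow> chart_inv c (snd c q) = q"
  by (simp add: is_chart_def homeomorphism_def)

lemma chart_inv_right: "is_chart c \<Longrightarrow> z \<in> snd c ` fst c \<Longrightarrow> snd c (chart_inv c z) = z"
  by (auto simp: is_chart_def homeomorphism_def)

lemma chart_inv_mem: "is_chart c \<Longrightarrow> z \<in> snd c ` (U \<inter> fst c) \<Longrightarrow> chart_inv c z \<in> U \<inter> fst c"
  using chart_inv_left by fastforce

lemma open_chart_image:
  assumes "is_chart c" "open U" shows "open (snd c ` (U \<inter> fst c))"
proof -
  have "snd c ` (U \<inter> fst c) = snd c ` fst c \<inter> chart_inv c -` U"
    using chart_inv_left[OF assms(1)] by auto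
  then show ?thesis
    using assms unfolding is_chart_def homeomorphism_def by (simp add: continuous_open_preimage)
qed

lemma open_chart_preimage:
  assumes "is_chart c" "open T" shows "open (fst c \<inter> snd c -` T)"
  using assms unfolding is_chart_def homeomorphism_def by (simp add: continuous_open_preimage)

lemma inner_axis_complex: "z \<bullet> axis i u = z $ i \<bullet> (u::complex)"
  by (rule inner_axis)

lemma Basis_vecE:
  assumes "b \<in> (Basis :: (complex^'n::finite) set)"
  obtains i where "b = axis i 1" | i where "b = axis i \<i>"
  using assms by (auto simp: Basis_vec_def Basis_complex_def)

locale complex_manifold =
  fixes \<A> :: "('a::t2_space, 'n::finite) chart set"
  assumes atlas: "complex_atlas \<A>"
begin

abbreviation X where "X \<equiv> mfd \<A>"

lemma stop_X [simp]: "stop X = euclidean"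
  by (simp add: mfd_def)

lemma sfun_X: "f \<in> sfun X U \<longleftrightarrow> (\<forall>c\<in>\<A>. Cinf_on (\<lambda>z. f (chart_inv c z)) (snd c ` (U \<inter> fst c)))"
  by (simp add: mfd_def)

lemma atlas_chart: "c \<in> \<A> \<Longrightarrow> holo_chart \<A> c"
  using atlas by (auto simp: complex_atlas_def holo_chart_def)

lemma holo_chart_is_chart: "holo_chart \<A> c \<Longrightarrow> is_chart c"
  by (simp add: holo_chart_def)

lemma atlas_is_chart: "c \<in> \<A> \<Longrightarrow> is_chart c"
  using atlas by (simp add: complex_atlas_def)

lemma atlas_cover: "\<exists>c\<in>\<A>. q \<in> fst c"
  using atlas by (auto simp: complex_atlas_def)

sublocale X: smooth_sheaf X
proof
  fix U W :: "'a set" and f g :: "'a \<Rightarrow> complex" and a assume "openin (stop X) U"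
  then have U: "open U" by simp
  note o = open_chart_image[OF atlas_is_chart U]
  show "(\<lambda>_. a) \<in> sfun X U" by (simp add: sfun_X Cinf_on_def Ck_on_const)
  show "(\<lambda>x. f x + g x) \<in> sfun X U" if "f \<in> sfun X U" "g \<in> sfun X U"
    using that Ck_on_add[OF o] unfolding sfun_X Cinf_on_def by blast
  show "(\<lambda>x. f x * g x) \<in> sfun X U" if "f \<in> sfun X U" "g \<in> sfun X U"
    using that Ck_on_mult[OF o] unfolding sfun_X Cinf_on_def by blast
  show "(\<lambda>x. cnj (f x)) \<in> sfun X U" if "f \<in> sfun X U"
    using that Ck_on_linear[OF o bounded_linear_cnj] unfolding sfun_X Cinf_on_def by blast
  show "f \<in> sfun X W" if "f \<in> sfun X U" "W \<subseteq> U"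
    using that Ck_on_subset[of _ _ _ "snd _ ` (W \<inter> fst _)"] unfolding sfun_X Cinf_on_def by (meson Int_mono image_mono order_refl)
  show "g \<in> sfun X U" if "f \<in> sfun X U" "\<And>x. x \<in> U \<Longrightarrow> f x = g x"
    unfolding sfun_X Cinf_on_def
  proof (intro ballI allI)
    fix c k assume c: "c \<in> \<A>"
    show "Ck_on k (\<lambda>z. g (chart_inv c z)) (snd c ` (U \<inter> fst c))"
      by (rule Ck_on_cong[OF o[OF c], of "\<lambda>z. f (chart_inv c z)"])
         (use that chart_inv_mem[OF atlas_is_chart[OF c]] c in \<open>auto simp: sfun_X Cinf_on_def\<close>)
  qed
  show "f \<in> sfun X U" if loc: "\<And>p. p \<in> U \<Longrightarrow> \<exists>W. openin (stop X) W \<and> p \<in> W \<and> f \<in> sfun X W"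
    unfolding sfun_X Cinf_on_def
  proof (intro ballI allI)
    fix c k assume c: "c \<in> \<A>"
    show "Ck_on k (\<lambda>z. f (chart_inv c z)) (snd c ` (U \<inter> fst c))"
    proof (rule Ck_on_local[OF _ o[OF c]])
      fix z assume "z \<in> snd c ` (U \<inter> fst c)"
      then obtain q where q: "q \<in> U" "q \<in> fst c" "z = snd c q" by blast
      obtain W where W: "open W" "q \<in> W" "f \<in> sfun X W" using loc[OF q(1)] by auto
      show "\<exists>V. open V \<and> z \<in> V \<and> Ck_on k (\<lambda>z. f (chart_inv c z)) V"
        using open_chart_image[OF atlas_is_chart[OF c] W(1)] W(2,3) q c
        by (intro exI[of _ "snd c ` (W \<inter> fst c)"]) (auto simp: sfun_X Cinf_on_def)
    qed
  qed
qed

lemma smooth_inverse_X: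
  assumes "open U" "f \<in> sfun X U" "\<And>q. q \<in> U \<Longrightarrow> f q \<noteq> 0"
  shows "(\<lambda>q. inverse (f q)) \<in> sfun X U"
  unfolding sfun_X Cinf_on_def
proof (intro ballI allI)
  fix c k assume c: "c \<in> \<A>"
  show "Ck_on k (\<lambda>z. inverse (f (chart_inv c z))) (snd c ` (U \<inter> fst c))"
    by (rule Ck_on_inverse[OF open_chart_image[OF atlas_is_chart[OF c] assms(1)]])
       (use assms(2,3) chart_inv_mem[OF atlas_is_chart[OF c]] c in \<open>auto simp: sfun_X Cinf_on_def\<close>)
qed

lemma holo_fun_smooth:
  assumes "open U" "f \<in> holo_fun \<A> U" shows "f \<in> sfun X U"
  using assms cn_holomorphic_imp_Cinf[OF open_chart_image[OF atlas_is_chart assms(1)]]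
  by (auto simp: sfun_X holo_fun_def)

text \<open>Charts that flatten a submanifold are compatible with the atlas but need not belong to it, so
  smoothness has to be transported to and from such charts.\<close>

lemma transition_smooth:
  assumes "is_chart c" "holo_transition c d" "is_chart d" "open U" "b \<in> Basis"
  shows "Ck_on k (\<lambda>z. snd d (chart_inv c z) \<bullet> b) (snd c ` (U \<inter> fst d \<inter> fst c))"
proof -
  obtain i u where b: "b = axis i u" using assms(5) by (auto elim: Basis_vecE)
  have o: "open (snd c ` (U \<inter> fst d \<inter> fst c))"
    using open_chart_image[OF assms(1), of "U \<inter> fst d"] assms(3,4) by (auto simp: is_chart_def)
  have "cn_holomorphic_on (\<lambda>z. snd d (chart_inv c z) $ i) (snd c ` (U \<inter> fst d \<inter> fst c))"
    using assms(2) unfolding holo_transition_def cn_holomorphic_on_def by blast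
  from cn_holomorphic_imp_Cinf[OF o this]
  show ?thesis
    using Ck_on_linear[OF o bounded_linear_inner_left[of u]]
    unfolding b inner_axis_complex Cinf_on_def by blast
qed

lemma smooth_in_chart:
  assumes c: "holo_chart \<A> c" and U: "open U" and f: "f \<in> sfun X U"
  shows "Cinf_on (\<lambda>z. f (chart_inv c z)) (snd c ` (U \<inter> fst c))"
  unfolding Cinf_on_def
proof
  fix k
  have ch: "is_chart c" using holo_chart_is_chart[OF c] .
  show "Ck_on k (\<lambda>z. f (chart_inv c z)) (snd c ` (U \<inter> fst c))"
  proof (rule Ck_on_local[OF _ open_chart_image[OF ch U]])
    fix z assume "z \<in> snd c ` (U \<inter> fst c)"
    then obtain q where q: "q \<in> U" "q \<in> fst c" "z = snd c q" by blast
    obtain d where d: "d \<in> \<A>" "q \<in> fst d" using atlas_cover by blast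
    have dch: "is_chart d" using atlas_is_chart[OF d(1)] .
    let ?V = "snd c ` (U \<inter> fst d \<inter> fst c)"
    have oV: "open ?V" using open_chart_image[OF ch, of "U \<inter> fst d"] U dch by (auto simp: is_chart_def)
    have "Ck_on k (\<lambda>z. f (chart_inv d (snd d (chart_inv c z)))) ?V"
    proof (rule Ck_on_compose[OF oV open_chart_image[OF dch U]])
      show "(\<lambda>z. snd d (chart_inv c z)) ` ?V \<subseteq> snd d ` (U \<inter> fst d)"
        using chart_inv_left[OF ch] by auto
      show "Ck_on k (\<lambda>z. f (chart_inv d z)) (snd d ` (U \<inter> fst d))"
        using f d(1) by (simp add: sfun_X Cinf_on_def)
      show "Ck_on k (\<lambda>z. snd d (chart_inv c z) \<bullet> b) ?V" if "b \<in> Basis" for b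
        using transition_smooth[OF ch _ dch U that] c d(1) by (simp add: holo_chart_def)
    qed
    then have "Ck_on k (\<lambda>z. f (chart_inv c z)) ?V"
      by (rule Ck_on_cong[OF oV, rotated]) (use chart_inv_left[OF ch] chart_inv_left[OF dch] in auto)
    then show "\<exists>V. open V \<and> z \<in> V \<and> Ck_on k (\<lambda>z. f (chart_inv c z)) V"
      using oV q d(2) by (intro exI[of _ ?V]) auto
  qed
qed

lemma smooth_of_chart:
  assumes c: "holo_chart \<A> c" and U: "open U" "U \<subseteq> fst c" and g: "Cinf_on g (snd c ` U)"
  shows "(\<lambda>q. g (snd c q)) \<in> sfun X U"
  unfolding sfun_X Cinf_on_def
proof (intro ballI allI)
  fix d k assume d: "d \<in> \<A>"
  have ch: "is_chart c" and dch: "is_chart d" using holo_chart_is_chart[OF c] atlas_is_chart[OF d] by auto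
  have e: "U \<inter> fst c \<inter> fst d = U \<inter> fst d" "U \<inter> fst c = U" using U(2) by auto
  show "Ck_on k (\<lambda>z. g (snd c (chart_inv d z))) (snd d ` (U \<inter> fst d))"
  proof (rule Ck_on_compose[where T = "snd c ` U" and f = g, OF open_chart_image[OF dch U(1)]])
    show "open (snd c ` U)" using open_chart_image[OF ch U(1)] e by simp
    show "(\<lambda>z. snd c (chart_inv d z)) ` snd d ` (U \<inter> fst d) \<subseteq> snd c ` U"
      using chart_inv_left[OF dch] by auto
    show "Ck_on k g (snd c ` U)" using g by (simp add: Cinf_on_def)
    show "Ck_on k (\<lambda>z. snd c (chart_inv d z) \<bullet> b) (snd d ` (U \<inter> fst d))" if "b \<in> Basis" for b
      using transition_smooth[OF dch _ ch U(1) that] c d e by (simp add: holo_chart_def)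
  qed
qed

subsection \<open>Coordinate frames\<close>

definition xcoord :: "('a, 'n) chart \<Rightarrow> complex^'n \<Rightarrow> 'a \<Rightarrow> complex" where
  "xcoord c b q = of_real (snd c q \<bullet> b)"

definition zcoord :: "('a, 'n) chart \<Rightarrow> 'n \<Rightarrow> 'a \<Rightarrow> complex" where
  "zcoord c i q = snd c q $ i"

definition dir_deriv :: "('a, 'n) chart \<Rightarrow> complex^'n \<Rightarrow> 'a \<Rightarrow> 'a tvec" where
  "dir_deriv c u q = (\<lambda>f. if f \<in> germs X q
     then frechet_derivative (\<lambda>z. f (chart_inv c z)) (at (snd c q)) u else 0)"

lemma germ_in_chart:
  assumes c: "holo_chart \<A> c" "q \<in> fst c" and f: "f \<in> germs X q"
  obtains U where "open U" "q \<in> U" "U \<subseteq> fst c" "f \<in> sfun X U"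
    "Cinf_on (\<lambda>z. f (chart_inv c z)) (snd c ` U)" "open (snd c ` U)"
proof -
  obtain U where U: "open U" "q \<in> U" "f \<in> sfun X U" using f by (rule X.germsE) auto
  have ch: "is_chart c" using holo_chart_is_chart[OF c(1)] .
  have o: "open (U \<inter> fst c)" using U(1) ch by (auto simp: is_chart_def)
  have s: "f \<in> sfun X (U \<inter> fst c)" using X.smooth_restrict[of U f "U \<inter> fst c"] U o by auto
  have e: "U \<inter> fst c \<inter> fst c = U \<inter> fst c" by blast
  show ?thesis
    using that[OF o _ _ s] smooth_in_chart[OF c(1) o s, unfolded e] open_chart_image[OF ch o, unfolded e] U(2) c(2) by blast
qed

lemma germ_has_derivative:
  assumes c: "holo_chart \<A> c" "q \<in> fst c" and f: "f \<in> germs X q"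
  shows "((\<lambda>z. f (chart_inv c z)) has_derivative (\<lambda>u. dir_deriv c u q f)) (at (snd c q))"
proof -
  obtain U where U: "q \<in> U" "Cinf_on (\<lambda>z. f (chart_inv c z)) (snd c ` U)" "open (snd c ` U)"
    using c f by (rule germ_in_chart)
  from Cinf_onD[OF U(3,2), of "snd c q"] U(1) f show ?thesis by (simp add: dir_deriv_def[abs_def])
qed

lemma dir_deriv_eqI:
  assumes "holo_chart \<A> c" "q \<in> fst c" "f \<in> germs X q"
    "((\<lambda>z. f (chart_inv c z)) has_derivative D) (at (snd c q))"
  shows "dir_deriv c u q f = D u"
  using has_derivative_unique[OF germ_has_derivative[OF assms(1-3)] assms(4)] by (rule fun_cong)

lemma dir_deriv_tangent:
  assumes c: "holo_chart \<A> c" "q \<in> fst c"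
  shows "dir_deriv c u q \<in> tangent X q"
proof (rule X.tangentI)
  note D = germ_has_derivative[OF c]
  have q: "chart_inv c (snd c q) = q" using chart_inv_left[OF holo_chart_is_chart[OF c(1)] c(2)] .
  fix f g assume f: "f \<in> germs X q" and g: "g \<in> germs X q"
  show "dir_deriv c u q (\<lambda>x. f x + g x) = dir_deriv c u q f + dir_deriv c u q g"
    by (rule dir_deriv_eqI[OF c X.germs_add[OF f g] has_derivative_add[OF D[OF f] D[OF g]]])
  have "dir_deriv c u q (\<lambda>x. f x * g x) = f q * dir_deriv c u q g + dir_deriv c u q f * g q"
    using dir_deriv_eqI[OF c X.germs_mult[OF f g] has_derivative_mult[OF D[OF f] D[OF g]]] q by simp
  then show "dir_deriv c u q (\<lambda>x. f x * g x) = f q * dir_deriv c u q g + g q * dir_deriv c u q f" by simp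
  show "dir_deriv c u q f = dir_deriv c u q g"
    if U: "openin (stop X) U" "q \<in> U" "\<And>x. x \<in> U \<Longrightarrow> f x = g x" for U
  proof (rule dir_deriv_eqI[OF c f])
    have ch: "is_chart c" using holo_chart_is_chart[OF c(1)] .
    show "((\<lambda>z. f (chart_inv c z)) has_derivative (\<lambda>u. dir_deriv c u q g)) (at (snd c q))"
      by (rule has_derivative_transform_within_open[OF D[OF g] open_chart_image[OF ch, of U]])
         (use U c chart_inv_mem[OF ch] in auto)
  qed
next
  fix f a assume f: "f \<in> germs X q"
  show "dir_deriv c u q (\<lambda>x. a * f x) = a * dir_deriv c u q f"
    by (rule dir_deriv_eqI[OF c X.germs_scale[OF f] has_derivative_mult_right[OF germ_has_derivative[OF c f]]])
qed (simp add: dir_deriv_def)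

lemma dir_deriv_smooth:
  assumes c: "holo_chart \<A> c" shows "smooth_field X (fst c) (dir_deriv c u)"
  unfolding smooth_field_def
proof (intro conjI ballI allI impI)
  have ch: "is_chart c" using holo_chart_is_chart[OF c] .
  show "dir_deriv c u q \<in> tangent X q" if "q \<in> fst c" for q using dir_deriv_tangent[OF c that] .
  fix W f assume W: "openin (stop X) W \<and> W \<subseteq> fst c \<and> f \<in> sfun X W"
  then have e: "W \<inter> fst c = W" and oW: "open W" by auto
  have "Cinf_on (\<lambda>z. f (chart_inv c z)) (snd c ` W)" using smooth_in_chart[OF c oW] W e by simp
  then have "(\<lambda>q. frechet_derivative (\<lambda>z. f (chart_inv c z)) (at (snd c q)) u) \<in> sfun X W"
    using W smooth_of_chart[OF c oW _ Cinf_on_deriv] by blast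
  then show "(\<lambda>q. dir_deriv c u q f) \<in> sfun X W"
    by (rule X.smooth_cong[rotated]) (use W X.germsI[of W] in \<open>auto simp: dir_deriv_def\<close>)
qed

lemma xcoord_smooth:
  assumes c: "holo_chart \<A> c" shows "xcoord c b \<in> sfun X (fst c)"
proof -
  have ch: "is_chart c" using holo_chart_is_chart[OF c] .
  have "bounded_linear (\<lambda>z::complex^'n. complex_of_real (z \<bullet> b))"
    using bounded_linear_compose[OF bounded_linear_of_real bounded_linear_inner_left] .
  from smooth_of_chart[OF c _ order_refl Cinf_on_bounded_linear[OF _ this]]
  show ?thesis using ch by (simp add: is_chart_def xcoord_def[abs_def])
qed

lemma zcoord_holo:
  assumes c: "holo_chart \<A> c" shows "zcoord c i \<in> holo_fun \<A> (fst c)"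
  using c by (auto simp: holo_fun_def holo_chart_def holo_transition_def zcoord_def[abs_def] Int_commute)

lemma chart_germs:
  assumes c: "holo_chart \<A> c" "q \<in> fst c"
  shows "xcoord c b \<in> germs X q" "zcoord c i \<in> germs X q" "(\<lambda>x. cnj (zcoord c i x)) \<in> germs X q"
proof -
  have o: "open (fst c)" using holo_chart_is_chart[OF c(1)] by (simp add: is_chart_def)
  show "xcoord c b \<in> germs X q" using X.germsI[of "fst c"] xcoord_smooth[OF c(1)] o c(2) by simp
  show "zcoord c i \<in> germs X q" using X.germsI[of "fst c"] holo_fun_smooth[OF o zcoord_holo[OF c(1)]] o c(2) by simp
  then show "(\<lambda>x. cnj (zcoord c i x)) \<in> germs X q" by (rule X.germs_cnj)
qed

lemma dir_deriv_xcoord: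
  assumes c: "holo_chart \<A> c" "q \<in> fst c" shows "dir_deriv c u q (xcoord c b) = of_real (u \<bullet> b)"
proof (rule dir_deriv_eqI[OF c chart_germs(1)[OF c]])
  have ch: "is_chart c" using holo_chart_is_chart[OF c(1)] .
  have "bounded_linear (\<lambda>z::complex^'n. complex_of_real (z \<bullet> b))"
    using bounded_linear_compose[OF bounded_linear_of_real bounded_linear_inner_left] .
  from bounded_linear_imp_has_derivative[OF this]
  show "((\<lambda>z. xcoord c b (chart_inv c z)) has_derivative (\<lambda>u. of_real (u \<bullet> b))) (at (snd c q))"
    by (rule has_derivative_transform_within_open[of _ _ _ _ "snd c ` fst c"])
       (use ch c(2) chart_inv_right[OF ch] in \<open>auto simp: is_chart_def xcoord_def\<close>)
qed

text \<open>By Hadamard's lemma \<open>f - f(q)\<close> is a combination of the functions \<open>x\<^sub>b - x\<^sub>b(q)\<close> with smooth coefficients;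
  by the Leibniz rule the derivatives of the coefficients do not contribute at \<open>q\<close>.\<close>

lemma tangent_eq_0:
  assumes c: "holo_chart \<A> c" "q \<in> fst c" and v: "v \<in> tangent X q"
    and z: "\<And>b. b \<in> Basis \<Longrightarrow> v (xcoord c b) = 0"
  shows "v = 0"
proof
  fix f
  have ch: "is_chart c" using holo_chart_is_chart[OF c(1)] .
  show "v f = 0 f"
  proof (cases "f \<in> germs X q")
    case True
    obtain U where U: "open U" "q \<in> U" "U \<subseteq> fst c" "Cinf_on (\<lambda>z. f (chart_inv c z)) (snd c ` U)" "open (snd c ` U)"
      using c True by (rule germ_in_chart)
    let ?z0 = "snd c q"
    obtain r where r: "r > 0" "ball ?z0 r \<subseteq> snd c ` U" using U(2,5) openE by blast
    have "Cinf_on (\<lambda>z. f (chart_inv c z)) (ball ?z0 r)"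
      using U(4) r(2) Ck_on_subset unfolding Cinf_on_def by blast
    then obtain g where g: "\<And>b. b \<in> Basis \<Longrightarrow> Cinf_on (g b) (ball ?z0 r)"
      "\<And>z. z \<in> ball ?z0 r \<Longrightarrow> f (chart_inv c z) = f (chart_inv c ?z0) + (\<Sum>b\<in>Basis. of_real ((z - ?z0) \<bullet> b) * g b z)"
      using r(1) by (rule hadamard) blast
    define V where "V = fst c \<inter> snd c -` ball ?z0 r"
    have V: "open V" "q \<in> V" "V \<subseteq> fst c" using open_chart_preimage[OF ch] c(2) r(1) by (auto simp: V_def)
    have im: "snd c ` V \<subseteq> ball ?z0 r" by (auto simp: V_def)
    have gs: "(\<lambda>y. g b (snd c y)) \<in> germs X q" if "b \<in> Basis" for b
    proof -
      have "Cinf_on (g b) (snd c ` V)" using g(1)[OF that] Ck_on_subset im unfolding Cinf_on_def by blast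
      from smooth_of_chart[OF c(1) V(1,3) this] show ?thesis using X.germsI[of V] V by simp
    qed
    define h where "h b y = xcoord c b y - of_real (?z0 \<bullet> b)" for b y
    have qt: "q \<in> topspace (stop X)" by simp
    have hg: "h b \<in> germs X q" for b
      unfolding h_def by (intro X.germs_diff chart_germs(1)[OF c] X.germs_const qt)
    have vh: "v (h b) = 0" if "b \<in> Basis" for b
      unfolding h_def using X.tangent_diff[OF v chart_germs(1)[OF c] X.germs_const[OF qt]] z[OF that] X.tangent_const[OF v] by simp
    have hq: "h b q = 0" for b by (simp add: h_def xcoord_def)
    have fh: "f y = f q + (\<Sum>b\<in>Basis. h b y * g b (snd c y))" if y: "y \<in> V" for y
    proof -
      have "snd c y \<in> ball ?z0 r" "y \<in> fst c" using y by (auto simp: V_def)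
      from g(2)[OF this(1)] show ?thesis
        using chart_inv_left[OF ch \<open>y \<in> fst c\<close>] chart_inv_left[OF ch c(2)]
        by (simp add: h_def xcoord_def inner_diff_left)
    qed
    have pr: "(\<lambda>y. h b y * g b (snd c y)) \<in> germs X q" if "b \<in> Basis" for b
      using X.germs_mult[OF hg gs[OF that]] .
    have sg: "(\<lambda>y. \<Sum>b\<in>Basis. h b y * g b (snd c y)) \<in> germs X q"
      by (rule X.germs_sum[OF qt pr])
    have ts: "v (\<lambda>y. \<Sum>b\<in>Basis. h b y * g b (snd c y)) = (\<Sum>b\<in>Basis. v (\<lambda>y. h b y * g b (snd c y)))"
      by (rule X.tangent_sum[OF v qt pr])
    have "v f = v (\<lambda>y. f q + (\<Sum>b\<in>Basis. h b y * g b (snd c y)))"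
      by (rule X.tangent_cong[OF v True _ V(2) fh]) (use V(1) in simp)
    also have "\<dots> = (\<Sum>b\<in>Basis. v (\<lambda>y. h b y * g b (snd c y)))"
      using X.tangent_add[OF v X.germs_const[OF qt] sg] ts X.tangent_const[OF v] by simp
    also have "\<dots> = 0"
      by (rule sum.neutral) (use X.tangent_mult[OF v hg gs] vh hq in simp)
    finally show ?thesis by simp
  qed (use X.tangent_outside[OF v] in simp)
qed

lemma chart_coord_frame:
  assumes c: "holo_chart \<A> c" shows "coord_frame X (fst c) Basis (xcoord c) (dir_deriv c)"
  unfolding coord_frame_def
proof (intro conjI ballI impI)
  show "openin (stop X) (fst c)" using holo_chart_is_chart[OF c] by (simp add: is_chart_def)
  show "dir_deriv c i q (xcoord c j) = (if i = j then 1 else 0)"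
    if "q \<in> fst c" "i \<in> Basis" "j \<in> Basis" for q i j
    using dir_deriv_xcoord[OF c that(1)] that(2,3) by (simp add: inner_Basis)
  show "v = 0" if "q \<in> fst c" "v \<in> tangent X q" "\<forall>i\<in>Basis. v (xcoord c i) = 0" for q v
    using tangent_eq_0[OF c that(1,2)] that(3) by blast
qed (use xcoord_smooth[OF c] dir_deriv_smooth[OF c] in auto)

subsection \<open>The complex structure\<close>

lemma xcoord_zcoord:
  "xcoord c (axis i 1) q = (1/2) * (zcoord c i q + cnj (zcoord c i q))"
  "xcoord c (axis i \<i>) q = (1/(2*\<i>)) * (zcoord c i q - cnj (zcoord c i q))"
  by (simp_all add: xcoord_def zcoord_def inner_axis_complex inner_complex_def complex_eq_iff)

lemma tangent_xcoord:
  assumes c: "holo_chart \<A> c" "q \<in> fst c" and v: "v \<in> tangent X q"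
  shows "v (xcoord c (axis i 1)) = (1/2) * (v (zcoord c i) + v (\<lambda>x. cnj (zcoord c i x)))"
    "v (xcoord c (axis i \<i>)) = (1/(2*\<i>)) * (v (zcoord c i) - v (\<lambda>x. cnj (zcoord c i x)))"
proof -
  note g = chart_germs(2,3)[OF c]
  have 1: "xcoord c (axis i 1) = (\<lambda>q. (1/2) * (zcoord c i q + cnj (zcoord c i q)))"
    and 2: "xcoord c (axis i \<i>) = (\<lambda>q. (1/(2*\<i>)) * (zcoord c i q - cnj (zcoord c i q)))"
    using xcoord_zcoord by blast+
  show "v (xcoord c (axis i 1)) = (1/2) * (v (zcoord c i) + v (\<lambda>x. cnj (zcoord c i x)))"
    unfolding 1 X.tangent_scale[OF v X.germs_add[OF g]] X.tangent_add[OF v g] ..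
  show "v (xcoord c (axis i \<i>)) = (1/(2*\<i>)) * (v (zcoord c i) - v (\<lambda>x. cnj (zcoord c i x)))"
    unfolding 2 X.tangent_scale[OF v X.germs_diff[OF g]] X.tangent_diff[OF v g] ..
qed

lemma tangent_eq_zcoord:
  assumes c: "holo_chart \<A> c" "q \<in> fst c" and v: "v \<in> tangent X q" and w: "w \<in> tangent X q"
    and e: "\<And>i. v (zcoord c i) = w (zcoord c i)" "\<And>i. v (\<lambda>x. cnj (zcoord c i x)) = w (\<lambda>x. cnj (zcoord c i x))"
  shows "v = w"
proof (rule X.coord_frame_eqI[OF chart_coord_frame[OF c(1)] c(2) v w])
  fix b :: "complex^'n" assume "b \<in> Basis"
  then obtain i where "b = axis i 1 \<or> b = axis i \<i>" by (metis Basis_vecE)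
  then show "v (xcoord c b) = w (xcoord c b)"
    by (elim disjE) (simp_all only: tangent_xcoord[OF c v] tangent_xcoord[OF c w] e)
qed

definition is_cstruct :: "'a \<Rightarrow> 'a tvec \<Rightarrow> 'a tvec \<Rightarrow> bool" where
  "is_cstruct p v w \<longleftrightarrow> w \<in> tangent X p \<and> (\<forall>U f. open U \<and> p \<in> U \<and> f \<in> holo_fun \<A> U \<longrightarrow>
     w f = \<i> * v f \<and> w (\<lambda>x. cnj (f x)) = - \<i> * v (\<lambda>x. cnj (f x)))"

lemma is_cstruct_coord:
  assumes "holo_chart \<A> c" "p \<in> fst c" "is_cstruct p v w"
  shows "w (zcoord c i) = \<i> * v (zcoord c i)" "w (\<lambda>x. cnj (zcoord c i x)) = - \<i> * v (\<lambda>x. cnj (zcoord c i x))"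
  using assms zcoord_holo[OF assms(1)] holo_chart_is_chart[OF assms(1)] unfolding is_cstruct_def is_chart_def by blast+

text \<open>In a chart \<open>J\<close> rotates the directions of differentiation by \<open>\<i>\<close>. It is unique since the holomorphic
  coordinates and their conjugates determine a tangent vector.\<close>

lemma is_cstruct_cstruct:
  assumes v: "v \<in> tangent X p" shows "is_cstruct p v (cstruct \<A> p v)"
proof -
  obtain c where c: "c \<in> \<A>" "p \<in> fst c" using atlas_cover by blast
  have h: "holo_chart \<A> c" using atlas_chart[OF c(1)] .
  have ch: "is_chart c" using atlas_is_chart[OF c(1)] .
  define w where "w = (\<Sum>b\<in>Basis. fscale (v (xcoord c b)) (dir_deriv c (\<i> *s b) p))"
  have wt: "w \<in> tangent X p" unfolding w_def by (intro X.tangent_closed dir_deriv_tangent[OF h c(2)])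
  have "is_cstruct p v w"
    unfolding is_cstruct_def
  proof (intro conjI allI impI)
    show "w \<in> tangent X p" by (rule wt)
    fix U f assume "open U \<and> p \<in> U \<and> f \<in> holo_fun \<A> U"
    then have U: "open U" "p \<in> U" "f \<in> holo_fun \<A> U" by auto
    have f: "f \<in> germs X p" using X.germsI[of U] U holo_fun_smooth by simp
    have "cn_holomorphic_on (\<lambda>z. f (chart_inv c z)) (snd c ` (U \<inter> fst c))" using U(3) c(1) by (simp add: holo_fun_def)
    then have rot: "dir_deriv c (\<i> *s b) p f = \<i> * dir_deriv c b p f" for b
      using cn_holomorphic_onD(2) U(2) c(2) f by (simp add: dir_deriv_def) blast
    have cn: "dir_deriv c u p (\<lambda>x. cnj (f x)) = cnj (dir_deriv c u p f)" for u
      by (rule dir_deriv_eqI[OF h c(2) X.germs_cnj[OF f] bounded_linear.has_derivative[OF bounded_linear_cnj germ_has_derivative[OF h c(2) f]]])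
    have ex: "v k = (\<Sum>b\<in>Basis. v (xcoord c b) * dir_deriv c b p k)" for k
      using fun_cong[OF X.coord_frame_expand[OF chart_coord_frame[OF h] c(2) v], of k] by (simp add: sum_fun_apply)
    have wf: "w k = (\<Sum>b\<in>Basis. v (xcoord c b) * dir_deriv c (\<i> *s b) p k)" for k
      by (simp add: w_def sum_fun_apply)
    show "w f = \<i> * v f" unfolding wf[of f] ex[of f] rot by (simp add: sum_distrib_left mult_ac)
    show "w (\<lambda>x. cnj (f x)) = - \<i> * v (\<lambda>x. cnj (f x))"
      unfolding wf[of "\<lambda>x. cnj (f x)"] ex[of "\<lambda>x. cnj (f x)"] cn rot by (simp add: sum_distrib_left mult_ac sum_negf)
  qed
  moreover have "w' = w" if "is_cstruct p v w'" for w'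
    by (rule tangent_eq_zcoord[OF h c(2)])
       (use that wt is_cstruct_coord[OF h c(2) that] is_cstruct_coord[OF h c(2) \<open>is_cstruct p v w\<close>] in \<open>auto simp: is_cstruct_def\<close>)
  ultimately show ?thesis
    unfolding cstruct_def is_cstruct_def[symmetric] by (rule theI)
qed

lemma cstruct_tangent: "v \<in> tangent X p \<Longrightarrow> cstruct \<A> p v \<in> tangent X p"
  using is_cstruct_cstruct by (simp add: is_cstruct_def)

lemma cstruct_0: "cstruct \<A> p 0 = 0"
proof -
  obtain c where c: "c \<in> \<A>" "p \<in> fst c" using atlas_cover by blast
  have h: "holo_chart \<A> c" using atlas_chart[OF c(1)] .
  note j = is_cstruct_cstruct[OF X.tangent_closed(1), of p]
  show ?thesis
    by (rule tangent_eq_zcoord[OF h c(2) cstruct_tangent[OF X.tangent_closed(1)] X.tangent_closed(1)])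
       (use is_cstruct_coord[OF h c(2) j] in auto)
qed

subsection \<open>Complex submanifolds\<close>

lemma slice_derivative:
  assumes F: "(F has_derivative D) (at z0)" and o: "open V" "z0 \<in> V"
    and z: "\<And>s::real. z0 + s *\<^sub>R b \<in> V \<Longrightarrow> F (z0 + s *\<^sub>R b) = 0"
  shows "D b = (0::complex)"
proof -
  have d: "((\<lambda>s. z0 + s *\<^sub>R b) has_derivative (\<lambda>s. s *\<^sub>R b)) (at (0::real))"
    by (auto intro!: derivative_eq_intros)
  have "((\<lambda>s. F (z0 + s *\<^sub>R b)) has_derivative (\<lambda>s. D (s *\<^sub>R b))) (at 0)"
    by (rule has_derivative_compose[OF d]) (use F in simp)
  moreover have "((\<lambda>s. F (z0 + s *\<^sub>R b)) has_derivative (\<lambda>s. 0)) (at 0)"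
  proof (rule has_derivative_transform_within_open[OF has_derivative_const])
    have "continuous_on UNIV (\<lambda>s. z0 + s *\<^sub>R b)" by (intro continuous_intros)
    then show "open ((\<lambda>s. z0 + s *\<^sub>R b) -` V)" using o(1) by (rule open_vimage[rotated])
    show "0 \<in> (\<lambda>s. z0 + s *\<^sub>R b) -` V" using o(2) by simp
    show "0 = F (z0 + s *\<^sub>R b)" if "s \<in> (\<lambda>s. z0 + s *\<^sub>R b) -` V" for s using z that by simp
  qed
  ultimately have "(\<lambda>s. D (s *\<^sub>R b)) = (\<lambda>s. 0)" by (rule has_derivative_unique)
  from fun_cong[OF this, of 1] show ?thesis by simp
qed

lemma submanifold_adapted_frame:
  assumes c: "holo_chart \<A> c"
    and slice: "snd c ` (fst c \<inter> M) = {z \<in> snd c ` fst c. \<forall>i. i \<notin> I \<longrightarrow> z $ i = 0}"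
  shows "adapted_frame X M (fst c) Basis {axis i u |i u. i \<in> I \<and> u \<in> Basis} (xcoord c) (dir_deriv c)"
  unfolding adapted_frame_def
proof (intro conjI ballI impI)
  let ?T = "{axis i u |i u. i \<in> I \<and> u \<in> Basis} :: (complex^'n) set"
  have ch: "is_chart c" using holo_chart_is_chart[OF c] .
  have zero: "snd c q $ i = 0" if "q \<in> fst c \<inter> M" "i \<notin> I" for q i
    using slice that by blast
  show "coord_frame X (fst c) Basis (xcoord c) (dir_deriv c)" by (rule chart_coord_frame[OF c])
  show "?T \<subseteq> Basis" by (auto simp: Basis_vec_def)
  show "xcoord c b q = 0" if b: "b \<in> Basis - ?T" and q: "q \<in> fst c \<inter> M" for b q
  proof -
    obtain i u where "b = axis i u" "u \<in> Basis" using b by (auto simp: Basis_vec_def)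
    then have "i \<notin> I" using b by blast
    then show ?thesis using zero[OF q] \<open>b = axis i u\<close> by (simp add: xcoord_def inner_axis_complex)
  qed
  fix b q f assume b: "b \<in> ?T" and q: "q \<in> fst c \<inter> M" and f: "f \<in> germs X q" and van: "vanishes_near X M q f"
  obtain i u where bi: "b = axis i u" "i \<in> I" using b by blast
  obtain V where V: "open V" "q \<in> V" "\<And>y. y \<in> V \<inter> M \<Longrightarrow> f y = 0" using van unfolding vanishes_near_def by auto
  show "dir_deriv c b q f = 0"
  proof (rule slice_derivative[OF germ_has_derivative[OF c _ f] open_chart_image[OF ch V(1)]])
    show "q \<in> fst c" "snd c q \<in> snd c ` (V \<inter> fst c)" using q V(2) by auto
    fix s :: real assume s: "snd c q + s *\<^sub>R b \<in> snd c ` (V \<inter> fst c)"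
    let ?z = "snd c q + s *\<^sub>R b"
    have y: "chart_inv c ?z \<in> V \<inter> fst c" using chart_inv_mem[OF ch s] .
    have "?z $ j = 0" if "j \<notin> I" for j
      using zero[OF q that] bi that by (auto simp: axis_def)
    then have "?z \<in> snd c ` (fst c \<inter> M)" unfolding slice using s by blast
    then have "chart_inv c ?z \<in> M" using chart_inv_left[OF ch] by fastforce
    then show "f (chart_inv c ?z) = 0" using V(3) y by blast
  qed
qed

end

locale poisson_submfd = complex_manifold \<A>
  for \<A> :: "('a::t2_space, 'n::finite) chart set" +
  fixes \<beta> :: "'a bivec" and m :: nat and M :: "'a set"
  assumes poisson: "poisson_structure \<A> \<beta>" and submfd: "poisson_submanifold \<A> \<beta> m M"
begin

lemma slice_chart:
  assumes "p \<in> M"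
  obtains c I where "holo_chart \<A> c" "p \<in> fst c"
    "snd c ` (fst c \<inter> M) = {z \<in> snd c ` fst c. \<forall>i. i \<notin> I \<longrightarrow> z $ i = 0}"
proof -
  have "complex_submanifold \<A> m M" using submfd by (simp add: poisson_submanifold_def)
  from bspec[OF this[unfolded complex_submanifold_def] assms] show ?thesis using that by blast
qed

sublocale M: adapted_submanifold X M "TYPE(complex^'n)"
proof
  show "(\<lambda>q. inverse (f q)) \<in> sfun X U" if "openin (stop X) U" "f \<in> sfun X U" "\<And>q. q \<in> U \<Longrightarrow> f q \<noteq> 0" for U f
    using smooth_inverse_X that by simp
  fix p assume "p \<in> M"
  then obtain c I where "holo_chart \<A> c" "p \<in> fst c"
    "snd c ` (fst c \<inter> M) = {z \<in> snd c ` fst c. \<forall>i. i \<notin> I \<longrightarrow> z $ i = 0}" by (rule slice_chart)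
  note c = this
  show "\<exists>U N T x (e :: complex^'n \<Rightarrow> 'a \<Rightarrow> 'a tvec). p \<in> U \<and> adapted_frame X M U N T x e"
    by (rule exI, rule exI, rule exI, rule exI, rule exI, rule conjI[OF c(2) submanifold_adapted_frame[OF c(1,3)]])
qed

lemma bivector:
  assumes "\<eta> \<in> cotangent X p" "\<zeta> \<in> cotangent X p"
  shows "\<beta> p \<eta> \<zeta> = - \<beta> p \<zeta> \<eta>" "\<beta> p (fscale a \<eta>) \<zeta> = a * \<beta> p \<eta> \<zeta>"
    "\<xi> \<in> cotangent X p \<Longrightarrow> \<beta> p (\<eta> + \<xi>) \<zeta> = \<beta> p \<eta> \<zeta> + \<beta> p \<xi> \<zeta>"
    "(\<And>v. v \<in> tangent X p \<Longrightarrow> cstruct \<A> p v = fscale \<i> v \<Longrightarrow> \<eta> v = 0) \<Longrightarrow> \<beta> p \<eta> \<zeta> = 0"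
proof -
  note h = poisson[unfolded poisson_structure_def holo_bivector_def, THEN conjunct1, THEN conjunct1, THEN spec, of p,
      THEN bspec, OF assms(1), THEN conjunct2, THEN bspec, OF assms(2)]
  show "\<beta> p \<eta> \<zeta> = - \<beta> p \<zeta> \<eta>" by (rule conjunct1[OF h])
  show "\<beta> p (fscale a \<eta>) \<zeta> = a * \<beta> p \<eta> \<zeta>"
    by (rule spec[OF conjunct1[OF conjunct2[OF h]]])
  show "\<beta> p (\<eta> + \<xi>) \<zeta> = \<beta> p \<eta> \<zeta> + \<beta> p \<xi> \<zeta>" if "\<xi> \<in> cotangent X p"
    by (rule bspec[OF conjunct1[OF conjunct2[OF conjunct2[OF h]]] that])
  show "\<beta> p \<eta> \<zeta> = 0" if "\<And>v. v \<in> tangent X p \<Longrightarrow> cstruct \<A> p v = fscale \<i> v \<Longrightarrow> \<eta> v = 0"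
    by (rule mp[OF conjunct2[OF conjunct2[OF conjunct2[OF h]]]]) (use that in blast)
qed

lemma bivector_sum:
  assumes \<zeta>: "\<zeta> \<in> cotangent X p" and \<eta>: "\<And>i. i \<in> N \<Longrightarrow> \<eta> i \<in> cotangent X p"
    and z: "\<And>i. i \<in> N \<Longrightarrow> \<beta> p (\<eta> i) \<zeta> = 0"
  shows "\<beta> p (\<Sum>i\<in>N. fscale (a i) (\<eta> i)) \<zeta> = 0"
  using \<eta> z
proof (induction N rule: infinite_finite_induct)
  case (insert i N)
  have "(\<Sum>i\<in>N. fscale (a i) (\<eta> i)) \<in> cotangent X p"
    by (intro X.cotangent_closed(6) X.cotangent_closed(3) insert.prems) auto
  then have "\<beta> p (fscale (a i) (\<eta> i) + (\<Sum>i\<in>N. fscale (a i) (\<eta> i))) \<zeta> =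
      \<beta> p (fscale (a i) (\<eta> i)) \<zeta> + \<beta> p (\<Sum>i\<in>N. fscale (a i) (\<eta> i)) \<zeta>"
    using bivector(3)[OF X.cotangent_closed(3)[OF insert.prems(1)] \<zeta>] by simp
  moreover have "\<beta> p (fscale (a i) (\<eta> i)) \<zeta> = 0"
    using bivector(2)[OF insert.prems(1) \<zeta>, of i "a i"] insert.prems(2)[of i] by simp
  moreover have "\<beta> p (\<Sum>i\<in>N. fscale (a i) (\<eta> i)) \<zeta> = 0"
    by (rule insert.IH) (use insert.prems in blast)+
  ultimately show ?case unfolding sum.insert[OF insert.hyps] by (simp only: add_0_right)
qed (use bivector(2)[OF X.cotangent_closed(1) \<zeta>, of 0] in \<open>simp_all only: sum.infinite sum.empty fscale_simps mult_zero_left not_False_eq_True\<close>)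

text \<open>The bivector annihilates conormal vectors: only their (1,0)-parts matter, these are combinations of
  differentials of functions in the ideal sheaf, and the ideal sheaf is stable under brackets.\<close>

lemma bivector_conormal:
  assumes p: "p \<in> M" and k: "(0, \<eta>) \<in> M.conormal_vecs p" and \<zeta>: "\<zeta> \<in> cotangent X p"
  shows "\<beta> p \<eta> \<zeta> = 0"
proof -
  obtain c I where c: "holo_chart \<A> c" "p \<in> fst c"
    and slice: "snd c ` (fst c \<inter> M) = {z \<in> snd c ` fst c. \<forall>i. i \<notin> I \<longrightarrow> z $ i = 0}"
    using p by (rule slice_chart)
  have o: "open (fst c)" using holo_chart_is_chart[OF c(1)] by (simp add: is_chart_def)
  have zero: "zcoord c i q = 0" if "q \<in> fst c \<inter> M" "i \<notin> I" for q i
    using slice that unfolding zcoord_def by blast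
  let ?dz = "\<lambda>i. differential X p (zcoord c i)" and ?dzb = "\<lambda>i. differential X p (\<lambda>x. cnj (zcoord c i x))"
  note dc = X.differential_cotangent[of p]
  have zb: "\<beta> p (?dzb i) \<xi> = 0" if "\<xi> \<in> cotangent X p" for \<xi> i
  proof (rule bivector(4)[OF dc that])
    fix v assume v: "v \<in> tangent X p" and J: "cstruct \<A> p v = fscale \<i> v"
    have "\<i> * v (\<lambda>x. cnj (zcoord c i x)) = - \<i> * v (\<lambda>x. cnj (zcoord c i x))"
      using is_cstruct_coord(2)[OF c is_cstruct_cstruct[OF v], of i] J by simp
    then show "?dzb i v = 0" using v by (simp add: differential_def)
  qed
  have zz: "\<beta> p (?dz j) (?dz i) = 0" if i: "i \<notin> I" for i j
  proof -
    have "zcoord c i \<in> ideal_sheaf \<A> M (fst c)"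
      using zcoord_holo[OF c(1)] zero i by (simp add: ideal_sheaf_def)
    then have "biv_bracket X \<beta> (zcoord c i) (zcoord c j) \<in> ideal_sheaf \<A> M (fst c)"
      using submfd o zcoord_holo[OF c(1)] unfolding poisson_submanifold_def by blast
    then have "\<beta> p (?dz i) (?dz j) = 0" using p c(2) by (simp add: ideal_sheaf_def biv_bracket_def)
    then show ?thesis by (subst bivector(1)[OF dc dc]) simp
  qed
  have dx: "differential X p (xcoord c (axis i 1)) = fscale (1/2) (?dz i + ?dzb i)"
    "differential X p (xcoord c (axis i \<i>)) = fscale (1/(2*\<i>)) (?dz i + fscale (-1) (?dzb i))" for i
    using tangent_xcoord[OF c] by (auto simp: differential_def fun_eq_iff)
  have xx: "\<beta> p (differential X p (xcoord c b)) \<xi> = 0"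
    if b: "b = axis i 1 \<or> b = axis i \<i>" and z: "\<beta> p (?dz i) \<xi> = 0" and \<xi>: "\<xi> \<in> cotangent X p" for b i \<xi>
    using b
  proof
    assume "b = axis i 1"
    then show ?thesis
      using z zb[OF \<xi>] bivector(2)[OF X.cotangent_closed(2)[OF dc dc] \<xi>] bivector(3)[OF dc \<xi> dc] by (simp add: dx)
  next
    assume "b = axis i \<i>"
    then show ?thesis
      unfolding dx[of i] using z zb[OF \<xi>] bivector(2)[OF dc \<xi>, of "-1"]
        bivector(2)[OF X.cotangent_closed(2)[OF dc X.cotangent_closed(3)[OF dc]] \<xi>]
        bivector(3)[OF dc \<xi> X.cotangent_closed(3)[OF dc]] by (simp only: dx) simp
  qed
  note fr = chart_coord_frame[OF c(1)]
  have dzz: "\<beta> p (?dz i) \<xi> = 0" if i: "i \<notin> I" and \<xi>: "\<xi> \<in> cotangent X p" for i \<xi>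
  proof -
    have "\<beta> p \<xi> (?dz i) = 0"
    proof (subst X.coord_frame_expand_cotangent[OF fr c(2) \<xi>], rule bivector_sum[OF dc dc])
      fix b :: "complex^'n" assume "b \<in> Basis"
      then obtain j where "b = axis j 1 \<or> b = axis j \<i>" by (metis Basis_vecE)
      from xx[OF this zz[OF i] dc] show "\<beta> p (differential X p (xcoord c b)) (?dz i) = 0" .
    qed
    then show ?thesis by (subst bivector(1)[OF dc \<xi>]) simp
  qed
  note kD = M.conormal_vecsD[OF k, simplified]
  let ?T = "{axis i u |i u. i \<in> I \<and> u \<in> Basis} :: (complex^'n) set"
  have "\<eta> = (\<Sum>b\<in>Basis. fscale (\<eta> (dir_deriv c b p)) (differential X p (xcoord c b)))"
    by (rule X.coord_frame_expand_cotangent[OF fr c(2) kD(2)])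
  also have "\<dots> = (\<Sum>b\<in>Basis - ?T. fscale (\<eta> (dir_deriv c b p)) (differential X p (xcoord c b)))"
  proof (rule sum.mono_neutral_right)
    show "\<forall>b\<in>Basis - (Basis - ?T). fscale (\<eta> (dir_deriv c b p)) (differential X p (xcoord c b)) = 0"
    proof
      fix b assume "b \<in> Basis - (Basis - ?T)"
      then have b: "b \<in> ?T" by blast
      have "\<exists>v\<in>tangent M.R p. push_tvec X p v = dir_deriv c b p"
      proof (rule M.tangent_descends[OF dir_deriv_tangent[OF c] p])
        show "dir_deriv c b p f = 0" if "f \<in> germs X p" "vanishes_near X M p f" for f
          using submanifold_adapted_frame[OF c(1) slice] b c(2) p that unfolding adapted_frame_def by blast
      qed
      then have "\<eta> (dir_deriv c b p) = 0" using kD(3) by metis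
      then show "fscale (\<eta> (dir_deriv c b p)) (differential X p (xcoord c b)) = 0" by simp
    qed
  qed auto
  finally have e: "\<eta> = (\<Sum>b\<in>Basis - ?T. fscale (\<eta> (dir_deriv c b p)) (differential X p (xcoord c b)))" .
  show ?thesis
  proof (subst e, rule bivector_sum[OF \<zeta> dc])
    fix b :: "complex^'n" assume b: "b \<in> Basis - ?T"
    then obtain i u where iu: "b = axis i u" "u \<in> Basis" by (auto simp: Basis_vec_def)
    then have "i \<notin> I" using b by blast
    moreover have "b = axis i 1 \<or> b = axis i \<i>" using iu by (auto simp: Basis_complex_def)
    ultimately show "\<beta> p (differential X p (xcoord c b)) \<zeta> = 0" using xx dzz \<zeta> by blast
  qed
qed

text \<open>The holomorphic normal coordinates and their conjugates vanish on \<open>M\<close>, and \<open>J\<close> only multiplies the values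
  of a tangent vector on them by \<open>\<plusminus> \<i>\<close>.\<close>

lemma cstruct_push:
  assumes p: "p \<in> M" and v: "v \<in> tangent M.R p"
  shows "\<exists>w\<in>tangent M.R p. push_tvec X p w = cstruct \<A> p (push_tvec X p v)"
proof -
  obtain c I where c: "holo_chart \<A> c" "p \<in> fst c"
    and slice: "snd c ` (fst c \<inter> M) = {z \<in> snd c ` fst c. \<forall>i. i \<notin> I \<longrightarrow> z $ i = 0}"
    using p by (rule slice_chart)
  have o: "open (fst c)" using holo_chart_is_chart[OF c(1)] by (simp add: is_chart_def)
  let ?u = "push_tvec X p v" and ?T = "{axis i u |i u. i \<in> I \<and> u \<in> Basis} :: (complex^'n) set"
  note u = M.push_tangent[OF v p]
  let ?w = "cstruct \<A> p ?u"
  note w = cstruct_tangent[OF u]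
  have van: "vanishes_near X M p (zcoord c i)" "vanishes_near X M p (\<lambda>x. cnj (zcoord c i x))" if "i \<notin> I" for i
    using slice that o c(2) unfolding vanishes_near_def zcoord_def by (auto intro!: exI[of _ "fst c"])
  have w0: "?w (xcoord c b) = 0" if b: "b \<in> Basis - ?T" for b
  proof -
    obtain i u' where iu: "b = axis i u'" "u' \<in> Basis" using b by (auto simp: Basis_vec_def)
    then have i: "i \<notin> I" using b by blast
    have "?w (zcoord c i) = 0" "?w (\<lambda>x. cnj (zcoord c i x)) = 0"
      using is_cstruct_coord[OF c is_cstruct_cstruct[OF u], of i]
        M.push_vanishing[OF v p chart_germs(2)[OF c] van(1)[OF i]] M.push_vanishing[OF v p chart_germs(3)[OF c] van(2)[OF i]] by simp_all
    then show ?thesis using tangent_xcoord[OF c w, of i] iu by (auto simp: Basis_complex_def)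
  qed
  show ?thesis
  proof (rule M.tangent_descends[OF w p])
    fix f assume f: "f \<in> germs X p" "vanishes_near X M p f"
    have "?w f = (\<Sum>b\<in>Basis. ?w (xcoord c b) * dir_deriv c b p f)"
      using fun_cong[OF X.coord_frame_expand[OF chart_coord_frame[OF c(1)] c(2) w], of f] by (simp add: sum_fun_apply)
    also have "\<dots> = 0"
    proof (rule sum.neutral, rule ballI)
      fix b :: "complex^'n" assume b: "b \<in> Basis"
      show "?w (xcoord c b) * dir_deriv c b p f = 0"
      proof (cases "b \<in> ?T")
        case True
        then have "dir_deriv c b p f = 0"
          using submanifold_adapted_frame[OF c(1) slice] c(2) p f unfolding adapted_frame_def by blast
        then show ?thesis by simp
      qed (use w0 b in simp)
    qed
    finally show "?w f = 0" .
  qed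
qed

lemma biv_map_conormal:
  assumes p: "p \<in> M" and k: "(0, \<eta>) \<in> M.conormal_vecs p"
  shows "biv_map X (real_bivector \<beta> t) p \<eta> = 0" "biv_map X (- real_bivector \<beta> t) p \<eta> = 0"
proof -
  have "(0, conj_covec \<eta>) \<in> M.conormal_vecs p"
    using M.conormal_vecs_conj[OF k] by (simp add: conj_gvec_def)
  then have "real_bivector \<beta> t p \<eta> \<zeta> = 0" if "\<zeta> \<in> cotangent X p" for \<zeta>
    using bivector_conormal[OF p] k that X.conj_cotangent[OF that] by (simp add: real_bivector_def)
  then show "biv_map X (real_bivector \<beta> t) p \<eta> = 0" "biv_map X (- real_bivector \<beta> t) p \<eta> = 0"
    using X.differential_cotangent by (auto simp: biv_map_def fun_eq_iff)
qed

text \<open>The bivector annihilates conormal covectors, so \<open>e\<^bsup>at\<^esup>\<close> and \<open>e\<^bsup>-at\<^esup>\<close> are the identity on the conormal space, and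
  the deformed structure acts there like the undeformed one, by \<open>- J\<^sup>*\<close>.\<close>

lemma poisson_deformation_conormal:
  assumes gc: "gen_complex X (poisson_deformation \<A> \<beta> t)"
  shows "conormal_invariant X (poisson_deformation \<A> \<beta> t) M"
proof -
  let ?A = "poisson_deformation \<A> \<beta> t"
  have so: "so_section X ?A" using gc by (simp add: gen_complex_def)
  have into: "?A p k \<in> M.conormal_vecs p" if p: "p \<in> M" and k: "k \<in> M.conormal_vecs p" for p k
  proof -
    obtain \<eta> where \<eta>: "k = (0, \<eta>)" using M.conormal_vecsD(1)[OF k] by (metis prod.collapse)
    note k' = k[unfolded \<eta>]
    define \<eta>' where "\<eta>' = (\<lambda>v. if v \<in> tangent X p then - \<eta> (cstruct \<A> p v) else 0)"
    have "exp_biv X (- real_bivector \<beta> t) p (0, \<eta>) = (0, \<eta>)"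
      using biv_map_conormal(2)[OF p k'] by (simp add: exp_biv_def zero_prod_def[symmetric])
    moreover have "gcs_of_complex \<A> p (0, \<eta>) = (0, \<eta>')"
      unfolding gcs_of_complex_def fst_conv snd_conv cstruct_0 \<eta>'_def ..
    ultimately have A1: "?A p k = exp_biv X (real_bivector \<beta> t) p (0, \<eta>')"
      by (simp add: poisson_deformation_def \<eta>)
    have kg: "k \<in> gfibre X p" using k by (auto simp: M.conormal_vecs_def M.related_def)
    have "?A p k \<in> gfibre X p" by (rule X.so_sectionD(1)[OF so _ kg]) simp
    then have c': "\<eta>' \<in> cotangent X p" unfolding A1 by (simp add: exp_biv_def gfibre_def)
    have k2: "(0, \<eta>') \<in> M.conormal_vecs p"
    proof (rule M.conormal_vecsI[OF c' p])
      fix v assume v: "v \<in> tangent M.R p"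
      obtain w where "w \<in> tangent M.R p" "push_tvec X p w = cstruct \<A> p (push_tvec X p v)"
        using cstruct_push[OF p v] by blast
      then have "\<eta> (cstruct \<A> p (push_tvec X p v)) = 0"
        using M.conormal_vecsD(3)[OF k', of w] by simp
      then show "\<eta>' (push_tvec X p v) = 0" by (simp add: \<eta>'_def)
    qed
    have "exp_biv X (real_bivector \<beta> t) p (0, \<eta>') = (0, \<eta>')"
      using biv_map_conormal(1)[OF p k2] by (simp add: exp_biv_def zero_prod_def[symmetric])
    then show ?thesis using A1 k2 by simp
  qed
  show ?thesis
    unfolding conormal_invariant_def
  proof
    fix p assume p: "p \<in> M"
    have "?A p ` M.conormal_vecs p = M.conormal_vecs p"
    proof (intro equalityI subsetI)
      fix k assume k: "k \<in> M.conormal_vecs p"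
      have pt: "p \<in> topspace (stop X)" by simp
      have kg: "k \<in> gfibre X p" using k by (auto simp: M.conormal_vecs_def M.related_def)
      have "- ?A p k \<in> M.conormal_vecs p"
        using gvs.subspace_neg[OF M.conormal_vecs_subspace into[OF p k]] .
      moreover have "?A p (- ?A p k) = k"
        using X.so_section_uminus[OF so pt X.so_sectionD(1)[OF so pt kg]] gc kg by (simp add: gen_complex_def)
      ultimately show "k \<in> ?A p ` M.conormal_vecs p" by (metis imageI)
    qed (use into[OF p] in auto)
    then show "?A p ` mixed_incl X p ` conormal X M p = mixed_incl X p ` conormal X M p"
      using M.conormal_image[OF p] by simp
  qed
qed

end

theorem theorem1p20:
  fixes \<A> :: "('a::t2_space, 'n::finite) chart set"
    and \<omega> :: "'a form"
    and \<beta> :: "'a bivec"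
    and \<epsilon> :: real
    and \<psi> :: "complex \<Rightarrow> 'a form"
    and m :: nat
    and M :: "'a set"
  assumes "complex_atlas \<A>"
    and "compact (UNIV :: 'a set)"
    and "kahler_form \<A> \<omega>"
    and "poisson_structure \<A> \<beta>"
    and "\<epsilon> > 0"
    and "analytic_family (mfd \<A>) (ball 0 \<epsilon>) \<psi>"
    and "\<And>t. t \<in> ball 0 \<epsilon> \<Longrightarrow>
           gen_kahler_one_spinor (mfd \<A>) (poisson_deformation \<A> \<beta> t) (\<psi> t)"
    and "poisson_submanifold \<A> \<beta> m M"
  shows "\<forall>t\<in>ball 0 \<epsilon>.
           conormal_invariant (mfd \<A>) (poisson_deformation \<A> \<beta> t) M \<and>
           gen_kahler_one_spinor (sub_space (mfd \<A>) M)
             (induced_endo (mfd \<A>) (poisson_deformation \<A> \<beta> t) M)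
             (pull_form (mfd \<A>) (\<psi> t))"
proof
  fix t :: complex assume t: "t \<in> ball 0 \<epsilon>"
  interpret poisson_submfd \<A> \<beta> m M
    by unfold_locales (use assms in auto)
  note gk = assms(7)[OF t]
  have "gen_complex (mfd \<A>) (poisson_deformation \<A> \<beta> t)"
    using gk by (simp add: gen_kahler_one_spinor_def)
  note inv = poisson_deformation_conormal[OF this]
  interpret K: kahler_reduction "mfd \<A>" M "TYPE(complex^'n)" "poisson_deformation \<A> \<beta> t" "\<psi> t"
    by unfold_locales (rule gk, rule inv)
  show "conormal_invariant (mfd \<A>) (poisson_deformation \<A> \<beta> t) M \<and>
      gen_kahler_one_spinor (sub_space (mfd \<A>) M)
        (induced_endo (mfd \<A>) (poisson_deformation \<A> \<beta> t) M) (pull_form (mfd \<A>) (\<psi> t))"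
    using inv K.gen_kahler_one_spinor_reduction by blast
qed

end
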